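(* Let $(M,g)$ be a Riemannian manifold of dimension $n\ge 3$, and let $N$ range over all integers $N\ge 1$ if $n$ is odd, and over $1\le N\le n/2$ if $n$ is even. Then the GJMS-operators of $(M,g)$ satisfy $$P_{2N}=\sum_{|I|=N} n_I\,\mathcal M_{2I}=\mathcal M_2^N+\text{compositions with fewer factors},$$ the sum running over all compositions $I$ of $N$. Moreover, all operators $\mathcal M_{2N}(g)$ are differential operators of order at most two, and they are given by the formula $$\sum_{N\ge 1}\mathcal M_{2N}(g)\,\frac{1}{(N-1)!^2}\left(\frac{r^2}{4}\right)^{N-1}=-\delta\,(g_r^{-1}d)-r^{-2}\left(\Delta_{g_+}(\log w)-|d\log w|^2_{g_+}\right),$$ understood as an identity of formal power series in $r$ (equality of all coefficients). For odd $n$ the left-hand sum is a formal infinite power series; for even $n$ the left-hand sum is taken only up to the power $r^{n-2}$, and the identity is one of coefficients up to $r^{n-2}$. The scalar term on the right acts by multiplication.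
   Context: Conventions: $\delta$ is the formal adjoint of $d$ with respect to $g$, and $\Delta_g=-\delta d$ (so $-\Delta_g\ge0$). Poincaré–Einstein metric: on $X=M\times(0,\varepsilon)$ let $g_+=r^{-2}(dr^2+g_r)$, $g_0=g$, with $g_r=g+r^2g_{(2)}+r^4g_{(4)}+\cdots$ even in $r$. For odd $n$, $\mathrm{Ric}(g_+)+ng_+$ is required to vanish to infinite order at $r=0$; this determines the formal power series $g_r$. For even $n$, one requires $\mathrm{Ric}(g_+)+ng_+=O(r^{n-2})$ together with vanishing of the $g$-trace of the coefficient of $r^{n-2}$; this determines $g_{(2)},\dots,g_{(n-2)}$ and $\mathrm{tr}_g\,g_{(n)}$, and one sets $g_r=g+r^2g_{(2)}+\cdots+r^ng_{(n)}$ (only $g_{(2)},\dots,g_{(n-2)}$ and $\mathrm{tr}_g\, g_{(n)}$ matter). In the expression $\delta(g_r^{-1}d)$ the metric $g_r$ is regarded, using $g$, as an endomorphism of one-forms on $M$. Set $v(r)=\mathrm{vol}(g_r)/\mathrm{vol}(g)=1+v_2r^2+v_4r^4+\cdots$ and $w(r)=\sqrt{v(r)}=1+w_2r^2+w_4r^4+\cdots$; $w$ is regarded as a function on $X$. GJMS-operators: let $\tilde g=2t\,dt\,d\rho+2\rho\,dt^2+t^2g(\rho)$ be the Fefferman–Graham ambient metric, where $g(\rho)=g_r$ for $\rho=-r^2/2$. Then $P_{2N}(g)u=\Delta_{\tilde g}^N(t^{N-n/2}\tilde u)|_{\rho=0,t=1}$, where $\tilde u(x,\rho)$ is any smooth extension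 of $u\in C^\infty(M)$ (the result is independent of the extension). $P_{2N}(g)=\Delta_g^N+$ lower-order terms; it is defined for all $N\ge1$ if $n$ is odd and for $2N\le n$ if $n$ is even. Combinatorics: a composition $I=(I_1,\dots,I_r)$ is a finite sequence of integers $I_j\ge1$; its size is $|I|=I_1+\cdots+I_r$. Put $$m_I=-(-1)^r|I|!\,(|I|-1)!\prod_{j=1}^r\frac{1}{I_j!\,(I_j-1)!}\prod_{j=1}^{r-1}\frac{1}{I_j+I_{j+1}},\qquad n_I=\prod_{j=1}^r\binom{\sum_{k\le j}I_k-1}{I_j-1}\binom{\sum_{k\ge j}I_k-1}{I_j-1}.$$ Set $P_{2I}=P_{2I_1}\circ\cdots\circ P_{2I_r}$, $\mathcal M_{2N}=\sum_{|I|=N}m_IP_{2I}$ and $\mathcal M_{2I}=\mathcal M_{2I_1}\circ\cdots\circ\mathcal M_{2I_r}$. *)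

theory Defs
  imports "HOL-Analysis.Analysis" "HOL-Library.Landau_Symbols"
begin

section \<open>Smooth functions on open subsets of Euclidean spaces\<close>

primrec C_k_on :: "nat \<Rightarrow> 'a::euclidean_space set \<Rightarrow> ('a \<Rightarrow> 'b::real_normed_vector) \<Rightarrow> bool" where
  "C_k_on 0 S f \<longleftrightarrow> continuous_on S f"
| "C_k_on (Suc k) S f \<longleftrightarrow> (\<forall>x\<in>S. f differentiable at x) \<and>
     (\<forall>v. C_k_on k S (\<lambda>x. frechet_derivative f (at x) v))"

definition smooth_on :: "'a::euclidean_space set \<Rightarrow> ('a \<Rightarrow> 'b::real_normed_vector) \<Rightarrow> bool" where
  "smooth_on S f \<longleftrightarrow> (\<forall>k. C_k_on k S f)"

definition pd :: "'k::finite \<Rightarrow> (real^'k \<Rightarrow> real) \<Rightarrow> real^'k \<Rightarrow> real" where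
  "pd a f y = frechet_derivative f (at y) (axis a 1)"

definition pds :: "'k::finite list \<Rightarrow> (real^'k \<Rightarrow> real) \<Rightarrow> real^'k \<Rightarrow> real" where
  "pds as f = foldr pd as f"

definition test_function :: "(real^'k) set \<Rightarrow> (real^'k::finite \<Rightarrow> real) \<Rightarrow> bool" where
  "test_function V \<psi> \<longleftrightarrow> smooth_on UNIV \<psi> \<and>
     compact (closure {y. \<psi> y \<noteq> 0}) \<and> closure {y. \<psi> y \<noteq> 0} \<subseteq> V"


section \<open>Manifolds and tensors\<close>

text \<open>An atlas is a family of charts (domain, coordinate map). Tensor fields are given by their
  components in every chart, subject to the classical transformation law; the index type
  \<open>'i\<close> serves to name the charts, also for the product manifolds below.\<close>

type_synonym ('i, 'a, 'k) atlas = "'i \<Rightarrow> 'a set \<times> ('a \<Rightarrow> real^'k)"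

abbreviation cdom :: "('i, 'a, 'k::finite) atlas \<Rightarrow> 'i \<Rightarrow> 'a set" where
  "cdom C i \<equiv> fst (C i)"

abbreviation cmap :: "('i, 'a, 'k::finite) atlas \<Rightarrow> 'i \<Rightarrow> 'a \<Rightarrow> real^'k" where
  "cmap C i \<equiv> snd (C i)"

abbreviation cimg :: "('i, 'a, 'k::finite) atlas \<Rightarrow> 'i \<Rightarrow> (real^'k) set" where
  "cimg C i \<equiv> cmap C i ` cdom C i"

abbreviation cinv :: "('i, 'a, 'k::finite) atlas \<Rightarrow> 'i \<Rightarrow> real^'k \<Rightarrow> 'a" where
  "cinv C i \<equiv> inv_into (cdom C i) (cmap C i)"

definition loc :: "('i, 'a, 'k::finite) atlas \<Rightarrow> 'i \<Rightarrow> ('a \<Rightarrow> 'b) \<Rightarrow> real^'k \<Rightarrow> 'b" where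
  "loc C i f = f \<circ> cinv C i"

definition smooth_atlas :: "('i, 'a::topological_space, 'k::finite) atlas \<Rightarrow> bool" where
  "smooth_atlas C \<longleftrightarrow> (\<Union>i. cdom C i) = UNIV \<and>
     (\<forall>i. open (cdom C i) \<and> open (cimg C i) \<and>
          homeomorphism (cdom C i) (cimg C i) (cmap C i) (cinv C i)) \<and>
     (\<forall>i j. smooth_on (cmap C i ` (cdom C i \<inter> cdom C j)) (cmap C j \<circ> cinv C i))"

definition smooth_fun :: "('i, 'a, 'k::finite) atlas \<Rightarrow> ('a \<Rightarrow> real) \<Rightarrow> bool" where
  "smooth_fun C u \<longleftrightarrow> (\<forall>i. smooth_on (cimg C i) (loc C i u))"

text \<open>The chart used at a point where a coordinate expression is evaluated that does not
  depend on the chart.\<close>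

definition chart_at :: "('i, 'a, 'k::finite) atlas \<Rightarrow> 'a \<Rightarrow> 'i" where
  "chart_at C x = (SOME i. x \<in> cdom C i)"

definition riemannian_metric ::
    "('i, 'a, 'k::finite) atlas \<Rightarrow> ('i \<Rightarrow> 'a \<Rightarrow> real^'k^'k) \<Rightarrow> bool" where
  "riemannian_metric C g \<longleftrightarrow>
     (\<forall>i. smooth_on (cimg C i) (loc C i (g i))) \<and>
     (\<forall>i. \<forall>x\<in>cdom C i. transpose (g i x) = g i x \<and> (\<forall>v. v \<noteq> 0 \<longrightarrow> v \<bullet> (g i x *v v) > 0)) \<and>
     (\<forall>i j. \<forall>x\<in>cdom C i \<inter> cdom C j.
        let J = matrix (frechet_derivative (cmap C j \<circ> cinv C i) (at (cmap C i x)))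
        in g i x = transpose J ** g j x ** J)"

definition dform :: "('i, 'a, 'k::finite) atlas \<Rightarrow> ('a \<Rightarrow> real) \<Rightarrow> 'i \<Rightarrow> 'a \<Rightarrow> real^'k" where
  "dform C f i x = (\<chi> a. pd a (loc C i f) (cmap C i x))"

definition vol_density :: "real^'k^'k::finite \<Rightarrow> real" where
  "vol_density G = sqrt \<bar>det G\<bar>"

text \<open>The formal adjoint of \<open>d\<close>: the smooth function \<open>\<delta>\<omega>\<close> with
  \<open>\<integral> \<langle>du, \<omega>\<rangle> dvol = \<integral> u \<delta>\<omega> dvol\<close> for all test functions \<open>u\<close> supported in a coordinate domain
  (which suffices by a partition of unity). The metric may be indefinite.\<close>

definition codiff :: "('i, 'a, 'k::finite) atlas \<Rightarrow> ('i \<Rightarrow> 'a \<Rightarrow> real^'k^'k) \<Rightarrow>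
    ('i \<Rightarrow> 'a \<Rightarrow> real^'k) \<Rightarrow> 'a \<Rightarrow> real" where
  "codiff C G \<omega> = (SOME f. smooth_fun C f \<and>
     (\<forall>i \<psi>. test_function (cimg C i) \<psi> \<longrightarrow>
        (LINT y:cimg C i|lborel.
           ((\<chi> a. pd a \<psi> y) \<bullet> (matrix_inv (loc C i (G i) y) *v loc C i (\<omega> i) y))
             * vol_density (loc C i (G i) y))
      = (LINT y:cimg C i|lborel. \<psi> y * loc C i f y * vol_density (loc C i (G i) y))))"

definition lapl :: "('i, 'a, 'k::finite) atlas \<Rightarrow> ('i \<Rightarrow> 'a \<Rightarrow> real^'k^'k) \<Rightarrow>
    ('a \<Rightarrow> real) \<Rightarrow> 'a \<Rightarrow> real" where
  "lapl C G f x = - codiff C G (dform C f) x"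

definition form_norm2 :: "('i, 'a, 'k::finite) atlas \<Rightarrow> ('i \<Rightarrow> 'a \<Rightarrow> real^'k^'k) \<Rightarrow>
    ('i \<Rightarrow> 'a \<Rightarrow> real^'k) \<Rightarrow> 'a \<Rightarrow> real" where
  "form_norm2 C G \<omega> x =
     (let i = chart_at C x in \<omega> i x \<bullet> (matrix_inv (G i x) *v \<omega> i x))"

definition christoffel :: "(real^'k \<Rightarrow> real^'k^'k) \<Rightarrow> 'k::finite \<Rightarrow> 'k \<Rightarrow> 'k \<Rightarrow> real^'k \<Rightarrow> real" where
  "christoffel G a b c y = (\<Sum>d\<in>UNIV. matrix_inv (G y) $ a $ d *
     (pd b (\<lambda>z. G z $ c $ d) y + pd c (\<lambda>z. G z $ b $ d) y - pd d (\<lambda>z. G z $ b $ c) y)) / 2"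

definition ricci :: "(real^'k \<Rightarrow> real^'k^'k) \<Rightarrow> real^'k \<Rightarrow> real^'k^'k::finite" where
  "ricci G y = (\<chi> b c. \<Sum>a\<in>UNIV.
     pd a (christoffel G a b c) y - pd c (christoffel G a a b) y
     + (\<Sum>d\<in>UNIV. christoffel G a a d y * christoffel G d b c y
               - christoffel G a c d y * christoffel G d a b y))"

definition diff_op :: "('i, 'a, 'k::finite) atlas \<Rightarrow> nat \<Rightarrow> (('a \<Rightarrow> real) \<Rightarrow> 'a \<Rightarrow> real) \<Rightarrow> bool" where
  "diff_op C m L \<longleftrightarrow> (\<forall>i. \<exists>coef :: 'k list \<Rightarrow> real^'k \<Rightarrow> real.
     (\<forall>as. smooth_on (cimg C i) (coef as)) \<and>
     (\<forall>u. smooth_fun C u \<longrightarrow> (\<forall>y\<in>cimg C i.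
        loc C i (L u) y = (\<Sum>as | length as \<le> m. coef as y * pds as (loc C i u) y))))"


section \<open>Poincare--Einstein and ambient metrics\<close>

text \<open>Charts of the product of a manifold with an interval \<open>T\<close>; the new coordinate has
  index \<open>None\<close>.\<close>

definition prod_atlas :: "('i, 'a, 'k::finite) atlas \<Rightarrow> real set \<Rightarrow> ('i, 'a \<times> real, 'k option) atlas" where
  "prod_atlas C T i = (cdom C i \<times> T,
     \<lambda>(x, s). \<chi> a. case a of None \<Rightarrow> s | Some j \<Rightarrow> cmap C i x $ j)"

text \<open>The family of metrics is parametrized by \<open>\<rho>\<close>: the component matrix of \<open>g(\<rho>)\<close> at \<open>x\<close> in the
  chart \<open>i\<close> is \<open>h i (x, \<rho>)\<close>, and \<open>g_r = g(-r^2/2)\<close>. Smoothness in \<open>\<rho>\<close> across \<open>0\<close> encodes that \<open>g_r\<close>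
  is smooth and even in \<open>r\<close>; the values for \<open>\<rho> > 0\<close> are an arbitrary smooth continuation.\<close>

definition rho_range :: "real \<Rightarrow> real set" where
  "rho_range \<epsilon> = {- (\<epsilon>\<^sup>2 / 2) <..< \<epsilon>\<^sup>2 / 2}"

definition metric_family :: "('i, 'm, 'n::finite) atlas \<Rightarrow> ('i \<Rightarrow> 'm \<Rightarrow> real^'n^'n) \<Rightarrow> real \<Rightarrow>
    ('i \<Rightarrow> 'm \<times> real \<Rightarrow> real^'n^'n) \<Rightarrow> bool" where
  "metric_family C g \<epsilon> h \<longleftrightarrow>
     (\<forall>i. \<forall>x\<in>cdom C i. h i (x, 0) = g i x) \<and>
     (\<forall>\<rho>\<in>rho_range \<epsilon>. riemannian_metric C (\<lambda>i x. h i (x, \<rho>))) \<and>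
     (\<forall>i. smooth_on (cimg (prod_atlas C (rho_range \<epsilon>)) i)
            (loc (prod_atlas C (rho_range \<epsilon>)) i (h i)))"

abbreviation g_r :: "('i \<Rightarrow> 'm \<times> real \<Rightarrow> real^'n^'n::finite) \<Rightarrow> real \<Rightarrow> 'i \<Rightarrow> 'm \<Rightarrow> real^'n^'n" where
  "g_r h r i x \<equiv> h i (x, - (r\<^sup>2 / 2))"

abbreviation X_atlas :: "('i, 'm, 'n::finite) atlas \<Rightarrow> real \<Rightarrow> ('i, 'm \<times> real, 'n option) atlas" where
  "X_atlas C \<epsilon> \<equiv> prod_atlas C {0<..<\<epsilon>}"

definition g_plus :: "('i \<Rightarrow> 'm \<times> real \<Rightarrow> real^'n^'n::finite) \<Rightarrow>
    'i \<Rightarrow> 'm \<times> real \<Rightarrow> real^('n option)^('n option)" where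
  "g_plus h i = (\<lambda>(x, r). \<chi> a b. (case (a, b) of
       (None, None) \<Rightarrow> 1
     | (Some j, Some k) \<Rightarrow> g_r h r i x $ j $ k
     | _ \<Rightarrow> 0) / r\<^sup>2)"

definition einstein_defect :: "('i, 'm, 'n::finite) atlas \<Rightarrow> real \<Rightarrow>
    ('i \<Rightarrow> 'm \<times> real \<Rightarrow> real^'n^'n) \<Rightarrow> 'i \<Rightarrow> 'm \<times> real \<Rightarrow> real^('n option)^('n option)" where
  "einstein_defect C \<epsilon> h i z =
     ricci (loc (X_atlas C \<epsilon>) i (g_plus h i)) (cmap (X_atlas C \<epsilon>) i z)
     + real CARD('n) *\<^sub>R g_plus h i z"

text \<open>For even \<open>n\<close> the Taylor coefficients of \<open>g_r\<close> left undetermined by the conditions are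
  arbitrary.\<close>

definition poincare_einstein :: "('i, 'm, 'n::finite) atlas \<Rightarrow> ('i \<Rightarrow> 'm \<Rightarrow> real^'n^'n) \<Rightarrow> real \<Rightarrow>
    ('i \<Rightarrow> 'm \<times> real \<Rightarrow> real^'n^'n) \<Rightarrow> bool" where
  "poincare_einstein C g \<epsilon> h \<longleftrightarrow> metric_family C g \<epsilon> h \<and>
     (\<forall>i. \<forall>x\<in>cdom C i.
       if odd CARD('n)
       then \<forall>k a b. (\<lambda>r. einstein_defect C \<epsilon> h i (x, r) $ a $ b) \<in> O[at_right 0](\<lambda>r. r ^ k)
       else (\<forall>a b. (\<lambda>r. einstein_defect C \<epsilon> h i (x, r) $ a $ b)
                     \<in> O[at_right 0](\<lambda>r. r ^ (CARD('n) - 2))) \<and>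
            (\<lambda>r. \<Sum>j\<in>UNIV. \<Sum>k\<in>UNIV. matrix_inv (g i x) $ j $ k *
                   einstein_defect C \<epsilon> h i (x, r) $ Some j $ Some k)
              \<in> o[at_right 0](\<lambda>r. r ^ (CARD('n) - 2)))"

text \<open>Points of the ambient space are written \<open>((x, \<rho>), t)\<close>, so that the coordinate \<open>t\<close> has index
  \<open>None\<close> and \<open>\<rho>\<close> has index \<open>Some None\<close>.\<close>

abbreviation ambient_atlas ::
    "('i, 'm, 'n::finite) atlas \<Rightarrow> real \<Rightarrow> ('i, ('m \<times> real) \<times> real, 'n option option) atlas" where
  "ambient_atlas C \<epsilon> \<equiv> prod_atlas (prod_atlas C (rho_range \<epsilon>)) {0<..}"

definition g_ambient :: "('i \<Rightarrow> 'm \<times> real \<Rightarrow> real^'n^'n::finite) \<Rightarrow>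
    'i \<Rightarrow> ('m \<times> real) \<times> real \<Rightarrow> real^('n option option)^('n option option)" where
  "g_ambient h i = (\<lambda>((x, \<rho>), t). \<chi> a b. (case (a, b) of
       (None, None) \<Rightarrow> 2 * \<rho>
     | (None, Some None) \<Rightarrow> t
     | (Some None, None) \<Rightarrow> t
     | (Some (Some j), Some (Some k)) \<Rightarrow> t\<^sup>2 * h i (x, \<rho>) $ j $ k
     | _ \<Rightarrow> 0))"


section \<open>GJMS operators\<close>

definition smooth_extension :: "('i, 'm, 'n::finite) atlas \<Rightarrow> real \<Rightarrow> ('m \<Rightarrow> real) \<Rightarrow>
    ('m \<times> real \<Rightarrow> real) \<Rightarrow> bool" where
  "smooth_extension C \<epsilon> u ue \<longleftrightarrow>
     smooth_fun (prod_atlas C (rho_range \<epsilon>)) ue \<and> (\<forall>x. ue (x, 0) = u x)"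

text \<open>\<open>gjms C \<epsilon> h N\<close> is the operator of order \<open>2N\<close>; the choice of the extension is irrelevant.\<close>

definition gjms :: "('i, 'm, 'n::finite) atlas \<Rightarrow> real \<Rightarrow> ('i \<Rightarrow> 'm \<times> real \<Rightarrow> real^'n^'n) \<Rightarrow>
    nat \<Rightarrow> ('m \<Rightarrow> real) \<Rightarrow> 'm \<Rightarrow> real" where
  "gjms C \<epsilon> h N u x =
     (let ue = (SOME ue. smooth_extension C \<epsilon> u ue)
      in (lapl (ambient_atlas C \<epsilon>) (g_ambient h) ^^ N)
           (\<lambda>(z, t). t powr (real N - real CARD('n) / 2) * ue z) ((x, 0), 1))"

definition compositions :: "nat \<Rightarrow> nat list set" where
  "compositions N = {I. (\<forall>k\<in>set I. 1 \<le> k) \<and> sum_list I = N}"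

definition m_coef :: "nat list \<Rightarrow> real" where
  "m_coef I = - ((-1) ^ length I) * fact (sum_list I) * fact (sum_list I - 1)
     * (\<Prod>j<length I. 1 / (fact (I ! j) * fact (I ! j - 1)))
     * (\<Prod>j<length I - 1. 1 / real (I ! j + I ! Suc j))"

definition n_coef :: "nat list \<Rightarrow> nat" where
  "n_coef I = (\<Prod>j<length I.
     (((\<Sum>k\<le>j. I ! k) - 1) choose (I ! j - 1)) *
     (((\<Sum>k=j..<length I. I ! k) - 1) choose (I ! j - 1)))"

definition op_comp :: "(nat \<Rightarrow> ('m \<Rightarrow> real) \<Rightarrow> 'm \<Rightarrow> real) \<Rightarrow> nat list \<Rightarrow> ('m \<Rightarrow> real) \<Rightarrow> 'm \<Rightarrow> real" where
  "op_comp P I = foldr (\<lambda>k Q. P k \<circ> Q) I id"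

definition M_op :: "('i, 'm, 'n::finite) atlas \<Rightarrow> real \<Rightarrow> ('i \<Rightarrow> 'm \<times> real \<Rightarrow> real^'n^'n) \<Rightarrow>
    nat \<Rightarrow> ('m \<Rightarrow> real) \<Rightarrow> 'm \<Rightarrow> real" where
  "M_op C \<epsilon> h N u x = (\<Sum>I\<in>compositions N. m_coef I * op_comp (gjms C \<epsilon> h) I u x)"


section \<open>The generating function\<close>

definition w_fun :: "('i, 'm, 'n::finite) atlas \<Rightarrow> ('i \<Rightarrow> 'm \<Rightarrow> real^'n^'n) \<Rightarrow>
    ('i \<Rightarrow> 'm \<times> real \<Rightarrow> real^'n^'n) \<Rightarrow> 'm \<times> real \<Rightarrow> real" where
  "w_fun C g h = (\<lambda>(x, r). let i = chart_at C x in
     sqrt (vol_density (g_r h r i x) / vol_density (g i x)))"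

text \<open>The one-form \<open>g_r^{-1} du\<close>, where \<open>g_r\<close> is regarded as the endomorphism
  \<open>\<omega>_j \<mapsto> (g_r)_{jk} g^{kl} \<omega>_l\<close> of one-forms.\<close>

definition gr_inv_d :: "('i, 'm, 'n::finite) atlas \<Rightarrow> ('i \<Rightarrow> 'm \<Rightarrow> real^'n^'n) \<Rightarrow>
    ('i \<Rightarrow> 'm \<times> real \<Rightarrow> real^'n^'n) \<Rightarrow> real \<Rightarrow> ('m \<Rightarrow> real) \<Rightarrow> 'i \<Rightarrow> 'm \<Rightarrow> real^'n" where
  "gr_inv_d C g h r u i x = matrix_inv (g_r h r i x ** matrix_inv (g i x)) *v dform C u i x"

definition generating_op :: "('i, 'm, 'n::finite) atlas \<Rightarrow> ('i \<Rightarrow> 'm \<Rightarrow> real^'n^'n) \<Rightarrow> real \<Rightarrow>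
    ('i \<Rightarrow> 'm \<times> real \<Rightarrow> real^'n^'n) \<Rightarrow> real \<Rightarrow> ('m \<Rightarrow> real) \<Rightarrow> 'm \<Rightarrow> real" where
  "generating_op C g \<epsilon> h r u x =
     - codiff C g (gr_inv_d C g h r u) x
     - (let lw = (\<lambda>z. ln (w_fun C g h z)) in
         lapl (X_atlas C \<epsilon>) (g_plus h) lw (x, r)
         - form_norm2 (X_atlas C \<epsilon>) (g_plus h) (dform (X_atlas C \<epsilon>) lw) (x, r)) / r\<^sup>2 * u x"

end

theory Submission
  imports Defs "HOL-Library.Function_Algebras"
begin

text \<open>
  The ambient Laplacian becomes simple after conjugation with \<open>w = sqrt (vol g(\<rho>) / vol g)\<close>: on
  functions \<open>t\<^bsup>\<gamma>\<^esup> \<phi>(x, \<rho>) / w\<close>, it acts as \<open>t\<^bsup>\<gamma>-2\<^esup> (S\<^sub>\<gamma> \<phi>) / w\<close> with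
  \<open>S\<^sub>\<gamma> = - 2 \<rho> \<partial>\<^sub>\<rho>\<^sup>2 + (2 \<gamma> + n - 2) \<partial>\<^sub>\<rho> + M(\<rho>)\<close>, where
  \<open>M(\<rho>) = - \<delta> (g(\<rho>)\<^sup>-\<^sup>1 d) + U(\<rho>)\<close> acts on functions of \<open>x\<close> only and \<open>U\<close> is a function
  (\<open>lapl_ambient\<close>). Conjugation with \<open>w\<close> works because the volume density of \<open>g(\<rho>)\<close> is \<open>w\<^sup>2\<close>
  times one that does not depend on \<open>\<rho>\<close>. The same cancellation on the collar shows that \<open>U\<close> at
  \<open>\<rho> = - r\<^sup>2/2\<close> is \<open>- r\<^sup>-\<^sup>2 (\<Delta> (log w) - |d log w|\<^sup>2)\<close> for the Poincare--Einstein metric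
  (\<open>laplacian_log_w\<close>). Hence \<open>M(- r\<^sup>2/2)\<close> is the generating operator on the right-hand side of the
  theorem (\<open>generating_op_eq_Mrho\<close>), and it is of second order for every \<open>r\<close>.

  It remains to identify the Taylor coefficients of \<open>M\<close> with the operators \<open>\<M>\<^bsub>2j\<^esub>\<close>. In the
  variable \<open>s = - \<rho>/2 = r\<^sup>2/4\<close>, with \<open>M = \<Sum>\<^sub>j \<mu>\<^sub>j s\<^bsup>j-1\<^esup>\<close>, the operator \<open>S\<^sub>\<gamma>\<close> becomes
  \<open>R\<^sub>k = s \<partial>\<^sup>2 - k \<partial> + M(s)\<close> with \<open>2 k = 2 \<gamma> + n - 2\<close>, and \<open>P\<^bsub>2N\<^esub>\<close> is the value at
  \<open>s = 0\<close> of \<open>R\<^bsub>1-N\<^esub> \<circ> \<dots> \<circ> R\<^bsub>N-3\<^esub> \<circ> R\<^bsub>N-1\<^esub>\<close> applied to a series with leading coefficient \<open>u\<close>. The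
  rest is algebra in the noncommuting operators \<open>\<mu>\<^sub>j\<close>:
  \<^item> By \<open>R\<^sub>k s = s R\<^bsub>k-2\<^esub> - k\<close>, the value depends only on \<open>u\<close>. The series is chosen as the
    solution \<open>\<Phi>\<close> of \<open>R\<^bsub>\<lambda>-1\<^esub> \<Phi> = 0\<close> at \<open>\<lambda> = N\<close>, truncated at the degree \<open>N\<close> in which the
    recursion breaks down. This gives \<open>P\<^bsub>2N\<^esub> = (N-1)!\<^sup>2 p\<^sub>N\<close>, where \<open>p\<^sub>N\<close> is the obstruction
    (\<open>Rit_eq_pcoef\<close>), and unwinding the recursion gives the coefficients \<open>n\<^sub>I\<close>.
  \<^item> As a function of \<open>\<lambda>\<close>, the coefficients of \<open>\<Phi>\<close> are rational, with residues expressed by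
    the \<open>p\<^sub>N\<close>. The partial fraction decomposition (\<open>Phi_partial_fractions\<close>) expresses the \<open>\<mu>\<^sub>j\<close> by
    the \<open>p\<^sub>N\<close>, with the coefficients \<open>m\<^sub>I\<close>. Hence \<open>\<M>\<^bsub>2j\<^esub> = (j-1)!\<^sup>2 \<mu>\<^sub>j\<close>.

  The formal adjoint \<open>\<delta>\<close> is characterized by integrals against test functions. It is computed by
  the usual divergence formula in charts (\<open>codiff_eq_local\<close>): the formula satisfies the
  characterization by integration by parts, does not depend on the chart by Jacobi's formula for the
  derivative of a determinant, and is the only solution by the fundamental lemma of the calculus of
  variations.
\<close>

section \<open>Calculus of smooth functions on open sets\<close>

lemma C_k_on_cong:
  assumes "open S" "\<And>x. x \<in> S \<Longrightarrow> f x = g x"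
  shows "C_k_on k S f \<longleftrightarrow> C_k_on k S g"
proof -
  have "C_k_on k S f \<Longrightarrow> C_k_on k S g" if "\<And>x. x \<in> S \<Longrightarrow> f x = g x" for f g :: "'a \<Rightarrow> 'b"
    using that
  proof (induction k arbitrary: f g)
    case 0
    then show ?case by (metis C_k_on.simps(1) continuous_on_cong)
  next
    case (Suc k)
    have d: "f differentiable at x" if "x \<in> S" for x using Suc.prems that by auto
    have d': "g differentiable at x" if "x \<in> S" for x
      using d[OF that] has_derivative_transform_within_open[of f _ x UNIV S g] assms(1) that Suc.prems(2)
      unfolding differentiable_def by blast
    have "frechet_derivative f (at x) v = frechet_derivative g (at x) v" if "x \<in> S" for x v
      using frechet_derivative_transform_within_open[OF d[OF that] assms(1) that Suc.prems(2)] by simp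
    then have "C_k_on k S (\<lambda>x. frechet_derivative g (at x) v)" for v
      using Suc.IH[of "\<lambda>x. frechet_derivative f (at x) v" "\<lambda>x. frechet_derivative g (at x) v"] Suc.prems
      by auto
    with d' show ?case by simp
  qed
  from this[of f g] this[of g f] assms(2) show ?thesis by force
qed

lemma C_k_on_Suc_imp: "C_k_on (Suc k) S f \<Longrightarrow> C_k_on k S f"
proof (induction k arbitrary: f)
  case 0
  then show ?case
    by (auto intro!: differentiable_imp_continuous_on simp: differentiable_on_def
        differentiable_at_withinI)
next
  case (Suc k)
  then show ?case by (metis C_k_on.simps(2))
qed

lemma smooth_on_cong:
  assumes "open S" "\<And>x. x \<in> S \<Longrightarrow> f x = g x"
  shows "smooth_on S f \<longleftrightarrow> smooth_on S g"
  using C_k_on_cong[OF assms] by (auto simp: smooth_on_def)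

lemma smooth_on_congI:
  "open S \<Longrightarrow> smooth_on S g \<Longrightarrow> (\<And>x. x \<in> S \<Longrightarrow> f x = g x) \<Longrightarrow> smooth_on S f"
  using smooth_on_cong[of S f g] by simp

lemma smooth_on_differentiable: "smooth_on S f \<Longrightarrow> x \<in> S \<Longrightarrow> f differentiable at x"
  unfolding smooth_on_def by (metis C_k_on.simps(2))

lemma smooth_on_has_derivative:
  "smooth_on S f \<Longrightarrow> x \<in> S \<Longrightarrow> (f has_derivative frechet_derivative f (at x)) (at x)"
  using smooth_on_differentiable frechet_derivative_works by blast

lemma smooth_on_frechet: "smooth_on S f \<Longrightarrow> smooth_on S (\<lambda>x. frechet_derivative f (at x) v)"
  unfolding smooth_on_def by (metis C_k_on.simps(2))

lemma smooth_on_continuous: "smooth_on S f \<Longrightarrow> continuous_on S f"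
  unfolding smooth_on_def by (metis C_k_on.simps(1))

lemma smooth_on_subset:
  assumes "smooth_on S f" "T \<subseteq> S"
  shows "smooth_on T f"
proof -
  have "C_k_on k T f" if "C_k_on k S f" for k and f :: "'a \<Rightarrow> 'b"
    using that
  proof (induction k arbitrary: f)
    case 0
    then show ?case using assms(2) continuous_on_subset by auto
  next
    case (Suc k)
    then show ?case using assms(2) by auto
  qed
  then show ?thesis using assms by (auto simp: smooth_on_def)
qed

text \<open>Smoothness by coinduction: a class of differentiable functions that is closed under directional
  derivatives on \<open>S\<close> consists of smooth functions. It suits functions whose higher derivatives are
  known up to parameters, such as the powers below.\<close>

lemma smooth_on_coinduct:
  assumes "open S" "Q f"
    and "\<And>f x. Q f \<Longrightarrow> x \<in> S \<Longrightarrow> f differentiable at x"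
    and "\<And>f v. Q f \<Longrightarrow> \<exists>g. Q g \<and> (\<forall>x\<in>S. frechet_derivative f (at x) v = g x)"
  shows "smooth_on S f"
proof -
  have "C_k_on k S f" if "Q f" for k f
    using that
  proof (induction k arbitrary: f)
    case 0
    then show ?case
      by (auto intro!: differentiable_imp_continuous_on simp: differentiable_on_def
          differentiable_at_withinI assms(3))
  next
    case (Suc k)
    have "C_k_on k S (\<lambda>x. frechet_derivative f (at x) v)" for v
    proof -
      obtain g where g: "Q g" "\<And>x. x \<in> S \<Longrightarrow> frechet_derivative f (at x) v = g x"
        using assms(4)[OF Suc.prems, of v] by blast
      show ?thesis by (subst C_k_on_cong[OF assms(1) g(2)]) (auto intro: Suc.IH g(1))
    qed
    then show ?case using assms(3)[OF Suc.prems] by simp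
  qed
  then show ?thesis using assms(2) by (auto simp: smooth_on_def)
qed

lemma smooth_on_derivative_intro:
  assumes "open S" "\<And>x. x \<in> S \<Longrightarrow> (f has_derivative D x) (at x)"
    and "\<And>v. smooth_on S (\<lambda>x. D x v)"
  shows "smooth_on S f"
proof -
  have e: "frechet_derivative f (at x) v = D x v" if "x \<in> S" for x v
    using frechet_derivative_at[OF assms(2)[OF that]] by simp
  have "C_k_on k S f" for k
  proof (cases k)
    case 0
    have "f differentiable_on S"
      using assms(2) has_derivative_at_withinI unfolding differentiable_on_def differentiable_def by blast
    then show ?thesis using 0 differentiable_imp_continuous_on by simp
  next
    case (Suc k')
    have "C_k_on k' S (\<lambda>x. frechet_derivative f (at x) v)" for v
      using assms(3)[of v] C_k_on_cong[OF assms(1), of "\<lambda>x. frechet_derivative f (at x) v" "\<lambda>x. D x v" k'] e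
      unfolding smooth_on_def by blast
    then show ?thesis using Suc assms(2) by (auto simp: differentiable_def)
  qed
  then show ?thesis by (simp add: smooth_on_def)
qed

lemma smooth_on_const [simp]: "smooth_on S (\<lambda>x. c)"
proof -
  have "C_k_on k S (\<lambda>x. c)" for k and c :: 'b
    by (induction k arbitrary: c) auto
  then show ?thesis by (simp add: smooth_on_def)
qed

lemma C_k_on_derivative_intro:
  assumes "open S" "\<And>x. x \<in> S \<Longrightarrow> (f has_derivative D x) (at x)"
    and "\<And>v. C_k_on k S (\<lambda>x. D x v)"
  shows "C_k_on (Suc k) S f"
proof -
  have e: "frechet_derivative f (at x) v = D x v" if "x \<in> S" for x v
    using frechet_derivative_at[OF assms(2)[OF that]] by simp
  have "C_k_on k S (\<lambda>x. frechet_derivative f (at x) v)" for v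
    using assms(3)[of v] C_k_on_cong[OF assms(1), of "\<lambda>x. frechet_derivative f (at x) v" "\<lambda>x. D x v" k] e
    by blast
  then show ?thesis using assms(2) by (auto simp: differentiable_def)
qed

lemma C_k_on_has_derivative:
  "C_k_on (Suc k) S f \<Longrightarrow> x \<in> S \<Longrightarrow> (f has_derivative frechet_derivative f (at x)) (at x)"
  using frechet_derivative_works by auto

lemma C_k_on_add:
  assumes "open S" "C_k_on k S f" "C_k_on k S g"
  shows "C_k_on k S (\<lambda>x. f x + g x)"
  using assms(2,3)
proof (induction k arbitrary: f g)
  case (Suc k)
  show ?case
  proof (rule C_k_on_derivative_intro[OF assms(1)])
    show "((\<lambda>x. f x + g x) has_derivative
        (\<lambda>v. frechet_derivative f (at x) v + frechet_derivative g (at x) v)) (at x)" if "x \<in> S" for x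
      by (intro has_derivative_add C_k_on_has_derivative[OF Suc.prems(1) that]
          C_k_on_has_derivative[OF Suc.prems(2) that])
  qed (use Suc in auto)
qed (auto intro: continuous_on_add)

lemma C_k_on_bilinear:
  assumes "open S" and b: "bounded_bilinear b" and "C_k_on k S f" "C_k_on k S g"
  shows "C_k_on k S (\<lambda>x. b (f x) (g x))"
  using assms(3,4)
proof (induction k arbitrary: f g)
  case 0
  then show ?case using bounded_bilinear.continuous_on[OF b] by auto
next
  case (Suc k)
  show ?case
  proof (rule C_k_on_derivative_intro[OF assms(1)])
    show "((\<lambda>x. b (f x) (g x)) has_derivative
       (\<lambda>v. b (f x) (frechet_derivative g (at x) v) + b (frechet_derivative f (at x) v) (g x))) (at x)"
      if "x \<in> S" for x
      by (intro bounded_bilinear.FDERIV[OF b] C_k_on_has_derivative[OF Suc.prems(1) that]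
          C_k_on_has_derivative[OF Suc.prems(2) that])
    show "C_k_on k S (\<lambda>x. b (f x) (frechet_derivative g (at x) v) + b (frechet_derivative f (at x) v) (g x))" for v
      using Suc.prems by (intro C_k_on_add[OF assms(1)] Suc.IH) (auto intro: C_k_on_Suc_imp)
  qed
qed

lemma smooth_on_add:
  "open S \<Longrightarrow> smooth_on S f \<Longrightarrow> smooth_on S g \<Longrightarrow> smooth_on S (\<lambda>x. f x + g x)"
  using C_k_on_add[of S _ f g] by (simp add: smooth_on_def)

lemma smooth_on_sum:
  assumes "open S" "\<And>i. i \<in> I \<Longrightarrow> smooth_on S (f i)"
  shows "smooth_on S (\<lambda>x. \<Sum>i\<in>I. f i x)"
  using assms(2) by (induction I rule: infinite_finite_induct) (auto intro: smooth_on_add[OF assms(1)])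

lemma smooth_on_bilinear:
  "open S \<Longrightarrow> bounded_bilinear b \<Longrightarrow> smooth_on S f \<Longrightarrow> smooth_on S g \<Longrightarrow> smooth_on S (\<lambda>x. b (f x) (g x))"
  using C_k_on_bilinear[of S b _ f g] by (simp add: smooth_on_def)

lemma smooth_on_bounded_linear:
  assumes "open S" "bounded_linear b" "smooth_on S f"
  shows "smooth_on S (\<lambda>x. b (f x))"
proof (rule smooth_on_coinduct[where Q = "\<lambda>h. \<exists>f. smooth_on S f \<and> h = (\<lambda>x. b (f x))"])
  fix h :: "'a \<Rightarrow> 'c" and v
  assume "\<exists>f. smooth_on S f \<and> h = (\<lambda>x. b (f x))"
  then obtain f where *: "smooth_on S f" "h = (\<lambda>x. b (f x))" by blast
  have hd: "(h has_derivative (\<lambda>v. b (frechet_derivative f (at x) v))) (at x)"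
    if "x \<in> S" for x
    unfolding *(2) by (intro bounded_linear.has_derivative[OF assms(2)] smooth_on_has_derivative[OF _ that] *)
  from frechet_derivative_at[OF hd] have
    "\<forall>x\<in>S. frechet_derivative h (at x) v = b (frechet_derivative f (at x) v)"
    by metis
  then show "\<exists>k. (\<exists>f. smooth_on S f \<and> k = (\<lambda>x. b (f x))) \<and> (\<forall>x\<in>S. frechet_derivative h (at x) v = k x)"
    using smooth_on_frechet[OF *(1)] by blast
next
  fix h :: "'a \<Rightarrow> 'c" and x assume "\<exists>f. smooth_on S f \<and> h = (\<lambda>x. b (f x))" "x \<in> S"
  then obtain f where *: "smooth_on S f" "h = (\<lambda>x. b (f x))" by blast
  show "h differentiable at x"
    unfolding *(2) differentiable_def
    using bounded_linear.has_derivative[OF assms(2) smooth_on_has_derivative[OF *(1) \<open>x \<in> S\<close>]] by blast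
next
  show "\<exists>f'. smooth_on S f' \<and> (\<lambda>x. b (f x)) = (\<lambda>x. b (f' x))" using assms(3) by blast
qed (rule assms(1))

lemma smooth_on_linear_map:
  assumes "open S" "bounded_linear b"
  shows "smooth_on S b"
proof (rule smooth_on_derivative_intro[where D = "\<lambda>_. b"])
  show "(b has_derivative b) (at x)" for x using assms(2) by (rule bounded_linear_imp_has_derivative)
qed (use assms(1) smooth_on_const in auto)

lemmas smooth_on_inner = smooth_on_bilinear[OF _ bounded_bilinear_inner]

lemma smooth_on_mult:
  fixes f g :: "'a::euclidean_space \<Rightarrow> real"
  shows "open S \<Longrightarrow> smooth_on S f \<Longrightarrow> smooth_on S g \<Longrightarrow> smooth_on S (\<lambda>x. f x * g x)"
  by (rule smooth_on_bilinear[OF _ bounded_bilinear_mult])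

lemma smooth_on_minus: "open S \<Longrightarrow> smooth_on S f \<Longrightarrow> smooth_on S (\<lambda>x. - f x)"
  using smooth_on_bounded_linear[OF _ bounded_linear_minus[OF bounded_linear_ident]] .

lemma smooth_on_diff:
  "open S \<Longrightarrow> smooth_on S f \<Longrightarrow> smooth_on S g \<Longrightarrow> smooth_on S (\<lambda>x. f x - g x)"
  using smooth_on_add[of S f "\<lambda>x. - g x"] smooth_on_minus[of S g] by simp

lemma smooth_on_prod:
  fixes f :: "'i \<Rightarrow> 'a::euclidean_space \<Rightarrow> real"
  assumes "open S" "\<And>i. i \<in> I \<Longrightarrow> smooth_on S (f i)"
  shows "smooth_on S (\<lambda>x. \<Prod>i\<in>I. f i x)"
  using assms(2) by (induction I rule: infinite_finite_induct) (auto intro: smooth_on_mult[OF assms(1)])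

lemma smooth_on_power:
  fixes f :: "'a::euclidean_space \<Rightarrow> real"
  assumes "open S" "smooth_on S f"
  shows "smooth_on S (\<lambda>x. f x ^ n)"
  by (induction n) (auto intro: smooth_on_mult assms)

lemma smooth_on_vec_nth: "open S \<Longrightarrow> smooth_on S f \<Longrightarrow> smooth_on S (\<lambda>x. f x $ i)"
  using smooth_on_bounded_linear[OF _ bounded_linear_vec_nth] .

lemma smooth_on_vec:
  fixes f :: "'a::euclidean_space \<Rightarrow> 'b::real_normed_vector^'k::finite"
  assumes "open S" "\<And>i. smooth_on S (\<lambda>x. f x $ i)"
  shows "smooth_on S f"
proof -
  have b: "bounded_linear (axis i :: 'b \<Rightarrow> 'b^'k)" for i
  proof (rule bounded_linear_intro)
    show "norm (axis i z :: 'b^'k) \<le> norm z * 1" for z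
      by (simp add: norm_vec_def L2_set_def axis_def if_distrib[of norm] if_distrib[of "\<lambda>x. x\<^sup>2"] cong: if_cong)
  qed (simp_all add: vec_eq_iff axis_def)
  have "smooth_on S (\<lambda>x. \<Sum>i\<in>UNIV. axis i (f x $ i))"
    by (intro smooth_on_sum smooth_on_bounded_linear[OF assms(1) b] assms)
  moreover have "(\<lambda>x. \<Sum>i\<in>UNIV. axis i (f x $ i)) = f"
    by (auto simp: vec_eq_iff fun_eq_iff axis_def)
  ultimately show ?thesis by simp
qed

text \<open>The derivative of a composition in a fixed direction involves the derivatives of the outer
  function in all directions; hence the expansion in a basis.\<close>

lemma smooth_on_compose:
  fixes f :: "'a::euclidean_space \<Rightarrow> 'b::euclidean_space" and g :: "'b \<Rightarrow> 'c::real_normed_vector"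
  assumes "open S" "smooth_on S f" "smooth_on T g" "\<And>x. x \<in> S \<Longrightarrow> f x \<in> T"
  shows "smooth_on S (\<lambda>x. g (f x))"
proof -
  have "C_k_on k S (\<lambda>x. g (f x))" if "smooth_on T g" for k and g :: "'b \<Rightarrow> 'c"
    using that
  proof (induction k arbitrary: g)
    case 0
    then show ?case
      using continuous_on_compose2[OF smooth_on_continuous[OF 0] smooth_on_continuous[OF assms(2)]] assms(4)
      by (auto simp: image_subset_iff)
  next
    case (Suc k)
    show ?case
    proof (rule C_k_on_derivative_intro[OF assms(1)])
      fix x assume x: "x \<in> S"
      have lin: "linear (frechet_derivative g (at (f x)))"
        using linear_frechet_derivative smooth_on_differentiable[OF Suc.prems assms(4)[OF x]] .
      have rep: "frechet_derivative g (at (f x)) w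
         = (\<Sum>b\<in>Basis. (w \<bullet> b) *\<^sub>R frechet_derivative g (at (f x)) b)" for w
        by (subst euclidean_representation[of w, symmetric])
          (simp only: linear_sum[OF lin] linear_cmul[OF lin])
      have eq: "(\<lambda>v. frechet_derivative g (at (f x)) (frechet_derivative f (at x) v))
         = (\<lambda>v. \<Sum>b\<in>Basis. (frechet_derivative f (at x) v \<bullet> b) *\<^sub>R frechet_derivative g (at (f x)) b)"
        by (rule ext) (rule rep)
      show "((\<lambda>x. g (f x)) has_derivative (\<lambda>v. \<Sum>b\<in>Basis. (frechet_derivative f (at x) v \<bullet> b)
          *\<^sub>R frechet_derivative g (at (f x)) b)) (at x)"
        using has_derivative_compose[OF smooth_on_has_derivative[OF assms(2) x]
            smooth_on_has_derivative[OF Suc.prems assms(4)[OF x]]] unfolding eq .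
    next
      fix v
      have term_b: "C_k_on k S (\<lambda>x. (frechet_derivative f (at x) v \<bullet> b) *\<^sub>R frechet_derivative g (at (f x)) b)" for b
      proof (rule C_k_on_bilinear[OF assms(1) bounded_bilinear_scaleR])
        show "C_k_on k S (\<lambda>x. frechet_derivative f (at x) v \<bullet> b)"
          using smooth_on_inner[OF assms(1) smooth_on_frechet[OF assms(2)] smooth_on_const]
          by (simp add: smooth_on_def)
        show "C_k_on k S (\<lambda>x. frechet_derivative g (at (f x)) b)"
          by (rule Suc.IH[OF smooth_on_frechet[OF Suc.prems]])
      qed
      have sums: "C_k_on k S (\<lambda>x. \<Sum>b\<in>B. F b x)" if "\<And>b. C_k_on k S (F b)" for F :: "'b \<Rightarrow> 'a \<Rightarrow> 'c" and B
      proof -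
        have z: "C_k_on k S (\<lambda>x. 0 :: 'c)"
          using smooth_on_const[of S "0 :: 'c"] unfolding smooth_on_def by blast
        show ?thesis
          by (induction B rule: infinite_finite_induct) (auto intro: C_k_on_add[OF assms(1)] that z)
      qed
      show "C_k_on k S (\<lambda>x. \<Sum>b\<in>Basis. (frechet_derivative f (at x) v \<bullet> b)
          *\<^sub>R frechet_derivative g (at (f x)) b)"
        by (rule sums[OF term_b])
    qed
  qed
  then show ?thesis using assms(3) by (simp add: smooth_on_def)
qed

lemma smooth_on_real_deriv_intro:
  fixes f :: "real \<Rightarrow> real"
  assumes "open S" "\<And>x. x \<in> S \<Longrightarrow> (f has_real_derivative D x) (at x)" "smooth_on S D"
  shows "smooth_on S f"
proof (rule smooth_on_derivative_intro[OF assms(1), where D = "\<lambda>x v. D x * v"])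
  show "(f has_derivative (\<lambda>v. D x * v)) (at x)" if "x \<in> S" for x
    using assms(2)[OF that] by (simp add: has_field_derivative_def)
  show "smooth_on S (\<lambda>x. D x * v)" for v
    by (intro smooth_on_mult assms smooth_on_const)
qed

lemma smooth_on_real_coinduct:
  fixes f :: "real \<Rightarrow> real"
  assumes "open S" "Q f" and "\<And>f. Q f \<Longrightarrow> \<exists>g. Q g \<and> (\<forall>x\<in>S. (f has_real_derivative g x) (at x))"
  shows "smooth_on S f"
proof (rule smooth_on_coinduct[OF assms(1), where Q = "\<lambda>h. \<exists>f c. Q f \<and> h = (\<lambda>x. c * f x)"])
  show "\<exists>g c. Q g \<and> f = (\<lambda>x. c * g x)" using assms(2) by (intro exI[of _ f] exI[of _ 1]) auto
next
  fix h :: "real \<Rightarrow> real" and x assume "\<exists>f c. Q f \<and> h = (\<lambda>x. c * f x)" "x \<in> S"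
  then obtain f c g where *: "h = (\<lambda>x. c * f x)" "(f has_real_derivative g) (at x)"
    using assms(3) by blast
  show "h differentiable at x"
    unfolding *(1) using DERIV_cmult[OF *(2), of c] by (auto simp: real_differentiable_def)
next
  fix h :: "real \<Rightarrow> real" and v assume "\<exists>f c. Q f \<and> h = (\<lambda>x. c * f x)"
  then obtain f c g where *: "h = (\<lambda>x. c * f x)" "Q g" "\<And>x. x \<in> S \<Longrightarrow> (f has_real_derivative g x) (at x)"
    using assms(3) by blast
  have "frechet_derivative h (at x) v = (c * v) * g x" if "x \<in> S" for x
  proof -
    have "(h has_derivative (\<lambda>v. (c * g x) * v)) (at x)"
      unfolding *(1) using DERIV_cmult[OF *(3)[OF that], of c] by (simp add: has_field_derivative_def)
    from frechet_derivative_at[OF this] show ?thesis by (metis mult.commute mult.left_commute)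
  qed
  then show "\<exists>k. (\<exists>f c. Q f \<and> k = (\<lambda>x. c * f x)) \<and> (\<forall>x\<in>S. frechet_derivative h (at x) v = k x)"
    using *(2) by blast
qed

lemma smooth_on_inverse: "smooth_on (- {0}) (inverse :: real \<Rightarrow> real)"
proof (rule smooth_on_real_coinduct[where Q = "\<lambda>f. \<exists>c n. f = (\<lambda>x. c * inverse x ^ n)"])
  show "\<exists>c n. (inverse::real\<Rightarrow>real) = (\<lambda>x. c * inverse x ^ n)" by (intro exI[of _ 1]) auto
  fix f :: "real \<Rightarrow> real" assume "\<exists>c n. f = (\<lambda>x. c * inverse x ^ n)"
  then obtain c n where f: "f = (\<lambda>x. c * inverse x ^ n)" by blast
  have "(f has_real_derivative (- c * n) * inverse x ^ (n + 1)) (at x)" if "x \<noteq> 0" for x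
    unfolding f using that
    by (auto intro!: derivative_eq_intros simp: field_simps)
      (cases n; simp add: field_simps power_add)
  then show "\<exists>g. (\<exists>c n. g = (\<lambda>x. c * inverse x ^ n)) \<and> (\<forall>x\<in>-{0}. (f has_real_derivative g x) (at x))"
    by (intro exI[of _ "\<lambda>x. (- c * n) * inverse x ^ (n + 1)"]) blast
qed auto

lemma smooth_on_powr: "smooth_on {0<..} (\<lambda>x::real. x powr a)"
proof (rule smooth_on_real_coinduct[where Q = "\<lambda>f. \<exists>c a. f = (\<lambda>x. c * x powr a)"])
  show "\<exists>c b. (\<lambda>x::real. x powr a) = (\<lambda>x. c * x powr b)" by (intro exI[of _ 1] exI[of _ a]) simp
  fix f :: "real \<Rightarrow> real" assume "\<exists>c a. f = (\<lambda>x. c * x powr a)"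
  then obtain c a where f: "f = (\<lambda>x. c * x powr a)" by blast
  have "(f has_real_derivative (c * a) * x powr (a - 1)) (at x)" if "x > 0" for x
    unfolding f using that by (auto intro!: derivative_eq_intros simp: powr_diff)
  then show "\<exists>g. (\<exists>c a. g = (\<lambda>x. c * x powr a)) \<and> (\<forall>x\<in>{0<..}. (f has_real_derivative g x) (at x))"
    by (intro exI[of _ "\<lambda>x. (c * a) * x powr (a - 1)"]) auto
qed auto

lemma smooth_on_sqrt: "smooth_on {0<..} sqrt"
  using smooth_on_powr[of "1/2"] smooth_on_cong[of "{0<..}" sqrt "\<lambda>x. x powr (1/2)"]
  by (simp add: powr_half_sqrt)

lemma smooth_on_ln: "smooth_on {0<..} (ln :: real \<Rightarrow> real)"
  by (rule smooth_on_real_deriv_intro[OF _ _ smooth_on_subset[OF smooth_on_inverse]])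
    (auto intro!: derivative_eq_intros simp: field_simps)

lemma smooth_on_divide:
  fixes f g :: "'a::euclidean_space \<Rightarrow> real"
  assumes "open S" "smooth_on S f" "smooth_on S g" "\<And>x. x \<in> S \<Longrightarrow> g x \<noteq> 0"
  shows "smooth_on S (\<lambda>x. f x / g x)"
  using smooth_on_mult[OF assms(1,2) smooth_on_compose[OF assms(1,3) smooth_on_inverse]] assms(4)
  by (simp add: divide_inverse)

text \<open>The function \<open>exp (-1/x)\<close>, extended by \<open>0\<close>, is smooth: all its derivatives have the form
  \<open>p (1/x) exp (-1/x)\<close> with a polynomial \<open>p\<close>.\<close>

definition exp_bump :: "real poly \<Rightarrow> real \<Rightarrow> real" where
  "exp_bump p x = (if x > 0 then poly p (inverse x) * exp (- inverse x) else 0)"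

lemma tendsto_poly_mult_exp_minus:
  fixes p :: "real poly"
  shows "((\<lambda>x. poly p x * exp (- x)) \<longlongrightarrow> 0) at_top"
proof -
  have "((\<lambda>x. \<Sum>i\<le>degree p. coeff p i * (x ^ i / exp x)) \<longlongrightarrow> (\<Sum>i\<le>degree p. coeff p i * 0)) at_top"
    by (intro tendsto_intros tendsto_power_div_exp_0)
  then show ?thesis
    by (simp add: poly_altdef exp_minus sum_distrib_left divide_inverse mult_ac)
qed

lemma exp_bump_has_derivative:
  "(exp_bump p has_real_derivative exp_bump ([:0, 0, 1:] * (p - pderiv p)) x) (at x)"
proof -
  consider "x > 0" | "x < 0" | "x = 0" by linarith
  then show ?thesis
  proof cases
    case 1
    have "((\<lambda>x. poly p (inverse x) * exp (- inverse x)) has_real_derivative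
       exp_bump ([:0, 0, 1:] * (p - pderiv p)) x) (at x)"
      using 1 by (auto simp: exp_bump_def intro!: derivative_eq_intros DERIV_chain2[OF poly_DERIV])
        (simp add: field_simps power2_eq_square)
    then show ?thesis
      by (rule has_field_derivative_transform_within_open[where S = "{0<..}"]) (use 1 in \<open>auto simp: exp_bump_def\<close>)
  next
    case 2
    have "((\<lambda>x. 0) has_real_derivative exp_bump ([:0, 0, 1:] * (p - pderiv p)) x) (at x)"
      using 2 by (auto simp: exp_bump_def)
    then show ?thesis
      by (rule has_field_derivative_transform_within_open[where S = "{..<0}"]) (use 2 in \<open>auto simp: exp_bump_def\<close>)
  next
    case 3
    have "((\<lambda>h. poly (pCons 0 p) (inverse h) * exp (- inverse h)) \<longlongrightarrow> 0) (at_right 0)"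
      by (rule filterlim_compose[OF tendsto_poly_mult_exp_minus filterlim_inverse_at_top_right])
    moreover have "\<forall>\<^sub>F h in at_right 0. poly (pCons 0 p) (inverse h) * exp (- inverse h) = exp_bump p h / h"
      by (auto simp: eventually_at_right_less exp_bump_def divide_inverse mult_ac eventually_at_filter)
    ultimately have "((\<lambda>h. exp_bump p h / h) \<longlongrightarrow> 0) (at_right 0)"
      by (rule Lim_transform_eventually)
    moreover have "((\<lambda>h. exp_bump p h / h) \<longlongrightarrow> 0) (at_left 0)"
      by (rule Lim_transform_eventually[OF tendsto_const])
        (auto simp: exp_bump_def eventually_at_filter)
    ultimately have "((\<lambda>h. exp_bump p h / h) \<longlongrightarrow> 0) (at 0)"
      by (simp add: filterlim_split_at)
    then show ?thesis using 3 by (simp add: DERIV_def exp_bump_def)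
  qed
qed

lemma smooth_on_exp_bump: "smooth_on UNIV (exp_bump p)"
  by (rule smooth_on_real_coinduct[where Q = "\<lambda>f. \<exists>p. f = exp_bump p"])
    (use exp_bump_has_derivative in \<open>blast+\<close>)

section \<open>Partial derivatives\<close>

lemma pd_eqI: "(f has_derivative f') (at y) \<Longrightarrow> pd a f y = f' (axis a 1)"
  unfolding pd_def using frechet_derivative_at by metis

lemma pd_cong:
  assumes "open S" "y \<in> S" "\<And>x. x \<in> S \<Longrightarrow> f x = g x"
  shows "pd a f y = pd a g y"
proof -
  have "(f has_derivative f') (at y) \<longleftrightarrow> (g has_derivative f') (at y)" for f'
    using has_derivative_transform_within_open[of f f' y UNIV S g]
      has_derivative_transform_within_open[of g f' y UNIV S f] assms by auto
  then show ?thesis by (simp add: pd_def frechet_derivative_def)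
qed

lemma smooth_on_pd: "smooth_on S f \<Longrightarrow> smooth_on S (pd a f)"
  unfolding pd_def by (rule smooth_on_frechet)

lemma frechet_derivative_eq_sum_pd:
  assumes "f differentiable at y"
  shows "frechet_derivative f (at y) v = (\<Sum>a\<in>UNIV. v $ a * pd a f y)"
proof -
  have lin: "linear (frechet_derivative f (at y))" by (rule linear_frechet_derivative[OF assms])
  have "v = (\<Sum>a\<in>UNIV. v $ a *\<^sub>R axis a 1)" by (simp add: basis_expansion scalar_mult_eq_scaleR[symmetric])
  then have "frechet_derivative f (at y) v = frechet_derivative f (at y) (\<Sum>a\<in>UNIV. v $ a *\<^sub>R axis a 1)" by simp
  also have "\<dots> = (\<Sum>a\<in>UNIV. v $ a * pd a f y)"
    by (simp add: linear_sum[OF lin] linear_cmul[OF lin] pd_def)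
  finally show ?thesis .
qed

lemma has_derivative_pd:
  assumes "f differentiable at y"
  shows "(f has_derivative (\<lambda>v. \<Sum>a\<in>UNIV. v $ a * pd a f y)) (at y)"
  using assms frechet_derivative_works frechet_derivative_eq_sum_pd[OF assms] by (metis (no_types, lifting) ext)

lemma pd_const [simp]: "pd a (\<lambda>y. c) y = 0"
  by (rule pd_eqI[OF has_derivative_const, simplified])

lemma pd_coord [simp]: "pd a (\<lambda>y. y $ b) y = (if a = b then 1 else 0)"
  using pd_eqI[OF bounded_linear_imp_has_derivative[OF bounded_linear_vec_nth], of a b y]
  by (simp add: axis_def)

lemma pd_add:
  assumes "f differentiable at y" "g differentiable at y"
  shows "pd a (\<lambda>x. f x + g x) y = pd a f y + pd a g y"
  using pd_eqI[OF has_derivative_add[OF assms[unfolded frechet_derivative_works]]] by (simp add: pd_def)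

lemma pd_diff:
  assumes "f differentiable at y" "g differentiable at y"
  shows "pd a (\<lambda>x. f x - g x) y = pd a f y - pd a g y"
  using pd_eqI[OF has_derivative_diff[OF assms[unfolded frechet_derivative_works]]] by (simp add: pd_def)

lemma pd_minus:
  assumes "f differentiable at y"
  shows "pd a (\<lambda>x. - f x) y = - pd a f y"
  using pd_eqI[OF has_derivative_minus[OF assms[unfolded frechet_derivative_works]]] by (simp add: pd_def)

lemma pd_mult:
  assumes "f differentiable at y" "g differentiable at y"
  shows "pd a (\<lambda>x. f x * g x) y = f y * pd a g y + pd a f y * g y"
  using pd_eqI[OF has_derivative_mult[OF assms[unfolded frechet_derivative_works]]] by (simp add: pd_def)

lemma pd_cmult:
  assumes "f differentiable at y"
  shows "pd a (\<lambda>x. c * f x) y = c * pd a f y"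
  using pd_mult[OF _ assms, of "\<lambda>_. c"] by simp

lemma pd_sum:
  assumes "\<And>i. i \<in> I \<Longrightarrow> f i differentiable at y"
  shows "pd a (\<lambda>x. \<Sum>i\<in>I. f i x) y = (\<Sum>i\<in>I. pd a (f i) y)"
  using pd_eqI[OF has_derivative_sum[OF assms[unfolded frechet_derivative_works]]] by (simp add: pd_def)

lemma pd_compose_real:
  assumes "f differentiable at y" "(\<phi> has_real_derivative d) (at (f y))"
  shows "pd a (\<lambda>x. \<phi> (f x)) y = d * pd a f y"
  using pd_eqI[OF has_derivative_compose[OF assms(1)[unfolded frechet_derivative_works]
        assms(2)[unfolded has_field_derivative_def]]]
  by (simp add: pd_def)

lemma pd_divide:
  assumes "f differentiable at y" "g differentiable at y" "g y \<noteq> 0"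
  shows "pd a (\<lambda>x. f x / g x) y = (pd a f y * g y - f y * pd a g y) / (g y)\<^sup>2"
  using pd_eqI[OF has_derivative_divide'[OF assms(1,2)[unfolded frechet_derivative_works] assms(3)]]
  by (simp add: pd_def power2_eq_square)

lemma pd_compose:
  fixes \<tau> :: "real^'l::finite \<Rightarrow> real^'k::finite"
  assumes "\<tau> differentiable at z" "f differentiable at (\<tau> z)"
  shows "pd a (\<lambda>x. f (\<tau> x)) z = (\<Sum>b\<in>UNIV. pd b f (\<tau> z) * pd a (\<lambda>x. \<tau> x $ b) z)"
proof -
  have c: "pd a (\<lambda>x. \<tau> x $ b) z = frechet_derivative \<tau> (at z) (axis a 1) $ b" for b
    using pd_eqI[OF bounded_linear.has_derivative[OF bounded_linear_vec_nth assms(1)[unfolded frechet_derivative_works]]] .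
  show ?thesis
    using pd_eqI[OF has_derivative_compose[OF assms(1)[unfolded frechet_derivative_works] has_derivative_pd[OF assms(2)]], of a]
    by (simp add: c mult.commute)
qed

lemma pd_along_line:
  assumes "f differentiable at (y + t *\<^sub>R axis a 1)"
  shows "((\<lambda>s. f (y + s *\<^sub>R axis a 1)) has_real_derivative pd a f (y + t *\<^sub>R axis a 1)) (at t)"
proof -
  have "((\<lambda>s. y + s *\<^sub>R axis a 1) has_derivative (\<lambda>s. s *\<^sub>R axis a 1)) (at t)"
    by (auto intro!: derivative_eq_intros)
  from has_derivative_compose[OF this assms[unfolded frechet_derivative_works]]
  show ?thesis
    using linear_cmul[OF linear_frechet_derivative[OF assms]]
    by (simp add: has_field_derivative_def pd_def mult.commute[of _ "frechet_derivative _ _ _"])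
qed

text \<open>The mean value theorem, applied once in each direction, to the second difference quotient. The
  corners of the parallelogram are at distance at most \<open>2 t\<close> from \<open>y\<close>; the radius \<open>3 t\<close> gives an
  open ball that contains them.\<close>

lemma second_difference_mean_value:
  fixes f :: "real^'k::finite \<Rightarrow> real"
  assumes S: "open S" "smooth_on S f" and t: "t > 0" "ball y (3 * t) \<subseteq> S"
  shows "\<exists>z\<in>ball y (3 * t). f (y + t *\<^sub>R axis a 1 + t *\<^sub>R axis b 1) - f (y + t *\<^sub>R axis a 1)
     - f (y + t *\<^sub>R axis b 1) + f y = t * t * pd b (pd a f) z"
proof -
  have inb: "y + s *\<^sub>R axis a 1 + r *\<^sub>R axis b 1 \<in> ball y (3 * t)" if "0 \<le> s" "s \<le> t" "0 \<le> r" "r \<le> t" for s r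
  proof -
    have "norm (s *\<^sub>R (axis a 1 :: real^'k) + r *\<^sub>R axis b 1) \<le> s + r"
      using norm_triangle_ineq[of "s *\<^sub>R (axis a 1 :: real^'k)" "r *\<^sub>R axis b 1"] that by simp
    moreover have "dist y (y + s *\<^sub>R axis a 1 + r *\<^sub>R axis b 1) = norm (s *\<^sub>R (axis a 1 :: real^'k) + r *\<^sub>R axis b 1)"
      using norm_minus_commute[of y "y + s *\<^sub>R axis a 1 + r *\<^sub>R axis b 1"] by (simp add: dist_norm algebra_simps)
    ultimately show ?thesis using that t by auto
  qed
  note inS = subsetD[OF t(2) inb]
  have d: "f differentiable at (y + s *\<^sub>R axis a 1 + r *\<^sub>R axis b 1)"
    "pd a f differentiable at (y + s *\<^sub>R axis a 1 + r *\<^sub>R axis b 1)"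
    if "0 \<le> s" "s \<le> t" "0 \<le> r" "r \<le> t" for s r
    using smooth_on_differentiable[OF S(2) inS[OF that]]
      smooth_on_differentiable[OF smooth_on_pd[OF S(2)] inS[OF that]] by auto
  have shift: "y + s *\<^sub>R axis a 1 + r *\<^sub>R axis b 1 = (y + r *\<^sub>R axis b 1) + s *\<^sub>R axis a 1" for s r :: real
    by simp
  define F where "F s = f (y + s *\<^sub>R axis a 1 + t *\<^sub>R axis b 1) - f (y + s *\<^sub>R axis a 1)" for s
  have F: "DERIV F s :> pd a f (y + s *\<^sub>R axis a 1 + t *\<^sub>R axis b 1) - pd a f (y + s *\<^sub>R axis a 1)"
    if "0 \<le> s" "s \<le> t" for s
  proof -
    have "((\<lambda>s. f (y + s *\<^sub>R axis a 1 + t *\<^sub>R axis b 1)) has_real_derivative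
        pd a f (y + s *\<^sub>R axis a 1 + t *\<^sub>R axis b 1)) (at s)"
      using pd_along_line[of f "y + t *\<^sub>R axis b 1" s a] d(1)[of s t] that t(1) by (simp only: shift)
    moreover have "((\<lambda>s. f (y + s *\<^sub>R axis a 1)) has_real_derivative pd a f (y + s *\<^sub>R axis a 1)) (at s)"
      using pd_along_line[of f y s a] d(1)[of s 0] that t(1) by simp
    ultimately show ?thesis unfolding F_def by (rule DERIV_diff)
  qed
  obtain \<xi> where \<xi>: "0 < \<xi>" "\<xi> < t"
    "F t - F 0 = t * (pd a f (y + \<xi> *\<^sub>R axis a 1 + t *\<^sub>R axis b 1) - pd a f (y + \<xi> *\<^sub>R axis a 1))"
    using MVT2[OF t(1) F] by auto
  have G: "DERIV (\<lambda>r. pd a f (y + \<xi> *\<^sub>R axis a 1 + r *\<^sub>R axis b 1)) r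
      :> pd b (pd a f) (y + \<xi> *\<^sub>R axis a 1 + r *\<^sub>R axis b 1)" if "0 \<le> r" "r \<le> t" for r
    using pd_along_line[of "pd a f" "y + \<xi> *\<^sub>R axis a 1" r b] d(2)[of \<xi> r] that \<xi>(1,2) by simp
  obtain \<eta> where \<eta>: "0 < \<eta>" "\<eta> < t"
    "pd a f (y + \<xi> *\<^sub>R axis a 1 + t *\<^sub>R axis b 1) - pd a f (y + \<xi> *\<^sub>R axis a 1 + 0 *\<^sub>R axis b 1)
      = t * pd b (pd a f) (y + \<xi> *\<^sub>R axis a 1 + \<eta> *\<^sub>R axis b 1)"
    using MVT2[OF t(1) G] by auto
  have "F t - F 0 = t * t * pd b (pd a f) (y + \<xi> *\<^sub>R axis a 1 + \<eta> *\<^sub>R axis b 1)"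
    using \<xi>(3) \<eta>(3) by simp
  then show ?thesis
    using inb[of \<xi> \<eta>] \<xi> \<eta> unfolding F_def by (intro bexI[of _ "y + \<xi> *\<^sub>R axis a 1 + \<eta> *\<^sub>R axis b 1"]) auto
qed

text \<open>Both mixed derivatives are limits of the same second difference quotient, which is symmetric in
  the two directions.\<close>

lemma pd_commute:
  assumes S: "open S" "smooth_on S f" "y \<in> S"
  shows "pd a (pd b f) y = pd b (pd a f) y"
proof (rule ccontr)
  assume ne: "pd a (pd b f) y \<noteq> pd b (pd a f) y"
  define e where "e = \<bar>pd a (pd b f) y - pd b (pd a f) y\<bar> / 2"
  have e: "e > 0" using ne by (simp add: e_def)
  have near: "\<exists>d>0. \<forall>z\<in>ball y d. \<bar>g z - g y\<bar> < e" if "smooth_on S g" for g :: "_ \<Rightarrow> real"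
  proof -
    have "isCont g y"
      using smooth_on_continuous[OF that] S(1,3) continuous_on_eq_continuous_at by blast
    then obtain d where "d > 0" "\<And>z. dist z y < d \<Longrightarrow> dist (g z) (g y) < e"
      using e unfolding continuous_at_eps_delta by meson
    then show ?thesis by (auto simp: dist_real_def dist_commute)
  qed
  obtain d1 where d1: "d1 > 0" "\<And>z. z \<in> ball y d1 \<Longrightarrow> \<bar>pd a (pd b f) z - pd a (pd b f) y\<bar> < e"
    using near[OF smooth_on_pd[OF smooth_on_pd[OF S(2)]]] by blast
  obtain d2 where d2: "d2 > 0" "\<And>z. z \<in> ball y d2 \<Longrightarrow> \<bar>pd b (pd a f) z - pd b (pd a f) y\<bar> < e"
    using near[OF smooth_on_pd[OF smooth_on_pd[OF S(2)]]] by blast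
  obtain d3 where d3: "d3 > 0" "ball y d3 \<subseteq> S" using S open_contains_ball by blast
  define t where "t = min d1 (min d2 d3) / 3"
  have t: "t > 0" "ball y (3 * t) \<subseteq> S" "ball y (3 * t) \<subseteq> ball y d1" "ball y (3 * t) \<subseteq> ball y d2"
    using d1(1) d2(1) d3 by (auto simp: t_def)
  obtain z1 where z1: "z1 \<in> ball y (3 * t)" "f (y + t *\<^sub>R axis b 1 + t *\<^sub>R axis a 1) - f (y + t *\<^sub>R axis b 1)
     - f (y + t *\<^sub>R axis a 1) + f y = t * t * pd a (pd b f) z1"
    using second_difference_mean_value[OF S(1,2) t(1,2)] by blast
  obtain z2 where z2: "z2 \<in> ball y (3 * t)" "f (y + t *\<^sub>R axis a 1 + t *\<^sub>R axis b 1) - f (y + t *\<^sub>R axis a 1)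
     - f (y + t *\<^sub>R axis b 1) + f y = t * t * pd b (pd a f) z2"
    using second_difference_mean_value[OF S(1,2) t(1,2)] by blast
  have swap: "y + t *\<^sub>R axis b 1 + t *\<^sub>R axis a 1 = y + t *\<^sub>R axis a 1 + t *\<^sub>R axis b 1"
    by (simp add: algebra_simps)
  have "t * t * pd a (pd b f) z1 = t * t * pd b (pd a f) z2"
    using z1(2)[unfolded swap] z2(2) by linarith
  then have "pd a (pd b f) z1 = pd b (pd a f) z2" using t(1) by simp
  moreover have "\<bar>pd a (pd b f) z1 - pd a (pd b f) y\<bar> < e" "\<bar>pd b (pd a f) z2 - pd b (pd a f) y\<bar> < e"
    using d1(2) d2(2) z1(1) z2(1) t(3,4) by auto
  ultimately show False unfolding e_def by (smt (verit, best) field_sum_of_halves)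
qed

section \<open>Sums over compositions\<close>

lemma sum_list_ge_length: "\<forall>k\<in>set I. 1 \<le> k \<Longrightarrow> length I \<le> sum_list (I::nat list)"
  by (induction I) auto

lemma finite_compositions: "finite (compositions N)"
proof (rule finite_subset)
  show "compositions N \<subseteq> {I. set I \<subseteq> {..N} \<and> length I \<le> N}"
    using sum_list_ge_length by (auto simp: compositions_def dest: member_le_sum_list)
qed (simp add: finite_lists_length_le)

lemma compositions_0 [simp]: "compositions 0 = {[]}"
proof -
  have "I = []" if "\<forall>k\<in>set I. 1 \<le> k" "sum_list I = 0" for I :: "nat list"
    using sum_list_ge_length[OF that(1)] that(2) by simp
  then show ?thesis by (auto simp: compositions_def)
qed

lemma sum_compositions_Cons:
  assumes "N > 0"
  shows "(\<Sum>I\<in>compositions N. f I) = (\<Sum>j<N. \<Sum>I\<in>compositions (N - Suc j). f (Suc j # I))"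
proof -
  have "(\<Sum>j<N. \<Sum>I\<in>compositions (N - Suc j). f (Suc j # I))
     = (\<Sum>(j, I)\<in>Sigma {..<N} (\<lambda>j. compositions (N - Suc j)). f (Suc j # I))"
    by (simp add: sum.Sigma finite_compositions)
  also have "\<dots> = (\<Sum>I\<in>compositions N. f I)"
  proof (rule sum.reindex_bij_witness[where i = "\<lambda>I. (hd I - 1, tl I)" and j = "\<lambda>(j, I). Suc j # I"])
    fix I assume "I \<in> compositions N"
    then show "(hd I - 1, tl I) \<in> Sigma {..<N} (\<lambda>j. compositions (N - Suc j))"
      and "(case (hd I - 1, tl I) of (j, I) \<Rightarrow> Suc j # I) = I"
      using assms by (cases I; force simp: compositions_def)+
  qed (auto simp: compositions_def)
  finally show ?thesis by simp
qed

lemma sum_compositions_snoc: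
  assumes "N > 0"
  shows "(\<Sum>I\<in>compositions N. f I) = (\<Sum>k=1..N. \<Sum>I\<in>compositions (N - k). f (I @ [k]))"
proof -
  have "(\<Sum>k=1..N. \<Sum>I\<in>compositions (N - k). f (I @ [k]))
     = (\<Sum>(k, I)\<in>Sigma {1..N} (\<lambda>k. compositions (N - k)). f (I @ [k]))"
    by (simp add: sum.Sigma finite_compositions)
  also have "\<dots> = (\<Sum>I\<in>compositions N. f I)"
  proof (rule sum.reindex_bij_witness[where i = "\<lambda>I. (last I, butlast I)" and j = "\<lambda>(k, I). I @ [k]"])
    fix I assume "I \<in> compositions N"
    then show "(last I, butlast I) \<in> Sigma {1..N} (\<lambda>k. compositions (N - k))"
      and "(case (last I, butlast I) of (k, I) \<Rightarrow> I @ [k]) = I"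
      using assms by (cases I rule: rev_cases; force simp: compositions_def)+
  qed (auto simp: compositions_def)
  finally show ?thesis by simp
qed

section \<open>Operators on a space of functions\<close>

instantiation "fun" :: (type, real_vector) real_vector
begin
definition scaleR_fun_def: "scaleR c f = (\<lambda>x. c *\<^sub>R f x)"
instance
  by standard (simp_all add: scaleR_fun_def plus_fun_def scaleR_add_right scaleR_add_left)
end

declare plus_fun_apply [simp del] minus_apply [simp del] uminus_apply [simp del] zero_fun_apply [simp del]

lemma sum_fun_apply: "(\<Sum>i\<in>A. f i) x = (\<Sum>i\<in>A. f i x)"
  by (induction A rule: infinite_finite_induct) (auto simp: zero_fun_def plus_fun_def)

definition lin_on :: "'v::real_vector set \<Rightarrow> ('v \<Rightarrow> 'v) \<Rightarrow> bool" where
  "lin_on V T \<longleftrightarrow> (\<forall>u\<in>V. T u \<in> V) \<and> (\<forall>u\<in>V. \<forall>v\<in>V. T (u + v) = T u + T v)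
     \<and> (\<forall>c. \<forall>u\<in>V. T (c *\<^sub>R u) = c *\<^sub>R T u)"

lemma lin_onD:
  assumes "lin_on V T" "u \<in> V"
  shows "T u \<in> V" "v \<in> V \<Longrightarrow> T (u + v) = T u + T v" "T (c *\<^sub>R u) = c *\<^sub>R T u"
  using assms by (auto simp: lin_on_def)

lemma lin_on_zero: "subspace V \<Longrightarrow> lin_on V T \<Longrightarrow> T 0 = 0"
  using lin_onD(3)[of V T 0 0] subspace_0 by auto

lemma lin_on_sum:
  assumes "subspace V" "lin_on V T" "\<And>i. i \<in> A \<Longrightarrow> f i \<in> V"
  shows "T (\<Sum>i\<in>A. f i) = (\<Sum>i\<in>A. T (f i))"
  using assms(3)
proof (induction A rule: infinite_finite_induct)
  case (insert x F)
  then have "(\<Sum>i\<in>F. f i) \<in> V" by (intro subspace_sum[OF assms(1)]) auto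
  with insert show ?case using lin_onD(2)[OF assms(2)] by auto
qed (auto simp: lin_on_zero[OF assms(1,2)])

lemma lin_on_lincomb:
  assumes "subspace V" "lin_on V T" "\<And>i. i \<in> A \<Longrightarrow> f i \<in> V"
  shows "T (\<Sum>i\<in>A. c i *\<^sub>R f i) = (\<Sum>i\<in>A. c i *\<^sub>R T (f i))"
  using lin_on_sum[OF assms(1,2), of A "\<lambda>i. c i *\<^sub>R f i"] lin_onD(3)[OF assms(2) assms(3)]
  by (simp add: subspace_scale[OF assms(1)] assms(3))

lemma lin_on_scaled: "subspace V \<Longrightarrow> lin_on V T \<Longrightarrow> lin_on V (\<lambda>u. c *\<^sub>R T u)"
  by (auto simp: lin_on_def subspace_scale scaleR_add_right)

lemma lin_on_sum_ops:
  assumes "subspace V" "\<And>i. i \<in> A \<Longrightarrow> lin_on V (T i)"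
  shows "lin_on V (\<lambda>u. \<Sum>i\<in>A. T i u)"
  using assms(2) unfolding lin_on_def
  by (auto simp: sum.distrib scaleR_sum_right intro!: subspace_sum[OF assms(1)] sum.cong)

lemma lin_on_compose: "lin_on V S \<Longrightarrow> lin_on V T \<Longrightarrow> lin_on V (\<lambda>u. S (T u))"
  by (auto simp: lin_on_def)

lemma lin_on_ident: "lin_on V (\<lambda>u. u)"
  by (auto simp: lin_on_def)

lemma op_comp_Nil [simp]: "op_comp P [] u = u"
  and op_comp_Cons [simp]: "op_comp P (k # I) u = P k (op_comp P I u)"
  by (simp_all add: op_comp_def)

lemma op_comp_snoc: "op_comp P (I @ [k]) u = op_comp P I (P k u)"
  by (induction I) auto

lemma op_comp_lin_on:
  assumes "\<And>k. k \<in> set I \<Longrightarrow> lin_on V (P k)"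
  shows "lin_on V (op_comp P I)"
  using assms
proof (induction I)
  case (Cons k I)
  then show ?case using lin_on_compose[of V "P k" "op_comp P I"] by auto
next
  case Nil
  have "op_comp P [] = (\<lambda>u. u)" by (rule ext) simp
  then show ?case by (simp add: lin_on_ident)
qed

lemma op_comp_cong:
  assumes "\<And>k u. k \<in> set I \<Longrightarrow> u \<in> V \<Longrightarrow> P k u = Q k u" "\<And>k. k \<in> set I \<Longrightarrow> lin_on V (Q k)" "u \<in> V"
  shows "op_comp P I u = op_comp Q I u"
  using assms(1,2)
proof (induction I)
  case (Cons k I)
  have "op_comp Q I u \<in> V"
    by (rule lin_onD(1)[OF op_comp_lin_on assms(3)]) (use Cons.prems in auto)
  with Cons show ?case by auto
qed auto

lemma op_comp_scaled:
  assumes "subspace V" "\<And>k. k \<in> set I \<Longrightarrow> lin_on V (P k)" "u \<in> V"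
  shows "op_comp (\<lambda>k u. c k *\<^sub>R P k u) I u = (\<Prod>k\<leftarrow>I. c k) *\<^sub>R op_comp P I u"
  using assms(2)
proof (induction I)
  case (Cons k I)
  have "op_comp P I u \<in> V"
    by (rule lin_onD(1)[OF op_comp_lin_on assms(3)]) (use Cons.prems in auto)
  with Cons show ?case using lin_onD(3)[of V "P k"] by auto
qed auto

section \<open>The operators \<open>s \<partial>\<^sup>2 - k \<partial> + \<Sum>\<^sub>j \<mu>\<^sub>j s\<^bsup>j-1\<^esup>\<close> on formal power series\<close>

text \<open>A formal power series \<open>\<Sum>\<^sub>a \<phi>\<^sub>a s\<^sup>a\<close> is represented by its coefficients. The operators \<open>\<mu> j\<close> are
  the coefficients of \<open>M(s) = \<Sum>\<^bsub>j\<ge>1\<^esub> \<mu>\<^sub>j s\<^bsup>j-1\<^esup>\<close>, and \<open>Rop k\<close> is \<open>s \<partial>\<^sup>2 - k \<partial> + M(s)\<close>. The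
  parameter drops by \<open>2\<close> in each factor of \<open>Rit\<close> because the ambient Laplacian lowers the degree of
  homogeneity by \<open>2\<close>.\<close>

locale operator_series =
  fixes V :: "('m \<Rightarrow> real) set" and \<mu> :: "nat \<Rightarrow> ('m \<Rightarrow> real) \<Rightarrow> 'm \<Rightarrow> real"
  assumes subspace: "subspace V" and lin: "\<And>j. lin_on V (\<mu> j)"
begin

definition Rop :: "real \<Rightarrow> (nat \<Rightarrow> 'm \<Rightarrow> real) \<Rightarrow> nat \<Rightarrow> 'm \<Rightarrow> real" where
  "Rop k \<phi> a = (real (Suc a) * (real a - k)) *\<^sub>R \<phi> (Suc a) + (\<Sum>b\<le>a. \<mu> (Suc b) (\<phi> (a - b)))"

primrec Rit :: "real \<Rightarrow> nat \<Rightarrow> (nat \<Rightarrow> 'm \<Rightarrow> real) \<Rightarrow> nat \<Rightarrow> 'm \<Rightarrow> real" where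
  "Rit \<kappa> 0 \<phi> = \<phi>"
| "Rit \<kappa> (Suc m) \<phi> = Rop (\<kappa> - 2 * real m) (Rit \<kappa> m \<phi>)"

definition times_s :: "(nat \<Rightarrow> 'm \<Rightarrow> real) \<Rightarrow> nat \<Rightarrow> 'm \<Rightarrow> real" where
  "times_s \<phi> a = (case a of 0 \<Rightarrow> 0 | Suc b \<Rightarrow> \<phi> b)"

lemma in_V [simp]: "u \<in> V \<Longrightarrow> \<mu> j u \<in> V"
  using lin lin_onD(1) by blast

lemma Rop_in_V: "(\<And>a. \<phi> a \<in> V) \<Longrightarrow> Rop k \<phi> a \<in> V"
  unfolding Rop_def by (intro subspace_add subspace_scale subspace_sum subspace) auto

lemma Rit_in_V: "(\<And>a. \<phi> a \<in> V) \<Longrightarrow> Rit \<kappa> m \<phi> a \<in> V"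
  by (induction m arbitrary: a) (auto intro: Rop_in_V)

lemma mu_lin:
  "u \<in> V \<Longrightarrow> v \<in> V \<Longrightarrow> \<mu> j (u + v) = \<mu> j u + \<mu> j v" "u \<in> V \<Longrightarrow> \<mu> j (c *\<^sub>R u) = c *\<^sub>R \<mu> j u" "\<mu> j 0 = 0"
  using lin_onD[OF lin] lin_on_zero[OF subspace lin] by auto

lemma Rop_lin:
  assumes "\<And>a. \<phi> a \<in> V" "\<And>a. \<psi> a \<in> V"
  shows "Rop k (\<lambda>a. \<phi> a + c *\<^sub>R \<psi> a) a = Rop k \<phi> a + c *\<^sub>R Rop k \<psi> a"
  using assms by (simp add: Rop_def mu_lin subspace_scale[OF subspace] sum.distrib scaleR_add_right
      scaleR_sum_right mult.commute)

lemma Rit_lin: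
  assumes "\<And>a. \<phi> a \<in> V" "\<And>a. \<psi> a \<in> V"
  shows "Rit \<kappa> m (\<lambda>a. \<phi> a + c *\<^sub>R \<psi> a) a = Rit \<kappa> m \<phi> a + c *\<^sub>R Rit \<kappa> m \<psi> a"
proof (induction m arbitrary: a)
  case (Suc m)
  have "Rit \<kappa> m (\<lambda>a. \<phi> a + c *\<^sub>R \<psi> a) = (\<lambda>a. Rit \<kappa> m \<phi> a + c *\<^sub>R Rit \<kappa> m \<psi> a)"
    by (rule ext) (rule Suc)
  then show ?case using Rop_lin[OF Rit_in_V Rit_in_V, OF assms] by simp
qed simp

text \<open>The commutation relation \<open>R\<^sub>k s = s R\<^bsub>k-2\<^esub> - k\<close>; the operators \<open>\<mu>\<^sub>j\<close> commute with \<open>s\<close>.\<close>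

lemma Rop_times_s:
  "Rop k (times_s \<phi>) a = times_s (Rop (k - 2) \<phi>) a - k *\<^sub>R \<phi> a"
proof (cases a)
  case 0
  then show ?thesis by (simp add: Rop_def times_s_def mu_lin)
next
  case (Suc c)
  have "(\<Sum>b\<le>c. \<mu> (Suc b) (times_s \<phi> (Suc c - b))) = (\<Sum>b\<le>c. \<mu> (Suc b) (\<phi> (c - b)))"
    by (intro sum.cong) (auto simp: times_s_def Suc_diff_le)
  moreover have "real (Suc (Suc c)) * (real (Suc c) - k) = real (Suc c) * (real c - (k - 2)) - k"
    by (simp add: algebra_simps)
  then have "(real (Suc (Suc c)) * (real (Suc c) - k)) *\<^sub>R \<phi> (Suc c)
      = (real (Suc c) * (real c - (k - 2))) *\<^sub>R \<phi> (Suc c) - k *\<^sub>R \<phi> (Suc c)"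
    by (simp only: scaleR_diff_left)
  ultimately show ?thesis
    using Suc by (simp add: Rop_def times_s_def mu_lin)
qed

text \<open>Iterating the commutation relation, the parameters \<open>\<kappa>, \<kappa> - 2, \<dots>\<close> add up to
  \<open>m (\<kappa> - m + 1)\<close>, since the composition of the remaining operators is the same in every term.\<close>

lemma Rit_times_s:
  assumes "\<And>a. \<phi> a \<in> V"
  shows "Rit \<kappa> m (times_s \<phi>) a
    = times_s (Rit (\<kappa> - 2) m \<phi>) a - (real m * (\<kappa> - real m + 1)) *\<^sub>R Rit (\<kappa> - 2) (m - 1) \<phi> a"
proof (induction m arbitrary: a)
  case (Suc m)
  let ?A = "Rit (\<kappa> - 2) m \<phi>" and ?B = "Rit (\<kappa> - 2) (m - 1) \<phi>" and ?c = "real m * (\<kappa> - real m + 1)"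
  have V: "?A a \<in> V" "?B a \<in> V" "times_s ?A a \<in> V" for a
    using Rit_in_V[of \<phi>] assms subspace_0[OF subspace] by (auto simp: times_s_def split: nat.split)
  have eq: "Rit \<kappa> m (times_s \<phi>) = (\<lambda>a. times_s ?A a + (- ?c) *\<^sub>R ?B a)"
    by (rule ext) (simp add: Suc)
  have B: "?c *\<^sub>R Rop (\<kappa> - 2 * real m) ?B a = ?c *\<^sub>R ?A a"
    by (cases m) (simp_all add: algebra_simps)
  have "Rit \<kappa> (Suc m) (times_s \<phi>) a
     = times_s (Rop (\<kappa> - 2 * real m - 2) ?A) a - (\<kappa> - 2 * real m) *\<^sub>R ?A a - ?c *\<^sub>R Rop (\<kappa> - 2 * real m) ?B a"
    unfolding Rit.simps eq Rop_lin[OF V(3,2)] Rop_times_s by simp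
  also have "\<dots> = times_s (Rop (\<kappa> - 2 * real m - 2) ?A) a - (\<kappa> - 2 * real m) *\<^sub>R ?A a - ?c *\<^sub>R ?A a"
    by (simp only: B)
  also have "\<dots> = times_s (Rit (\<kappa> - 2) (Suc m) \<phi>) a
      - ((\<kappa> - 2 * real m) + ?c) *\<^sub>R ?A a"
  proof -
    have "\<kappa> - 2 * real m - 2 = (\<kappa> - 2) - 2 * real m" by simp
    then show ?thesis by (simp only: Rit.simps scaleR_add_left diff_diff_eq)
  qed
  also have "(\<kappa> - 2 * real m) + ?c = real (Suc m) * (\<kappa> - real (Suc m) + 1)"
    by (simp add: algebra_simps)
  finally show ?case by simp
qed simp

text \<open>The sum of the parameters \<open>N - 1, N - 3, \<dots>, 1 - N\<close> vanishes; hence the composition of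
  the \<open>N\<close> operators maps multiples of \<open>s\<close> to multiples of \<open>s\<close>.\<close>

lemma Rit_depends_on_leading_coefficient:
  assumes "\<And>a. \<phi> a \<in> V" "\<And>a. \<psi> a \<in> V" "\<phi> 0 = \<psi> 0"
  shows "Rit (real N - 1) N \<phi> 0 = Rit (real N - 1) N \<psi> 0"
proof -
  define \<theta> where "\<theta> a = \<phi> (Suc a) - \<psi> (Suc a)" for a
  have \<theta>: "\<theta> a \<in> V" for a using assms subspace_diff[OF subspace] by (auto simp: \<theta>_def)
  have t: "times_s \<theta> a \<in> V" for a
    using \<theta> subspace_0[OF subspace] by (auto simp: times_s_def split: nat.split)
  have eq: "\<phi> = (\<lambda>a. \<psi> a + 1 *\<^sub>R times_s \<theta> a)"
    using assms(3) by (auto simp: times_s_def \<theta>_def split: nat.split)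
  have "Rit (real N - 1) N \<phi> 0 = Rit (real N - 1) N \<psi> 0 + 1 *\<^sub>R Rit (real N - 1) N (times_s \<theta>) 0"
    using Rit_lin[where \<phi> = \<psi> and \<psi> = "times_s \<theta>", OF assms(2) t, of "real N - 1" N 1 0]
    by (simp only: eq[symmetric])
  also have "Rit (real N - 1) N (times_s \<theta>) 0 = 0"
    unfolding Rit_times_s[where \<phi> = \<theta>, OF \<theta>] by (simp add: times_s_def)
  finally show ?thesis by simp
qed

text \<open>The coefficients of the solution \<open>\<Sum>\<^sub>a Phi \<lambda> a u s\<^sup>a\<close> of \<open>Rop (\<lambda> - 1) \<phi> = 0\<close> with
  leading coefficient \<open>u\<close>.\<close>

fun Phi :: "real \<Rightarrow> nat \<Rightarrow> ('m \<Rightarrow> real) \<Rightarrow> 'm \<Rightarrow> real" where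
  "Phi l a u = (if a = 0 then u
     else (1 / (real a * (l - real a))) *\<^sub>R (\<Sum>j<a. \<mu> (Suc j) (Phi l (a - Suc j) u)))"

declare Phi.simps [simp del]

lemma Phi_0 [simp]: "Phi l 0 u = u"
  by (simp add: Phi.simps)

lemma Phi_lin: "lin_on V (Phi l a)"
proof (induction a rule: less_induct)
  case (less a)
  show ?case
  proof (cases "a = 0")
    case True
    then show ?thesis using lin_on_ident by (simp add: Phi.simps[abs_def])
  next
    case False
    have "Phi l a = (\<lambda>u. (1 / (real a * (l - real a))) *\<^sub>R (\<Sum>j<a. \<mu> (Suc j) (Phi l (a - Suc j) u)))"
      using False by (simp add: Phi.simps[of l a] fun_eq_iff)
    moreover have "lin_on V \<dots>"
      by (intro lin_on_scaled lin_on_sum_ops lin_on_compose[OF lin less] subspace) (use False in auto)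
    ultimately show ?thesis by simp
  qed
qed

lemma Phi_in_V: "u \<in> V \<Longrightarrow> Phi l a u \<in> V"
  using Phi_lin lin_onD(1) by blast

text \<open>The right-hand side of the recursion for \<open>Phi (real N) N\<close>, which would have to vanish because the
  factor \<open>l - a\<close> does.\<close>

definition pcoef :: "nat \<Rightarrow> ('m \<Rightarrow> real) \<Rightarrow> 'm \<Rightarrow> real" where
  "pcoef N u = (\<Sum>j<N. \<mu> (Suc j) (Phi (real N) (N - Suc j) u))"

lemma pcoef_lin: "lin_on V (pcoef N)"
  unfolding pcoef_def[abs_def] by (intro lin_on_sum_ops lin_on_compose[OF lin Phi_lin] subspace)

lemma Phi_recursion:
  assumes "a > 0" "l \<noteq> real a"
  shows "(\<Sum>j<a. \<mu> (Suc j) (Phi l (a - Suc j) u)) = (real a * (l - real a)) *\<^sub>R Phi l a u"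
  using assms by (simp add: Phi.simps[of l a])

text \<open>At \<open>\<lambda> = N\<close> the recursion for \<open>Phi\<close> breaks down in degree \<open>N\<close>, and the obstruction is
  \<open>pcoef N u\<close>. Starting from the solution truncated below degree \<open>N\<close>, the first operator leaves a
  series that starts in degree \<open>N - 1\<close> with \<open>pcoef N u\<close>, and each of the other \<open>N - 1\<close> operators
  lowers the degree of the leading term by one.\<close>

lemma Rit_eq_pcoef:
  assumes "N \<ge> 1" "\<And>a. \<psi> a \<in> V"
  shows "Rit (real N - 1) N \<psi> 0 = (fact (N - 1))\<^sup>2 *\<^sub>R pcoef N (\<psi> 0)"
proof -
  define \<phi> where "\<phi> a = (if a < N then Phi (real N) a (\<psi> 0) else 0)" for a
  have \<phi>: "\<phi> a \<in> V" for a
    using assms(2) Phi_in_V subspace_0[OF subspace] by (auto simp: \<phi>_def)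
  have step: "i < N \<Longrightarrow> (\<forall>a < N - Suc i. Rit (real N - 1) (Suc i) \<phi> a = 0) \<and>
     Rit (real N - 1) (Suc i) \<phi> (N - Suc i) = (\<Prod>l=1..i. real l * (real N - real l)) *\<^sub>R pcoef N (\<psi> 0)" for i
  proof (induction i)
    case 0
    have *: "(\<Sum>b\<le>a. \<mu> (Suc b) (\<phi> (a - b))) = (\<Sum>b<Suc a. \<mu> (Suc b) (Phi (real N) (Suc a - Suc b) (\<psi> 0)))" if "a < N" for a
      using that unfolding lessThan_Suc_atMost by (intro sum.cong) (auto simp: \<phi>_def)
    have "Rop (real N - 1) \<phi> a = 0" if "a < N - 1" for a
    proof -
      have "real (Suc a) * (real a - (real N - 1)) = - (real (Suc a) * (real N - real (Suc a)))"
        by (simp add: algebra_simps)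
      moreover have "\<phi> (Suc a) = Phi (real N) (Suc a) (\<psi> 0)" "a < N" using that by (auto simp: \<phi>_def)
      ultimately show ?thesis
        using that *[of a] Phi_recursion[of "Suc a" "real N" "\<psi> 0"]
        by (simp only: Rop_def scaleR_minus_left) simp
    qed
    moreover have "Rop (real N - 1) \<phi> (N - 1) = pcoef N (\<psi> 0)"
      using *[of "N - 1"] assms(1) by (simp add: Rop_def pcoef_def of_nat_diff)
    ultimately show ?case by simp
  next
    case (Suc i)
    let ?\<psi> = "Rit (real N - 1) (Suc i) \<phi>"
    have z: "?\<psi> a = 0" if "a < N - Suc i" for a using Suc that by auto
    have sum0: "(\<Sum>b\<le>a. \<mu> (Suc b) (?\<psi> (a - b))) = 0" if "a < N - Suc i" for a
      using that z by (intro sum.neutral) (auto simp: mu_lin simp del: Rit.simps)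
    have "Rit (real N - 1) (Suc (Suc i)) \<phi> a = 0" if "a < N - Suc (Suc i)" for a
      using that sum0[of a] z[of "Suc a"] by (subst Rit.simps) (simp add: Rop_def del: Rit.simps)
    moreover have "Rit (real N - 1) (Suc (Suc i)) \<phi> (N - Suc (Suc i))
        = (\<Prod>l=1..Suc i. real l * (real N - real l)) *\<^sub>R pcoef N (\<psi> 0)"
    proof -
      have S: "Suc (N - Suc (Suc i)) = N - Suc i" using Suc.prems by simp
      have "Rit (real N - 1) (Suc (Suc i)) \<phi> (N - Suc (Suc i))
        = (real (N - Suc i) * (real (N - Suc (Suc i)) - (real N - 1 - 2 * real (Suc i)))) *\<^sub>R ?\<psi> (N - Suc i)"
        using sum0[of "N - Suc (Suc i)"] Suc.prems by (subst Rit.simps) (simp add: Rop_def S del: Rit.simps)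
      also have "?\<psi> (N - Suc i) = (\<Prod>l=1..i. real l * (real N - real l)) *\<^sub>R pcoef N (\<psi> 0)"
        using Suc by auto
      finally show ?thesis
        using Suc.prems by (simp add: of_nat_diff algebra_simps del: Rit.simps)
    qed
    ultimately show ?case by blast
  qed
  have "Rit (real N - 1) N \<psi> 0 = Rit (real N - 1) N \<phi> 0"
    by (rule Rit_depends_on_leading_coefficient) (use assms \<phi> in \<open>auto simp: \<phi>_def\<close>)
  also have "\<dots> = (\<Prod>l=1..N-1. real l * (real N - real l)) *\<^sub>R pcoef N (\<psi> 0)"
    using step[of "N - 1"] assms(1) by (simp del: Rit.simps)
  also have "(\<Prod>l=1..N-1. real l * (real N - real l)) = (fact (N - 1))\<^sup>2"
  proof -
    have "(\<Prod>l=1..N-1. real N - real l) = (\<Prod>l=1..N-1. real l)"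
      using assms(1) by (intro prod.reindex_bij_witness[of _ "\<lambda>l. N - l" "\<lambda>l. N - l"]) (auto simp: of_nat_diff)
    then show ?thesis by (simp add: prod.distrib fact_prod power2_eq_square)
  qed
  finally show ?thesis .
qed

text \<open>As a function of \<open>\<lambda>\<close>, \<open>Phi \<lambda> a\<close> is rational with at most simple poles in \<open>1, \<dots>, a\<close>. The
  residues at \<open>N\<close> vanish for \<open>a < N\<close>, start with \<open>pcoef N u / N\<close> for \<open>a = N\<close>, and satisfy the
  recursion for \<open>Phi (- N)\<close> after a shift of the degree by \<open>N\<close>, because
  \<open>a (N - a) = (a - N) (- N - (a - N))\<close>. The decomposition into partial fractions inverts the passage
  from the \<open>\<mu>\<^sub>j\<close> to the \<open>pcoef N\<close>.\<close>

definition qcoef :: "nat \<Rightarrow> ('m \<Rightarrow> real) \<Rightarrow> 'm \<Rightarrow> real" where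
  "qcoef N u = (1 / real N) *\<^sub>R pcoef N u"

lemma qcoef_lin: "lin_on V (qcoef N)"
  unfolding qcoef_def[abs_def] by (intro lin_on_scaled pcoef_lin subspace)

lemma qcoef_in_V [simp]: "u \<in> V \<Longrightarrow> qcoef N u \<in> V"
  using qcoef_lin lin_onD(1) by blast

text \<open>The recursion applied to the decompositions in lower degrees. The recursion for \<open>Phi (- N)\<close>
  produces the factor \<open>a (N - a) / (l - N) = - a + a (l - a) / (l - N)\<close>.\<close>

lemma Phi_partial_fractions_aux:
  assumes IH: "\<And>b. b < a \<Longrightarrow> Phi l b u = (if b = 0 then u else 0)
      + (\<Sum>N=1..b. (1 / (l - real N)) *\<^sub>R Phi (- real N) (b - N) (qcoef N u))"
    and a: "a > 0" and l: "l \<notin> real ` {1..<a}" and u: "u \<in> V"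
  shows "(\<Sum>j<a. \<mu> (Suc j) (Phi l (a - Suc j) u)) = \<mu> a u
     - real a *\<^sub>R (\<Sum>N=1..<a. Phi (- real N) (a - N) (qcoef N u))
     + (real a * (l - real a)) *\<^sub>R (\<Sum>N=1..<a. (1 / (l - real N)) *\<^sub>R Phi (- real N) (a - N) (qcoef N u))"
proof -
  let ?F = "\<lambda>j N. (1 / (l - real N)) *\<^sub>R \<mu> (Suc j) (Phi (- real N) (a - Suc j - N) (qcoef N u))"
  have V: "Phi (- real N) b (qcoef N u) \<in> V" for N b
    using u by (intro Phi_in_V) simp
  have "\<mu> (Suc j) (Phi l (a - Suc j) u) = (if Suc j = a then \<mu> a u else 0) + (\<Sum>N=1..a - Suc j. ?F j N)"
    if "j < a" for j
  proof -
    have "Phi l (a - Suc j) u = (if a - Suc j = 0 then u else 0)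
      + (\<Sum>N=1..a - Suc j. (1 / (l - real N)) *\<^sub>R Phi (- real N) (a - Suc j - N) (qcoef N u))"
      by (rule IH) (use a in auto)
    moreover have "(\<Sum>N=1..a - Suc j. (1 / (l - real N)) *\<^sub>R Phi (- real N) (a - Suc j - N) (qcoef N u)) \<in> V"
      by (intro subspace_sum subspace_scale subspace V)
    moreover have "(if a - Suc j = 0 then u else 0) \<in> V" using u subspace_0[OF subspace] by auto
    ultimately have "\<mu> (Suc j) (Phi l (a - Suc j) u) = \<mu> (Suc j) (if a - Suc j = 0 then u else 0)
      + (\<Sum>N=1..a - Suc j. ?F j N)"
      using lin_on_lincomb[OF subspace lin V, of "Suc j"] by (simp add: mu_lin)
    moreover have "Suc j = a" if "a - Suc j = 0" using that \<open>j < a\<close> by simp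
    ultimately show ?thesis by (auto simp: mu_lin)
  qed
  then have "(\<Sum>j<a. \<mu> (Suc j) (Phi l (a - Suc j) u))
      = (\<Sum>j<a. if Suc j = a then \<mu> a u else 0) + (\<Sum>j<a. \<Sum>N=1..a - Suc j. ?F j N)"
    by (simp add: sum.distrib)
  also have "(\<Sum>j<a. if Suc j = a then \<mu> a u else 0) = \<mu> a u"
  proof -
    have "(\<Sum>j<a. if Suc j = a then \<mu> a u else 0) = (\<Sum>j\<in>{..<a}. if j = a - 1 then \<mu> a u else 0)"
      using a by (intro sum.cong) auto
    then show ?thesis using a by simp
  qed
  also have "(\<Sum>j<a. \<Sum>N=1..a - Suc j. ?F j N) = (\<Sum>N=1..<a. \<Sum>j<a - N. ?F j N)"
    by (subst (1 2) sum.Sigma; (simp; fail)?)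
      (rule sum.reindex_bij_witness[of _ "\<lambda>(N, j). (j, N)" "\<lambda>(j, N). (N, j)"]; auto)
  also have "\<dots> = (\<Sum>N=1..<a. - real a *\<^sub>R Phi (- real N) (a - N) (qcoef N u)
       + (real a * (l - real a) * (1 / (l - real N))) *\<^sub>R Phi (- real N) (a - N) (qcoef N u))"
  proof (intro sum.cong refl)
    fix N assume N: "N \<in> {1..<a}"
    have "(\<Sum>j<a - N. ?F j N)
      = (1 / (l - real N)) *\<^sub>R (\<Sum>j<a - N. \<mu> (Suc j) (Phi (- real N) (a - N - Suc j) (qcoef N u)))"
      by (simp add: scaleR_sum_right diff_commute add.commute)
    also have "\<dots> = (1 / (l - real N) * (real (a - N) * (- real N - real (a - N)))) *\<^sub>R Phi (- real N) (a - N) (qcoef N u)"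
      using N by (subst Phi_recursion) auto
    also have "1 / (l - real N) * (real (a - N) * (- real N - real (a - N)))
        = - real a + real a * (l - real a) * (1 / (l - real N))"
    proof -
      have "l - real N \<noteq> 0" using N l by auto
      then show ?thesis using N by (simp add: of_nat_diff divide_simps) (simp add: algebra_simps)
    qed
    finally show "(\<Sum>j<a - N. ?F j N) = - real a *\<^sub>R Phi (- real N) (a - N) (qcoef N u)
       + (real a * (l - real a) * (1 / (l - real N))) *\<^sub>R Phi (- real N) (a - N) (qcoef N u)"
      by (simp only: scaleR_add_left)
  qed
  finally show ?thesis
    by (simp add: sum.distrib scaleR_sum_right sum_negf sum_subtractf)
qed

lemma Phi_partial_fractions:
  assumes "l \<notin> real ` {1..a}" "u \<in> V"
  shows "Phi l a u = (if a = 0 then u else 0)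
      + (\<Sum>N=1..a. (1 / (l - real N)) *\<^sub>R Phi (- real N) (a - N) (qcoef N u))"
  using assms(1)
proof (induction a arbitrary: l rule: less_induct)
  case (less a)
  show ?case
  proof (cases "a = 0")
    case False
    then have a: "a > 0" by simp
    define X where "X = (\<Sum>N=1..<a. Phi (- real N) (a - N) (qcoef N u))"
    define Y where "Y l = (\<Sum>N=1..<a. (1 / (l - real N)) *\<^sub>R Phi (- real N) (a - N) (qcoef N u))" for l
    have aux: "(\<Sum>j<a. \<mu> (Suc j) (Phi l (a - Suc j) u)) = \<mu> a u - real a *\<^sub>R X + (real a * (l - real a)) *\<^sub>R Y l"
      if "l \<notin> real ` {1..<a}" for l
      unfolding X_def Y_def
      by (rule Phi_partial_fractions_aux[OF less.IH]) (use that a assms(2) in auto)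
    \<comment> \<open>At \<open>l = a\<close> the term with \<open>Y\<close> has the factor \<open>l - a = 0\<close>.\<close>
    have q: "\<mu> a u - real a *\<^sub>R X = real a *\<^sub>R qcoef a u"
    proof -
      have "real a \<notin> real ` {1..<a}" by auto
      from aux[OF this] show ?thesis using a by (simp add: qcoef_def pcoef_def)
    qed
    have la: "l \<noteq> real a" "l \<notin> real ` {1..<a}" using less.prems a by auto
    have "(real a * (l - real a)) *\<^sub>R Phi l a u = real a *\<^sub>R qcoef a u + (real a * (l - real a)) *\<^sub>R Y l"
      using Phi_recursion[OF a la(1), of u] aux[OF la(2)] q by simp
    then have "(1 / (real a * (l - real a))) *\<^sub>R ((real a * (l - real a)) *\<^sub>R Phi l a u)
        = (1 / (real a * (l - real a))) *\<^sub>R (real a *\<^sub>R qcoef a u + (real a * (l - real a)) *\<^sub>R Y l)"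
      by simp
    then have "Phi l a u = Y l + (1 / (l - real a)) *\<^sub>R qcoef a u"
      using la(1) a by (simp add: scaleR_add_right add.commute)
    also have "\<dots> = (\<Sum>N=1..a. (1 / (l - real N)) *\<^sub>R Phi (- real N) (a - N) (qcoef N u))"
    proof -
      have "{1..a} = insert a {1..<a}" using a by auto
      then show ?thesis by (simp add: Y_def add.commute)
    qed
    finally show ?thesis using False by simp
  qed simp
qed

text \<open>The identity that results from the recursion in degree \<open>a\<close> for \<open>\<lambda> \<rightarrow> \<infinity>\<close>. It is obtained without
  a limit, by the choice \<open>\<lambda> = a\<close>.\<close>

lemma mu_eq_sum_qcoef:
  assumes "a > 0" "u \<in> V"
  shows "\<mu> a u = real a *\<^sub>R (\<Sum>N=1..a. Phi (- real N) (a - N) (qcoef N u))"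
proof -
  have "(\<Sum>j<a. \<mu> (Suc j) (Phi (real a) (a - Suc j) u)) = \<mu> a u
     - real a *\<^sub>R (\<Sum>N=1..<a. Phi (- real N) (a - N) (qcoef N u))
     + (real a * (real a - real a)) *\<^sub>R (\<Sum>N=1..<a. (1 / (real a - real N)) *\<^sub>R Phi (- real N) (a - N) (qcoef N u))"
    by (rule Phi_partial_fractions_aux; (rule Phi_partial_fractions)?) (use assms in auto)
  then have "real a *\<^sub>R qcoef a u = \<mu> a u - real a *\<^sub>R (\<Sum>N=1..<a. Phi (- real N) (a - N) (qcoef N u))"
    using assms(1) by (simp add: qcoef_def pcoef_def)
  moreover have "{1..a} = insert a {1..<a}" using assms(1) by auto
  ultimately show ?thesis by (simp add: scaleR_add_right)
qed
end

section \<open>The coefficients \<open>n\<^sub>I\<close> and \<open>m\<^sub>I\<close>\<close>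

text \<open>The coefficient of \<open>\<mu>\<^bsub>I\<^sub>1\<^esub> \<circ> \<dots> \<circ> \<mu>\<^bsub>I\<^sub>r\<^esub>\<close> in \<open>Phi l |I|\<close>: each application of the recursion
  contributes the reciprocal of \<open>a (l - a)\<close>, where \<open>a\<close> is the sum of the remaining entries.\<close>

primrec phi_coef :: "real \<Rightarrow> nat list \<Rightarrow> real" where
  "phi_coef l [] = 1"
| "phi_coef l (k # I) = phi_coef l I / (real (k + sum_list I) * (l - real (k + sum_list I)))"

lemma phi_coef_eq_prod:
  "phi_coef l I = (\<Prod>j<length I. 1 / (real (sum_list (drop j I)) * (l - real (sum_list (drop j I)))))"
  by (induction I) (auto simp: prod.lessThan_Suc_shift simp del: prod.lessThan_Suc)

lemma sum_nth_atMost_eq_take: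
  "j < length I \<Longrightarrow> (\<Sum>k\<le>j. I ! k) = sum_list (take (Suc j) (I::nat list))"
  by (induction j) (simp_all add: take_Suc_conv_app_nth)

lemma sum_nth_atLeast_eq_drop:
  "(\<Sum>k=j..<length I. I ! k) = sum_list (drop j (I::nat list))"
proof -
  have "(\<Sum>k=j..<length I. I ! k) = (\<Sum>k<length I - j. I ! (j + k))"
    by (rule sum.reindex_bij_witness[of _ "\<lambda>k. j + k" "\<lambda>k. k - j"]) auto
  then show ?thesis by (simp add: sum_list_sum_nth atLeast0LessThan)
qed

lemma real_choose_pred:
  assumes "s \<ge> 1" "x \<ge> 1"
  shows "real ((s + x - 1) choose (x - 1)) = fact (s + x - 1) * (1 / fact (x - 1)) * (1 / (real s * fact (s - 1)))"
proof -
  have "fact s = real s * fact (s - 1)" using assms(1) by (metis fact_reduce of_nat_fact of_nat_mult not_one_le_zero zero_less_iff_neq_zero fact_nonzero)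
  then show ?thesis
    using assms binomial_fact[of "x - 1" "s + x - 1", where 'a = real] by simp
qed

text \<open>Each binomial is \<open>(S\<^sub>j - 1)! / ((I\<^sub>j - 1)! (S\<^sub>j - I\<^sub>j)!)\<close> with the partial sum \<open>S\<^sub>j\<close>, and
  \<open>S\<^sub>j - I\<^sub>j = S\<^bsub>j-1\<^esub>\<close>; hence the product telescopes up to the factors \<open>1 / S\<^bsub>j-1\<^esub>\<close>.\<close>

lemma prod_prefix_binomials:
  assumes "I \<noteq> []" "\<forall>k\<in>set I. 1 \<le> k"
  shows "(\<Prod>j<length I. real ((sum_list (take (Suc j) I) - 1) choose (I ! j - 1)))
    = fact (sum_list I - 1) * (\<Prod>k\<leftarrow>I. 1 / fact (k - 1)) * (\<Prod>j=1..<length I. 1 / real (sum_list (take j I)))"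
  using assms
proof (induction I rule: rev_induct)
  case (snoc x I)
  show ?case
  proof (cases "I = []")
    case False
    define s where "s = sum_list I"
    have s: "s \<ge> 1" using sum_list_ge_length[of I] snoc.prems False
      by (cases I) (auto simp: s_def)
    have x: "x \<ge> 1" using snoc.prems by auto
    have "(\<Prod>j<length (I @ [x]). real ((sum_list (take (Suc j) (I @ [x])) - 1) choose ((I @ [x]) ! j - 1)))
       = (\<Prod>j<length I. real ((sum_list (take (Suc j) I) - 1) choose (I ! j - 1))) * real ((s + x - 1) choose (x - 1))"
      by (simp add: nth_append s_def)
    also have "\<dots> = fact (s + x - 1) * ((\<Prod>k\<leftarrow>I. 1 / fact (k - 1)) * (1 / fact (x - 1)))
        * ((\<Prod>j=1..<length I. 1 / real (sum_list (take j I))) * (1 / real s))"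
      unfolding real_choose_pred[OF s x] using snoc False by (simp add: s_def)
    also have "(\<Prod>j=1..<length I. 1 / real (sum_list (take j I))) * (1 / real s)
        = (\<Prod>j=1..<length (I @ [x]). 1 / real (sum_list (take j (I @ [x]))))"
    proof -
      have "{1..<length (I @ [x])} = insert (length I) {1..<length I}" using False by (cases I) auto
      then show ?thesis by (simp add: s_def)
    qed
    finally show ?thesis by (simp add: s_def)
  qed simp
qed simp

lemma prod_suffix_binomials:
  assumes "I \<noteq> []" "\<forall>k\<in>set I. 1 \<le> k"
  shows "(\<Prod>j<length I. real ((sum_list (drop j I) - 1) choose (I ! j - 1)))
    = fact (sum_list I - 1) * (\<Prod>k\<leftarrow>I. 1 / fact (k - 1)) * (\<Prod>j=1..<length I. 1 / real (sum_list (drop j I)))"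
  using assms
proof (induction I)
  case (Cons x I)
  show ?case
  proof (cases "I = []")
    case False
    define s where "s = sum_list I"
    have s: "s \<ge> 1" using sum_list_ge_length[of I] Cons.prems False
      by (cases I) (auto simp: s_def)
    have x: "x \<ge> 1" using Cons.prems by auto
    have "(\<Prod>j<length (x # I). real ((sum_list (drop j (x # I)) - 1) choose ((x # I) ! j - 1)))
       = real ((s + x - 1) choose (x - 1)) * (\<Prod>j<length I. real ((sum_list (drop j I) - 1) choose (I ! j - 1)))"
      by (simp add: s_def prod.lessThan_Suc_shift add.commute del: prod.lessThan_Suc)
    also have "\<dots> = fact (s + x - 1) * ((1 / fact (x - 1)) * (\<Prod>k\<leftarrow>I. 1 / fact (k - 1)))
        * ((1 / real s) * (\<Prod>j=1..<length I. 1 / real (sum_list (drop j I))))"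
      unfolding real_choose_pred[OF s x] using Cons False by (simp add: s_def)
    also have "(1 / real s) * (\<Prod>j=1..<length I. 1 / real (sum_list (drop j I)))
        = (\<Prod>j<length I. 1 / real (sum_list (drop j I)))"
    proof -
      have "{..<length I} = insert 0 {1..<length I}" using False by (cases I) auto
      then show ?thesis by (simp add: s_def)
    qed
    also have "\<dots> = (\<Prod>j=1..<length (x # I). 1 / real (sum_list (drop j (x # I))))"
      by (rule prod.reindex_bij_witness[of _ "\<lambda>j. j - 1" Suc]) (auto simp: drop_Cons')
    finally show ?thesis by (simp add: s_def add.commute)
  qed simp
qed simp

text \<open>For \<open>l = |I|\<close> the factors \<open>a (l - a)\<close> of \<open>phi_coef\<close> are products of a suffix sum and the
  complementary prefix sum, as in the two products of binomials. The tail of \<open>I\<close> appears because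
  the first step of the recursion, in which \<open>l - a = 0\<close>, carries no denominator in \<open>pcoef\<close>.\<close>

lemma n_coef_eq_phi_coef:
  assumes "I \<noteq> []" "\<forall>k\<in>set I. 1 \<le> k"
  shows "real (n_coef I)
    = (fact (sum_list I - 1))\<^sup>2 * (\<Prod>k\<leftarrow>I. 1 / (fact (k - 1))\<^sup>2) * phi_coef (real (sum_list I)) (tl I)"
proof -
  have "phi_coef (real (sum_list I)) (tl I)
     = (\<Prod>j=1..<length I. 1 / (real (sum_list (drop j I)) * (real (sum_list I) - real (sum_list (drop j I)))))"
    unfolding phi_coef_eq_prod using assms(1)
    by (intro prod.reindex_bij_witness[of _ "\<lambda>j. j - 1" Suc]) (auto simp: drop_Suc)
  also have "\<dots> = (\<Prod>j=1..<length I. (1 / real (sum_list (drop j I))) * (1 / real (sum_list (take j I))))"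
  proof (intro prod.cong refl)
    fix j
    have "sum_list I = sum_list (take j I) + sum_list (drop j I)"
      by (metis append_take_drop_id sum_list_append)
    then show "1 / (real (sum_list (drop j I)) * (real (sum_list I) - real (sum_list (drop j I))))
      = (1 / real (sum_list (drop j I))) * (1 / real (sum_list (take j I)))" by simp
  qed
  also have "\<dots> = (\<Prod>j=1..<length I. 1 / real (sum_list (drop j I))) * (\<Prod>j=1..<length I. 1 / real (sum_list (take j I)))"
    by (rule prod.distrib)
  finally have phi: "phi_coef (real (sum_list I)) (tl I) = \<dots>" .
  have "(\<Prod>k\<leftarrow>I. 1 / (fact (k - 1))\<^sup>2) = (\<Prod>k\<leftarrow>I. 1 / fact (k - 1)) * (\<Prod>k\<leftarrow>I. 1 / fact (k - 1) :: real)"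
    by (induction I) (auto simp: power2_eq_square)
  moreover have "real (n_coef I) = (\<Prod>j<length I. real ((sum_list (take (Suc j) I) - 1) choose (I ! j - 1)))
     * (\<Prod>j<length I. real ((sum_list (drop j I) - 1) choose (I ! j - 1)))"
    unfolding n_coef_def prod.distrib[symmetric]
    by (simp add: sum_nth_atMost_eq_take sum_nth_atLeast_eq_drop)
  ultimately show ?thesis
    unfolding prod_prefix_binomials[OF assms] prod_suffix_binomials[OF assms] phi
    by (simp add: power2_eq_square)
qed

text \<open>The product of the factors \<open>1 / (- K - N)\<close> from the partial fraction decomposition at \<open>l = - K\<close>,
  iterated along \<open>I\<close>; the last entry is paired with \<open>K\<close>.\<close>

definition mq_coef :: "nat \<Rightarrow> nat list \<Rightarrow> real" where
  "mq_coef K I = (-1) ^ length I * (\<Prod>j<length I. 1 / real ((I @ [K]) ! j + (I @ [K]) ! Suc j))"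

lemma mq_coef_Nil [simp]: "mq_coef K [] = 1"
  by (simp add: mq_coef_def)

lemma mq_coef_snoc: "mq_coef K (I @ [N]) = - (1 / (real N + real K)) * mq_coef N I"
proof -
  have "(\<Prod>j<length I. 1 / real ((I @ [N] @ [K]) ! j + (I @ [N] @ [K]) ! Suc j))
     = (\<Prod>j<length I. 1 / real ((I @ [N]) ! j + (I @ [N]) ! Suc j))"
    by (intro prod.cong refl) (auto simp: nth_append)
  then show ?thesis by (simp add: mq_coef_def nth_append)
qed

lemma m_coef_snoc:
  assumes "\<forall>k\<in>set (I @ [N]). 1 \<le> k"
  shows "m_coef (I @ [N]) = (fact (sum_list (I @ [N]) - 1))\<^sup>2 * real (sum_list (I @ [N])) * mq_coef N I
     * (\<Prod>k\<leftarrow>I @ [N]. 1 / real k * (1 / (fact (k - 1))\<^sup>2))"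
proof -
  have fact_pred: "fact k = real k * fact (k - 1)" if "1 \<le> k" for k :: nat
    using that by (cases k) auto
  have *: "(\<Prod>j<length J. 1 / (fact (J ! j) * fact (J ! j - 1))) = (\<Prod>k\<leftarrow>J. 1 / real k * (1 / (fact (k - 1))\<^sup>2))"
    if "\<forall>k\<in>set J. 1 \<le> k" for J :: "nat list"
    using that
    by (induction J) (auto simp: prod.lessThan_Suc_shift fact_pred power2_eq_square simp del: prod.lessThan_Suc)
  have "1 \<le> sum_list (I @ [N])" using assms by simp
  from fact_pred[OF this] show ?thesis
    unfolding m_coef_def *[OF assms] by (simp add: mq_coef_def power2_eq_square)
qed

context operator_series
begin

lemma mu_lincomb_op_comp:
  assumes "u \<in> V"
  shows "\<mu> j (\<Sum>I\<in>A. c I *\<^sub>R op_comp \<mu> I u) = (\<Sum>I\<in>A. c I *\<^sub>R \<mu> j (op_comp \<mu> I u))"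
  by (rule lin_on_lincomb[OF subspace lin], rule lin_onD(1)[OF op_comp_lin_on assms], rule lin)

lemma Phi_eq_sum_compositions:
  assumes "u \<in> V"
  shows "Phi l a u = (\<Sum>I\<in>compositions a. phi_coef l I *\<^sub>R op_comp \<mu> I u)"
proof (induction a rule: less_induct)
  case (less a)
  show ?case
  proof (cases "a = 0")
    case False
    then have a: "a > 0" by simp
    have "(\<Sum>j<a. \<mu> (Suc j) (Phi l (a - Suc j) u))
       = (\<Sum>j<a. \<Sum>I\<in>compositions (a - Suc j). phi_coef l I *\<^sub>R op_comp \<mu> (Suc j # I) u)"
    proof (intro sum.cong refl)
      fix j
      have "Phi l (a - Suc j) u = (\<Sum>I\<in>compositions (a - Suc j). phi_coef l I *\<^sub>R op_comp \<mu> I u)"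
        by (rule less) (use a in auto)
      then show "\<mu> (Suc j) (Phi l (a - Suc j) u)
        = (\<Sum>I\<in>compositions (a - Suc j). phi_coef l I *\<^sub>R op_comp \<mu> (Suc j # I) u)"
        by (simp add: mu_lincomb_op_comp assms)
    qed
    then have "Phi l a u = (\<Sum>j<a. \<Sum>I\<in>compositions (a - Suc j).
        (1 / (real a * (l - real a)) * phi_coef l I) *\<^sub>R op_comp \<mu> (Suc j # I) u)"
      using a by (simp add: Phi.simps[of l a] scaleR_sum_right)
    also have "\<dots> = (\<Sum>j<a. \<Sum>I\<in>compositions (a - Suc j).
        phi_coef l (Suc j # I) *\<^sub>R op_comp \<mu> (Suc j # I) u)"
    proof (intro sum.cong refl)
      fix j I assume "j \<in> {..<a}" "I \<in> compositions (a - Suc j)"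
      then have "Suc j + sum_list I = a" by (auto simp: compositions_def)
      then have "phi_coef l (Suc j # I) = 1 / (real a * (l - real a)) * phi_coef l I"
        by (simp only: phi_coef.simps) simp
      then show "(1 / (real a * (l - real a)) * phi_coef l I) *\<^sub>R op_comp \<mu> (Suc j # I) u
        = phi_coef l (Suc j # I) *\<^sub>R op_comp \<mu> (Suc j # I) u" by (simp only:)
    qed
    also have "\<dots> = (\<Sum>I\<in>compositions a. phi_coef l I *\<^sub>R op_comp \<mu> I u)"
      by (rule sum_compositions_Cons[OF a, symmetric])
    finally show ?thesis .
  qed simp
qed

lemma pcoef_eq_sum_compositions:
  assumes "u \<in> V" "N > 0"
  shows "pcoef N u = (\<Sum>I\<in>compositions N. phi_coef (real N) (tl I) *\<^sub>R op_comp \<mu> I u)"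
proof -
  have "\<mu> (Suc j) (Phi (real N) (N - Suc j) u)
     = (\<Sum>I\<in>compositions (N - Suc j). phi_coef (real N) I *\<^sub>R op_comp \<mu> (Suc j # I) u)" for j
    by (simp add: Phi_eq_sum_compositions[OF assms(1)] mu_lincomb_op_comp[OF assms(1)])
  then show ?thesis by (simp add: pcoef_def sum_compositions_Cons[OF assms(2)])
qed

text \<open>At negative integers the partial fraction decomposition has no poles and expresses
  \<open>Phi (- K)\<close> by the operators \<open>Phi (- N)\<close> in lower degree; hence it can be iterated.\<close>

lemma Phi_neg_eq_sum_compositions:
  assumes "u \<in> V"
  shows "Phi (- real K) b u = (\<Sum>I\<in>compositions b. mq_coef K I *\<^sub>R op_comp qcoef I u)"
  using assms
proof (induction b arbitrary: K u rule: less_induct)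
  case (less b)
  show ?case
  proof (cases "b = 0")
    case False
    have "- real K \<notin> real ` {1..b}" by auto
    then have "Phi (- real K) b u
      = (\<Sum>N=1..b. (1 / (- real K - real N)) *\<^sub>R Phi (- real N) (b - N) (qcoef N u))"
      using Phi_partial_fractions[of "- real K" b u] False less.prems by simp
    also have "\<dots> = (\<Sum>N=1..b. \<Sum>I\<in>compositions (b - N). mq_coef K (I @ [N]) *\<^sub>R op_comp qcoef (I @ [N]) u)"
    proof (intro sum.cong refl)
      fix N assume N: "N \<in> {1..b}"
      have "Phi (- real N) (b - N) (qcoef N u)
         = (\<Sum>I\<in>compositions (b - N). mq_coef N I *\<^sub>R op_comp qcoef I (qcoef N u))"
        by (rule less.IH) (use N less.prems in auto)
      moreover have "1 / (- real K - real N) = - (1 / (real N + real K))"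
        by (simp add: minus_divide_right)
      ultimately show "(1 / (- real K - real N)) *\<^sub>R Phi (- real N) (b - N) (qcoef N u)
        = (\<Sum>I\<in>compositions (b - N). mq_coef K (I @ [N]) *\<^sub>R op_comp qcoef (I @ [N]) u)"
        by (simp only: scaleR_sum_right scaleR_scaleR mq_coef_snoc op_comp_snoc)
    qed
    finally show ?thesis using False by (simp only: sum_compositions_snoc[of b])
  qed simp
qed

text \<open>\<open>Pop N\<close> and \<open>Mop N\<close> will be identified with \<open>P\<^bsub>2N\<^esub>\<close> and \<open>\<M>\<^bsub>2N\<^esub>\<close>.\<close>

definition Pop :: "nat \<Rightarrow> ('m \<Rightarrow> real) \<Rightarrow> 'm \<Rightarrow> real" where
  "Pop N u = (fact (N - 1))\<^sup>2 *\<^sub>R pcoef N u"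

definition Mop :: "nat \<Rightarrow> ('m \<Rightarrow> real) \<Rightarrow> 'm \<Rightarrow> real" where
  "Mop N u = (fact (N - 1))\<^sup>2 *\<^sub>R \<mu> N u"

lemma Pop_lin: "lin_on V (Pop N)" and Mop_lin: "lin_on V (Mop N)"
  unfolding Pop_def[abs_def] Mop_def[abs_def] by (intro lin_on_scaled pcoef_lin lin subspace)+

lemma Pop_eq_sum_n_coef:
  assumes "u \<in> V" "N > 0"
  shows "Pop N u = (\<Sum>I\<in>compositions N. real (n_coef I) *\<^sub>R op_comp Mop I u)"
proof -
  have "\<mu> k u = (1 / (fact (k - 1))\<^sup>2) *\<^sub>R Mop k u" for k u
    by (simp add: Mop_def)
  then have \<mu>: "\<mu> = (\<lambda>k u. (1 / (fact (k - 1))\<^sup>2) *\<^sub>R Mop k u)" by blast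
  have "op_comp \<mu> I u = (\<Prod>k\<leftarrow>I. 1 / (fact (k - 1))\<^sup>2) *\<^sub>R op_comp Mop I u" for I
    by (subst \<mu>) (rule op_comp_scaled[OF subspace Mop_lin assms(1)])
  then have "Pop N u = (\<Sum>I\<in>compositions N. ((fact (N - 1))\<^sup>2 * phi_coef (real N) (tl I)
      * (\<Prod>k\<leftarrow>I. 1 / (fact (k - 1))\<^sup>2)) *\<^sub>R op_comp Mop I u)"
    using assms by (simp add: Pop_def pcoef_eq_sum_compositions scaleR_sum_right mult.assoc)
  also have "\<dots> = (\<Sum>I\<in>compositions N. real (n_coef I) *\<^sub>R op_comp Mop I u)"
  proof (intro sum.cong refl)
    fix I assume I: "I \<in> compositions N"
    then have "I \<noteq> []" using assms(2) by (auto simp: compositions_def)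
    then show "((fact (N - 1))\<^sup>2 * phi_coef (real N) (tl I) * (\<Prod>k\<leftarrow>I. 1 / (fact (k - 1))\<^sup>2)) *\<^sub>R op_comp Mop I u
       = real (n_coef I) *\<^sub>R op_comp Mop I u"
      using n_coef_eq_phi_coef[of I] I by (auto simp: compositions_def mult_ac)
  qed
  finally show ?thesis .
qed

lemma Mop_eq_sum_m_coef:
  assumes "u \<in> V" "N > 0"
  shows "Mop N u = (\<Sum>I\<in>compositions N. m_coef I *\<^sub>R op_comp Pop I u)"
proof -
  have "qcoef k u = (1 / real k * (1 / (fact (k - 1))\<^sup>2)) *\<^sub>R Pop k u" for k u
    by (simp add: Pop_def qcoef_def)
  then have q: "qcoef = (\<lambda>k u. (1 / real k * (1 / (fact (k - 1))\<^sup>2)) *\<^sub>R Pop k u)" by blast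
  have *: "op_comp qcoef I u = (\<Prod>k\<leftarrow>I. 1 / real k * (1 / (fact (k - 1))\<^sup>2)) *\<^sub>R op_comp Pop I u" for I
    by (subst q) (rule op_comp_scaled[OF subspace Pop_lin assms(1)])
  have "Mop N u = (\<Sum>k=1..N. \<Sum>I\<in>compositions (N - k).
      ((fact (N - 1))\<^sup>2 * real N * mq_coef k I) *\<^sub>R op_comp qcoef (I @ [k]) u)"
    using assms by (simp add: Mop_def mu_eq_sum_qcoef Phi_neg_eq_sum_compositions scaleR_sum_right op_comp_snoc
        mult.assoc)
  also have "\<dots> = (\<Sum>k=1..N. \<Sum>I\<in>compositions (N - k). m_coef (I @ [k]) *\<^sub>R op_comp Pop (I @ [k]) u)"
  proof (intro sum.cong refl)
    fix k I assume k: "k \<in> {1..N}" and I: "I \<in> compositions (N - k)"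
    then have "sum_list (I @ [k]) = N" "\<forall>i\<in>set (I @ [k]). 1 \<le> i" by (auto simp: compositions_def)
    then show "((fact (N - 1))\<^sup>2 * real N * mq_coef k I) *\<^sub>R op_comp qcoef (I @ [k]) u
      = m_coef (I @ [k]) *\<^sub>R op_comp Pop (I @ [k]) u"
      using m_coef_snoc[of I k] by (simp only: *[of "I @ [k]"] scaleR_scaleR)
  qed
  finally show ?thesis by (simp only: sum_compositions_snoc[OF assms(2)])
qed

end

section \<open>Integration by parts and the fundamental lemma of the calculus of variations\<close>

lemma smooth_on_Un:
  assumes "open S" "open T" "smooth_on S f" "smooth_on T f"
  shows "smooth_on (S \<union> T) f"
proof -
  have "C_k_on k (S \<union> T) f" if "C_k_on k S f" "C_k_on k T f" for k and f :: "'a \<Rightarrow> 'b"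
    using that
  proof (induction k arbitrary: f)
    case 0
    then show ?case using continuous_on_open_Un assms by auto
  next
    case (Suc k)
    then show ?case by auto
  qed
  then show ?thesis using assms by (auto simp: smooth_on_def)
qed

text \<open>A product with a test function is smooth on the whole space after extension by zero, so that
  integrals over a coordinate domain become integrals over the whole space.\<close>

definition zero_ext :: "'a set \<Rightarrow> ('a \<Rightarrow> real) \<Rightarrow> 'a \<Rightarrow> real" where
  "zero_ext U f y = (if y \<in> U then f y else 0)"

lemma smooth_on_zero_ext:
  assumes "open U" "smooth_on U f" "compact K" "K \<subseteq> U" "\<And>y. y \<in> U \<Longrightarrow> y \<notin> K \<Longrightarrow> f y = 0"
  shows "smooth_on UNIV (zero_ext U f)"
proof -
  have "smooth_on U (zero_ext U f)"
    using assms(2) smooth_on_cong[OF assms(1), of "zero_ext U f" f] by (simp add: zero_ext_def)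
  moreover have "open (- K)" using assms(3) by (simp add: compact_imp_closed open_Compl)
  moreover from this have "smooth_on (- K) (zero_ext U f)"
    using smooth_on_cong[of "- K" "zero_ext U f" "\<lambda>_. 0"] assms(5) by (auto simp: zero_ext_def)
  moreover have "U \<union> - K = UNIV" using assms(4) by auto
  ultimately show ?thesis using smooth_on_Un[OF assms(1)] by metis
qed

lemma integrable_compact_support:
  fixes f :: "'a::euclidean_space \<Rightarrow> real"
  assumes "continuous_on UNIV f" "compact K" "\<And>y. y \<notin> K \<Longrightarrow> f y = 0"
  shows "integrable lborel f"
proof -
  have "integrable lborel (\<lambda>x. indicator K x *\<^sub>R f x)"
    using borel_integrable_compact[OF assms(2) continuous_on_subset[OF assms(1)]] by simp
  moreover have "(\<lambda>x. indicator K x *\<^sub>R f x) = f"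
    by (rule ext) (auto simp: indicator_def assms(3))
  ultimately show ?thesis by simp
qed

lemma integrable_zero_ext:
  fixes f :: "'a::euclidean_space \<Rightarrow> real"
  assumes "open U" "smooth_on U f" "compact K" "K \<subseteq> U" "\<And>y. y \<in> U \<Longrightarrow> y \<notin> K \<Longrightarrow> f y = 0"
  shows "integrable lborel (zero_ext U f)"
  using smooth_on_continuous[OF smooth_on_zero_ext[OF assms]] assms(3)
  by (rule integrable_compact_support) (use assms in \<open>auto simp: zero_ext_def\<close>)

lemma set_integral_eq_zero_ext:
  "(LINT y:U|lborel. f y) = (LINT y|lborel. zero_ext U f y)"
  unfolding set_lebesgue_integral_def zero_ext_def
  by (intro Bochner_Integration.integral_cong refl) (auto simp: indicator_def)

lemma integral_translate:
  fixes f :: "'a::euclidean_space \<Rightarrow> real"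
  assumes "continuous_on UNIV f"
  shows "(LINT y|lborel. f (y + c)) = (LINT y|lborel. f y)"
proof -
  have "(LINT y|lborel. f y) = (LINT y|distr lborel borel ((+) c). f y)"
    by (simp add: lborel_distr_plus)
  also have "\<dots> = (LINT y|lborel. f (c + y))"
    by (rule integral_distr) (auto intro!: borel_measurable_continuous_onI assms)
  finally show ?thesis by (simp add: add.commute)
qed

text \<open>The integral of every difference quotient vanishes by translation invariance, and the
  difference quotients converge boundedly to the derivative.\<close>

lemma integral_pd_compact_support:
  fixes \<phi> :: "real^'k::finite \<Rightarrow> real"
  assumes smooth: "smooth_on UNIV \<phi>" and K: "compact K" "\<And>y. y \<notin> K \<Longrightarrow> \<phi> y = 0"
  shows "(LINT y|lborel. pd a \<phi> y) = 0"
proof -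
  define e :: "real^'k" where "e = axis a 1"
  define t :: "nat \<Rightarrow> real" where "t n = inverse (real (Suc n))" for n
  have t: "t n > 0" "t n \<le> 1" for n by (auto simp: t_def field_simps)
  have tlim: "t \<longlonglongrightarrow> 0" unfolding t_def by (rule LIMSEQ_inverse_real_of_nat)
  have cont: "continuous_on UNIV \<phi>" "continuous_on UNIV (pd a \<phi>)"
    using smooth smooth_on_pd smooth_on_continuous by blast+
  have diff: "\<phi> differentiable at y" for y using smooth_on_differentiable[OF smooth] by simp
  have pd0: "pd a \<phi> y = 0" if "y \<notin> K" for y
  proof -
    have "pd a \<phi> y = pd a (\<lambda>_. 0) y"
      by (rule pd_cong[of "- K"]) (use that K in \<open>auto simp: compact_imp_closed open_Compl\<close>)
    then show ?thesis by simp
  qed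
  obtain B where B: "\<And>y. \<bar>pd a \<phi> y\<bar> \<le> B"
  proof -
    have "bounded (pd a \<phi> ` K)"
      using compact_continuous_image[OF continuous_on_subset[OF cont(2)] K(1)] compact_imp_bounded by blast
    then obtain B where "\<And>y. y \<in> K \<Longrightarrow> \<bar>pd a \<phi> y\<bar> \<le> B" by (auto simp: bounded_iff)
    then have "\<bar>pd a \<phi> y\<bar> \<le> max B 0" for y using pd0[of y] by (cases "y \<in> K") force+
    then show ?thesis using that by blast
  qed
  \<comment> \<open>\<open>K'\<close> contains the supports of all the difference quotients, whose steps are at most \<open>1\<close>.\<close>
  define K' where "K' = {x - z | x z. x \<in> K \<and> z \<in> cball 0 1}"
  have K': "compact K'" unfolding K'_def by (intro compact_differences K(1) compact_cball)
  have KK': "K \<subseteq> K'" unfolding K'_def by force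
  define s where "s n y = (\<phi> (y + t n *\<^sub>R e) - \<phi> y) / t n" for n y
  have bound: "\<bar>s n y\<bar> \<le> B * indicator K' y" for n y
  proof (cases "y \<in> K'")
    case True
    have "DERIV (\<lambda>s. \<phi> (y + s *\<^sub>R e)) r :> pd a \<phi> (y + r *\<^sub>R e)" for r
      unfolding e_def by (rule pd_along_line[OF diff])
    then obtain \<xi> where "\<phi> (y + t n *\<^sub>R e) - \<phi> (y + 0 *\<^sub>R e) = (t n - 0) * pd a \<phi> (y + \<xi> *\<^sub>R e)"
      using MVT2[OF t(1)[of n], of "\<lambda>s. \<phi> (y + s *\<^sub>R e)" "\<lambda>r. pd a \<phi> (y + r *\<^sub>R e)"] by blast
    then have "s n y = pd a \<phi> (y + \<xi> *\<^sub>R e)" using t(1)[of n] by (simp add: s_def)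
    then show ?thesis using B True by simp
  next
    case False
    have "y + t n *\<^sub>R e \<notin> K"
    proof
      assume "y + t n *\<^sub>R e \<in> K"
      moreover have "t n *\<^sub>R e \<in> cball 0 1" using t[of n] by (simp add: e_def)
      ultimately have "(y + t n *\<^sub>R e) - t n *\<^sub>R e \<in> K'" unfolding K'_def by blast
      then show False using False by simp
    qed
    then show ?thesis using False KK' K(2) by (auto simp: s_def)
  qed
  have int: "integrable lborel \<phi>" by (rule integrable_compact_support[OF cont(1) K])
  have ints: "integrable lborel (\<lambda>y. \<phi> (y + c))" for c
  proof (rule integrable_compact_support)
    show "continuous_on UNIV (\<lambda>y. \<phi> (y + c))"
      by (intro continuous_on_compose2[OF cont(1)] continuous_intros) auto
    show "compact ((\<lambda>x. x - c) ` K)" by (intro compact_continuous_image continuous_intros K(1))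
    fix y assume "y \<notin> (\<lambda>x. x - c) ` K"
    then have "y + c \<notin> K" by (metis add_diff_cancel_right' imageI)
    then show "\<phi> (y + c) = 0" by (rule K(2))
  qed
  have "(LINT y|lborel. s n y) = 0" for n
    unfolding s_def using integral_translate[OF cont(1)] int ints by simp
  moreover have "(\<lambda>n. LINT y|lborel. s n y) \<longlonglongrightarrow> (LINT y|lborel. pd a \<phi> y)"
  proof (rule integral_dominated_convergence[where w = "\<lambda>y. B * indicator K' y"])
    show "integrable lborel (\<lambda>y. B * indicator K' y)"
      using K' by (intro integrable_mult_right integrable_real_indicator)
        (use emeasure_compact_finite[OF K'] in \<open>auto simp: borel_compact\<close>)
    show "AE y in lborel. (\<lambda>n. s n y) \<longlonglongrightarrow> pd a \<phi> y"
    proof (intro AE_I2)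
      fix y
      have "((\<lambda>r. (\<phi> (y + r *\<^sub>R e) - \<phi> y) / r) \<longlongrightarrow> pd a \<phi> y) (at 0)"
        using pd_along_line[OF diff, where y = y and t = 0 and a = a] by (simp add: DERIV_def e_def)
      moreover have "filterlim t (at 0) sequentially"
        using tlim t(1) by (auto simp: filterlim_at less_le)
      ultimately show "(\<lambda>n. s n y) \<longlonglongrightarrow> pd a \<phi> y"
        unfolding s_def by (rule filterlim_compose)
    qed
    show "AE y in lborel. norm (s n y) \<le> B * indicator K' y" for n using bound by simp
    show "s n \<in> borel_measurable lborel" for n
      unfolding s_def using int ints by measurable
    show "pd a \<phi> \<in> borel_measurable lborel"
      using borel_measurable_continuous_onI[OF cont(2)] by simp
  qed
  ultimately show ?thesis by (simp add: LIMSEQ_const_iff)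
qed

text \<open>The extension by zero of \<open>\<psi> Y\<close> is smooth with compact support, so its derivatives integrate to
  zero.\<close>

lemma integration_by_parts:
  fixes \<psi> :: "real^'k::finite \<Rightarrow> real"
  assumes U: "open U" and \<psi>: "test_function U \<psi>" and Y: "\<And>a. smooth_on U (Y a)"
  shows "(LINT y:U|lborel. (\<Sum>a\<in>UNIV. pd a \<psi> y * Y a y)) = (LINT y:U|lborel. \<psi> y * - (\<Sum>a\<in>UNIV. pd a (Y a) y))"
proof -
  define K where "K = closure {y. \<psi> y \<noteq> 0}"
  have K: "compact K" "K \<subseteq> U" and K0: "\<psi> y = 0" if "y \<notin> K" for y
    using \<psi> closure_subset[of "{y. \<psi> y \<noteq> 0}"] that by (auto simp: test_function_def K_def)
  have KU: "compact K" "K \<subseteq> U" using \<psi> by (auto simp: test_function_def K_def)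
  have s\<psi>: "smooth_on U \<psi>" using \<psi> smooth_on_subset[of UNIV \<psi> U] by (auto simp: test_function_def)
  have pd0: "pd a \<psi> y = 0" if "y \<notin> K" for y a
  proof -
    have "pd a \<psi> y = pd a (\<lambda>_. 0) y"
      by (rule pd_cong[of "- K"]) (use that K0 KU in \<open>auto simp: compact_imp_closed open_Compl\<close>)
    then show ?thesis by simp
  qed
  have sm: "smooth_on U (\<lambda>y. pd a \<psi> y * Y a y)" "smooth_on U (\<lambda>y. \<psi> y * pd a (Y a) y)" "smooth_on U (\<lambda>y. \<psi> y * Y a y)" for a
    by (intro smooth_on_mult U Y s\<psi> smooth_on_pd)+
  have i: "integrable lborel (zero_ext U (\<lambda>y. pd a \<psi> y * Y a y))" "integrable lborel (zero_ext U (\<lambda>y. \<psi> y * pd a (Y a) y))" for a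
    by (rule integrable_zero_ext[OF U sm(1) KU], simp add: pd0)
      (rule integrable_zero_ext[OF U sm(2) KU], simp add: K0)
  have "(LINT y|lborel. zero_ext U (\<lambda>y. pd a \<psi> y * Y a y) y) + (LINT y|lborel. zero_ext U (\<lambda>y. \<psi> y * pd a (Y a) y) y) = 0" for a
  proof -
    let ?\<Phi> = "zero_ext U (\<lambda>y. \<psi> y * Y a y)"
    have "(LINT y|lborel. pd a ?\<Phi> y) = 0"
      by (rule integral_pd_compact_support[OF smooth_on_zero_ext[OF U sm(3) KU] KU(1)])
        (auto simp: K0 zero_ext_def)
    moreover have "pd a ?\<Phi> y = zero_ext U (\<lambda>y. pd a \<psi> y * Y a y) y + zero_ext U (\<lambda>y. \<psi> y * pd a (Y a) y) y" for y
    proof (cases "y \<in> U")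
      case True
      have "pd a ?\<Phi> y = pd a (\<lambda>y. \<psi> y * Y a y) y"
        by (rule pd_cong[OF U True]) (simp add: zero_ext_def)
      also have "\<dots> = \<psi> y * pd a (Y a) y + pd a \<psi> y * Y a y"
        by (rule pd_mult) (use True smooth_on_differentiable s\<psi> Y in blast)+
      finally show ?thesis using True by (simp add: zero_ext_def)
    next
      case False
      then have "y \<in> - K" using KU by auto
      then have "pd a ?\<Phi> y = pd a (\<lambda>_. 0) y"
        by (intro pd_cong[of "- K"]) (use K0 KU in \<open>auto simp: compact_imp_closed open_Compl zero_ext_def\<close>)
      then show ?thesis using False by (simp add: zero_ext_def)
    qed
    ultimately show ?thesis using i by (simp add: Bochner_Integration.integral_add)
  qed
  then have *: "(LINT y|lborel. zero_ext U (\<lambda>y. pd a \<psi> y * Y a y) y) = - (LINT y|lborel. zero_ext U (\<lambda>y. \<psi> y * pd a (Y a) y) y)" for a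
    by (simp add: eq_neg_iff_add_eq_0)
  have "(LINT y:U|lborel. (\<Sum>a\<in>UNIV. pd a \<psi> y * Y a y)) = (LINT y|lborel. (\<Sum>a\<in>UNIV. zero_ext U (\<lambda>y. pd a \<psi> y * Y a y) y))"
    unfolding set_integral_eq_zero_ext by (intro Bochner_Integration.integral_cong refl) (simp add: zero_ext_def)
  also have "\<dots> = (\<Sum>a\<in>UNIV. - (LINT y|lborel. zero_ext U (\<lambda>y. \<psi> y * pd a (Y a) y) y))"
    using i by (simp add: Bochner_Integration.integral_sum *)
  also have "\<dots> = (LINT y|lborel. - (\<Sum>a\<in>UNIV. zero_ext U (\<lambda>y. \<psi> y * pd a (Y a) y) y))"
    using i by (simp add: Bochner_Integration.integral_sum sum_negf)
  also have "\<dots> = (LINT y:U|lborel. \<psi> y * - (\<Sum>a\<in>UNIV. pd a (Y a) y))"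
    unfolding set_integral_eq_zero_ext
    by (intro Bochner_Integration.integral_cong refl) (simp add: zero_ext_def sum_distrib_left)
  finally show ?thesis .
qed

text \<open>If \<open>F z > 0\<close>, a nonnegative test function supported in a small ball around \<open>z\<close> has a positive
  integral against \<open>F\<close>.\<close>

lemma fundamental_lemma_pos:
  fixes F :: "real^'k::finite \<Rightarrow> real"
  assumes U: "open U" and F: "continuous_on U F" and z: "z \<in> U"
    and int: "\<And>\<psi>. test_function U \<psi> \<Longrightarrow> (LINT y:U|lborel. \<psi> y * F y) = 0"
  shows "\<not> F z > 0"
proof
  assume "F z > 0"
  have "open (U \<inter> F -` {0<..})" using F U continuous_open_preimage[OF F U] by auto
  moreover have "z \<in> U \<inter> F -` {0<..}" using z \<open>F z > 0\<close> by auto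
  ultimately obtain d where d: "d > 0" "cball z d \<subseteq> U \<inter> F -` {0<..}"
    using open_contains_cball by metis
  define \<psi> where "\<psi> y = exp_bump 1 (d\<^sup>2 - (y - z) \<bullet> (y - z))" for y
  have pos: "\<psi> y > 0 \<longleftrightarrow> y \<in> ball z d" and nonneg: "\<psi> y \<ge> 0" for y
  proof -
    have "(y - z) \<bullet> (y - z) < d\<^sup>2 \<longleftrightarrow> dist z y < d"
      using d(1) norm_lt_square[of "y - z" d] by (simp add: dist_norm norm_minus_commute)
    then show "\<psi> y > 0 \<longleftrightarrow> y \<in> ball z d" "\<psi> y \<ge> 0" by (auto simp: \<psi>_def exp_bump_def)
  qed
  have sm: "smooth_on UNIV \<psi>"
  proof -
    have lin: "smooth_on UNIV (\<lambda>y. y - z)"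
      by (rule smooth_on_diff[OF open_UNIV smooth_on_linear_map[OF open_UNIV bounded_linear_ident] smooth_on_const])
    show ?thesis
      unfolding \<psi>_def
      by (rule smooth_on_compose[OF open_UNIV smooth_on_diff[OF open_UNIV smooth_on_const
            smooth_on_inner[OF open_UNIV lin lin]] smooth_on_exp_bump]) simp
  qed
  have sub: "closure {y. \<psi> y \<noteq> 0} \<subseteq> cball z d"
  proof (rule closure_minimal)
    show "{y. \<psi> y \<noteq> 0} \<subseteq> cball z d" using pos nonneg by (force simp: less_le)
  qed simp
  moreover have "compact (closure {y. \<psi> y \<noteq> 0})"
    using sub compact_cball[of z d] by (metis closed_closure closed_subset compact_Int_closed inf.absorb_iff2)
  ultimately have test: "test_function U \<psi>" using sm d(2) by (auto simp: test_function_def)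
  let ?f = "zero_ext U (\<lambda>y. \<psi> y * F y)"
  have f: "?f = (\<lambda>y. indicator (cball z d) y *\<^sub>R (\<psi> y * F y))"
  proof
    fix y
    have "\<psi> y = 0" if "y \<notin> cball z d" using that pos[of y] nonneg[of y] by auto
    then show "?f y = indicator (cball z d) y *\<^sub>R (\<psi> y * F y)"
      using d(2) by (auto simp: zero_ext_def indicator_def)
  qed
  have ge: "?f y \<ge> 0" for y
    using d(2) nonneg[of y] unfolding f by (auto simp: indicator_def intro!: mult_nonneg_nonneg)
  have "integrable lborel ?f"
    unfolding f using d(2)
    by (intro borel_integrable_compact compact_cball continuous_intros continuous_on_subset[OF F]
        continuous_on_subset[OF smooth_on_continuous[OF sm]]) auto
  moreover have "(LINT y|lborel. ?f y) = 0"
    using int[OF test] by (simp add: set_integral_eq_zero_ext)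
  ultimately have "AE y in lborel. ?f y = 0"
    using integral_nonneg_eq_0_iff_AE[of lborel ?f] ge by simp
  moreover have "?f y \<noteq> 0" if "y \<in> ball z d" for y
  proof -
    have "\<psi> y > 0" using that pos by blast
    moreover have y: "y \<in> cball z d" using that by simp
    moreover have "F y > 0" using subsetD[OF d(2) y] by simp
    ultimately show ?thesis by (simp add: f)
  qed
  ultimately have "AE y in lborel. y \<notin> ball z d" by (auto elim: eventually_mono)
  then have "emeasure lborel (ball z d) = 0"
    by (subst (asm) AE_iff_measurable[of "ball z d"]) auto
  then have "measure lborel (ball z d) = 0" by (simp add: measure_def)
  then show False using content_ball_pos[OF d(1), of z] by simp
qed

lemma fundamental_lemma:
  fixes F :: "real^'k::finite \<Rightarrow> real"
  assumes U: "open U" and F: "continuous_on U F" and z: "z \<in> U"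
    and int: "\<And>\<psi>. test_function U \<psi> \<Longrightarrow> (LINT y:U|lborel. \<psi> y * F y) = 0"
  shows "F z = 0"
proof -
  have "(LINT y:U|lborel. \<psi> y * - F y) = 0" if "test_function U \<psi>" for \<psi>
    using int[OF that] by (simp add: set_lebesgue_integral_def)
  then have "\<not> - F z > 0"
    by (intro fundamental_lemma_pos[OF U continuous_on_minus[OF F] z]) auto
  moreover have "\<not> F z > 0" by (rule fundamental_lemma_pos[OF U F z int])
  ultimately show ?thesis by linarith
qed

section \<open>Smooth matrices and the derivative of the determinant\<close>

lemma smooth_on_entries:
  assumes "open S" "smooth_on S A"
  shows "smooth_on S (\<lambda>y. A y $ i $ j)"
  using smooth_on_vec_nth[OF assms(1) smooth_on_vec_nth[OF assms]] .

lemma smooth_on_entriesI: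
  fixes A :: "'a::euclidean_space \<Rightarrow> real^'l::finite^'k::finite"
  assumes "open S" "\<And>i j. smooth_on S (\<lambda>y. A y $ i $ j)"
  shows "smooth_on S A"
  by (intro smooth_on_vec assms)

lemma smooth_on_det:
  fixes A :: "'a::euclidean_space \<Rightarrow> real^'l::finite^'l"
  assumes "open S" "\<And>i j. smooth_on S (\<lambda>y. A y $ i $ j)"
  shows "smooth_on S (\<lambda>y. det (A y))"
  unfolding det_def
  by (intro smooth_on_sum smooth_on_mult smooth_on_prod assms smooth_on_const)

lemma smooth_on_matrix_vector_mult:
  fixes A :: "'a::euclidean_space \<Rightarrow> real^'l::finite^'k::finite"
  assumes "open S" "\<And>i j. smooth_on S (\<lambda>y. A y $ i $ j)" "\<And>j. smooth_on S (\<lambda>y. v y $ j)"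
  shows "smooth_on S (\<lambda>y. (A y *v v y) $ i)"
  unfolding matrix_vector_mult_def by (simp, intro smooth_on_sum smooth_on_mult assms)

lemma smooth_on_matrix_mult:
  fixes A :: "'a::euclidean_space \<Rightarrow> real^'l::finite^'k::finite" and B :: "'a \<Rightarrow> real^'p::finite^'l"
  assumes "open S" "\<And>i j. smooth_on S (\<lambda>y. A y $ i $ j)" "\<And>i j. smooth_on S (\<lambda>y. B y $ i $ j)"
  shows "smooth_on S (\<lambda>y. (A y ** B y) $ i $ j)"
  unfolding matrix_matrix_mult_def by (simp, intro smooth_on_sum smooth_on_mult assms)

lemma matrix_inv_works:
  fixes A :: "real^'l::finite^'l"
  assumes "det A \<noteq> 0"
  shows "A ** matrix_inv A = mat 1" "matrix_inv A ** A = mat 1"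
proof -
  have "\<exists>A'. A ** A' = mat 1 \<and> A' ** A = mat 1"
    using assms invertible_det_nz[of A] by (auto simp: invertible_def)
  from someI_ex[OF this] show "A ** matrix_inv A = mat 1" "matrix_inv A ** A = mat 1"
    by (auto simp: matrix_inv_def)
qed

lemma matrix_inv_eqI:
  fixes A B :: "real^'l::finite^'l"
  assumes "A ** B = mat 1"
  shows "matrix_inv A = B"
proof -
  have "det A * det B = 1" using assms by (metis det_I det_mul)
  then have "det A \<noteq> 0" by auto
  then have "matrix_inv A ** (A ** B) = B" using matrix_inv_works[of A] by (simp add: matrix_mul_assoc)
  then show ?thesis using assms by simp
qed

lemma matrix_inv_entry_cramer:
  fixes A :: "real^'l::finite^'l"
  assumes "det A \<noteq> 0"
  shows "matrix_inv A $ k $ l = det (\<chi> i j. if j = k then axis l 1 $ i else A $ i $ j) / det A"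
proof -
  have "A *v (matrix_inv A *v axis l 1) = axis l 1"
    by (simp add: matrix_vector_mul_assoc matrix_inv_works[OF assms])
  then have "matrix_inv A *v axis l 1 = (\<chi> k. det (\<chi> i j. if j = k then axis l 1 $ i else A $ i $ j) / det A)"
    using cramer[OF assms] by blast
  moreover have "(matrix_inv A *v axis l 1) $ k = matrix_inv A $ k $ l"
    by (simp add: matrix_vector_mult_basis column_def)
  ultimately show ?thesis by simp
qed

lemma smooth_on_matrix_inv:
  fixes A :: "'a::euclidean_space \<Rightarrow> real^'l::finite^'l"
  assumes "open S" "\<And>i j. smooth_on S (\<lambda>y. A y $ i $ j)" "\<And>y. y \<in> S \<Longrightarrow> det (A y) \<noteq> 0"
  shows "smooth_on S (\<lambda>y. matrix_inv (A y) $ k $ l)"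
proof -
  have "smooth_on S (\<lambda>y. det (\<chi> i j. if j = k then axis l 1 $ i else A y $ i $ j) / det (A y))"
  proof (intro smooth_on_divide smooth_on_det assms)
    show "smooth_on S (\<lambda>y. (\<chi> i j. if j = k then axis l 1 $ i else A y $ i $ j) $ i $ j)" for i j
      using assms(2) by (cases "j = k") simp_all
  qed
  then show ?thesis
    using smooth_on_cong[OF assms(1), of "\<lambda>y. matrix_inv (A y) $ k $ l"] matrix_inv_entry_cramer[OF assms(3)]
    by simp
qed

lemma vol_density_pos: "det G \<noteq> 0 \<Longrightarrow> vol_density G > 0"
  by (simp add: vol_density_def)

lemma smooth_on_vol_density:
  fixes A :: "'a::euclidean_space \<Rightarrow> real^'l::finite^'l"
  assumes "open S" "\<And>i j. smooth_on S (\<lambda>y. A y $ i $ j)" "\<And>y. y \<in> S \<Longrightarrow> det (A y) \<noteq> 0"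
  shows "smooth_on S (\<lambda>y. vol_density (A y))"
proof -
  have "smooth_on S (\<lambda>y. sqrt (sqrt ((det (A y))\<^sup>2)))"
  proof (rule smooth_on_compose[OF assms(1) _ smooth_on_sqrt])
    show "smooth_on S (\<lambda>y. sqrt ((det (A y))\<^sup>2))"
      by (rule smooth_on_compose[OF assms(1) _ smooth_on_sqrt])
        (use assms in \<open>auto intro!: smooth_on_power smooth_on_det\<close>)
  qed (use assms in auto)
  then show ?thesis by (simp add: vol_density_def[abs_def])
qed

lemma pd_prod:
  fixes f :: "'i \<Rightarrow> real^'k::finite \<Rightarrow> real"
  assumes "\<And>i. i \<in> I \<Longrightarrow> f i differentiable at y"
  shows "pd a (\<lambda>x. \<Prod>i\<in>I. f i x) y = (\<Sum>i\<in>I. pd a (f i) y * (\<Prod>j\<in>I - {i}. f j y))"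
  using pd_eqI[OF has_derivative_prod[OF assms[unfolded frechet_derivative_works]]] by (simp add: pd_def)

lemma differentiable_prod:
  fixes f :: "'i \<Rightarrow> real^'k::finite \<Rightarrow> real"
  assumes "\<And>i. i \<in> I \<Longrightarrow> f i differentiable at y"
  shows "(\<lambda>x. \<Prod>i\<in>I. f i x) differentiable at y"
  unfolding differentiable_def
  by (rule exI, rule has_derivative_prod, rule assms[unfolded frechet_derivative_works])

text \<open>In the Leibniz formula, a permutation other than the identity contributes at least two factors
  that vanish at the identity matrix, and thus a product with derivative zero.\<close>

lemma pd_det_at_identity:
  fixes B :: "real^'k::finite \<Rightarrow> real^'l::finite^'l"
  assumes "B y = mat 1" "\<And>i j. (\<lambda>z. B z $ i $ j) differentiable at y"
  shows "pd a (\<lambda>z. det (B z)) y = (\<Sum>i\<in>UNIV. pd a (\<lambda>z. B z $ i $ i) y)"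
proof -
  have By: "B y $ i $ j = (if i = j then 1 else 0)" for i j using assms(1) by (simp add: mat_def)
  have "pd a (\<lambda>z. det (B z)) y
     = (\<Sum>p\<in>{p. p permutes UNIV}. of_int (sign p) * (\<Sum>i\<in>UNIV. pd a (\<lambda>z. B z $ i $ p i) y * (\<Prod>j\<in>UNIV - {i}. B y $ j $ p j)))"
    unfolding det_def
    by (subst pd_sum) (auto simp: pd_cmult pd_prod assms(2) differentiable_prod intro!: differentiable_mult sum.cong)
  also have "\<dots> = (\<Sum>p\<in>{p. p permutes (UNIV :: 'l set)}. if p = id then (\<Sum>i\<in>UNIV. pd a (\<lambda>z. B z $ i $ i) y) else 0)"
  proof (intro sum.cong refl)
    fix p :: "'l \<Rightarrow> 'l" assume "p \<in> {p. p permutes UNIV}"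
    then have p: "p permutes UNIV" by simp
    show "of_int (sign p) * (\<Sum>i\<in>UNIV. pd a (\<lambda>z. B z $ i $ p i) y * (\<Prod>j\<in>UNIV - {i}. B y $ j $ p j))
      = (if p = id then (\<Sum>i\<in>UNIV. pd a (\<lambda>z. B z $ i $ i) y) else 0)"
    proof (cases "p = id")
      case True
      then show ?thesis by (simp add: By)
    next
      case False
      then obtain k where k: "p k \<noteq> k" by (auto simp: fun_eq_iff)
      then have k': "p (p k) \<noteq> p k" using permutes_inj[OF p] by (auto dest: injD)
      have "(\<Prod>j\<in>UNIV - {i}. B y $ j $ p j) = 0" for i
      proof (cases "i = k")
        case True
        then show ?thesis using k k' by (intro prod_zero bexI[of _ "p k"]) (auto simp: By)
      next
        case False
        then show ?thesis using k by (intro prod_zero bexI[of _ k]) (auto simp: By)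
      qed
      then show ?thesis using False by (simp only: mult_zero_right sum.neutral_const if_False)
    qed
  qed
  also have "\<dots> = (\<Sum>i\<in>UNIV. pd a (\<lambda>z. B z $ i $ i) y)"
    by (simp add: permutes_id finite_permutations)
  finally show ?thesis .
qed

text \<open>Jacobi's formula, reduced to the derivative at the identity by multiplicativity.\<close>

lemma pd_det:
  fixes A :: "real^'k::finite \<Rightarrow> real^'l::finite^'l"
  assumes "det (A y) \<noteq> 0" "\<And>i j. (\<lambda>z. A z $ i $ j) differentiable at y"
  shows "pd a (\<lambda>z. det (A z)) y = det (A y) * (\<Sum>i\<in>UNIV. \<Sum>j\<in>UNIV. matrix_inv (A y) $ i $ j * pd a (\<lambda>z. A z $ j $ i) y)"
proof -
  let ?B = "\<lambda>z. matrix_inv (A y) ** A z"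
  have entry: "?B z $ i $ k = (\<Sum>j\<in>UNIV. matrix_inv (A y) $ i $ j * A z $ j $ k)" for z i k
    by (simp add: matrix_matrix_mult_def)
  have d: "(\<lambda>z. ?B z $ i $ k) differentiable at y" for i k
    unfolding entry by (intro differentiable_sum differentiable_mult differentiable_const assms(2) ballI finite)
  have "det (A z) = det (A y) * det (?B z)" for z
    using arg_cong[OF matrix_inv_works(1)[OF assms(1)], of det] by (simp add: det_mul)
  then have "(\<lambda>z. det (A z)) = (\<lambda>z. det (A y) * det (?B z))" by (rule ext)
  then have "pd a (\<lambda>z. det (A z)) y = pd a (\<lambda>z. det (A y) * det (?B z)) y"
    by (rule arg_cong)
  also have "\<dots> = det (A y) * pd a (\<lambda>z. det (?B z)) y"
  proof (rule pd_cmult)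
    show "(\<lambda>z. det (?B z)) differentiable at y"
      unfolding det_def
      by (intro differentiable_sum differentiable_mult differentiable_const differentiable_prod d ballI)
        (simp add: finite_permutations)
  qed
  also have "pd a (\<lambda>z. det (?B z)) y = (\<Sum>i\<in>UNIV. pd a (\<lambda>z. ?B z $ i $ i) y)"
    by (rule pd_det_at_identity) (use matrix_inv_works(2)[OF assms(1)] d in auto)
  also have "\<dots> = (\<Sum>i\<in>UNIV. \<Sum>j\<in>UNIV. matrix_inv (A y) $ i $ j * pd a (\<lambda>z. A z $ j $ i) y)"
  proof (intro sum.cong refl)
    fix i
    have "pd a (\<lambda>z. ?B z $ i $ i) y = (\<Sum>j\<in>UNIV. pd a (\<lambda>z. matrix_inv (A y) $ i $ j * A z $ j $ i) y)"
      unfolding entry by (intro pd_sum differentiable_mult differentiable_const assms(2))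
    also have "\<dots> = (\<Sum>j\<in>UNIV. matrix_inv (A y) $ i $ j * pd a (\<lambda>z. A z $ j $ i) y)"
      by (intro sum.cong refl pd_cmult assms(2))
    finally show "pd a (\<lambda>z. ?B z $ i $ i) y = (\<Sum>j\<in>UNIV. matrix_inv (A y) $ i $ j * pd a (\<lambda>z. A z $ j $ i) y)" .
  qed
  finally show ?thesis .
qed

section \<open>The formal adjoint of the differential in coordinates\<close>

definition jac :: "(real^'k \<Rightarrow> real^'k) \<Rightarrow> real^'k \<Rightarrow> real^'k^'k::finite" where
  "jac \<tau> z = matrix (frechet_derivative \<tau> (at z))"

lemma jac_entry:
  assumes "\<tau> differentiable at z"
  shows "jac \<tau> z $ b $ a = pd a (\<lambda>z. \<tau> z $ b) z"
  using pd_eqI[OF bounded_linear.has_derivative[OF bounded_linear_vec_nth assms[unfolded frechet_derivative_works]]]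
  by (simp add: jac_def matrix_def)

text \<open>The vector field \<open>Y\<close> and its image \<open>Y'\<close> are multiplied with the density of a measure, so that
  the transformation law involves the Jacobian determinant. Differentiating the law gives, besides
  the divergences, two terms that cancel: the derivative of the determinant, by Jacobi's formula,
  and the second derivatives of \<open>\<tau>\<close>, which are symmetric.\<close>

lemma divergence_transform:
  fixes \<tau> :: "real^'k::finite \<Rightarrow> real^'k"
  assumes W: "open W" and \<tau>: "smooth_on W \<tau>" and W': "\<And>z. z \<in> W \<Longrightarrow> \<tau> z \<in> W'"
    and J0: "\<And>z. z \<in> W \<Longrightarrow> det (jac \<tau> z) \<noteq> 0"
    and Y: "\<And>a. smooth_on W (Y a)" and Y': "\<And>b. smooth_on W' (Y' b)"
    and tr: "\<And>z b. z \<in> W \<Longrightarrow> \<bar>det (jac \<tau> z)\<bar> * Y' b (\<tau> z) = (\<Sum>c\<in>UNIV. jac \<tau> z $ b $ c * Y c z)"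
    and z: "z \<in> W"
  shows "\<bar>det (jac \<tau> z)\<bar> * (\<Sum>b\<in>UNIV. pd b (Y' b) (\<tau> z)) = (\<Sum>a\<in>UNIV. pd a (Y a) z)"
proof -
  let ?J = "\<lambda>b a z. jac \<tau> z $ b $ a" and ?D = "\<lambda>z. det (jac \<tau> z)"
  let ?I = "matrix_inv (jac \<tau> z)"
  have comp: "smooth_on W (\<lambda>z. \<tau> z $ b)" for b by (rule smooth_on_vec_nth[OF W \<tau>])
  have Jeq: "?J b a x = pd a (\<lambda>z. \<tau> z $ b) x" if "x \<in> W" for a b x
    by (rule jac_entry[OF smooth_on_differentiable[OF \<tau> that]])
  have J: "smooth_on W (?J b a)" for a b
    using smooth_on_cong[OF W Jeq] smooth_on_pd[OF comp] by simp
  have D: "smooth_on W ?D" by (rule smooth_on_det[OF W J])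
  have d: "f differentiable at z" if "smooth_on W f" for f :: "real^'k \<Rightarrow> real"
    using smooth_on_differentiable[OF that z] .
  have d\<tau>: "\<tau> differentiable at z" by (rule smooth_on_differentiable[OF \<tau> z])
  have dY': "Y' b differentiable at (\<tau> z)" for b by (rule smooth_on_differentiable[OF Y' W'[OF z]])
  have dZ: "(\<lambda>z. Y' b (\<tau> z)) differentiable at z" for b
    using differentiable_compose[OF dY' d\<tau>] .
  have sym: "pd a (?J b c) z = pd c (?J b a) z" for a b c
  proof -
    have "pd a (?J b c) z = pd a (pd c (\<lambda>z. \<tau> z $ b)) z" by (rule pd_cong[OF W z Jeq])
    also have "\<dots> = pd c (pd a (\<lambda>z. \<tau> z $ b)) z" by (rule pd_commute[OF W comp z])
    also have "\<dots> = pd c (?J b a) z" by (rule pd_cong[OF W z Jeq[symmetric]])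
    finally show ?thesis .
  qed
  define t where "t a = (\<Sum>i\<in>UNIV. \<Sum>j\<in>UNIV. ?I $ i $ j * pd a (?J j i) z)" for a
  have absD: "pd a (\<lambda>z. \<bar>?D z\<bar>) z = \<bar>?D z\<bar> * t a" and dabsD: "(\<lambda>z. \<bar>?D z\<bar>) differentiable at z" for a
  proof -
    have "((\<lambda>x. \<bar>x\<bar>) has_real_derivative sgn (?D z)) (at (?D z))"
    proof (cases "?D z > 0")
      case True
      have "((\<lambda>x::real. x) has_real_derivative sgn (?D z)) (at (?D z))"
        using True by (auto intro!: derivative_eq_intros)
      then show ?thesis
        by (rule has_field_derivative_transform_within_open[where S = "{0<..}"]) (use True in auto)
    next
      case False
      then have neg: "?D z < 0" using J0[OF z] by simp
      have "((\<lambda>x::real. - x) has_real_derivative sgn (?D z)) (at (?D z))"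
        using neg by (auto intro!: derivative_eq_intros)
      then show ?thesis
        by (rule has_field_derivative_transform_within_open[where S = "{..<0}"]) (use neg in auto)
    qed
    note abs = this
    have "pd a (\<lambda>z. \<bar>?D z\<bar>) z = sgn (?D z) * pd a ?D z"
      by (rule pd_compose_real[OF d[OF D] abs])
    also have "pd a ?D z = ?D z * t a"
      unfolding t_def by (rule pd_det[OF J0[OF z] d[OF J]])
    finally show "pd a (\<lambda>z. \<bar>?D z\<bar>) z = \<bar>?D z\<bar> * t a" by (simp add: abs_sgn mult.commute mult.left_commute)
    show "(\<lambda>z. \<bar>?D z\<bar>) differentiable at z"
    proof -
      have "(\<lambda>x::real. \<bar>x\<bar>) differentiable at (?D z)" using abs by (auto simp: real_differentiable_def)
      from differentiable_compose[OF this d[OF D]] show ?thesis .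
    qed
  qed
  have IJ: "(\<Sum>b\<in>UNIV. ?I $ a $ b * ?J b c z) = (if a = c then 1 else 0)"
    and JI: "(\<Sum>b\<in>UNIV. ?J a b z * ?I $ b $ c) = (if a = c then 1 else 0)" for a c
    using matrix_inv_works[OF J0[OF z]] by (auto simp: matrix_matrix_mult_def mat_def vec_eq_iff)
  \<comment> \<open>The derivative of the transformation law in direction \<open>a\<close>; contracted with the inverse of
    the Jacobian matrix, its four terms are computed in (1) to (4), and (2) and (4) cancel.\<close>
  have law: "\<bar>?D z\<bar> * pd a (\<lambda>z. Y' b (\<tau> z)) z + \<bar>?D z\<bar> * t a * Y' b (\<tau> z)
      = (\<Sum>c\<in>UNIV. ?J b c z * pd a (Y c) z) + (\<Sum>c\<in>UNIV. pd a (?J b c) z * Y c z)" for a b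
  proof -
    have "pd a (\<lambda>z. \<bar>?D z\<bar> * Y' b (\<tau> z)) z = pd a (\<lambda>z. \<Sum>c\<in>UNIV. ?J b c z * Y c z) z"
      by (rule pd_cong[OF W z tr])
    moreover have "pd a (\<lambda>z. \<bar>?D z\<bar> * Y' b (\<tau> z)) z
       = \<bar>?D z\<bar> * pd a (\<lambda>z. Y' b (\<tau> z)) z + \<bar>?D z\<bar> * t a * Y' b (\<tau> z)"
      by (subst pd_mult[OF dabsD dZ]) (simp only: absD)
    moreover have "pd a (\<lambda>z. \<Sum>c\<in>UNIV. ?J b c z * Y c z) z = (\<Sum>c\<in>UNIV. pd a (\<lambda>z. ?J b c z * Y c z) z)"
      by (intro pd_sum d smooth_on_mult W J Y)
    moreover have "pd a (\<lambda>z. ?J b c z * Y c z) z = ?J b c z * pd a (Y c) z + pd a (?J b c) z * Y c z" for c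
      by (intro pd_mult d J Y)
    ultimately show ?thesis by (simp only: sum.distrib)
  qed
  have chain: "pd a (\<lambda>z. Y' b (\<tau> z)) z = (\<Sum>e\<in>UNIV. pd e (Y' b) (\<tau> z) * ?J e a z)" for a b
    using pd_compose[OF d\<tau> dY'] Jeq[OF z] by simp
  have "(\<Sum>a\<in>UNIV. \<Sum>b\<in>UNIV. ?I $ a $ b * pd a (\<lambda>z. Y' b (\<tau> z)) z)
      = (\<Sum>a\<in>UNIV. \<Sum>b\<in>UNIV. \<Sum>e\<in>UNIV. pd e (Y' b) (\<tau> z) * (?J e a z * ?I $ a $ b))"
    by (simp add: chain sum_distrib_left mult_ac)
  also have "\<dots> = (\<Sum>b\<in>UNIV. \<Sum>e\<in>UNIV. \<Sum>a\<in>UNIV. pd e (Y' b) (\<tau> z) * (?J e a z * ?I $ a $ b))"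
    by (subst sum.swap) (intro sum.cong refl sum.swap)
  also have "\<dots> = (\<Sum>b\<in>UNIV. pd b (Y' b) (\<tau> z))"
    by (simp add: sum_distrib_left[symmetric] JI if_distrib[of "\<lambda>x. _ * x"] cong: if_cong)
  finally have 1: "(\<Sum>a\<in>UNIV. \<Sum>b\<in>UNIV. ?I $ a $ b * pd a (\<lambda>z. Y' b (\<tau> z)) z) = (\<Sum>b\<in>UNIV. pd b (Y' b) (\<tau> z))" .
  have "(\<Sum>b\<in>UNIV. ?I $ a $ b * (\<bar>?D z\<bar> * Y' b (\<tau> z))) = Y a z" for a
  proof -
    have "(\<Sum>b\<in>UNIV. ?I $ a $ b * (\<bar>?D z\<bar> * Y' b (\<tau> z))) = (\<Sum>b\<in>UNIV. \<Sum>c\<in>UNIV. (?I $ a $ b * ?J b c z) * Y c z)"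
      by (simp only: tr[OF z] sum_distrib_left mult.assoc)
    also have "\<dots> = (\<Sum>c\<in>UNIV. (\<Sum>b\<in>UNIV. ?I $ a $ b * ?J b c z) * Y c z)"
      by (subst sum.swap) (simp add: sum_distrib_right)
    finally show ?thesis by (simp add: IJ if_distrib[of "\<lambda>x. x * _"] cong: if_cong)
  qed
  then have "(\<Sum>a\<in>UNIV. t a * (\<Sum>b\<in>UNIV. ?I $ a $ b * (\<bar>?D z\<bar> * Y' b (\<tau> z)))) = (\<Sum>a\<in>UNIV. t a * Y a z)"
    by simp
  then have 2: "(\<Sum>a\<in>UNIV. \<Sum>b\<in>UNIV. ?I $ a $ b * (\<bar>?D z\<bar> * t a * Y' b (\<tau> z))) = (\<Sum>a\<in>UNIV. t a * Y a z)"
    by (simp add: sum_distrib_left mult_ac)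
  have "(\<Sum>a\<in>UNIV. \<Sum>b\<in>UNIV. ?I $ a $ b * (\<Sum>c\<in>UNIV. ?J b c z * pd a (Y c) z))
      = (\<Sum>a\<in>UNIV. \<Sum>b\<in>UNIV. \<Sum>c\<in>UNIV. (?I $ a $ b * ?J b c z) * pd a (Y c) z)"
    by (simp add: sum_distrib_left mult_ac)
  also have "\<dots> = (\<Sum>a\<in>UNIV. \<Sum>c\<in>UNIV. (\<Sum>b\<in>UNIV. ?I $ a $ b * ?J b c z) * pd a (Y c) z)"
    by (rule sum.cong[OF refl], subst sum.swap) (simp only: sum_distrib_right)
  also have "\<dots> = (\<Sum>a\<in>UNIV. pd a (Y a) z)"
    by (simp add: IJ if_distrib[of "\<lambda>x. x * _"] cong: if_cong)
  finally have 3: "(\<Sum>a\<in>UNIV. \<Sum>b\<in>UNIV. ?I $ a $ b * (\<Sum>c\<in>UNIV. ?J b c z * pd a (Y c) z)) = (\<Sum>a\<in>UNIV. pd a (Y a) z)" .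
  have swap: "(\<Sum>c\<in>UNIV. pd a (?J b c) z * Y c z) = (\<Sum>c\<in>UNIV. pd c (?J b a) z * Y c z)" for a b
  proof (rule sum.cong[OF refl])
    show "pd a (?J b c) z * Y c z = pd c (?J b a) z * Y c z" for c
      using sym by (rule arg_cong)
  qed
  have "(\<Sum>a\<in>UNIV. \<Sum>b\<in>UNIV. ?I $ a $ b * (\<Sum>c\<in>UNIV. pd a (?J b c) z * Y c z))
      = (\<Sum>a\<in>UNIV. \<Sum>b\<in>UNIV. \<Sum>c\<in>UNIV. (?I $ a $ b * pd c (?J b a) z) * Y c z)"
    unfolding swap by (simp only: sum_distrib_left mult.assoc)
  also have "\<dots> = (\<Sum>a\<in>UNIV. \<Sum>c\<in>UNIV. \<Sum>b\<in>UNIV. (?I $ a $ b * pd c (?J b a) z) * Y c z)"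
    by (rule sum.cong[OF refl], rule sum.swap)
  also have "\<dots> = (\<Sum>c\<in>UNIV. \<Sum>a\<in>UNIV. \<Sum>b\<in>UNIV. (?I $ a $ b * pd c (?J b a) z) * Y c z)"
    by (rule sum.swap)
  also have "\<dots> = (\<Sum>c\<in>UNIV. t c * Y c z)"
    by (simp add: t_def sum_distrib_right)
  finally have 4: "(\<Sum>a\<in>UNIV. \<Sum>b\<in>UNIV. ?I $ a $ b * (\<Sum>c\<in>UNIV. pd a (?J b c) z * Y c z)) = (\<Sum>c\<in>UNIV. t c * Y c z)" .
  have "(\<Sum>a\<in>UNIV. \<Sum>b\<in>UNIV. ?I $ a $ b * (\<bar>?D z\<bar> * pd a (\<lambda>z. Y' b (\<tau> z)) z + \<bar>?D z\<bar> * t a * Y' b (\<tau> z)))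
     = \<bar>?D z\<bar> * (\<Sum>a\<in>UNIV. \<Sum>b\<in>UNIV. ?I $ a $ b * pd a (\<lambda>z. Y' b (\<tau> z)) z)
       + (\<Sum>a\<in>UNIV. \<Sum>b\<in>UNIV. ?I $ a $ b * (\<bar>?D z\<bar> * t a * Y' b (\<tau> z)))"
    by (simp add: distrib_left sum.distrib sum_distrib_left mult_ac)
  moreover have "(\<Sum>a\<in>UNIV. \<Sum>b\<in>UNIV. ?I $ a $ b * ((\<Sum>c\<in>UNIV. ?J b c z * pd a (Y c) z) + (\<Sum>c\<in>UNIV. pd a (?J b c) z * Y c z)))
     = (\<Sum>a\<in>UNIV. pd a (Y a) z) + (\<Sum>c\<in>UNIV. t c * Y c z)"
    by (simp only: distrib_left sum.distrib 3 4)
  ultimately show ?thesis unfolding law 1 2 by simp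
qed

locale charts =
  fixes C :: "('i, 'a::topological_space, 'k::finite) atlas"
  assumes open_cdom: "open (cdom C i)" and open_cimg: "open (cimg C i)"
    and homeo: "homeomorphism (cdom C i) (cimg C i) (cmap C i) (cinv C i)"
    and smooth_transition: "smooth_on (cmap C i ` (cdom C i \<inter> cdom C j)) (cmap C j \<circ> cinv C i)"
begin

abbreviation overlap :: "'i \<Rightarrow> 'i \<Rightarrow> (real^'k) set" where
  "overlap i j \<equiv> cmap C i ` (cdom C i \<inter> cdom C j)"

abbreviation transition :: "'i \<Rightarrow> 'i \<Rightarrow> real^'k \<Rightarrow> real^'k" where
  "transition i j \<equiv> cmap C j \<circ> cinv C i"

lemma cinv_cmap [simp]: "x \<in> cdom C i \<Longrightarrow> cinv C i (cmap C i x) = x"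
  using homeo[of i] by (simp add: homeomorphism_def)

lemma cmap_cinv [simp]: "y \<in> cimg C i \<Longrightarrow> cmap C i (cinv C i y) = y"
  by (rule f_inv_into_f)

lemma cinv_in: "y \<in> cimg C i \<Longrightarrow> cinv C i y \<in> cdom C i"
  by (rule inv_into_into)

lemma loc_cmap [simp]: "x \<in> cdom C i \<Longrightarrow> loc C i f (cmap C i x) = f x"
  by (simp add: loc_def)

lemma open_overlap: "open (overlap i j)"
proof -
  have "openin (top_of_set (cimg C i)) (overlap i j)"
    by (rule homeomorphism_imp_open_map[OF homeo]) (auto intro: openin_open_Int open_cdom)
  then show ?thesis using open_cimg openin_open_trans by blast
qed

lemma overlap_subset: "overlap i j \<subseteq> cimg C i" by auto

lemma transition_in_overlap: "z \<in> overlap i j \<Longrightarrow> transition i j z \<in> overlap j i"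
  by auto

lemma transition_differentiable: "z \<in> overlap i j \<Longrightarrow> transition i j differentiable at z"
  by (rule smooth_on_differentiable[OF smooth_transition])

lemma jac_transition_inverse:
  assumes z: "z \<in> overlap i j"
  shows "jac (transition j i) (transition i j z) ** jac (transition i j) z = mat 1"
proof -
  have d: "transition i j differentiable at z" "transition j i differentiable at (transition i j z)"
    using transition_differentiable[OF z] transition_differentiable[OF transition_in_overlap[OF z]] by auto
  have "frechet_derivative (transition j i \<circ> transition i j) (at z) = frechet_derivative (\<lambda>x. x) (at z)"
    by (rule frechet_derivative_transform_within_open[OF differentiable_chain_at[OF d] open_overlap z])
      auto
  also have "\<dots> = (\<lambda>x. x)" by (metis frechet_derivative_at has_derivative_ident)
  finally have "frechet_derivative (transition j i) (at (transition i j z)) \<circ> frechet_derivative (transition i j) (at z)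
      = (\<lambda>x. x)"
    unfolding frechet_derivative_compose[OF d] .
  moreover have "matrix (frechet_derivative (transition j i) (at (transition i j z)) \<circ> frechet_derivative (transition i j) (at z))
     = jac (transition j i) (transition i j z) ** jac (transition i j) z"
    unfolding jac_def by (rule matrix_compose) (use d linear_frechet_derivative in auto)
  moreover have "matrix (\<lambda>x::real^'k. x) = mat 1"
    by (simp add: matrix_def mat_def axis_def vec_eq_iff)
  ultimately show ?thesis by (simp only:)
qed

lemma det_jac_transition: "z \<in> overlap i j \<Longrightarrow> det (jac (transition i j) z) \<noteq> 0"
  using arg_cong[OF jac_transition_inverse, of z i j det] by (auto simp: det_mul)

end

text \<open>Nondegeneracy in place of positive definiteness admits the ambient metric, which is
  Lorentzian.\<close>

definition metric_on :: "('i, 'a::topological_space, 'k::finite) atlas \<Rightarrow> ('i \<Rightarrow> 'a \<Rightarrow> real^'k^'k) \<Rightarrow> bool" where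
  "metric_on C G \<longleftrightarrow> (\<forall>i. smooth_on (cimg C i) (loc C i (G i))) \<and>
     (\<forall>i. \<forall>x\<in>cdom C i. det (G i x) \<noteq> 0) \<and>
     (\<forall>i j. \<forall>x\<in>cdom C i \<inter> cdom C j. G i x
       = transpose (jac (cmap C j \<circ> cinv C i) (cmap C i x)) ** G j x ** jac (cmap C j \<circ> cinv C i) (cmap C i x))"

definition covector_on :: "('i, 'a::topological_space, 'k::finite) atlas \<Rightarrow> ('i \<Rightarrow> 'a \<Rightarrow> real^'k) \<Rightarrow> bool" where
  "covector_on C \<omega> \<longleftrightarrow> (\<forall>i. smooth_on (cimg C i) (loc C i (\<omega> i))) \<and>
     (\<forall>i j. \<forall>x\<in>cdom C i \<inter> cdom C j. \<omega> i x
       = transpose (jac (cmap C j \<circ> cinv C i) (cmap C i x)) *v \<omega> j x)"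

lemma metric_onD:
  assumes "metric_on C G"
  shows "smooth_on (cimg C i) (loc C i (G i))" "x \<in> cdom C i \<Longrightarrow> det (G i x) \<noteq> 0"
    and "x \<in> cdom C i \<Longrightarrow> x \<in> cdom C j \<Longrightarrow> G i x
       = transpose (jac (cmap C j \<circ> cinv C i) (cmap C i x)) ** G j x ** jac (cmap C j \<circ> cinv C i) (cmap C i x)"
  using assms unfolding metric_on_def by blast+

lemma covector_onD:
  assumes "covector_on C \<omega>"
  shows "smooth_on (cimg C i) (loc C i (\<omega> i))"
    and "x \<in> cdom C i \<Longrightarrow> x \<in> cdom C j \<Longrightarrow> \<omega> i x = transpose (jac (cmap C j \<circ> cinv C i) (cmap C i x)) *v \<omega> j x"
  using assms unfolding covector_on_def by blast+

text \<open>\<open>\<delta>\<omega>\<close> is \<open>- |G|\<^sup>-\<^sup>1\<^sup>/\<^sup>2 \<partial>\<^sub>a (|G|\<^sup>1\<^sup>/\<^sup>2 G\<^sup>a\<^sup>b \<omega>\<^sub>b)\<close> in coordinates, where \<open>|G|\<close> is the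
  absolute value of the determinant. The flux is the vector density whose divergence is taken.\<close>

definition flux :: "('i, 'a, 'k::finite) atlas \<Rightarrow> ('i \<Rightarrow> 'a \<Rightarrow> real^'k^'k) \<Rightarrow> ('i \<Rightarrow> 'a \<Rightarrow> real^'k)
    \<Rightarrow> 'i \<Rightarrow> 'k \<Rightarrow> real^'k \<Rightarrow> real" where
  "flux C G \<omega> i a y = vol_density (loc C i (G i) y) * (matrix_inv (loc C i (G i) y) *v loc C i (\<omega> i) y) $ a"

definition local_codiff :: "('i, 'a, 'k::finite) atlas \<Rightarrow> ('i \<Rightarrow> 'a \<Rightarrow> real^'k^'k) \<Rightarrow> ('i \<Rightarrow> 'a \<Rightarrow> real^'k)
    \<Rightarrow> 'i \<Rightarrow> real^'k \<Rightarrow> real" where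
  "local_codiff C G \<omega> i y = - (\<Sum>a\<in>UNIV. pd a (flux C G \<omega> i a) y) / vol_density (loc C i (G i) y)"

context charts
begin

lemma metric_on_smooth:
  assumes "metric_on C G"
  shows "smooth_on (cimg C i) (\<lambda>y. loc C i (G i) y $ a $ b)"
    and "y \<in> cimg C i \<Longrightarrow> det (loc C i (G i) y) \<noteq> 0"
    and "smooth_on (cimg C i) (\<lambda>y. vol_density (loc C i (G i) y))"
    and "smooth_on (cimg C i) (\<lambda>y. matrix_inv (loc C i (G i) y) $ a $ b)"
proof -
  show 1: "smooth_on (cimg C i) (\<lambda>y. loc C i (G i) y $ a $ b)" for a b
    by (rule smooth_on_entries[where A = "loc C i (G i)", OF open_cimg metric_onD(1)[OF assms]])
  show 2: "det (loc C i (G i) y) \<noteq> 0" if "y \<in> cimg C i" for y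
    using metric_onD(2)[OF assms cinv_in[OF that]] by (simp add: loc_def)
  show "smooth_on (cimg C i) (\<lambda>y. vol_density (loc C i (G i) y))"
    by (rule smooth_on_vol_density[OF open_cimg 1 2])
  show "smooth_on (cimg C i) (\<lambda>y. matrix_inv (loc C i (G i) y) $ a $ b)"
    by (rule smooth_on_matrix_inv[OF open_cimg 1 2])
qed

lemma smooth_on_flux:
  assumes "metric_on C G" "covector_on C \<omega>"
  shows "smooth_on (cimg C i) (flux C G \<omega> i a)"
  unfolding flux_def
proof (intro smooth_on_mult open_cimg metric_on_smooth(3)[OF assms(1)] smooth_on_matrix_vector_mult)
  show "smooth_on (cimg C i) (\<lambda>y. loc C i (\<omega> i) y $ j)" for j
    by (rule smooth_on_vec_nth[where f = "loc C i (\<omega> i)", OF open_cimg covector_onD(1)[OF assms(2)]])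
qed (rule metric_on_smooth(4)[OF assms(1)])

lemma smooth_on_local_codiff:
  assumes "metric_on C G" "covector_on C \<omega>"
  shows "smooth_on (cimg C i) (local_codiff C G \<omega> i)"
  unfolding local_codiff_def
proof (intro smooth_on_divide smooth_on_minus smooth_on_sum smooth_on_pd smooth_on_flux assms open_cimg
    metric_on_smooth(3)[OF assms(1)])
  show "vol_density (loc C i (G i) y) \<noteq> 0" if "y \<in> cimg C i" for y
    using vol_density_pos[OF metric_on_smooth(2)[OF assms(1) that]] by simp
qed

lemma flux_transform:
  assumes G: "metric_on C G" and \<omega>: "covector_on C \<omega>" and z: "z \<in> overlap i j"
  defines "J \<equiv> jac (transition i j) z"
  shows "vol_density (loc C i (G i) z) = \<bar>det J\<bar> * vol_density (loc C j (G j) (transition i j z))"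
    and "\<bar>det J\<bar> * flux C G \<omega> j b (transition i j z) = (\<Sum>c\<in>UNIV. J $ b $ c * flux C G \<omega> i c z)"
proof -
  define x where "x = cinv C i z"
  have x: "x \<in> cdom C i" "x \<in> cdom C j" "cmap C i x = z" "cinv C j (transition i j z) = x"
    using z by (auto simp: x_def)
  have detJ: "det J \<noteq> 0" unfolding J_def by (rule det_jac_transition[OF z])
  have Gi: "G i x = transpose J ** G j x ** J" and \<omega>i: "\<omega> i x = transpose J *v \<omega> j x"
    using metric_onD(3)[OF G x(1,2)] covector_onD(2)[OF \<omega> x(1,2)] unfolding x(3) J_def .
  have nz: "det (G i x) \<noteq> 0" "det (G j x) \<noteq> 0" using metric_onD(2)[OF G] x by blast+
  have vol: "vol_density (G i x) = \<bar>det J\<bar> * vol_density (G j x)"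
    by (simp add: vol_density_def Gi det_mul abs_mult real_sqrt_mult)
  then show "vol_density (loc C i (G i) z) = \<bar>det J\<bar> * vol_density (loc C j (G j) (transition i j z))"
    unfolding loc_def comp_apply[of "G i"] comp_apply[of "G j"] x(4) x_def[symmetric] .
  define vi where "vi = matrix_inv (G i x) *v \<omega> i x"
  define vj where "vj = matrix_inv (G j x) *v \<omega> j x"
  have "transpose J *v (G j x *v (J *v vi)) = G i x *v vi"
    by (simp add: Gi matrix_vector_mul_assoc matrix_mul_assoc)
  also have "\<dots> = transpose J *v \<omega> j x"
    by (simp add: vi_def matrix_vector_mul_assoc matrix_inv_works[OF nz(1)] \<omega>i)
  finally have "matrix_inv (transpose J) *v (transpose J *v (G j x *v (J *v vi)))
      = matrix_inv (transpose J) *v (transpose J *v \<omega> j x)" by simp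
  moreover have "matrix_inv (transpose J) *v (transpose J *v v) = v" for v
  proof -
    have "det (transpose J) \<noteq> 0" using detJ by (simp add: det_transpose)
    from matrix_inv_works(2)[OF this] show ?thesis
      by (simp only: matrix_vector_mul_assoc matrix_vector_mul_lid)
  qed
  ultimately have "G j x *v (J *v vi) = \<omega> j x" by simp
  then have "matrix_inv (G j x) *v (G j x *v (J *v vi)) = vj" by (simp add: vj_def)
  then have "vj = J *v vi" by (simp add: matrix_vector_mul_assoc matrix_inv_works[OF nz(2)] matrix_mul_assoc)
  moreover have "flux C G \<omega> j b (transition i j z) = vol_density (G j x) * vj $ b"
    unfolding flux_def loc_def comp_apply[of "G j"] comp_apply[of "\<omega> j"] x(4) vj_def ..
  moreover have "flux C G \<omega> i c z = \<bar>det J\<bar> * vol_density (G j x) * vi $ c" for c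
    unfolding flux_def loc_def comp_apply[of "G i"] comp_apply[of "\<omega> i"] x_def[symmetric] vol vi_def ..
  ultimately show "\<bar>det J\<bar> * flux C G \<omega> j b (transition i j z) = (\<Sum>c\<in>UNIV. J $ b $ c * flux C G \<omega> i c z)"
    by (simp add: matrix_vector_mult_def sum_distrib_left mult_ac)
qed

text \<open>The flux is a vector density, so \<open>divergence_transform\<close> applies; the Jacobian determinant cancels
  against the one in the volume density.\<close>

lemma local_codiff_chart_independent:
  assumes G: "metric_on C G" and \<omega>: "covector_on C \<omega>" and x: "x \<in> cdom C i" "x \<in> cdom C j"
  shows "local_codiff C G \<omega> i (cmap C i x) = local_codiff C G \<omega> j (cmap C j x)"
proof -
  define z where "z = cmap C i x"
  have z: "z \<in> overlap i j" "transition i j z = cmap C j x" using x by (auto simp: z_def)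
  have div: "\<bar>det (jac (transition i j) z)\<bar> * (\<Sum>b\<in>UNIV. pd b (flux C G \<omega> j b) (transition i j z))
      = (\<Sum>a\<in>UNIV. pd a (flux C G \<omega> i a) z)"
  proof (rule divergence_transform[OF open_overlap smooth_transition])
    show "smooth_on (overlap i j) (flux C G \<omega> i a)" for a
      by (rule smooth_on_subset[OF smooth_on_flux[OF G \<omega>] overlap_subset])
    show "smooth_on (overlap j i) (flux C G \<omega> j b)" for b
      by (rule smooth_on_subset[OF smooth_on_flux[OF G \<omega>] overlap_subset])
  qed (use z(1) transition_in_overlap det_jac_transition flux_transform(2)[OF G \<omega>] in blast)+
  show ?thesis
    unfolding local_codiff_def z_def[symmetric] z(2)[symmetric] flux_transform(1)[OF G \<omega> z(1)] div[symmetric]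
    using det_jac_transition[OF z(1)] by simp
qed

lemma local_codiff_weak:
  assumes G: "metric_on C G" and \<omega>: "covector_on C \<omega>" and \<psi>: "test_function (cimg C i) \<psi>"
  shows "(LINT y:cimg C i|lborel. ((\<chi> a. pd a \<psi> y) \<bullet> (matrix_inv (loc C i (G i) y) *v loc C i (\<omega> i) y))
             * vol_density (loc C i (G i) y))
      = (LINT y:cimg C i|lborel. \<psi> y * local_codiff C G \<omega> i y * vol_density (loc C i (G i) y))"
proof -
  have "(LINT y:cimg C i|lborel. ((\<chi> a. pd a \<psi> y) \<bullet> (matrix_inv (loc C i (G i) y) *v loc C i (\<omega> i) y))
             * vol_density (loc C i (G i) y))
      = (LINT y:cimg C i|lborel. (\<Sum>a\<in>UNIV. pd a \<psi> y * flux C G \<omega> i a y))"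
    by (intro set_lebesgue_integral_cong) (auto simp: open_cimg flux_def inner_vec_def sum_distrib_left sum_distrib_right mult_ac)
  also have "\<dots> = (LINT y:cimg C i|lborel. \<psi> y * - (\<Sum>a\<in>UNIV. pd a (flux C G \<omega> i a) y))"
    by (rule integration_by_parts[OF open_cimg \<psi> smooth_on_flux[OF G \<omega>]])
  also have "\<dots> = (LINT y:cimg C i|lborel. \<psi> y * local_codiff C G \<omega> i y * vol_density (loc C i (G i) y))"
  proof (intro set_lebesgue_integral_cong allI impI)
    fix y assume "y \<in> cimg C i"
    then have "vol_density (loc C i (G i) y) \<noteq> 0" using vol_density_pos[OF metric_on_smooth(2)[OF G]] by force
    then show "\<psi> y * - (\<Sum>a\<in>UNIV. pd a (flux C G \<omega> i a) y) = \<psi> y * local_codiff C G \<omega> i y * vol_density (loc C i (G i) y)"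
      by (simp add: local_codiff_def)
  qed (simp add: open_cimg)
  finally show ?thesis .
qed

text \<open>The local expressions agree on overlaps and define a smooth function that satisfies the defining
  property of \<open>codiff\<close>. By the fundamental lemma every function with this property is equal to it.\<close>

lemma codiff_eq_local:
  assumes G: "metric_on C G" and \<omega>: "covector_on C \<omega>"
  shows "smooth_fun C (codiff C G \<omega>)"
    and "x \<in> cdom C i \<Longrightarrow> codiff C G \<omega> x = local_codiff C G \<omega> i (cmap C i x)"
proof -
  let ?P = "\<lambda>f. smooth_fun C f \<and>
     (\<forall>i \<psi>. test_function (cimg C i) \<psi> \<longrightarrow>
        (LINT y:cimg C i|lborel. ((\<chi> a. pd a \<psi> y) \<bullet> (matrix_inv (loc C i (G i) y) *v loc C i (\<omega> i) y))
             * vol_density (loc C i (G i) y))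
      = (LINT y:cimg C i|lborel. \<psi> y * loc C i f y * vol_density (loc C i (G i) y)))"
  define f0 where "f0 x = local_codiff C G \<omega> (chart_at C x) (cmap C (chart_at C x) x)" for x
  have f0: "loc C i f0 y = local_codiff C G \<omega> i y" if y: "y \<in> cimg C i" for i y
  proof -
    have x: "cinv C i y \<in> cdom C i" by (rule cinv_in[OF y])
    then have "cinv C i y \<in> cdom C (chart_at C (cinv C i y))" unfolding chart_at_def by (rule someI)
    from local_codiff_chart_independent[OF G \<omega> this x] show ?thesis
      using y by (simp add: f0_def loc_def)
  qed
  have "?P f0"
  proof (intro conjI allI impI)
    show "smooth_fun C f0"
      unfolding smooth_fun_def
    proof
      show "smooth_on (cimg C i) (loc C i f0)" for i
        using smooth_on_cong[OF open_cimg, of i "loc C i f0" "local_codiff C G \<omega> i"] f0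
          smooth_on_local_codiff[OF G \<omega>] by blast
    qed
    show "(LINT y:cimg C i|lborel. ((\<chi> a. pd a \<psi> y) \<bullet> (matrix_inv (loc C i (G i) y) *v loc C i (\<omega> i) y))
             * vol_density (loc C i (G i) y))
      = (LINT y:cimg C i|lborel. \<psi> y * loc C i f0 y * vol_density (loc C i (G i) y))"
      if "test_function (cimg C i) \<psi>" for i \<psi>
      unfolding local_codiff_weak[OF G \<omega> that]
      by (intro set_lebesgue_integral_cong) (auto simp: open_cimg f0)
  qed
  from someI[where P = ?P, OF this] have P: "?P (codiff C G \<omega>)" unfolding codiff_def .
  then show "smooth_fun C (codiff C G \<omega>)" by simp
  assume x: "x \<in> cdom C i"
  let ?vd = "\<lambda>y. vol_density (loc C i (G i) y)"
  let ?c = "loc C i (codiff C G \<omega>)"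
  have sm: "smooth_on (cimg C i) ?c" using P by (auto simp: smooth_fun_def)
  have "(?c (cmap C i x) - local_codiff C G \<omega> i (cmap C i x)) * ?vd (cmap C i x) = 0"
  proof (rule fundamental_lemma[OF open_cimg])
    have s: "smooth_on (cimg C i) (\<lambda>y. (?c y - local_codiff C G \<omega> i y) * ?vd y)"
      by (intro smooth_on_mult smooth_on_diff open_cimg sm smooth_on_local_codiff[OF G \<omega>] metric_on_smooth(3)[OF G])
    show "continuous_on (cimg C i) (\<lambda>y. (?c y - local_codiff C G \<omega> i y) * ?vd y)"
      by (rule smooth_on_continuous[OF s])
    show "cmap C i x \<in> cimg C i" using x by simp
    fix \<psi> assume \<psi>: "test_function (cimg C i) \<psi>"
    have K: "compact (closure {y. \<psi> y \<noteq> 0})" "closure {y. \<psi> y \<noteq> 0} \<subseteq> cimg C i"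
      and s\<psi>: "smooth_on (cimg C i) \<psi>"
      using \<psi> smooth_on_subset[of UNIV \<psi>] by (auto simp: test_function_def)
    have K0: "\<psi> y = 0" if "y \<notin> closure {y. \<psi> y \<noteq> 0}" for y
      using that closure_subset[of "{y. \<psi> y \<noteq> 0}"] by auto
    have int: "integrable lborel (zero_ext (cimg C i) (\<lambda>y. \<psi> y * u y * ?vd y))" if "smooth_on (cimg C i) u" for u
    proof (rule integrable_zero_ext[OF open_cimg _ K])
      show "smooth_on (cimg C i) (\<lambda>y. \<psi> y * u y * ?vd y)"
        by (intro smooth_on_mult open_cimg s\<psi> that metric_on_smooth(3)[OF G])
      fix y assume "y \<notin> closure {y. \<psi> y \<noteq> 0}"
      from K0[OF this] show "\<psi> y * u y * ?vd y = 0" by simp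
    qed
    have "(LINT y|lborel. zero_ext (cimg C i) (\<lambda>y. \<psi> y * ?c y * ?vd y) y)
        = (LINT y|lborel. zero_ext (cimg C i) (\<lambda>y. \<psi> y * local_codiff C G \<omega> i y * ?vd y) y)"
      using trans[OF sym[OF P[THEN conjunct2, rule_format, OF \<psi>]] local_codiff_weak[OF G \<omega> \<psi>]]
      unfolding set_integral_eq_zero_ext .
    then have "(LINT y|lborel. zero_ext (cimg C i) (\<lambda>y. \<psi> y * ?c y * ?vd y) y
        - zero_ext (cimg C i) (\<lambda>y. \<psi> y * local_codiff C G \<omega> i y * ?vd y) y) = 0"
      using int[OF sm] int[OF smooth_on_local_codiff[OF G \<omega>]] by (subst Bochner_Integration.integral_diff) auto
    moreover have "zero_ext (cimg C i) (\<lambda>y. \<psi> y * ?c y * ?vd y) y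
        - zero_ext (cimg C i) (\<lambda>y. \<psi> y * local_codiff C G \<omega> i y * ?vd y) y
        = zero_ext (cimg C i) (\<lambda>y. \<psi> y * ((?c y - local_codiff C G \<omega> i y) * ?vd y)) y" for y
      by (simp add: zero_ext_def algebra_simps)
    ultimately show "(LINT y:cimg C i|lborel. \<psi> y * ((?c y - local_codiff C G \<omega> i y) * ?vd y)) = 0"
      unfolding set_integral_eq_zero_ext by simp
  qed
  moreover have "?vd (cmap C i x) \<noteq> 0"
    using vol_density_pos[OF metric_on_smooth(2)[OF G]] x by (metis imageI less_irrefl)
  ultimately show "codiff C G \<omega> x = local_codiff C G \<omega> i (cmap C i x)" using x by simp
qed

lemma covector_on_dform:
  assumes "smooth_fun C f"
  shows "covector_on C (dform C f)"
proof -
  have sm: "smooth_on (cimg C i) (loc C i f)" for i using assms by (auto simp: smooth_fun_def)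
  show ?thesis
    unfolding covector_on_def
  proof (intro conjI allI ballI)
    fix i
    have "loc C i (dform C f i) y = (\<chi> a. pd a (loc C i f) y)" if "y \<in> cimg C i" for y
      using that by (simp add: loc_def dform_def)
    then show "smooth_on (cimg C i) (loc C i (dform C f i))"
      using smooth_on_cong[OF open_cimg, of i "loc C i (dform C f i)" "\<lambda>y. \<chi> a. pd a (loc C i f) y"]
        smooth_on_vec[OF open_cimg, of i "\<lambda>y. \<chi> a. pd a (loc C i f) y"] smooth_on_pd[OF sm] by simp
  next
    fix i j x assume x: "x \<in> cdom C i \<inter> cdom C j"
    let ?z = "cmap C i x"
    have z: "?z \<in> overlap i j" "transition i j ?z = cmap C j x" using x by auto
    have "dform C f i x $ a = (transpose (jac (transition i j) ?z) *v dform C f j x) $ a" for a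
    proof -
      have "pd a (loc C i f) ?z = pd a (\<lambda>y. loc C j f (transition i j y)) ?z"
        by (rule pd_cong[OF open_overlap z(1)]) (auto simp: loc_def)
      also have "\<dots> = (\<Sum>b\<in>UNIV. pd b (loc C j f) (transition i j ?z) * pd a (\<lambda>y. transition i j y $ b) ?z)"
      proof (rule pd_compose)
        show "transition i j differentiable at ?z" by (rule transition_differentiable[OF z(1)])
        show "loc C j f differentiable at (transition i j ?z)"
          by (rule smooth_on_differentiable[OF sm]) (use x in auto)
      qed
      also have "\<dots> = (\<Sum>b\<in>UNIV. jac (transition i j) ?z $ b $ a * pd b (loc C j f) (cmap C j x))"
        using jac_entry[OF transition_differentiable[OF z(1)]] z(2) by (simp add: mult.commute)
      finally show ?thesis
        by (simp add: dform_def matrix_vector_mult_def transpose_def)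
    qed
    then show "dform C f i x = transpose (jac (transition i j) ?z) *v dform C f j x"
      by (simp add: vec_eq_iff)
  qed
qed

end

section \<open>Products with an interval\<close>

text \<open>Points of a chart of a product are written \<open>ext y s\<close>, with the new coordinate \<open>s\<close> at index
  \<open>None\<close>; \<open>base\<close> forgets \<open>s\<close>.\<close>

definition ext :: "real^'k \<Rightarrow> real \<Rightarrow> real^('k::finite option)" where
  "ext y s = (\<chi> a. case a of None \<Rightarrow> s | Some j \<Rightarrow> y $ j)"

definition base :: "real^('k::finite option) \<Rightarrow> real^'k" where
  "base z = (\<chi> j. z $ Some j)"

lemma ext_nth [simp]: "ext y s $ None = s" "ext y s $ Some j = y $ j"
  by (simp_all add: ext_def)

lemma base_nth [simp]: "base z $ j = z $ Some j"
  by (simp add: base_def)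

lemma base_ext [simp]: "base (ext y s) = y"
  by (simp add: vec_eq_iff)

lemma ext_base [simp]: "ext (base z) (z $ None) = z"
  by (simp add: vec_eq_iff ext_def split: option.split)

lemma sum_option: "(\<Sum>a\<in>(UNIV::'k::finite option set). f a) = f None + (\<Sum>j\<in>UNIV. f (Some j))"
  by (simp add: UNIV_option_conv sum.reindex)

lemma prod_atlas_alt: "prod_atlas C T i = (cdom C i \<times> T, \<lambda>(x, s). ext (cmap C i x) s)"
  by (simp add: prod_atlas_def ext_def)

lemma smooth_on_base: "smooth_on S base" if "open S"
proof (rule smooth_on_vec[OF that])
  show "smooth_on S (\<lambda>z. base z $ j)" for j
    using smooth_on_linear_map[OF that bounded_linear_vec_nth] by simp
qed

lemma smooth_on_ext:
  assumes "open S" "\<And>j. smooth_on S (\<lambda>z. f z $ j)" "smooth_on S r"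
  shows "smooth_on S (\<lambda>z. ext (f z) (r z))"
proof (rule smooth_on_vec[OF assms(1)])
  show "smooth_on S (\<lambda>z. ext (f z) (r z) $ a)" for a
    using assms by (cases a) simp_all
qed

lemma smooth_on_compose_base:
  fixes f :: "real^'k::finite \<Rightarrow> 'c::real_normed_vector"
  assumes "open S" "smooth_on U f" "\<And>z. z \<in> S \<Longrightarrow> base z \<in> U"
  shows "smooth_on S (\<lambda>z. f (base z))"
  by (rule smooth_on_compose[OF assms(1) smooth_on_base[OF assms(1)] assms(2,3)])

lemma base_differentiable: "base differentiable at z"
  using smooth_on_differentiable[OF smooth_on_base[OF open_UNIV]] by simp

lemma ext_differentiable: "(\<lambda>y. ext y s) differentiable at y" "ext y differentiable at s"
proof -
  have "smooth_on UNIV (\<lambda>y::real^'a. ext y s)"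
    by (intro smooth_on_ext open_UNIV smooth_on_const smooth_on_linear_map bounded_linear_vec_nth)
  then show "(\<lambda>y. ext y s) differentiable at y" by (rule smooth_on_differentiable) simp
  have "smooth_on UNIV (\<lambda>s. ext y s)"
    by (intro smooth_on_ext open_UNIV smooth_on_const smooth_on_linear_map bounded_linear_ident)
  then show "ext y differentiable at s" by (rule smooth_on_differentiable) simp
qed

lemma pd_compose_base:
  assumes "f differentiable at (base z)"
  shows "pd (Some j) (\<lambda>z. f (base z)) z = pd j f (base z)" "pd None (\<lambda>z. f (base z)) z = 0"
  using pd_compose[OF base_differentiable assms] by (simp_all add: if_distrib[of "\<lambda>x. _ * x"] cong: if_cong)

lemma pd_slice:
  assumes "F differentiable at (ext y s)"
  shows "pd j (\<lambda>y. F (ext y s)) y = pd (Some j) F (ext y s)"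
  using pd_compose[OF ext_differentiable(1) assms]
  by (simp add: sum_option if_distrib[of "\<lambda>x. _ * x"] cong: if_cong)

lemma DERIV_slice:
  assumes "F differentiable at (ext y s)"
  shows "((\<lambda>s. F (ext y s)) has_real_derivative pd None F (ext y s)) (at s)"
proof -
  have e: "ext y r = ext y 0 + r *\<^sub>R axis None 1" for r
    by (simp add: vec_eq_iff ext_def axis_def split: option.split)
  show ?thesis
    using pd_along_line[of F "ext y 0" s None] assms by (simp only: e[symmetric])
qed

context charts
begin

lemma cdom_prod [simp]: "cdom (prod_atlas C T) i = cdom C i \<times> T"
  and cmap_prod [simp]: "cmap (prod_atlas C T) i (x, s) = ext (cmap C i x) s"
  by (simp_all add: prod_atlas_alt)

lemma cimg_prod: "z \<in> cimg (prod_atlas C T) i \<longleftrightarrow> base z \<in> cimg C i \<and> z $ None \<in> T"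
proof
  assume "z \<in> cimg (prod_atlas C T) i"
  then show "base z \<in> cimg C i \<and> z $ None \<in> T" by (auto simp: prod_atlas_alt)
next
  assume "base z \<in> cimg C i \<and> z $ None \<in> T"
  then obtain x where "x \<in> cdom C i" "base z = cmap C i x" "z $ None \<in> T" by auto
  then have "(x, z $ None) \<in> cdom (prod_atlas C T) i" "z = cmap (prod_atlas C T) i (x, z $ None)"
    using ext_base[of z] by auto
  then show "z \<in> cimg (prod_atlas C T) i" by blast
qed

lemma ext_in_cimg_prod: "ext y s \<in> cimg (prod_atlas C T) i \<longleftrightarrow> y \<in> cimg C i \<and> s \<in> T"
  using cimg_prod[of "ext y s" T i] by (simp only: base_ext ext_nth)

lemma cinv_prod:
  assumes "z \<in> cimg (prod_atlas C T) i"
  shows "cinv (prod_atlas C T) i z = (cinv C i (base z), z $ None)"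
proof -
  have z: "base z \<in> cimg C i" "z $ None \<in> T" using assms cimg_prod by auto
  have "inj_on (cmap (prod_atlas C T) i) (cdom (prod_atlas C T) i)"
  proof (rule inj_onI)
    fix p q assume pq: "p \<in> cdom (prod_atlas C T) i" "q \<in> cdom (prod_atlas C T) i"
      "cmap (prod_atlas C T) i p = cmap (prod_atlas C T) i q"
    obtain x s x' s' where *: "p = (x, s)" "q = (x', s')" by fastforce
    have "ext (cmap C i x) s = ext (cmap C i x') s'" using pq(3) * by simp
    then have "cmap C i x = cmap C i x'" "s = s'" by (metis base_ext, metis ext_nth(1))
    then show "p = q" using pq(1,2) * by (metis cdom_prod cinv_cmap mem_Sigma_iff)
  qed
  moreover have "(cinv C i (base z), z $ None) \<in> cdom (prod_atlas C T) i"
    using z cinv_in by simp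
  moreover have "cmap (prod_atlas C T) i (cinv C i (base z), z $ None) = z"
    using z by simp
  ultimately show ?thesis by (metis inv_into_f_f)
qed

lemma loc_prod:
  assumes "z \<in> cimg (prod_atlas C T) i"
  shows "loc (prod_atlas C T) i f z = f (cinv C i (base z), z $ None)"
  using cinv_prod[OF assms] by (simp add: loc_def)

lemma open_cimg_prod:
  assumes "open T"
  shows "open (cimg (prod_atlas C T) i)"
proof -
  have "cimg (prod_atlas C T) i = base -` cimg C i \<inter> (\<lambda>z. z $ None) -` T"
    using cimg_prod by blast
  moreover have "open (base -` cimg C i :: (real^('k option)) set)"
    by (rule open_vimage[OF open_cimg]) (use smooth_on_continuous[OF smooth_on_base] open_UNIV in blast)
  moreover have "open ((\<lambda>z::real^('k option). z $ None) -` T)"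
    by (rule open_vimage[OF assms]) (intro continuous_intros)
  ultimately show ?thesis by (simp only: open_Int)
qed

lemma transition_prod:
  assumes "z \<in> cmap (prod_atlas C T) i ` (cdom (prod_atlas C T) i \<inter> cdom (prod_atlas C T) j)"
  shows "base z \<in> overlap i j" "z $ None \<in> T"
    "(cmap (prod_atlas C T) j \<circ> cinv (prod_atlas C T) i) z = ext (transition i j (base z)) (z $ None)"
proof -
  obtain x s where x: "x \<in> cdom C i" "x \<in> cdom C j" "s \<in> T" "z = ext (cmap C i x) s"
    using assms by auto
  have "z \<in> cimg (prod_atlas C T) i" using assms by blast
  from cinv_prod[OF this] x show "base z \<in> overlap i j" "z $ None \<in> T"
    "(cmap (prod_atlas C T) j \<circ> cinv (prod_atlas C T) i) z = ext (transition i j (base z)) (z $ None)"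
    by auto
qed

lemma open_overlap_prod:
  assumes "open T"
  shows "open (cmap (prod_atlas C T) i ` (cdom (prod_atlas C T) i \<inter> cdom (prod_atlas C T) j))"
proof -
  have "cmap (prod_atlas C T) i ` (cdom (prod_atlas C T) i \<inter> cdom (prod_atlas C T) j)
      = base -` overlap i j \<inter> (\<lambda>z. z $ None) -` T" (is "?L = ?R")
  proof (intro equalityI subsetI)
    fix z assume "z \<in> ?R"
    then obtain x where x: "x \<in> cdom C i" "x \<in> cdom C j" "base z = cmap C i x" "z $ None \<in> T" by auto
    then have "(x, z $ None) \<in> cdom (prod_atlas C T) i \<inter> cdom (prod_atlas C T) j"
      and "z = cmap (prod_atlas C T) i (x, z $ None)" using ext_base[of z] by auto
    then show "z \<in> ?L" by blast
  next
    fix z assume "z \<in> ?L"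
    from transition_prod(1,2)[OF this] show "z \<in> ?R" by (intro IntI vimageI2)
  qed
  moreover have "open (base -` overlap i j :: (real^('k option)) set)"
    by (rule open_vimage[OF open_overlap]) (use smooth_on_continuous[OF smooth_on_base] open_UNIV in blast)
  moreover have "open ((\<lambda>z::real^('k option). z $ None) -` T)"
    by (rule open_vimage[OF assms]) (intro continuous_intros)
  ultimately show ?thesis by (simp only: open_Int)
qed

lemma smooth_transition_prod:
  assumes "open T"
  shows "smooth_on (cmap (prod_atlas C T) i ` (cdom (prod_atlas C T) i \<inter> cdom (prod_atlas C T) j))
    (\<lambda>z. ext (transition i j (base z)) (z $ None))" (is "smooth_on ?W _")
proof (rule smooth_on_ext)
  show W: "open ?W" by (rule open_overlap_prod[OF assms])
  show "smooth_on ?W (\<lambda>z. transition i j (base z) $ k)" for k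
    by (rule smooth_on_compose_base[OF W smooth_on_vec_nth[OF open_overlap smooth_transition]])
      (rule transition_prod(1))
  show "smooth_on ?W (\<lambda>z. z $ None)" by (rule smooth_on_linear_map[OF W bounded_linear_vec_nth])
qed

lemma charts_prod:
  assumes "open T"
  shows "charts (prod_atlas C T)"
proof
  fix i j
  show "open (cdom (prod_atlas C T) i)" using open_cdom assms by (simp add: open_Times)
  show "open (cimg (prod_atlas C T) i)" by (rule open_cimg_prod[OF assms])
  show "homeomorphism (cdom (prod_atlas C T) i) (cimg (prod_atlas C T) i) (cmap (prod_atlas C T) i) (cinv (prod_atlas C T) i)"
  proof (rule homeomorphismI)
    have "continuous_on (cdom C i) (cmap C i)" using homeo[of i] by (simp add: homeomorphism_def)
    then have c: "continuous_on (cdom C i \<times> T) (\<lambda>p. cmap C i (fst p))"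
      by (rule continuous_on_compose2) (auto intro: continuous_intros)
    have "continuous_on (cdom C i \<times> T) (\<lambda>p. case a of None \<Rightarrow> snd p | Some j \<Rightarrow> cmap C i (fst p) $ j)" for a
      by (cases a) (auto intro!: continuous_intros c)
    then have "continuous_on (cdom C i \<times> T) (\<lambda>p. ext (cmap C i (fst p)) (snd p))"
      unfolding ext_def by (intro continuous_on_vec_lambda)
    then show "continuous_on (cdom (prod_atlas C T) i) (cmap (prod_atlas C T) i)"
      by (simp add: prod_atlas_alt case_prod_beta')
    have "continuous_on (cimg C i) (cinv C i)" using homeo[of i] by (simp add: homeomorphism_def)
    then have "continuous_on (cimg (prod_atlas C T) i) (\<lambda>z. cinv C i (base z))"
      by (rule continuous_on_compose2)
        (use smooth_on_continuous[OF smooth_on_base[OF open_UNIV]] continuous_on_subset cimg_prod in blast)+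
    then have "continuous_on (cimg (prod_atlas C T) i) (\<lambda>z. (cinv C i (base z), z $ None))"
      by (intro continuous_on_Pair continuous_intros)
    then show "continuous_on (cimg (prod_atlas C T) i) (cinv (prod_atlas C T) i)"
      by (subst continuous_on_cong[OF refl cinv_prod])
    show "cinv (prod_atlas C T) i ` cimg (prod_atlas C T) i \<subseteq> cdom (prod_atlas C T) i"
      by (rule image_subsetI) (rule inv_into_into)
    show "cinv (prod_atlas C T) i (cmap (prod_atlas C T) i x) = x" if "x \<in> cdom (prod_atlas C T) i" for x
    proof -
      obtain x' s where x': "x = (x', s)" by (cases x)
      with that have x: "x = (x', s)" "x' \<in> cdom C i" "s \<in> T" by simp_all
      have "cmap (prod_atlas C T) i x \<in> cimg (prod_atlas C T) i" using that by blast
      from cinv_prod[OF this] show ?thesis using x by simp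
    qed
  qed (auto intro: f_inv_into_f)
  show "smooth_on (cmap (prod_atlas C T) i ` (cdom (prod_atlas C T) i \<inter> cdom (prod_atlas C T) j))
     (cmap (prod_atlas C T) j \<circ> cinv (prod_atlas C T) i)" (is "smooth_on ?W ?\<tau>")
    by (rule smooth_on_congI[OF open_overlap_prod[OF assms] smooth_transition_prod[OF assms] transition_prod(3)])
qed

end

text \<open>The Jacobian matrix of a transition map of the product, in terms of the one of the factor.\<close>

definition blk :: "real^'k^'k \<Rightarrow> real^('k::finite option)^('k option)" where
  "blk J = (\<chi> a b. case a of None \<Rightarrow> (case b of None \<Rightarrow> 1 | Some j \<Rightarrow> 0)
     | Some i \<Rightarrow> (case b of None \<Rightarrow> 0 | Some j \<Rightarrow> J $ i $ j))"

lemma blk_nth [simp]: "blk J $ None $ None = 1" "blk J $ None $ Some j = 0"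
  "blk J $ Some i $ None = 0" "blk J $ Some i $ Some j = J $ i $ j"
  by (simp_all add: blk_def)

lemma (in charts) jac_prod:
  assumes T: "open T" and x: "x \<in> cdom C i" "x \<in> cdom C j" and s: "s \<in> T"
  shows "jac (cmap (prod_atlas C T) j \<circ> cinv (prod_atlas C T) i) (cmap (prod_atlas C T) i (x, s))
     = blk (jac (transition i j) (cmap C i x))"
proof -
  let ?W = "cmap (prod_atlas C T) i ` (cdom (prod_atlas C T) i \<inter> cdom (prod_atlas C T) j)"
  let ?\<tau> = "\<lambda>z. ext (transition i j (base z)) (z $ None)"
  let ?z = "ext (cmap C i x) s"
  interpret P: charts "prod_atlas C T" by (rule charts_prod[OF T])
  have z: "?z \<in> ?W" using x s by (auto simp: image_iff intro!: bexI[of _ "(x, s)"])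
  have d: "?\<tau> differentiable at ?z"
    by (rule smooth_on_differentiable[OF smooth_transition_prod[OF T] z])
  have "frechet_derivative ?\<tau> (at ?z) = frechet_derivative (cmap (prod_atlas C T) j \<circ> cinv (prod_atlas C T) i) (at ?z)"
    by (rule frechet_derivative_transform_within_open[OF d open_overlap_prod[OF T] z])
      (rule transition_prod(3)[symmetric])
  then have "jac (cmap (prod_atlas C T) j \<circ> cinv (prod_atlas C T) i) ?z = jac ?\<tau> ?z"
    by (simp add: jac_def)
  also have "\<dots> = blk (jac (transition i j) (cmap C i x))"
  proof -
    have bz: "cmap C i x \<in> overlap i j" using x by blast
    have dt: "transition i j differentiable at (cmap C i x)" by (rule transition_differentiable[OF bz])
    have dt': "(\<lambda>y. transition i j y $ k) differentiable at (base ?z)" for k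
      using smooth_on_differentiable[OF smooth_on_vec_nth[OF open_overlap smooth_transition] bz] by simp
    have "jac ?\<tau> ?z $ a $ b = blk (jac (transition i j) (cmap C i x)) $ a $ b" for a b
    proof (cases a)
      case None
      have "jac ?\<tau> ?z $ None $ b = pd b (\<lambda>z. z $ None) ?z" unfolding jac_entry[OF d] by simp
      with None show ?thesis by (cases b) simp_all
    next
      case (Some k)
      have "jac ?\<tau> ?z $ Some k $ b = pd b (\<lambda>z. transition i j (base z) $ k) ?z"
        unfolding jac_entry[OF d] by simp
      with Some show ?thesis
        by (cases b) (simp_all only: pd_compose_base[OF dt'] jac_entry[OF dt] blk_nth base_ext)
    qed
    then show ?thesis by (simp add: vec_eq_iff)
  qed
  finally show ?thesis by simp
qed

text \<open>In the Leibniz formula only the permutations that fix \<open>None\<close> contribute, and these are the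
  permutations of the remaining indices.\<close>

lemma det_first_column:
  fixes A :: "real^('k::finite option)^('k option)"
  assumes "\<And>j. A $ Some j $ None = 0"
  shows "det A = A $ None $ None * det (\<chi> i j. A $ Some i $ Some j :: real^'k^'k)"
proof -
  let ?m = "map_permutation (UNIV :: 'k set) Some"
  have rng: "range (Some :: 'k \<Rightarrow> 'k option) = UNIV - {None}" by (auto simp: UNIV_option_conv)
  have m: "?m q (Some k) = Some (q k)" "?m q None = None" if "q permutes UNIV" for q k
    by (rule map_permutation_apply) (auto simp: map_permutation_def restrict_id_def)
  have mp: "?m q permutes UNIV" if "q permutes UNIV" for q
  proof -
    have "?m q permutes range Some"
      by (rule map_permutation_permutes[OF inj_on_imp_bij_betw that]) simp
    then show ?thesis by (rule permutes_subset) simp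
  qed
  have "det A = (\<Sum>p\<in>{p. p permutes UNIV}. of_int (sign p) * (\<Prod>i\<in>UNIV. A $ i $ p i))"
    by (simp add: det_def)
  also have "\<dots> = (\<Sum>p\<in>?m ` {q. q permutes UNIV}. of_int (sign p) * (\<Prod>i\<in>UNIV. A $ i $ p i))"
  proof (rule sum.mono_neutral_right)
    show "\<forall>p\<in>{p. p permutes UNIV} - ?m ` {q. q permutes UNIV}. of_int (sign p) * (\<Prod>i\<in>UNIV. A $ i $ p i) = 0"
    proof
      fix p assume p: "p \<in> {p. p permutes (UNIV :: 'k option set)} - ?m ` {q. q permutes UNIV}"
      then have perm: "p permutes UNIV" by simp
      have "p None \<noteq> None"
      proof
        assume n: "p None = None"
        define q where "q k = the (p (Some k))" for k
        have pS: "p (Some k) = Some (q k)" for k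
        proof -
          have "p (Some k) \<noteq> None" using n permutes_inj[OF perm] by (metis injD option.distinct(1))
          then show ?thesis by (simp add: q_def)
        qed
        have "bij q"
        proof (rule bijI)
          show "inj q" using pS permutes_inj[OF perm] by (metis injD injI option.inject)
          show "surj q"
          proof (rule surjI)
            fix k
            show "q (the (inv p (Some k))) = k"
            proof -
              obtain a where a: "p a = Some k" using permutes_surj[OF perm] by (metis surjD)
              then obtain k' where "a = Some k'" using n by (cases a) auto
              moreover have "inv p (Some k) = a" using a permutes_inj[OF perm] by (metis inv_f_f)
              ultimately show ?thesis using a pS by simp
            qed
          qed
        qed
        then have q: "q permutes UNIV" by (rule bij_imp_permutes) simp
        have "p = ?m q"
        proof
          fix a show "p a = ?m q a" using m[OF q] n pS by (cases a) auto
        qed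
        then show False using p q by blast
      qed
      obtain a where a: "p a = None" using permutes_surj[OF perm] by (metis surjD)
      then obtain k where "a = Some k" using \<open>p None \<noteq> None\<close> by (cases a) auto
      then have "A $ a $ p a = 0" using assms a by simp
      then have "(\<Prod>i\<in>UNIV. A $ i $ p i) = 0" by (intro prod_zero) auto
      then show "of_int (sign p) * (\<Prod>i\<in>UNIV. A $ i $ p i) = 0" by simp
    qed
  qed (use mp in \<open>auto simp: finite_permutations\<close>)
  also have "\<dots> = (\<Sum>q\<in>{q. q permutes UNIV}. of_int (sign (?m q)) * (\<Prod>i\<in>UNIV. A $ i $ ?m q i))"
  proof (rule sum.reindex[unfolded comp_def])
    show "inj_on ?m {q. q permutes UNIV}"
    proof (rule inj_onI)
      fix q q' assume "q \<in> {q. q permutes UNIV}" "q' \<in> {q. q permutes UNIV}" "?m q = ?m q'"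
      then show "q = q'" using m(1) by (metis ext mem_Collect_eq option.inject)
    qed
  qed
  also have "\<dots> = (\<Sum>q\<in>{q. q permutes UNIV}. A $ None $ None * (of_int (sign q) * (\<Prod>i\<in>UNIV. A $ Some i $ Some (q i))))"
  proof (rule sum.cong[OF refl])
    fix q assume "q \<in> {q. q permutes (UNIV :: 'k set)}"
    then have q: "q permutes UNIV" by simp
    have "(\<Prod>i\<in>UNIV. A $ i $ ?m q i) = A $ None $ None * (\<Prod>i\<in>UNIV. A $ Some i $ Some (q i))"
      by (simp add: UNIV_option_conv prod.reindex m[OF q])
    moreover have "sign (?m q) = sign q" using sign_map_permutation[where p = q and A = UNIV and f = Some] q by simp
    ultimately show "of_int (sign (?m q)) * (\<Prod>i\<in>UNIV. A $ i $ ?m q i)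
      = A $ None $ None * (of_int (sign q) * (\<Prod>i\<in>UNIV. A $ Some i $ Some (q i)))" by simp
  qed
  also have "\<dots> = A $ None $ None * det (\<chi> i j. A $ Some i $ Some j :: real^'k^'k)"
    by (simp add: det_def sum_distrib_left)
  finally show ?thesis .
qed

lemma det_scale:
  fixes A :: "real^'k::finite^'k"
  shows "det (\<chi> i j. c * A $ i $ j) = c ^ CARD('k) * det A"
proof -
  have "(\<chi> i j. c * A $ i $ j) = (\<chi> i. c *s A $ i)" by (simp add: vec_eq_iff)
  then show ?thesis using det_rows_mul[of "\<lambda>_. c" "\<lambda>i. A $ i"] by simp
qed

declare (in charts) cdom_prod [simp del]

section \<open>The ambient metric and the Poincare--Einstein metric as block matrices\<close>

definition amb :: "real \<Rightarrow> real \<Rightarrow> real^'n^'n \<Rightarrow> real^('n::finite option option)^('n option option)" where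
  "amb \<rho> t K = (\<chi> a b. (case (a, b) of
       (None, None) \<Rightarrow> 2 * \<rho>
     | (None, Some None) \<Rightarrow> t
     | (Some None, None) \<Rightarrow> t
     | (Some (Some j), Some (Some k)) \<Rightarrow> t\<^sup>2 * K $ j $ k
     | _ \<Rightarrow> 0))"

definition amb_inverse :: "real \<Rightarrow> real \<Rightarrow> real^'n^'n \<Rightarrow> real^('n::finite option option)^('n option option)" where
  "amb_inverse \<rho> t K = (\<chi> a b. (case (a, b) of
       (Some None, Some None) \<Rightarrow> - 2 * \<rho> / t\<^sup>2
     | (None, Some None) \<Rightarrow> 1 / t
     | (Some None, None) \<Rightarrow> 1 / t
     | (Some (Some j), Some (Some k)) \<Rightarrow> K $ j $ k / t\<^sup>2
     | _ \<Rightarrow> 0))"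

definition pe :: "real \<Rightarrow> real^'n^'n \<Rightarrow> real^('n::finite option)^('n option)" where
  "pe r K = (\<chi> a b. (case (a, b) of
       (None, None) \<Rightarrow> 1
     | (Some j, Some k) \<Rightarrow> K $ j $ k
     | _ \<Rightarrow> 0) / r\<^sup>2)"

definition pe_inverse :: "real \<Rightarrow> real^'n^'n \<Rightarrow> real^('n::finite option)^('n option)" where
  "pe_inverse r K = (\<chi> a b. (case (a, b) of
       (None, None) \<Rightarrow> 1
     | (Some j, Some k) \<Rightarrow> K $ j $ k
     | _ \<Rightarrow> 0) * r\<^sup>2)"

lemma g_ambient_eq_amb: "g_ambient h i ((x, \<rho>), t) = amb \<rho> t (h i (x, \<rho>))"
  by (simp add: g_ambient_def amb_def)

lemma g_plus_eq_pe: "g_plus h i (x, r) = pe r (h i (x, - (r\<^sup>2 / 2)))"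
  by (simp add: g_plus_def pe_def)

lemma amb_nth:
  "amb \<rho> t K $ None $ None = 2 * \<rho>" "amb \<rho> t K $ None $ Some None = t"
  "amb \<rho> t K $ Some None $ None = t" "amb \<rho> t K $ Some None $ Some None = 0"
  "amb \<rho> t K $ None $ Some (Some k) = 0" "amb \<rho> t K $ Some (Some k) $ None = 0"
  "amb \<rho> t K $ Some None $ Some (Some k) = 0" "amb \<rho> t K $ Some (Some k) $ Some None = 0"
  "amb \<rho> t K $ Some (Some j) $ Some (Some k) = t\<^sup>2 * K $ j $ k"
  by (simp_all add: amb_def)

lemma amb_inverse_nth:
  "amb_inverse \<rho> t K $ None $ None = 0" "amb_inverse \<rho> t K $ None $ Some None = 1 / t"
  "amb_inverse \<rho> t K $ Some None $ None = 1 / t" "amb_inverse \<rho> t K $ Some None $ Some None = - 2 * \<rho> / t\<^sup>2"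
  "amb_inverse \<rho> t K $ None $ Some (Some k) = 0" "amb_inverse \<rho> t K $ Some (Some k) $ None = 0"
  "amb_inverse \<rho> t K $ Some None $ Some (Some k) = 0" "amb_inverse \<rho> t K $ Some (Some k) $ Some None = 0"
  "amb_inverse \<rho> t K $ Some (Some j) $ Some (Some k) = K $ j $ k / t\<^sup>2"
  by (simp_all add: amb_inverse_def)

lemma pe_nth:
  "pe r K $ None $ None = 1 / r\<^sup>2" "pe r K $ None $ Some k = 0" "pe r K $ Some k $ None = 0"
  "pe r K $ Some j $ Some k = K $ j $ k / r\<^sup>2"
  by (simp_all add: pe_def)

lemma pe_inverse_nth:
  "pe_inverse r K $ None $ None = r\<^sup>2" "pe_inverse r K $ None $ Some k = 0" "pe_inverse r K $ Some k $ None = 0"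
  "pe_inverse r K $ Some j $ Some k = K $ j $ k * r\<^sup>2"
  by (simp_all add: pe_inverse_def)

lemma matrix_inv_amb:
  fixes K :: "real^'n::finite^'n"
  assumes "t \<noteq> 0" "det K \<noteq> 0"
  shows "matrix_inv (amb \<rho> t K) = amb_inverse \<rho> t (matrix_inv K)"
proof (rule matrix_inv_eqI)
  have "(\<Sum>k\<in>UNIV. K $ i $ k * matrix_inv K $ k $ j) = (if i = j then 1 else 0)" for i j
    using matrix_inv_works(1)[OF assms(2)] by (auto simp: matrix_matrix_mult_def mat_def vec_eq_iff)
  then show "amb \<rho> t K ** amb_inverse \<rho> t (matrix_inv K) = mat 1"
    using assms(1)
    by (simp add: vec_eq_iff split_option_all matrix_matrix_mult_def sum_option amb_nth amb_inverse_nth mat_def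
        field_simps power2_eq_square)
qed

lemma matrix_inv_pe:
  fixes K :: "real^'n::finite^'n"
  assumes "r \<noteq> 0" "det K \<noteq> 0"
  shows "matrix_inv (pe r K) = pe_inverse r (matrix_inv K)"
proof (rule matrix_inv_eqI)
  have "(\<Sum>k\<in>UNIV. K $ i $ k * matrix_inv K $ k $ j) = (if i = j then 1 else 0)" for i j
    using matrix_inv_works(1)[OF assms(2)] by (auto simp: matrix_matrix_mult_def mat_def vec_eq_iff)
  then show "pe r K ** pe_inverse r (matrix_inv K) = mat 1"
    using assms(1)
    by (simp add: vec_eq_iff split_option_all matrix_matrix_mult_def sum_option pe_nth pe_inverse_nth mat_def)
qed

lemma congruence_blk:
  fixes G :: "real^('k::finite option)^('k option)"
  shows "(transpose (blk J) ** G ** blk J) $ None $ None = G $ None $ None"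
    and "(transpose (blk J) ** G ** blk J) $ None $ Some k = (\<Sum>l\<in>UNIV. G $ None $ Some l * J $ l $ k)"
    and "(transpose (blk J) ** G ** blk J) $ Some k $ None = (\<Sum>l\<in>UNIV. G $ Some l $ None * J $ l $ k)"
    and "(transpose (blk J) ** G ** blk J) $ Some j $ Some k
      = (transpose J ** (\<chi> i l. G $ Some i $ Some l) ** J) $ j $ k"
  by (simp_all add: matrix_matrix_mult_def transpose_def sum_option mult.commute)

lemma amb_congruence:
  "transpose (blk (blk J)) ** amb \<rho> t K ** blk (blk J) = amb \<rho> t (transpose J ** K ** J)"
proof -
  have "(\<chi> i l. (\<chi> i l. amb \<rho> t K $ Some i $ Some l) $ Some i $ Some l) = (\<chi> i l. t\<^sup>2 * K $ i $ l)"
    by (simp add: vec_eq_iff amb_nth)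
  moreover have "(transpose J ** (\<chi> i l. t\<^sup>2 * K $ i $ l) ** J) $ j $ k = t\<^sup>2 * (transpose J ** K ** J) $ j $ k" for j k
    by (simp add: matrix_matrix_mult_def sum_distrib_left sum_distrib_right mult_ac)
  ultimately show ?thesis
    by (simp add: vec_eq_iff split_option_all congruence_blk amb_nth sum_option)
qed

lemma pe_congruence:
  "transpose (blk J) ** pe r K ** blk J = pe r (transpose J ** K ** J)"
proof -
  have "(\<chi> i l. pe r K $ Some i $ Some l) = (\<chi> i l. K $ i $ l / r\<^sup>2)"
    by (simp add: vec_eq_iff pe_nth)
  moreover have "(transpose J ** (\<chi> i l. K $ i $ l / r\<^sup>2) ** J) $ j $ k = (transpose J ** K ** J) $ j $ k / r\<^sup>2" for j k
    by (simp add: matrix_matrix_mult_def sum_divide_distrib sum_distrib_right)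
  ultimately show ?thesis
    by (simp add: vec_eq_iff split_option_all congruence_blk pe_nth)
qed

text \<open>Exchanging the first two columns makes the matrix block triangular.\<close>

lemma abs_det_amb:
  fixes K :: "real^'n::finite^'n"
  shows "\<bar>det (amb \<rho> t K)\<bar> = t\<^sup>2 * (t\<^sup>2) ^ CARD('n) * \<bar>det K\<bar>"
proof -
  let ?p = "Transposition.transpose None (Some None :: 'n option option)"
  let ?B = "\<chi> i j. amb \<rho> t K $ i $ ?p j"
  have "?p permutes UNIV" by (rule permutes_swap_id) auto
  from det_permute_columns[OF this, of "amb \<rho> t K"]
  have 1: "\<bar>det ?B\<bar> = \<bar>det (amb \<rho> t K)\<bar>" by (simp add: abs_mult sign_def)
  have p: "?p None = Some None" "?p (Some None) = None" "?p (Some (Some k)) = Some (Some k)" for k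
    by (simp_all add: Transposition.transpose_def)
  have "?B $ Some j $ None = 0" for j by (cases j) (simp_all add: p amb_nth)
  from det_first_column[of ?B, OF this]
  have "det ?B = t * det (\<chi> i j. ?B $ Some i $ Some j)" by (simp add: p amb_nth)
  also have "det (\<chi> i j. ?B $ Some i $ Some j) = t * det (\<chi> i j. t\<^sup>2 * K $ i $ j)"
  proof -
    have "(\<chi> i j. ?B $ Some i $ Some j) $ Some j $ None = 0" for j
      by (simp add: p amb_nth)
    from det_first_column[of "\<chi> i j. ?B $ Some i $ Some j", OF this] show ?thesis by (simp add: p amb_nth)
  qed
  finally show ?thesis
    unfolding 1[symmetric] det_scale by (simp add: abs_mult power2_eq_square)
qed

lemma vol_density_amb:
  fixes K :: "real^'n::finite^'n"
  assumes "t > 0"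
  shows "vol_density (amb \<rho> t K) = t powr (real CARD('n) + 1) * vol_density K"
proof -
  have "t\<^sup>2 * (t\<^sup>2) ^ CARD('n) = (t ^ Suc CARD('n))\<^sup>2" by (simp add: power_mult_distrib power2_eq_square power_mult[symmetric])
  then have "sqrt (t\<^sup>2 * (t\<^sup>2) ^ CARD('n)) = t ^ Suc CARD('n)"
    using assms by (simp only: real_sqrt_abs) simp
  moreover have "t ^ Suc CARD('n) = t powr (real CARD('n) + 1)"
    using assms powr_realpow[of t "Suc CARD('n)"] by (simp add: add.commute)
  ultimately show ?thesis by (simp add: vol_density_def abs_det_amb real_sqrt_mult)
qed

lemma vol_density_pe:
  fixes K :: "real^'n::finite^'n"
  assumes "r > 0"
  shows "vol_density (pe r K) = r powr (- real CARD('n) - 1) * vol_density K"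
proof -
  have "det (pe r K) = 1 / r\<^sup>2 * det (\<chi> i j. (1 / r\<^sup>2) * K $ i $ j)"
    using det_first_column[of "pe r K"] by (simp add: pe_nth)
  then have "\<bar>det (pe r K)\<bar> = (1 / r ^ Suc CARD('n))\<^sup>2 * \<bar>det K\<bar>"
    unfolding det_scale by (simp add: abs_mult power_one_over power_mult_distrib power2_eq_square)
  then have "vol_density (pe r K) = (1 / r ^ Suc CARD('n)) * vol_density K"
    using assms by (simp add: vol_density_def real_sqrt_mult real_sqrt_divide)
  moreover have "1 / r ^ Suc CARD('n) = r powr (- real CARD('n) - 1)"
  proof -
    have "- real CARD('n) - 1 = - (real (Suc CARD('n)))" by simp
    then have "r powr (- real CARD('n) - 1) = r powr (- (real (Suc CARD('n))))" by (simp only:)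
    also have "\<dots> = 1 / r ^ Suc CARD('n)"
      using assms by (simp only: powr_minus powr_realpow) (simp add: divide_inverse)
    finally show ?thesis by simp
  qed
  ultimately show ?thesis by (simp only:)
qed

section \<open>Conjugation with the square root of the volume ratio\<close>

text \<open>In the following \<open>m w\<^sup>2\<close> is the volume density of the metrics \<open>g(\<rho>)\<close>, where \<open>m\<close> is that
  of \<open>g(0)\<close>, \<open>H\<close> is the inverse of \<open>g(\<rho>)\<close>, and \<open>\<rho>\<close> is the coordinate with index \<open>None\<close>. Thus
  \<open>adiv\<close> is the coordinate expression of \<open>- \<delta> (g(\<rho>)\<^sup>-\<^sup>1 d)\<close>, with the adjoint taken for \<open>g(0)\<close>, and
  \<open>potential\<close> is the term of order zero that the conjugation with \<open>w\<close> produces.\<close>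

definition aflux :: "(real^('k::finite option) \<Rightarrow> real) \<Rightarrow> ('k \<Rightarrow> 'k \<Rightarrow> real^('k option) \<Rightarrow> real)
    \<Rightarrow> (real^('k option) \<Rightarrow> real) \<Rightarrow> 'k \<Rightarrow> real^('k option) \<Rightarrow> real" where
  "aflux m H F j z = m z * (\<Sum>k\<in>UNIV. H j k z * pd (Some k) F z)"

definition adiv :: "(real^('k::finite option) \<Rightarrow> real) \<Rightarrow> ('k \<Rightarrow> 'k \<Rightarrow> real^('k option) \<Rightarrow> real)
    \<Rightarrow> (real^('k option) \<Rightarrow> real) \<Rightarrow> real^('k option) \<Rightarrow> real" where
  "adiv m H F z = (\<Sum>j\<in>UNIV. pd (Some j) (aflux m H F j) z) / m z"

definition potential :: "(real^('k::finite option) \<Rightarrow> real) \<Rightarrow> ('k \<Rightarrow> 'k \<Rightarrow> real^('k option) \<Rightarrow> real)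
    \<Rightarrow> (real^('k option) \<Rightarrow> real) \<Rightarrow> real^('k option) \<Rightarrow> real" where
  "potential m H w z = 2 * z $ None * pd None (pd None w) z / w z
     - (real CARD('k) - 2) * pd None w z / w z - adiv m H w z / w z"

locale slab =
  fixes Z :: "(real^('k::finite option)) set" and m w :: "real^('k option) \<Rightarrow> real"
    and H :: "'k \<Rightarrow> 'k \<Rightarrow> real^('k option) \<Rightarrow> real"
  assumes open_Z: "open Z" and smooth_m: "smooth_on Z m" and smooth_w: "smooth_on Z w"
    and smooth_H: "\<And>j k. smooth_on Z (H j k)"
    and m_pos: "\<And>z. z \<in> Z \<Longrightarrow> m z > 0" and w_pos: "\<And>z. z \<in> Z \<Longrightarrow> w z > 0"
    and pd_m: "\<And>z. z \<in> Z \<Longrightarrow> pd None m z = 0" and H_sym: "\<And>z j k. z \<in> Z \<Longrightarrow> H j k z = H k j z"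
begin

lemma smooth_on_aflux:
  assumes "smooth_on Z F"
  shows "smooth_on Z (aflux m H F j)"
  unfolding aflux_def
  by (intro smooth_on_mult smooth_on_sum smooth_on_pd assms open_Z smooth_m smooth_H)

lemma smooth_on_adiv:
  assumes "smooth_on Z F"
  shows "smooth_on Z (adiv m H F)"
  unfolding adiv_def
proof (intro smooth_on_divide smooth_on_sum smooth_on_pd smooth_on_aflux assms open_Z smooth_m)
  show "m z \<noteq> 0" if "z \<in> Z" for z using m_pos[OF that] by simp
qed

lemma smooth_on_potential: "smooth_on Z (potential m H w)"
proof -
  have "w z \<noteq> 0" if "z \<in> Z" for z using w_pos[OF that] by simp
  then show ?thesis
    unfolding potential_def
    by (intro smooth_on_diff smooth_on_divide smooth_on_mult smooth_on_pd smooth_on_const smooth_on_adiv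
        smooth_w open_Z smooth_on_linear_map bounded_linear_vec_nth)
qed

lemma differentiable_on_slab: "smooth_on Z F \<Longrightarrow> z \<in> Z \<Longrightarrow> F differentiable at z"
  by (rule smooth_on_differentiable)

lemma aflux_cross_terms:
  assumes "z \<in> Z"
  shows "(\<Sum>j\<in>UNIV. pd (Some j) F z * aflux m H G j z) = (\<Sum>j\<in>UNIV. pd (Some j) G z * aflux m H F j z)"
proof -
  have "(\<Sum>j\<in>UNIV. pd (Some j) F z * aflux m H G j z)
      = (\<Sum>j\<in>UNIV. \<Sum>k\<in>UNIV. m z * H j k z * pd (Some j) F z * pd (Some k) G z)"
    by (simp add: aflux_def sum_distrib_left mult_ac)
  also have "\<dots> = (\<Sum>k\<in>UNIV. \<Sum>j\<in>UNIV. m z * H j k z * pd (Some j) F z * pd (Some k) G z)"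
    by (rule sum.swap)
  also have "\<dots> = (\<Sum>j\<in>UNIV. \<Sum>k\<in>UNIV. m z * H j k z * pd (Some k) F z * pd (Some j) G z)"
    using H_sym[OF assms] by simp
  also have "\<dots> = (\<Sum>j\<in>UNIV. pd (Some j) G z * aflux m H F j z)"
    by (simp add: aflux_def sum_distrib_left mult_ac)
  finally show ?thesis .
qed

text \<open>The left-hand side is the ambient Laplacian of \<open>t\<^sup>\<gamma> f\<close>, divided by \<open>t\<^bsup>\<gamma>-2\<^esup>\<close>. With \<open>f = \<Phi> / w\<close> one has
  \<open>v \<partial>f = m (w \<partial>\<Phi> - \<Phi> \<partial>w)\<close>, so that in the second derivatives the products of first derivatives
  of \<open>\<Phi>\<close> and \<open>w\<close> cancel; what remains of \<open>w\<close> acts by multiplication.\<close>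

lemma conjugated_laplacian:
  fixes n \<gamma> :: real
  assumes \<Phi>: "smooth_on Z \<Phi>" and z: "z \<in> Z"
  defines "f \<equiv> \<lambda>z. \<Phi> z / w z" and "v \<equiv> \<lambda>z. m z * (w z)\<^sup>2"
  assumes n: "n = real CARD('k)"
  shows "((n + \<gamma>) * (v z * pd None f z)
      + pd None (\<lambda>z. v z * (\<gamma> * f z - 2 * z $ None * pd None f z)) z
      + (\<Sum>j\<in>UNIV. pd (Some j) (\<lambda>z. v z * (\<Sum>k\<in>UNIV. H j k z * pd (Some k) f z)) z)) / v z
    = (1 / w z) * (- 2 * z $ None * pd None (pd None \<Phi>) z + (2 * \<gamma> + n - 2) * pd None \<Phi> z
        + adiv m H \<Phi> z + potential m H w z * \<Phi> z)"
proof -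
  note d = differentiable_on_slab
  have wz: "w z > 0" "m z > 0" using w_pos m_pos z by auto
  have pdf: "v x * pd a f x = m x * (pd a \<Phi> x * w x - \<Phi> x * pd a w x)" if "x \<in> Z" for x a
    using w_pos[OF that] pd_divide[OF d[OF \<Phi> that] d[OF smooth_w that], of a]
    by (simp add: f_def v_def)
  have vf: "v x * f x = m x * (\<Phi> x * w x)" if "x \<in> Z" for x
    using w_pos[OF that] by (simp add: f_def v_def power2_eq_square)
  define B where "B = (\<lambda>z. pd None \<Phi> z * w z - \<Phi> z * pd None w z)"
  have sB: "smooth_on Z B" unfolding B_def
    by (intro smooth_on_diff smooth_on_mult smooth_on_pd open_Z \<Phi> smooth_w)
  have pdB: "pd None B z = pd None (pd None \<Phi>) z * w z - \<Phi> z * pd None (pd None w) z"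
    unfolding B_def
    by (subst pd_diff) (auto intro!: d[OF _ z] smooth_on_mult smooth_on_pd open_Z \<Phi> smooth_w
        simp: pd_mult[OF d[OF smooth_on_pd[OF \<Phi>] z] d[OF smooth_w z]]
          pd_mult[OF d[OF \<Phi> z] d[OF smooth_on_pd[OF smooth_w] z]])
  have sN: "smooth_on Z (\<lambda>z. z $ None)" by (rule smooth_on_linear_map[OF open_Z bounded_linear_vec_nth])
  \<comment> \<open>\<open>m B\<close> is \<open>v \<partial>\<^sub>\<rho> f\<close>, and \<open>m E\<close> is the function that is differentiated in the second summand.\<close>
  define E where "E = (\<lambda>z. \<gamma> * (\<Phi> z * w z) - 2 * (z $ None * B z))"
  have sPw: "smooth_on Z (\<lambda>z. \<Phi> z * w z)" and sNB: "smooth_on Z (\<lambda>z. z $ None * B z)"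
    by (intro smooth_on_mult open_Z \<Phi> smooth_w sN sB)+
  have sE: "smooth_on Z E" unfolding E_def
    by (intro smooth_on_diff smooth_on_mult[OF open_Z smooth_on_const] open_Z sPw sNB)
  have "pd None E z = pd None (\<lambda>z. \<gamma> * (\<Phi> z * w z)) z - pd None (\<lambda>z. 2 * (z $ None * B z)) z"
    unfolding E_def by (intro pd_diff d[OF _ z] smooth_on_mult[OF open_Z smooth_on_const] sPw sNB)
  also have "pd None (\<lambda>z. \<gamma> * (\<Phi> z * w z)) z = \<gamma> * (\<Phi> z * pd None w z + pd None \<Phi> z * w z)"
    by (simp only: pd_cmult[OF d[OF sPw z]] pd_mult[OF d[OF \<Phi> z] d[OF smooth_w z]])
  also have "pd None (\<lambda>z. 2 * (z $ None * B z)) z = 2 * (z $ None * pd None B z + B z)"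
    by (simp add: pd_cmult[OF d[OF sNB z]] pd_mult[OF d[OF sN z] d[OF sB z]])
  finally have pdE: "pd None E z = \<gamma> * (\<Phi> z * pd None w z + pd None \<Phi> z * w z) - 2 * (z $ None * pd None B z + B z)" .
  have "pd None (\<lambda>z. v z * (\<gamma> * f z - 2 * z $ None * pd None f z)) z = pd None (\<lambda>z. m z * E z) z"
  proof (rule pd_cong[OF open_Z z])
    fix x assume x: "x \<in> Z"
    have "v x * (\<gamma> * f x - 2 * x $ None * pd None f x) = \<gamma> * (v x * f x) - 2 * x $ None * (v x * pd None f x)"
      by (simp add: algebra_simps)
    also have "\<dots> = m x * E x" unfolding vf[OF x] pdf[OF x] by (simp add: E_def B_def algebra_simps)
    finally show "v x * (\<gamma> * f x - 2 * x $ None * pd None f x) = m x * E x" .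
  qed
  also have "\<dots> = m z * pd None E z"
    using pd_mult[OF d[OF smooth_m z] d[OF sE z], of None] pd_m[OF z] by simp
  finally have 2: "pd None (\<lambda>z. v z * (\<gamma> * f z - 2 * z $ None * pd None f z)) z = m z * pd None E z" .
  have 3: "pd (Some j) (\<lambda>z. v z * (\<Sum>k\<in>UNIV. H j k z * pd (Some k) f z)) z
     = w z * pd (Some j) (aflux m H \<Phi> j) z + pd (Some j) w z * aflux m H \<Phi> j z
       - (\<Phi> z * pd (Some j) (aflux m H w j) z + pd (Some j) \<Phi> z * aflux m H w j z)" for j
  proof -
    have "pd (Some j) (\<lambda>z. v z * (\<Sum>k\<in>UNIV. H j k z * pd (Some k) f z)) z
       = pd (Some j) (\<lambda>z. w z * aflux m H \<Phi> j z - \<Phi> z * aflux m H w j z) z"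
    proof (rule pd_cong[OF open_Z z])
      fix x assume x: "x \<in> Z"
      have "v x * (\<Sum>k\<in>UNIV. H j k x * pd (Some k) f x) = (\<Sum>k\<in>UNIV. H j k x * (v x * pd (Some k) f x))"
        by (simp add: sum_distrib_left mult_ac)
      also have "\<dots> = w x * aflux m H \<Phi> j x - \<Phi> x * aflux m H w j x"
        unfolding pdf[OF x] by (simp add: aflux_def sum_distrib_left sum_subtractf[symmetric] algebra_simps)
      finally show "v x * (\<Sum>k\<in>UNIV. H j k x * pd (Some k) f x) = w x * aflux m H \<Phi> j x - \<Phi> x * aflux m H w j x" .
    qed
    also have "\<dots> = pd (Some j) (\<lambda>z. w z * aflux m H \<Phi> j z) z - pd (Some j) (\<lambda>z. \<Phi> z * aflux m H w j z) z"
      by (intro pd_diff d[OF _ z] smooth_on_mult open_Z smooth_on_aflux \<Phi> smooth_w)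
    also have "pd (Some j) (\<lambda>z. w z * aflux m H \<Phi> j z) z = w z * pd (Some j) (aflux m H \<Phi> j) z + pd (Some j) w z * aflux m H \<Phi> j z"
      by (intro pd_mult d[OF _ z] smooth_on_aflux \<Phi> smooth_w)
    also have "pd (Some j) (\<lambda>z. \<Phi> z * aflux m H w j z) z = \<Phi> z * pd (Some j) (aflux m H w j) z + pd (Some j) \<Phi> z * aflux m H w j z"
      by (intro pd_mult d[OF _ z] smooth_on_aflux \<Phi> smooth_w)
    finally show ?thesis .
  qed
  have "(\<Sum>j\<in>UNIV. pd (Some j) (\<lambda>z. v z * (\<Sum>k\<in>UNIV. H j k z * pd (Some k) f z)) z)
    = w z * (\<Sum>j\<in>UNIV. pd (Some j) (aflux m H \<Phi> j) z) - \<Phi> z * (\<Sum>j\<in>UNIV. pd (Some j) (aflux m H w j) z)"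
    unfolding 3 using aflux_cross_terms[OF z, of w \<Phi>]
    by (simp add: sum.distrib sum_subtractf sum_distrib_left)
  also have "\<dots> = m z * (w z * adiv m H \<Phi> z - \<Phi> z * adiv m H w z)"
    using wz by (simp add: adiv_def algebra_simps)
  finally have 3: "(\<Sum>j\<in>UNIV. pd (Some j) (\<lambda>z. v z * (\<Sum>k\<in>UNIV. H j k z * pd (Some k) f z)) z)
    = m z * (w z * adiv m H \<Phi> z - \<Phi> z * adiv m H w z)" .
  define \<Phi>1 \<Phi>2 w1 w2 A A' where "\<Phi>1 = pd None \<Phi> z" and "\<Phi>2 = pd None (pd None \<Phi>) z" and "w1 = pd None w z"
    and "w2 = pd None (pd None w) z" and "A = adiv m H \<Phi> z" and "A' = adiv m H w z"
  have "((n + \<gamma>) * (v z * pd None f z)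
      + pd None (\<lambda>z. v z * (\<gamma> * f z - 2 * z $ None * pd None f z)) z
      + (\<Sum>j\<in>UNIV. pd (Some j) (\<lambda>z. v z * (\<Sum>k\<in>UNIV. H j k z * pd (Some k) f z)) z)) / v z
    = ((n + \<gamma>) * (m z * (\<Phi>1 * w z - \<Phi> z * w1))
      + m z * (\<gamma> * (\<Phi> z * w1 + \<Phi>1 * w z) - 2 * (z $ None * (\<Phi>2 * w z - \<Phi> z * w2) + (\<Phi>1 * w z - \<Phi> z * w1)))
      + m z * (w z * A - \<Phi> z * A')) / (m z * (w z)\<^sup>2)"
    unfolding 2 3 pdE pdB pdf[OF z] by (simp add: v_def B_def \<Phi>1_def \<Phi>2_def w1_def w2_def A_def A'_def)
  also have "\<dots> = (1 / w z) * (- 2 * z $ None * \<Phi>2 + (2 * \<gamma> + n - 2) * \<Phi>1 + A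
      + (2 * z $ None * w2 / w z - (n - 2) * w1 / w z - A' / w z) * \<Phi> z)"
    using wz by (simp add: divide_simps power2_eq_square) (simp add: algebra_simps)
  finally show ?thesis
    by (simp add: potential_def n \<Phi>1_def \<Phi>2_def w1_def w2_def A_def A'_def)
qed

text \<open>The left-hand side is \<open>r\<^sup>-\<^sup>2 (\<Delta> (log w) - |d log w|\<^sup>2)\<close> on the collar, in the coordinate
  \<open>\<rho> = - r\<^sup>2/2\<close>. Since \<open>v d log w = m w dw\<close>, the divergence of this field is \<open>w\<close> times that of
  \<open>m dw\<close>, up to a quadratic term in \<open>dw\<close> that is cancelled by the norm of \<open>d log w\<close>.\<close>

lemma potential_via_log:
  fixes n :: real
  assumes z: "z \<in> Z"
  defines "l \<equiv> \<lambda>z. ln (w z)" and "v \<equiv> \<lambda>z. m z * (w z)\<^sup>2"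
  assumes n: "n = real CARD('k)"
  shows "((n - 2) * (v z * pd None l z) - 2 * z $ None * pd None (\<lambda>z. v z * pd None l z) z
      + (\<Sum>j\<in>UNIV. pd (Some j) (\<lambda>z. v z * (\<Sum>k\<in>UNIV. H j k z * pd (Some k) l z)) z)) / v z
      - (- 2 * z $ None * (pd None l z)\<^sup>2 + (\<Sum>j\<in>UNIV. \<Sum>k\<in>UNIV. pd (Some j) l z * H j k z * pd (Some k) l z))
    = - potential m H w z"
proof -
  note d = differentiable_on_slab
  have wz: "w z > 0" "m z > 0" using w_pos m_pos z by auto
  have pdl: "pd a l x = pd a w x / w x" if "x \<in> Z" for x a
  proof -
    have "(ln has_real_derivative 1 / w x) (at (w x))" using w_pos[OF that] by (auto intro!: derivative_eq_intros)
    from pd_compose_real[OF d[OF smooth_w that] this] show ?thesis by (simp add: l_def)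
  qed
  have v1: "v x * pd a l x = m x * (w x * pd a w x)" if "x \<in> Z" for x a
    using w_pos[OF that] by (simp add: pdl[OF that] v_def power2_eq_square)
  have sww: "smooth_on Z (\<lambda>z. w z * pd None w z)"
    by (intro smooth_on_mult smooth_on_pd open_Z smooth_w)
  have "pd None (\<lambda>z. v z * pd None l z) z = pd None (\<lambda>z. m z * (w z * pd None w z)) z"
    by (rule pd_cong[OF open_Z z v1])
  also have "\<dots> = m z * (w z * pd None (pd None w) z + pd None w z * pd None w z)"
    using pd_mult[OF d[OF smooth_m z] d[OF sww z], of None] pd_m[OF z]
      pd_mult[OF d[OF smooth_w z] d[OF smooth_on_pd[OF smooth_w] z], of None] by simp
  finally have 2: "pd None (\<lambda>z. v z * pd None l z) z = m z * (w z * pd None (pd None w) z + pd None w z * pd None w z)" .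
  have 3: "pd (Some j) (\<lambda>z. v z * (\<Sum>k\<in>UNIV. H j k z * pd (Some k) l z)) z
     = w z * pd (Some j) (aflux m H w j) z + pd (Some j) w z * aflux m H w j z" for j
  proof -
    have "pd (Some j) (\<lambda>z. v z * (\<Sum>k\<in>UNIV. H j k z * pd (Some k) l z)) z = pd (Some j) (\<lambda>z. w z * aflux m H w j z) z"
    proof (rule pd_cong[OF open_Z z])
      fix x assume x: "x \<in> Z"
      have "v x * (\<Sum>k\<in>UNIV. H j k x * pd (Some k) l x) = (\<Sum>k\<in>UNIV. H j k x * (v x * pd (Some k) l x))"
        by (simp add: sum_distrib_left mult_ac)
      also have "\<dots> = w x * aflux m H w j x"
        unfolding v1[OF x] by (simp add: aflux_def sum_distrib_left mult_ac)
      finally show "v x * (\<Sum>k\<in>UNIV. H j k x * pd (Some k) l x) = w x * aflux m H w j x" .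
    qed
    also have "\<dots> = w z * pd (Some j) (aflux m H w j) z + pd (Some j) w z * aflux m H w j z"
      by (intro pd_mult d[OF _ z] smooth_on_aflux smooth_w)
    finally show ?thesis .
  qed
  define Q where "Q = (\<Sum>j\<in>UNIV. \<Sum>k\<in>UNIV. pd (Some j) w z * H j k z * pd (Some k) w z)"
  have "(\<Sum>j\<in>UNIV. pd (Some j) w z * aflux m H w j z) = m z * Q"
    by (simp add: Q_def aflux_def sum_distrib_left mult_ac)
  moreover have "(\<Sum>j\<in>UNIV. pd (Some j) (aflux m H w j) z) = m z * adiv m H w z"
    using wz by (simp add: adiv_def)
  ultimately have 4: "(\<Sum>j\<in>UNIV. pd (Some j) (\<lambda>z. v z * (\<Sum>k\<in>UNIV. H j k z * pd (Some k) l z)) z)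
     = m z * (w z * adiv m H w z + Q)"
    unfolding 3 by (simp add: sum.distrib sum_distrib_left[symmetric] algebra_simps)
  have 5: "(\<Sum>j\<in>UNIV. \<Sum>k\<in>UNIV. pd (Some j) l z * H j k z * pd (Some k) l z) = Q / (w z)\<^sup>2"
    unfolding Q_def sum_divide_distrib pdl[OF z] by (simp add: power2_eq_square)
  define w1 w2 A' where "w1 = pd None w z" and "w2 = pd None (pd None w) z" and "A' = adiv m H w z"
  show ?thesis
    unfolding 2 4 5 unfolding v1[OF z] pdl[OF z] potential_def n[symmetric] w1_def[symmetric] w2_def[symmetric] A'_def[symmetric]
    using wz by (simp add: v_def divide_simps power2_eq_square) (simp add: algebra_simps)
qed

end

section \<open>The operators of a family of metrics\<close>

lemma pd_powr_base:
  fixes Q :: "real^'k::finite \<Rightarrow> real"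
  assumes Q: "Q differentiable at (base y)" and y: "y $ None > 0"
  shows "pd None (\<lambda>y. (y $ None) powr \<kappa> * Q (base y)) y = \<kappa> * (y $ None) powr (\<kappa> - 1) * Q (base y)"
    and "pd (Some a) (\<lambda>y. (y $ None) powr \<kappa> * Q (base y)) y = (y $ None) powr \<kappa> * pd a Q (base y)"
    and "(\<lambda>y. (y $ None) powr \<kappa>) differentiable at y"
proof -
  have dN: "(\<lambda>y::real^('k option). y $ None) differentiable at y"
    using bounded_linear_imp_has_derivative[OF bounded_linear_vec_nth] differentiable_def by blast
  have pw: "((\<lambda>s. s powr \<kappa>) has_real_derivative \<kappa> * (y $ None) powr (\<kappa> - 1)) (at (y $ None))"
    using y by (auto intro!: derivative_eq_intros simp: powr_diff)
  have "(\<lambda>s::real. s powr \<kappa>) differentiable at (y $ None)" using pw by (auto simp: real_differentiable_def)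
  from differentiable_compose[OF this dN] show dp: "(\<lambda>y. (y $ None) powr \<kappa>) differentiable at y" .
  have dQ: "(\<lambda>y. Q (base y)) differentiable at y" by (rule differentiable_compose[OF Q base_differentiable])
  have pp: "pd b (\<lambda>y. (y $ None) powr \<kappa>) y = \<kappa> * (y $ None) powr (\<kappa> - 1) * pd b (\<lambda>y. y $ None) y" for b
    by (rule pd_compose_real[OF dN pw])
  show "pd None (\<lambda>y. (y $ None) powr \<kappa> * Q (base y)) y = \<kappa> * (y $ None) powr (\<kappa> - 1) * Q (base y)"
    by (simp add: pd_mult[OF dp dQ] pp pd_compose_base[OF Q])
  show "pd (Some a) (\<lambda>y. (y $ None) powr \<kappa> * Q (base y)) y = (y $ None) powr \<kappa> * pd a Q (base y)"
    by (simp add: pd_mult[OF dp dQ] pp pd_compose_base[OF Q])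
qed

lemma smooth_on_powr_nth:
  assumes "open S" "\<And>y. y \<in> S \<Longrightarrow> y $ a > 0"
  shows "smooth_on S (\<lambda>y::real^'k::finite. (y $ a) powr \<kappa>)"
  by (rule smooth_on_compose[OF assms(1) smooth_on_linear_map[OF assms(1) bounded_linear_vec_nth] smooth_on_powr])
    (use assms(2) in simp)

lemma riemannian_metric_det:
  assumes "riemannian_metric C G" "x \<in> cdom C i"
  shows "det (G i x) \<noteq> 0"
proof
  assume "det (G i x) = 0"
  then have "\<not> invertible (G i x)" by (simp add: invertible_det_nz)
  then obtain v where v: "G i x *v v = 0" "v \<noteq> 0"
    using matrix_left_invertible_ker[of "G i x"] invertible_left_inverse by blast
  have "\<forall>v. v \<noteq> 0 \<longrightarrow> v \<bullet> (G i x *v v) > 0"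
    using assms unfolding riemannian_metric_def by blast
  with v have "v \<bullet> (G i x *v v) > 0" by blast
  then show False using v(1) by simp
qed

lemma riemannian_metric_sym:
  assumes "riemannian_metric C G" "x \<in> cdom C i"
  shows "transpose (G i x) = G i x"
  using assms unfolding riemannian_metric_def by blast

lemma riemannian_imp_metric_on:
  assumes "riemannian_metric C G"
  shows "metric_on C G"
  using assms riemannian_metric_det[OF assms] unfolding metric_on_def riemannian_metric_def jac_def Let_def
  by blast

lemma vol_density_congruence:
  "vol_density (transpose J ** G ** J) = \<bar>det J\<bar> * vol_density G"
  by (simp add: vol_density_def det_mul abs_mult real_sqrt_mult)

lemma matrix_inv_symmetric:
  fixes A :: "real^'k::finite^'k"
  assumes "det A \<noteq> 0" "transpose A = A"
  shows "matrix_inv A $ j $ k = matrix_inv A $ k $ j"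
proof -
  have "A ** transpose (matrix_inv A) = transpose (matrix_inv A ** A)"
    using assms(2) by (simp add: matrix_transpose_mul)
  also have "\<dots> = mat 1" by (simp add: matrix_inv_works[OF assms(1)])
  finally have "matrix_inv A = transpose (matrix_inv A)" by (rule matrix_inv_eqI)
  then have "matrix_inv A $ j $ k = transpose (matrix_inv A) $ j $ k" by simp
  then show ?thesis by (simp add: transpose_def)
qed

text \<open>Both signs of \<open>\<rho>\<close> occur: the operators on \<open>M\<close> come from derivatives at \<open>\<rho> = 0\<close>, whereas the
  collar corresponds to \<open>\<rho> < 0\<close>.\<close>

locale pe_family = charts C for C :: "('i, 'm::topological_space, 'n::finite) atlas" +
  fixes g :: "'i \<Rightarrow> 'm \<Rightarrow> real^'n^'n" and \<epsilon> :: real and h :: "'i \<Rightarrow> 'm \<times> real \<Rightarrow> real^'n^'n"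
  assumes cover: "(\<Union>i. cdom C i) = UNIV" and eps: "\<epsilon> > 0"
    and metric_g: "riemannian_metric C g" and family: "metric_family C g \<epsilon> h"
begin

abbreviation "R \<equiv> rho_range \<epsilon>"
abbreviation "C1 \<equiv> prod_atlas C R"

lemma open_R: "open R" and zero_in_R: "0 \<in> R"
  using eps by (auto simp: rho_range_def)

lemma rho_of_r:
  assumes "0 < r" "r < \<epsilon>"
  shows "- (r\<^sup>2 / 2) \<in> R"
proof -
  have "r\<^sup>2 < \<epsilon>\<^sup>2" by (rule power_strict_mono) (use assms in auto)
  moreover have "r\<^sup>2 > 0" using assms(1) by simp
  ultimately show ?thesis unfolding rho_range_def greaterThanLessThan_iff by linarith
qed

sublocale slab1: charts C1
  by (rule charts_prod[OF open_R])

sublocale ambient: charts "prod_atlas C1 {0<..}"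
  by (rule slab1.charts_prod) simp

sublocale collar: charts "prod_atlas C {0<..<\<epsilon>}"
  by (rule charts_prod) simp

lemma chart_at_in: "x \<in> cdom C (chart_at C x)"
proof -
  obtain i where "x \<in> cdom C i" using cover by blast
  then show ?thesis unfolding chart_at_def by (rule someI)
qed

lemma metric_rho: "\<rho> \<in> R \<Longrightarrow> riemannian_metric C (\<lambda>i x. h i (x, \<rho>))"
  using family by (auto simp: metric_family_def)

lemma h_zero: "x \<in> cdom C i \<Longrightarrow> h i (x, 0) = g i x"
  using family by (auto simp: metric_family_def)

text \<open>Coordinate expressions over the slab of charts of \<open>M\<close> times the \<open>\<rho>\<close>-interval: the metrics
  \<open>g(\<rho>)\<close>, their inverses, the volume density of \<open>g\<close> (constant in \<open>\<rho>\<close>), and the function \<open>w\<close>.\<close>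

definition hl :: "'i \<Rightarrow> real^('n option) \<Rightarrow> real^'n^'n" where
  "hl i z = loc C1 i (h i) z"

definition Hl :: "'i \<Rightarrow> 'n \<Rightarrow> 'n \<Rightarrow> real^('n option) \<Rightarrow> real" where
  "Hl i j k z = matrix_inv (hl i z) $ j $ k"

definition ml :: "'i \<Rightarrow> real^('n option) \<Rightarrow> real" where
  "ml i z = vol_density (loc C i (g i) (base z))"

definition wl :: "'i \<Rightarrow> real^('n option) \<Rightarrow> real" where
  "wl i z = sqrt (vol_density (hl i z) / ml i z)"

lemma hl_eq: "z \<in> cimg C1 i \<Longrightarrow> hl i z = h i (cinv C i (base z), z $ None)"
  unfolding hl_def by (rule loc_prod)

lemma hl_ext: "x \<in> cdom C i \<Longrightarrow> \<rho> \<in> R \<Longrightarrow> hl i (ext (cmap C i x) \<rho>) = h i (x, \<rho>)"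
  by (subst hl_eq) (auto simp: ext_in_cimg_prod)

lemma ml_ext: "x \<in> cdom C i \<Longrightarrow> ml i (ext (cmap C i x) \<rho>) = vol_density (g i x)"
  by (simp add: ml_def)

lemma smooth_hl: "smooth_on (cimg C1 i) (\<lambda>z. hl i z $ j $ k)"
proof (rule smooth_on_entries[where A = "hl i", OF slab1.open_cimg])
  have "hl i = loc C1 i (h i)" by (rule ext) (simp add: hl_def)
  then show "smooth_on (cimg C1 i) (hl i)" using family by (auto simp: metric_family_def)
qed

lemma hl_props:
  assumes "z \<in> cimg C1 i"
  shows "det (hl i z) \<noteq> 0" "transpose (hl i z) = hl i z" "ml i z > 0"
proof -
  have z: "base z \<in> cimg C i" "z $ None \<in> R" using assms cimg_prod by auto
  have x: "cinv C i (base z) \<in> cdom C i" by (rule cinv_in[OF z(1)])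
  show "det (hl i z) \<noteq> 0" "transpose (hl i z) = hl i z"
    unfolding hl_eq[OF assms]
    using riemannian_metric_det[OF metric_rho[OF z(2)] x] riemannian_metric_sym[OF metric_rho[OF z(2)] x] by auto
  show "ml i z > 0"
    unfolding ml_def loc_def comp_def using vol_density_pos[OF riemannian_metric_det[OF metric_g x]] .
qed

lemma slab_local: "slab (cimg C1 i) (ml i) (wl i) (Hl i)"
proof
  show op: "open (cimg C1 i)" by (rule slab1.open_cimg)
  have base: "base z \<in> cimg C i" if "z \<in> cimg C1 i" for z using that cimg_prod by auto
  have sm: "smooth_on (cimg C i) (\<lambda>y. vol_density (loc C i (g i) y))"
    by (rule metric_on_smooth(3)[OF riemannian_imp_metric_on[OF metric_g]])
  show m: "smooth_on (cimg C1 i) (ml i)"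
    unfolding ml_def by (rule smooth_on_compose_base[OF op sm base])
  show "ml i z > 0" if "z \<in> cimg C1 i" for z by (rule hl_props(3)[OF that])
  have v: "vol_density (hl i z) > 0" if "z \<in> cimg C1 i" for z by (rule vol_density_pos[OF hl_props(1)[OF that]])
  have q: "vol_density (hl i z) / ml i z > 0" if "z \<in> cimg C1 i" for z
    using v[OF that] hl_props(3)[OF that] by simp
  show "smooth_on (cimg C1 i) (wl i)"
    unfolding wl_def
  proof (rule smooth_on_compose[OF op _ smooth_on_sqrt])
    show "smooth_on (cimg C1 i) (\<lambda>z. vol_density (hl i z) / ml i z)"
    proof (intro smooth_on_divide op m smooth_on_vol_density smooth_hl hl_props(1))
      show "ml i z \<noteq> 0" if "z \<in> cimg C1 i" for z using hl_props(3)[OF that] by simp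
    qed
  qed (use q in simp)
  show "wl i z > 0" if "z \<in> cimg C1 i" for z using q[OF that] by (simp add: wl_def)
  show "smooth_on (cimg C1 i) (Hl i j k)" for j k
    unfolding Hl_def by (intro smooth_on_matrix_inv op smooth_hl hl_props(1))
  show "pd None (ml i) z = 0" if "z \<in> cimg C1 i" for z
    unfolding ml_def
    by (rule pd_compose_base(2)[OF smooth_on_differentiable[OF sm base[OF that]]])
  show "Hl i j k z = Hl i k j z" if "z \<in> cimg C1 i" for z j k
    unfolding Hl_def by (rule matrix_inv_symmetric[OF hl_props(1,2)[OF that]])
qed

lemma vol_density_hl:
  assumes "z \<in> cimg C1 i"
  shows "vol_density (hl i z) = ml i z * (wl i z)\<^sup>2"
  using hl_props(3)[OF assms] vol_density_pos[OF hl_props(1)[OF assms]] by (simp add: wl_def)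

definition w_rho :: "'m \<times> real \<Rightarrow> real" where
  "w_rho = (\<lambda>(x, \<rho>). let i = chart_at C x in sqrt (vol_density (h i (x, \<rho>)) / vol_density (g i x)))"

lemma w_fun_eq_w_rho: "w_fun C g h (x, r) = w_rho (x, - (r\<^sup>2 / 2))"
  by (simp add: w_fun_def w_rho_def)

lemma w_rho_local:
  assumes x: "x \<in> cdom C i" and \<rho>: "\<rho> \<in> R"
  shows "w_rho (x, \<rho>) = wl i (ext (cmap C i x) \<rho>)"
proof -
  let ?j = "chart_at C x"
  let ?J = "jac (transition i ?j) (cmap C i x)"
  have z: "cmap C i x \<in> overlap i ?j" using x chart_at_in by blast
  have J: "det ?J \<noteq> 0" by (rule det_jac_transition[OF z])
  have "vol_density (h i (x, \<rho>)) = \<bar>det ?J\<bar> * vol_density (h ?j (x, \<rho>))"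
    using metric_onD(3)[OF riemannian_imp_metric_on[OF metric_rho[OF \<rho>]] x chart_at_in]
    by (simp only: vol_density_congruence)
  moreover have "vol_density (g i x) = \<bar>det ?J\<bar> * vol_density (g ?j x)"
    using metric_onD(3)[OF riemannian_imp_metric_on[OF metric_g] x chart_at_in]
    by (simp only: vol_density_congruence)
  ultimately show ?thesis
    using J by (simp add: w_rho_def Let_def wl_def hl_ext[OF x \<rho>] ml_ext[OF x])
qed

lemma loc_local:
  assumes "z \<in> cimg C1 i" "\<And>x \<rho>. x \<in> cdom C i \<Longrightarrow> \<rho> \<in> R \<Longrightarrow> \<phi> (x, \<rho>) = \<Phi> (ext (cmap C i x) \<rho>)"
  shows "loc C1 i \<phi> z = \<Phi> z"
proof -
  have z: "base z \<in> cimg C i" "z $ None \<in> R" using assms(1) cimg_prod by auto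
  show ?thesis
    unfolding loc_prod[OF assms(1)] using assms(2)[OF cinv_in[OF z(1)] z(2)] z(1) by simp
qed

lemma smooth_fun_localI:
  assumes "\<And>i x \<rho>. x \<in> cdom C i \<Longrightarrow> \<rho> \<in> R \<Longrightarrow> \<phi> (x, \<rho>) = \<Phi> i (ext (cmap C i x) \<rho>)"
    and "\<And>i. smooth_on (cimg C1 i) (\<Phi> i)"
  shows "smooth_fun C1 \<phi>"
  unfolding smooth_fun_def
proof
  fix i
  show "smooth_on (cimg C1 i) (loc C1 i \<phi>)"
  proof (rule smooth_on_congI[OF slab1.open_cimg assms(2)])
    show "loc C1 i \<phi> z = \<Phi> i z" if "z \<in> cimg C1 i" for z
      using that by (rule loc_local) (rule assms(1))
  qed
qed

lemma smooth_w_rho: "smooth_fun C1 w_rho"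
  by (rule smooth_fun_localI[where \<Phi> = wl]) (use w_rho_local slab.smooth_w[OF slab_local] in auto)

lemma w_rho_pos: "\<rho> \<in> R \<Longrightarrow> w_rho (x, \<rho>) > 0"
  using w_rho_local[OF chart_at_in] slab.w_pos[OF slab_local] chart_at_in
  by (simp add: ext_in_cimg_prod)

lemma w_rho_zero: "w_rho (x, 0) = 1"
  using vol_density_pos[OF riemannian_metric_det[OF metric_g chart_at_in, of x]]
  by (simp add: w_rho_def h_zero[OF chart_at_in])

lemma loc_ext:
  assumes "x \<in> cdom C i" "\<rho> \<in> R"
  shows "loc C1 i \<phi> (ext (cmap C i x) \<rho>) = \<phi> (x, \<rho>)"
  using loc_prod[of "ext (cmap C i x) \<rho>" R i \<phi>] assms by (simp add: ext_in_cimg_prod)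

lemma smooth_fun_slice:
  assumes "smooth_fun C1 \<phi>" "\<rho> \<in> R"
  shows "smooth_fun C (\<lambda>x. \<phi> (x, \<rho>))"
  unfolding smooth_fun_def
proof
  fix i
  have "smooth_on (cimg C i) (\<lambda>y. loc C1 i \<phi> (ext y \<rho>))"
  proof (rule smooth_on_compose[where f = "\<lambda>y. ext y \<rho>" and g = "loc C1 i \<phi>" and T = "cimg C1 i", OF open_cimg])
    show "smooth_on (cimg C i) (\<lambda>y. ext y \<rho>)"
      by (intro smooth_on_ext open_cimg smooth_on_const smooth_on_linear_map bounded_linear_vec_nth)
    show "smooth_on (cimg C1 i) (loc C1 i \<phi>)" using assms(1) unfolding smooth_fun_def by blast
    show "ext y \<rho> \<in> cimg C1 i" if "y \<in> cimg C i" for y using that assms(2) ext_in_cimg_prod by blast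
  qed
  then show "smooth_on (cimg C i) (loc C i (\<lambda>x. \<phi> (x, \<rho>)))"
  proof (rule smooth_on_congI[OF open_cimg])
    fix y assume y: "y \<in> cimg C i"
    then have "ext y \<rho> \<in> cimg C1 i" using assms(2) ext_in_cimg_prod by blast
    from loc_prod[OF this, of \<phi>] show "loc C i (\<lambda>x. \<phi> (x, \<rho>)) y = loc C1 i \<phi> (ext y \<rho>)"
      by (simp add: loc_def)
  qed
qed

lemma smooth_fun_const_ext:
  assumes "smooth_fun C u"
  shows "smooth_fun C1 (\<lambda>(x, \<rho>). u x)"
proof (rule smooth_fun_localI[where \<Phi> = "\<lambda>i z. loc C i u (base z)"])
  show "smooth_on (cimg C1 i) (\<lambda>z. loc C i u (base z))" for i
    by (rule smooth_on_compose_base[OF slab1.open_cimg, of "cimg C i"])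
      (use assms cimg_prod in \<open>auto simp: smooth_fun_def\<close>)
qed simp

lemma deriv_iterate_local:
  assumes \<phi>: "smooth_fun C1 \<phi>" and x: "x \<in> cdom C i" and \<rho>: "\<rho> \<in> R"
  shows "(deriv ^^ k) (\<lambda>\<rho>. \<phi> (x, \<rho>)) \<rho> = (pd None ^^ k) (loc C1 i \<phi>) (ext (cmap C i x) \<rho>)"
    and "smooth_on (cimg C1 i) ((pd None ^^ k) (loc C1 i \<phi>))"
proof -
  have sm: "smooth_on (cimg C1 i) ((pd None ^^ k) (loc C1 i \<phi>))" for k
    by (induction k) (use \<phi> smooth_on_pd in \<open>auto simp: smooth_fun_def\<close>)
  from sm show "smooth_on (cimg C1 i) ((pd None ^^ k) (loc C1 i \<phi>))" .
  show "(deriv ^^ k) (\<lambda>\<rho>. \<phi> (x, \<rho>)) \<rho> = (pd None ^^ k) (loc C1 i \<phi>) (ext (cmap C i x) \<rho>)"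
    using \<rho>
  proof (induction k arbitrary: \<rho>)
    case 0
    from loc_ext[OF x 0, of \<phi>] show ?case by simp
  next
    case (Suc k)
    let ?G = "(pd None ^^ k) (loc C1 i \<phi>)"
    have ev: "\<forall>\<^sub>F r in nhds \<rho>. (deriv ^^ k) (\<lambda>\<rho>. \<phi> (x, \<rho>)) r = ?G (ext (cmap C i x) r)"
      using eventually_nhds_in_open[OF open_R Suc.prems] by (rule eventually_mono) (rule Suc.IH)
    have "ext (cmap C i x) \<rho> \<in> cimg C1 i" using x Suc.prems by (simp add: ext_in_cimg_prod)
    then have "((\<lambda>r. ?G (ext (cmap C i x) r)) has_real_derivative pd None ?G (ext (cmap C i x) \<rho>)) (at \<rho>)"
      by (intro DERIV_slice smooth_on_differentiable[OF sm])
    then have "deriv (\<lambda>r. ?G (ext (cmap C i x) r)) \<rho> = pd None ?G (ext (cmap C i x) \<rho>)"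
      by (rule DERIV_imp_deriv)
    then show ?case using deriv_cong_ev[OF ev refl] by simp
  qed
qed

definition omega :: "real \<Rightarrow> ('m \<Rightarrow> real) \<Rightarrow> 'i \<Rightarrow> 'm \<Rightarrow> real^'n" where
  "omega \<rho> u = (\<lambda>i x. matrix_inv (h i (x, \<rho>) ** matrix_inv (g i x)) *v dform C u i x)"

definition Dop :: "real \<Rightarrow> ('m \<Rightarrow> real) \<Rightarrow> 'm \<Rightarrow> real" where
  "Dop \<rho> u x = - codiff C g (omega \<rho> u) x"

lemma gr_inv_d_eq_omega: "gr_inv_d C g h r u = omega (- (r\<^sup>2 / 2)) u"
  by (intro ext) (simp add: gr_inv_d_def omega_def)

lemma covector_on_omega:
  assumes \<rho>: "\<rho> \<in> R" and u: "smooth_fun C u"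
  shows "covector_on C (omega \<rho> u)"
  unfolding covector_on_def
proof (intro conjI allI ballI)
  have G: "metric_on C g" and K: "metric_on C (\<lambda>i x. h i (x, \<rho>))"
    using riemannian_imp_metric_on metric_g metric_rho[OF \<rho>] by blast+
  have du: "covector_on C (dform C u)" by (rule covector_on_dform[OF u])
  fix i
  let ?A = "\<lambda>y. loc C i (\<lambda>x. h i (x, \<rho>)) y ** matrix_inv (loc C i (g i) y)"
  have "smooth_on (cimg C i) (\<lambda>y. ?A y $ a $ b)" for a b
    by (intro smooth_on_matrix_mult open_cimg metric_on_smooth(1)[OF K] metric_on_smooth(4)[OF G])
  moreover have "det (?A y) \<noteq> 0" if "y \<in> cimg C i" for y
  proof -
    have "det (loc C i (g i) y) * det (matrix_inv (loc C i (g i) y)) = 1"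
      using arg_cong[OF matrix_inv_works(1)[OF metric_on_smooth(2)[OF G that]], of det] by (simp add: det_mul)
    then show ?thesis using metric_on_smooth(2)[OF K that] by (auto simp: det_mul)
  qed
  ultimately have inv: "smooth_on (cimg C i) (\<lambda>y. matrix_inv (?A y) $ a $ b)" for a b
    by (intro smooth_on_matrix_inv open_cimg)
  have du': "smooth_on (cimg C i) (\<lambda>y. loc C i (dform C u i) y $ a)" for a
    by (rule smooth_on_vec_nth[where f = "loc C i (dform C u i)", OF open_cimg covector_onD(1)[OF du]])
  have "smooth_on (cimg C i) (\<lambda>y. (matrix_inv (?A y) *v loc C i (dform C u i) y) $ a)" for a
    by (intro smooth_on_matrix_vector_mult open_cimg inv du')
  then have "smooth_on (cimg C i) (\<lambda>y. matrix_inv (?A y) *v loc C i (dform C u i) y)"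
    by (intro smooth_on_vec open_cimg)
  moreover have "loc C i (omega \<rho> u i) = (\<lambda>y. matrix_inv (?A y) *v loc C i (dform C u i) y)"
    by (auto simp: loc_def omega_def fun_eq_iff)
  ultimately show "smooth_on (cimg C i) (loc C i (omega \<rho> u i))" by simp
  fix j x assume x': "x \<in> cdom C i \<inter> cdom C j"
  then have x: "x \<in> cdom C i" "x \<in> cdom C j" by auto
  let ?J = "jac (transition i j) (cmap C i x)"
  have J: "det (transpose ?J) \<noteq> 0" using det_jac_transition[of "cmap C i x" i j] x by (auto simp: det_transpose)
  have gi: "g i x = transpose ?J ** g j x ** ?J" by (rule metric_onD(3)[OF G x])
  have hi: "h i (x, \<rho>) = transpose ?J ** h j (x, \<rho>) ** ?J" by (rule metric_onD(3)[OF K x])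
  have ui: "dform C u i x = transpose ?J *v dform C u j x" by (rule covector_onD(2)[OF du x])
  have nz: "det (g i x) \<noteq> 0" "det (g j x) \<noteq> 0" "det (h i (x, \<rho>)) \<noteq> 0" "det (h j (x, \<rho>)) \<noteq> 0"
    using metric_onD(2)[OF G] metric_onD(2)[OF K] x by blast+
  have "transpose ?J ** (g j x ** (?J ** matrix_inv (g i x) ** transpose ?J)) = g i x ** matrix_inv (g i x) ** transpose ?J"
    by (simp add: gi matrix_mul_assoc)
  also have "\<dots> = transpose ?J" by (simp add: matrix_inv_works[OF nz(1)])
  finally have "matrix_inv (transpose ?J) ** (transpose ?J ** (g j x ** (?J ** matrix_inv (g i x) ** transpose ?J)))
     = matrix_inv (transpose ?J) ** transpose ?J" by simp
  then have "g j x ** (?J ** matrix_inv (g i x) ** transpose ?J) = mat 1"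
    unfolding matrix_mul_assoc[of "matrix_inv (transpose ?J)"] matrix_inv_works(2)[OF J] by simp
  then have gj: "matrix_inv (g j x) = ?J ** matrix_inv (g i x) ** transpose ?J" by (rule matrix_inv_eqI)
  let ?Ai = "h i (x, \<rho>) ** matrix_inv (g i x)" and ?Aj = "h j (x, \<rho>) ** matrix_inv (g j x)"
  have comm: "?Ai ** transpose ?J = transpose ?J ** ?Aj"
    by (simp add: gj hi matrix_mul_assoc)
  have det_inv: "det (matrix_inv A) \<noteq> 0" if "det A \<noteq> 0" for A :: "real^'n^'n"
    using arg_cong[OF matrix_inv_works(1)[OF that], of det] by (auto simp: det_mul)
  have Anz: "det ?Ai \<noteq> 0" "det ?Aj \<noteq> 0"
    using nz det_inv[OF nz(1)] det_inv[OF nz(2)] by (auto simp: det_mul)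
  have "?Ai *v (transpose ?J *v (matrix_inv ?Aj *v dform C u j x)) = dform C u i x"
  proof -
    have "?Ai *v (transpose ?J *v (matrix_inv ?Aj *v dform C u j x))
       = (?Ai ** transpose ?J) *v (matrix_inv ?Aj *v dform C u j x)"
      by (simp only: matrix_vector_mul_assoc matrix_mul_assoc)
    also have "\<dots> = transpose ?J *v ((?Aj ** matrix_inv ?Aj) *v dform C u j x)"
      unfolding comm by (simp only: matrix_vector_mul_assoc matrix_mul_assoc)
    also have "\<dots> = dform C u i x" unfolding matrix_inv_works(1)[OF Anz(2)] ui by simp
    finally show ?thesis .
  qed
  then have "matrix_inv ?Ai *v dform C u i x
    = matrix_inv ?Ai *v (?Ai *v (transpose ?J *v (matrix_inv ?Aj *v dform C u j x)))" by simp
  also have "\<dots> = transpose ?J *v (matrix_inv ?Aj *v dform C u j x)"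
    unfolding matrix_vector_mul_assoc[of "matrix_inv ?Ai" ?Ai] matrix_inv_works(2)[OF Anz(1)] by simp
  finally show "omega \<rho> u i x = transpose ?J *v omega \<rho> u j x" by (simp only: omega_def)
qed

text \<open>The flux of \<open>g(\<rho>)\<^sup>-\<^sup>1 du\<close> with respect to \<open>g\<close> is \<open>m g\<^sup>-\<^sup>1 (g(\<rho>) g\<^sup>-\<^sup>1)\<^sup>-\<^sup>1 du\<close>, that is
  \<open>m g(\<rho>)\<^sup>-\<^sup>1 du\<close>. The function \<open>\<Phi>\<close> may be any smooth function on the slab that extends the
  coordinate expression of \<open>u\<close> from the slice at \<open>\<rho>\<close>.\<close>

lemma Dop_local:
  assumes \<rho>: "\<rho> \<in> R" and u: "smooth_fun C u" and x: "x \<in> cdom C i"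
    and \<Phi>: "smooth_on (cimg C1 i) \<Phi>" and eq: "\<And>y. y \<in> cimg C i \<Longrightarrow> loc C i u y = \<Phi> (ext y \<rho>)"
  shows "Dop \<rho> u x = adiv (ml i) (Hl i) \<Phi> (ext (cmap C i x) \<rho>)"
proof -
  interpret S: slab "cimg C1 i" "ml i" "wl i" "Hl i" by (rule slab_local)
  have G: "metric_on C g" by (rule riemannian_imp_metric_on[OF metric_g])
  have ext_in: "ext y \<rho> \<in> cimg C1 i" if "y \<in> cimg C i" for y
    using that \<rho> ext_in_cimg_prod by blast
  have flux: "flux C g (omega \<rho> u) i a y = aflux (ml i) (Hl i) \<Phi> a (ext y \<rho>)" if y: "y \<in> cimg C i" for a y
  proof -
    have xy: "cinv C i y \<in> cdom C i" by (rule cinv_in[OF y])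
    let ?x = "cinv C i y"
    have nz: "det (g i ?x) \<noteq> 0" "det (h i (?x, \<rho>)) \<noteq> 0"
      using riemannian_metric_det[OF metric_g xy] riemannian_metric_det[OF metric_rho[OF \<rho>] xy] by auto
    have "h i (?x, \<rho>) ** matrix_inv (g i ?x) ** (g i ?x ** matrix_inv (h i (?x, \<rho>)))
       = h i (?x, \<rho>) ** (matrix_inv (g i ?x) ** g i ?x) ** matrix_inv (h i (?x, \<rho>))"
      by (simp only: matrix_mul_assoc)
    also have "\<dots> = mat 1" by (simp add: matrix_inv_works[OF nz(1)] matrix_inv_works[OF nz(2)])
    finally have "matrix_inv (h i (?x, \<rho>) ** matrix_inv (g i ?x)) = g i ?x ** matrix_inv (h i (?x, \<rho>))"
      by (rule matrix_inv_eqI)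
    then have "matrix_inv (g i ?x) *v omega \<rho> u i ?x
        = (matrix_inv (g i ?x) ** g i ?x) *v (matrix_inv (h i (?x, \<rho>)) *v dform C u i ?x)"
      by (simp only: omega_def matrix_vector_mul_assoc matrix_mul_assoc)
    also have "\<dots> = matrix_inv (h i (?x, \<rho>)) *v dform C u i ?x"
      unfolding matrix_inv_works(2)[OF nz(1)] by simp
    finally have v: "matrix_inv (g i ?x) *v omega \<rho> u i ?x = matrix_inv (h i (?x, \<rho>)) *v dform C u i ?x" .
    have hh: "hl i (ext y \<rho>) = h i (?x, \<rho>)" using hl_eq[OF ext_in[OF y]] by simp
    have "pd k (loc C i u) y = pd (Some k) \<Phi> (ext y \<rho>)" for k
    proof -
      have "pd k (loc C i u) y = pd k (\<lambda>y. \<Phi> (ext y \<rho>)) y" by (rule pd_cong[OF open_cimg y eq])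
      also have "\<dots> = pd (Some k) \<Phi> (ext y \<rho>)"
        by (rule pd_slice[OF smooth_on_differentiable[OF \<Phi> ext_in[OF y]]])
      finally show ?thesis .
    qed
    then have "dform C u i ?x $ k = pd (Some k) \<Phi> (ext y \<rho>)" for k
      using y by (simp add: dform_def)
    then show ?thesis
      unfolding flux_def aflux_def loc_def comp_def v Hl_def hh
      by (simp add: matrix_vector_mult_def ml_def loc_def)
  qed
  let ?y = "cmap C i x"
  have y: "?y \<in> cimg C i" using x by blast
  have "pd a (flux C g (omega \<rho> u) i a) ?y = pd (Some a) (aflux (ml i) (Hl i) \<Phi> a) (ext ?y \<rho>)" for a
  proof -
    have "pd a (flux C g (omega \<rho> u) i a) ?y = pd a (\<lambda>y. aflux (ml i) (Hl i) \<Phi> a (ext y \<rho>)) ?y"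
      by (rule pd_cong[OF open_cimg y flux])
    also have "\<dots> = pd (Some a) (aflux (ml i) (Hl i) \<Phi> a) (ext ?y \<rho>)"
      by (rule pd_slice[OF smooth_on_differentiable[OF S.smooth_on_aflux[OF \<Phi>] ext_in[OF y]]])
    finally show ?thesis .
  qed
  then show ?thesis
    unfolding Dop_def codiff_eq_local(2)[OF G covector_on_omega[OF \<rho> u] x] local_codiff_def adiv_def
    by (simp add: ml_def)
qed

text \<open>The global form of \<open>potential\<close>.\<close>

definition Upot :: "'m \<times> real \<Rightarrow> real" where
  "Upot = (\<lambda>(x, \<rho>). 2 * \<rho> * deriv (deriv (\<lambda>\<rho>. w_rho (x, \<rho>))) \<rho> / w_rho (x, \<rho>)
     - (real CARD('n) - 2) * deriv (\<lambda>\<rho>. w_rho (x, \<rho>)) \<rho> / w_rho (x, \<rho>)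
     - Dop \<rho> (\<lambda>x. w_rho (x, \<rho>)) x / w_rho (x, \<rho>))"

lemma loc_slice:
  assumes "y \<in> cimg C i" "\<rho> \<in> R"
  shows "loc C i (\<lambda>x. \<phi> (x, \<rho>)) y = loc C1 i \<phi> (ext y \<rho>)"
proof -
  have "ext y \<rho> \<in> cimg C1 i" using assms ext_in_cimg_prod by blast
  from loc_prod[OF this, of \<phi>] show ?thesis by (simp add: loc_def)
qed

lemma loc_w_rho: "z \<in> cimg C1 i \<Longrightarrow> loc C1 i w_rho z = wl i z"
  by (rule loc_local[where \<phi> = w_rho and \<Phi> = "wl i" and i = i], assumption) (rule w_rho_local)

lemma pd_loc_w_rho:
  assumes "z \<in> cimg C1 i"
  shows "pd a (loc C1 i w_rho) z = pd a (wl i) z"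
  by (rule pd_cong[OF slab1.open_cimg assms]) (rule loc_w_rho)

lemma Upot_local:
  assumes x: "x \<in> cdom C i" and \<rho>: "\<rho> \<in> R"
  shows "Upot (x, \<rho>) = potential (ml i) (Hl i) (wl i) (ext (cmap C i x) \<rho>)"
proof -
  interpret S: slab "cimg C1 i" "ml i" "wl i" "Hl i" by (rule slab_local)
  let ?z = "ext (cmap C i x) \<rho>"
  have z: "?z \<in> cimg C1 i" using x \<rho> by (simp add: ext_in_cimg_prod)
  have d1: "deriv (\<lambda>\<rho>. w_rho (x, \<rho>)) \<rho> = pd None (wl i) ?z"
    using deriv_iterate_local(1)[OF smooth_w_rho x \<rho>, of 1] pd_loc_w_rho[OF z] by simp
  have "pd None (pd None (loc C1 i w_rho)) ?z = pd None (pd None (wl i)) ?z"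
    by (rule pd_cong[OF slab1.open_cimg z pd_loc_w_rho])
  then have d2: "deriv (deriv (\<lambda>\<rho>. w_rho (x, \<rho>))) \<rho> = pd None (pd None (wl i)) ?z"
    using deriv_iterate_local(1)[OF smooth_w_rho x \<rho>, of 2] by (simp add: numeral_2_eq_2)
  have D: "Dop \<rho> (\<lambda>x. w_rho (x, \<rho>)) x = adiv (ml i) (Hl i) (wl i) ?z"
  proof (rule Dop_local[OF \<rho> smooth_fun_slice[OF smooth_w_rho \<rho>] x S.smooth_w])
    fix y assume y: "y \<in> cimg C i"
    then have "ext y \<rho> \<in> cimg C1 i" using \<rho> ext_in_cimg_prod by blast
    from loc_w_rho[OF this] show "loc C i (\<lambda>x. w_rho (x, \<rho>)) y = wl i (ext y \<rho>)"
      using loc_slice[OF y \<rho>, of w_rho] by simp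
  qed
  show ?thesis
    unfolding Upot_def potential_def by (simp add: d1 d2 D w_rho_local[OF x \<rho>])
qed

definition Mrho :: "real \<Rightarrow> ('m \<Rightarrow> real) \<Rightarrow> 'm \<Rightarrow> real" where
  "Mrho \<rho> u x = Dop \<rho> u x + Upot (x, \<rho>) * u x"

lemma Mrho_local:
  assumes \<phi>: "smooth_fun C1 \<phi>" and x: "x \<in> cdom C i" and \<rho>: "\<rho> \<in> R"
  shows "Mrho \<rho> (\<lambda>x. \<phi> (x, \<rho>)) x = adiv (ml i) (Hl i) (loc C1 i \<phi>) (ext (cmap C i x) \<rho>)
      + potential (ml i) (Hl i) (wl i) (ext (cmap C i x) \<rho>) * loc C1 i \<phi> (ext (cmap C i x) \<rho>)"
proof -
  have "Dop \<rho> (\<lambda>x. \<phi> (x, \<rho>)) x = adiv (ml i) (Hl i) (loc C1 i \<phi>) (ext (cmap C i x) \<rho>)"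
  proof (rule Dop_local[OF \<rho> smooth_fun_slice[OF \<phi> \<rho>] x])
    show "smooth_on (cimg C1 i) (loc C1 i \<phi>)" using \<phi> unfolding smooth_fun_def by blast
    show "loc C i (\<lambda>x. \<phi> (x, \<rho>)) y = loc C1 i \<phi> (ext y \<rho>)" if "y \<in> cimg C i" for y
      by (rule loc_slice[OF that \<rho>])
  qed
  then show ?thesis by (simp add: Mrho_def Upot_local[OF x \<rho>] loc_ext[OF x \<rho>])
qed

end

section \<open>The ambient Laplacian and the Laplacian of the Poincare--Einstein metric\<close>

context pe_family
begin

abbreviation "C2 \<equiv> prod_atlas C1 {0<..}"

lemma loc_ambient:
  assumes "y \<in> cimg C2 i"
  shows "base y \<in> cimg C1 i" "y $ None > 0"
    "loc C2 i f y = f ((cinv C i (base (base y)), base y $ None), y $ None)"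
proof -
  show y: "base y \<in> cimg C1 i" "y $ None > 0"
    using assms slab1.cimg_prod[of y "{0<..}" i] by auto
  show "loc C2 i f y = f ((cinv C i (base (base y)), base y $ None), y $ None)"
    unfolding slab1.loc_prod[OF assms] cinv_prod[OF y(1)] ..
qed

lemma loc_g_ambient:
  assumes "y \<in> cimg C2 i"
  shows "loc C2 i (g_ambient h i) y = amb (base y $ None) (y $ None) (hl i (base y))"
  unfolding loc_ambient(3)[OF assms] g_ambient_eq_amb hl_eq[OF loc_ambient(1)[OF assms]] ..

lemma metric_on_g_ambient: "metric_on C2 (g_ambient h)"
  unfolding metric_on_def
proof (intro conjI allI ballI)
  fix i
  note op = ambient.open_cimg[of i]
  have hb: "smooth_on (cimg C2 i) (\<lambda>y. hl i (base y) $ j $ k)" for j k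
    by (rule smooth_on_compose_base[OF op smooth_hl]) (rule loc_ambient(1))
  have nN: "smooth_on (cimg C2 i) (\<lambda>y. y $ a)" for a
    by (rule smooth_on_linear_map[OF op bounded_linear_vec_nth])
  have "smooth_on (cimg C2 i) (\<lambda>y. amb (base y $ None) (y $ None) (hl i (base y)) $ a $ b)" for a b
  proof -
    consider "a = None" "b = None" | "a = None" "b = Some None" | k where "a = None" "b = Some (Some k)"
      | "a = Some None" "b = None" | "a = Some None" "b = Some None" | k where "a = Some None" "b = Some (Some k)"
      | j where "a = Some (Some j)" "b = None" | j where "a = Some (Some j)" "b = Some None"
      | j k where "a = Some (Some j)" "b = Some (Some k)"
      by (metis option.exhaust)
    then show ?thesis
      by cases (simp_all add: amb_nth nN smooth_on_mult[OF op] smooth_on_power[OF op] hb)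
  qed
  then have "smooth_on (cimg C2 i) (\<lambda>y. amb (base y $ None) (y $ None) (hl i (base y)))"
    by (intro smooth_on_entriesI op)
  then show "smooth_on (cimg C2 i) (loc C2 i (g_ambient h i))"
    by (rule smooth_on_congI[OF op]) (rule loc_g_ambient)
next
  fix i p assume p: "p \<in> cdom C2 i"
  obtain x \<rho> t where p': "p = ((x, \<rho>), t)" by (metis surj_pair)
  have x: "x \<in> cdom C i" "\<rho> \<in> R" "t > 0" using p unfolding p' slab1.cdom_prod cdom_prod by auto
  have "det (h i (x, \<rho>)) \<noteq> 0" by (rule riemannian_metric_det[OF metric_rho[OF x(2)] x(1)])
  then have "\<bar>det (amb \<rho> t (h i (x, \<rho>)))\<bar> \<noteq> 0" unfolding abs_det_amb using x(3) by simp
  then show "det (g_ambient h i p) \<noteq> 0" unfolding p' g_ambient_eq_amb by simp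
next
  fix i j p assume p: "p \<in> cdom C2 i \<inter> cdom C2 j"
  obtain x \<rho> t where p': "p = ((x, \<rho>), t)" by (metis surj_pair)
  have x: "x \<in> cdom C i" "x \<in> cdom C j" "\<rho> \<in> R" "t \<in> {0<..}"
    using p unfolding p' slab1.cdom_prod cdom_prod by auto
  have xr: "(x, \<rho>) \<in> cdom C1 i" "(x, \<rho>) \<in> cdom C1 j" using x unfolding cdom_prod by auto
  have J: "jac (cmap C2 j \<circ> cinv C2 i) (cmap C2 i p) = blk (blk (jac (transition i j) (cmap C i x)))"
    unfolding p' slab1.jac_prod[OF open_greaterThan xr x(4)] jac_prod[OF open_R x(1,2,3)] ..
  show "g_ambient h i p = transpose (jac (cmap C2 j \<circ> cinv C2 i) (cmap C2 i p)) ** g_ambient h j p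
      ** jac (cmap C2 j \<circ> cinv C2 i) (cmap C2 i p)"
    unfolding J unfolding p' g_ambient_eq_amb amb_congruence
    using metric_onD(3)[OF riemannian_imp_metric_on[OF metric_rho[OF x(3)]] x(1,2)] by simp
qed

definition Sop :: "real \<Rightarrow> ('m \<times> real \<Rightarrow> real) \<Rightarrow> 'm \<times> real \<Rightarrow> real" where
  "Sop \<gamma> \<phi> = (\<lambda>(x, \<rho>). - 2 * \<rho> * deriv (deriv (\<lambda>\<rho>. \<phi> (x, \<rho>))) \<rho>
     + (2 * \<gamma> + real CARD('n) - 2) * deriv (\<lambda>\<rho>. \<phi> (x, \<rho>)) \<rho> + Mrho \<rho> (\<lambda>x. \<phi> (x, \<rho>)) x)"

lemma Sop_local:
  assumes \<phi>: "smooth_fun C1 \<phi>" and x: "x \<in> cdom C i" and \<rho>: "\<rho> \<in> R"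
  defines "z \<equiv> ext (cmap C i x) \<rho>" and "\<Phi> \<equiv> loc C1 i \<phi>"
  shows "Sop \<gamma> \<phi> (x, \<rho>) = - 2 * z $ None * pd None (pd None \<Phi>) z
     + (2 * \<gamma> + real CARD('n) - 2) * pd None \<Phi> z + adiv (ml i) (Hl i) \<Phi> z
     + potential (ml i) (Hl i) (wl i) z * \<Phi> z"
  using deriv_iterate_local(1)[OF \<phi> x \<rho>, of 1] deriv_iterate_local(1)[OF \<phi> x \<rho>, of 2] Mrho_local[OF \<phi> x \<rho>]
  by (simp add: Sop_def z_def \<Phi>_def numeral_2_eq_2)

text \<open>The components of the ambient flux of \<open>t\<^sup>\<gamma> \<phi> / w\<close> are powers of \<open>t\<close> times functions of
  \<open>(x, \<rho>)\<close>, so the divergence reduces to the one in \<open>conjugated_laplacian\<close>.\<close>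

lemma lapl_ambient:
  fixes F :: "('m \<times> real) \<times> real \<Rightarrow> real"
  assumes \<phi>: "smooth_fun C1 \<phi>"
    and F: "\<And>x \<rho> t. \<rho> \<in> R \<Longrightarrow> t > 0 \<Longrightarrow> F ((x, \<rho>), t) = t powr \<gamma> * (\<phi> (x, \<rho>) / w_rho (x, \<rho>))"
    and \<rho>: "\<rho> \<in> R" and t: "t > 0"
  shows "lapl C2 (g_ambient h) F ((x, \<rho>), t) = t powr (\<gamma> - 2) * (Sop \<gamma> \<phi> (x, \<rho>) / w_rho (x, \<rho>))"
proof -
  define f where "f i z = loc C1 i \<phi> z / wl i z" for i z
  have sl: "smooth_on (cimg C1 i) (loc C1 i \<phi>)" for i using \<phi> unfolding smooth_fun_def by blast
  have sf: "smooth_on (cimg C1 i) (f i)" for i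
  proof -
    interpret S: slab "cimg C1 i" "ml i" "wl i" "Hl i" by (rule slab_local)
    show ?thesis unfolding f_def
      by (intro smooth_on_divide S.open_Z sl S.smooth_w) (use S.w_pos in force)
  qed
  have locF: "loc C2 i F y = (y $ None) powr \<gamma> * f i (base y)" if y: "y \<in> cimg C2 i" for i y
  proof -
    have b: "base y \<in> cimg C1 i" "y $ None > 0" by (rule loc_ambient[OF y])+
    then have "base y $ None \<in> R" using cimg_prod by blast
    from F[OF this b(2)] have "loc C2 i F y = (y $ None) powr \<gamma> * (\<phi> (cinv C i (base (base y)), base y $ None)
        / w_rho (cinv C i (base (base y)), base y $ None))"
      unfolding loc_ambient(3)[OF y] .
    also have "\<dots> = (y $ None) powr \<gamma> * (loc C1 i \<phi> (base y) / loc C1 i w_rho (base y))"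
      unfolding loc_prod[OF b(1)] ..
    finally show ?thesis unfolding f_def loc_w_rho[OF b(1)] .
  qed
  have smF: "smooth_fun C2 F"
    unfolding smooth_fun_def
  proof
    fix i
    note op = ambient.open_cimg[of i]
    have "smooth_on (cimg C2 i) (\<lambda>y. (y $ None) powr \<gamma> * f i (base y))"
    proof (rule smooth_on_mult[OF op])
      show "smooth_on (cimg C2 i) (\<lambda>y. (y $ None) powr \<gamma>)"
        by (rule smooth_on_powr_nth[OF op]) (rule loc_ambient(2))
      show "smooth_on (cimg C2 i) (\<lambda>y. f i (base y))"
        by (rule smooth_on_compose_base[OF op sf]) (rule loc_ambient(1))
    qed
    then show "smooth_on (cimg C2 i) (loc C2 i F)"
      by (rule smooth_on_congI[OF op]) (rule locF)
  qed
  define i where "i = chart_at C x"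
  have x: "x \<in> cdom C i" unfolding i_def by (rule chart_at_in)
  interpret S: slab "cimg C1 i" "ml i" "wl i" "Hl i" by (rule slab_local)
  let ?n = "real CARD('n)"
  define v where "v z = ml i z * (wl i z)\<^sup>2" for z
  have sv: "smooth_on (cimg C1 i) v" unfolding v_def
    by (intro smooth_on_mult smooth_on_power S.open_Z S.smooth_m S.smooth_w)
  define Q0 where "Q0 z = v z * pd None (f i) z" for z
  \<comment> \<open>The components of the flux along \<open>t\<close>, \<open>\<rho>\<close> and \<open>M\<close>, up to powers of \<open>t\<close>.\<close>
  define Q1 where "Q1 z = v z * (\<gamma> * f i z - 2 * z $ None * pd None (f i) z)" for z
  define Q2 where "Q2 j z = v z * (\<Sum>k\<in>UNIV. Hl i j k z * pd (Some k) (f i) z)" for j z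
  have sQ: "smooth_on (cimg C1 i) Q0" "smooth_on (cimg C1 i) Q1" "smooth_on (cimg C1 i) (Q2 j)" for j
    unfolding Q0_def Q1_def Q2_def
    by (intro smooth_on_mult smooth_on_diff smooth_on_sum smooth_on_pd smooth_on_const S.open_Z sv sf S.smooth_H
        smooth_on_linear_map bounded_linear_vec_nth)+
  have flux: "flux C2 (g_ambient h) (dform C2 F) i None y = (y $ None) powr (?n + \<gamma>) * Q0 (base y)"
    "flux C2 (g_ambient h) (dform C2 F) i (Some None) y = (y $ None) powr (?n + \<gamma> - 1) * Q1 (base y)"
    "flux C2 (g_ambient h) (dform C2 F) i (Some (Some j)) y = (y $ None) powr (?n + \<gamma> - 1) * Q2 j (base y)"
    and vol: "vol_density (loc C2 i (g_ambient h i) y) = (y $ None) powr (?n + 1) * v (base y)"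
    if y: "y \<in> cimg C2 i" for y j
  proof -
    define t z where "t = y $ None" and "z = base y"
    have z: "z \<in> cimg C1 i" "t > 0" unfolding t_def z_def by (rule loc_ambient[OF y])+
    show vol: "vol_density (loc C2 i (g_ambient h i) y) = (y $ None) powr (?n + 1) * v (base y)"
      unfolding loc_g_ambient[OF y] vol_density_amb[OF loc_ambient(2)[OF y]]
        vol_density_hl[OF loc_ambient(1)[OF y]] v_def ..
    have inv: "matrix_inv (loc C2 i (g_ambient h i) y) = amb_inverse (z $ None) t (matrix_inv (hl i z))"
      unfolding loc_g_ambient[OF y] t_def z_def
      by (rule matrix_inv_amb) (use z hl_props(1) in \<open>auto simp: t_def z_def\<close>)
    have d: "loc C2 i (dform C2 F i) y $ a = pd a (\<lambda>y. (y $ None) powr \<gamma> * f i (base y)) y" for a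
    proof -
      have "loc C2 i (dform C2 F i) y $ a = pd a (loc C2 i F) y"
        using ambient.cmap_cinv[OF y] by (simp add: loc_def dform_def)
      also have "\<dots> = pd a (\<lambda>y. (y $ None) powr \<gamma> * f i (base y)) y"
        by (rule pd_cong[OF ambient.open_cimg y locF])
      finally show ?thesis .
    qed
    have df: "f i differentiable at (base y)"
      by (rule smooth_on_differentiable[OF sf loc_ambient(1)[OF y]])
    note dN = d[of None, unfolded pd_powr_base(1)[OF df loc_ambient(2)[OF y]], folded t_def z_def]
    note dS = d[of "Some _", unfolded pd_powr_base(2)[OF df loc_ambient(2)[OF y]], folded t_def z_def]
    define A B where "A = t powr (?n + 1)" and "B = t powr \<gamma>"
    have p: "t powr (?n + \<gamma>) = A * B / t" "t powr (?n + \<gamma> - 1) = A * B / t\<^sup>2" "t powr (\<gamma> - 1) = B / t"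
      using z(2) by (simp_all add: A_def B_def powr_add powr_diff power2_eq_square)
    have mv: "flux C2 (g_ambient h) (dform C2 F) i a y
       = A * v z * (\<Sum>b\<in>UNIV. amb_inverse (z $ None) t (matrix_inv (hl i z)) $ a $ b * loc C2 i (dform C2 F i) y $ b)" for a
      unfolding flux_def vol inv by (simp add: matrix_vector_mult_def A_def t_def z_def)
    show "flux C2 (g_ambient h) (dform C2 F) i None y = (y $ None) powr (?n + \<gamma>) * Q0 (base y)"
      unfolding mv t_def[symmetric] z_def[symmetric] p
      using z(2) by (simp add: sum_option amb_inverse_nth dN dS Q0_def B_def)
    show "flux C2 (g_ambient h) (dform C2 F) i (Some None) y = (y $ None) powr (?n + \<gamma> - 1) * Q1 (base y)"
      unfolding mv t_def[symmetric] z_def[symmetric] p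
      using z(2) by (simp add: sum_option amb_inverse_nth dN dS Q1_def p(3) B_def[symmetric])
        (simp add: field_simps power2_eq_square)
    show "flux C2 (g_ambient h) (dform C2 F) i (Some (Some j)) y = (y $ None) powr (?n + \<gamma> - 1) * Q2 j (base y)"
      unfolding mv t_def[symmetric] z_def[symmetric] p
      using z(2) by (simp add: sum_option amb_inverse_nth dN dS Q2_def Hl_def B_def[symmetric]
          sum_distrib_left sum_distrib_right sum_divide_distrib mult_ac)
  qed
  let ?z = "ext (cmap C i x) \<rho>" and ?y = "ext (ext (cmap C i x) \<rho>) t"
  have z: "?z \<in> cimg C1 i" using x \<rho> by (simp add: ext_in_cimg_prod)
  have y: "?y \<in> cimg C2 i" using z t slab1.ext_in_cimg_prod[of ?z t "{0<..}" i] by simp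
  have p: "((x, \<rho>), t) \<in> cdom C2 i" unfolding slab1.cdom_prod cdom_prod using x \<rho> t by simp
  have cm: "cmap C2 i ((x, \<rho>), t) = ?y" by simp
  have dQ: "Q differentiable at (base ?y)" if "smooth_on (cimg C1 i) Q" for Q :: "real^('n option) \<Rightarrow> real"
    using smooth_on_differentiable[OF that z] by simp
  have yt: "?y $ None > 0" using t by simp
  have "pd None (flux C2 (g_ambient h) (dform C2 F) i None) ?y
      = pd None (\<lambda>y. (y $ None) powr (?n + \<gamma>) * Q0 (base y)) ?y"
    by (rule pd_cong[OF ambient.open_cimg y flux(1)])
  then have 1: "pd None (flux C2 (g_ambient h) (dform C2 F) i None) ?y = (?n + \<gamma>) * t powr (?n + \<gamma> - 1) * Q0 ?z"
    unfolding pd_powr_base(1)[OF dQ[OF sQ(1)] yt] by simp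
  have "pd (Some None) (flux C2 (g_ambient h) (dform C2 F) i (Some None)) ?y
      = pd (Some None) (\<lambda>y. (y $ None) powr (?n + \<gamma> - 1) * Q1 (base y)) ?y"
    by (rule pd_cong[OF ambient.open_cimg y flux(2)])
  then have 2: "pd (Some None) (flux C2 (g_ambient h) (dform C2 F) i (Some None)) ?y = t powr (?n + \<gamma> - 1) * pd None Q1 ?z"
    unfolding pd_powr_base(2)[OF dQ[OF sQ(2)] yt] by simp
  have 3: "pd (Some (Some j)) (flux C2 (g_ambient h) (dform C2 F) i (Some (Some j))) ?y = t powr (?n + \<gamma> - 1) * pd (Some j) (Q2 j) ?z" for j
  proof -
    have "pd (Some (Some j)) (flux C2 (g_ambient h) (dform C2 F) i (Some (Some j))) ?y
      = pd (Some (Some j)) (\<lambda>y. (y $ None) powr (?n + \<gamma> - 1) * Q2 j (base y)) ?y"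
      by (rule pd_cong[OF ambient.open_cimg y flux(3)])
    then show ?thesis unfolding pd_powr_base(2)[OF dQ[OF sQ(3)] yt] by simp
  qed
  have vz: "v ?z > 0" unfolding v_def using S.m_pos[OF z] S.w_pos[OF z] by simp
  have pw: "t powr (?n + \<gamma> - 1) = t powr (?n + 1) * t powr (\<gamma> - 2)"
    by (simp add: powr_add[symmetric])
  have "lapl C2 (g_ambient h) F ((x, \<rho>), t)
      = (\<Sum>a\<in>UNIV. pd a (flux C2 (g_ambient h) (dform C2 F) i a) ?y) / vol_density (loc C2 i (g_ambient h i) ?y)"
    unfolding lapl_def ambient.codiff_eq_local(2)[OF metric_on_g_ambient ambient.covector_on_dform[OF smF] p] local_codiff_def cm
    by simp
  also have "\<dots> = t powr (?n + \<gamma> - 1) * ((?n + \<gamma>) * Q0 ?z + pd None Q1 ?z + (\<Sum>j\<in>UNIV. pd (Some j) (Q2 j) ?z))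
       / (t powr (?n + 1) * v ?z)"
    unfolding sum_option 1 2 3 vol[OF y] by (simp add: algebra_simps sum_distrib_left)
  also have "\<dots> = t powr (\<gamma> - 2) * (((?n + \<gamma>) * Q0 ?z + pd None Q1 ?z + (\<Sum>j\<in>UNIV. pd (Some j) (Q2 j) ?z)) / v ?z)"
    unfolding pw using t by simp
  also have "((?n + \<gamma>) * Q0 ?z + pd None Q1 ?z + (\<Sum>j\<in>UNIV. pd (Some j) (Q2 j) ?z)) / v ?z
     = Sop \<gamma> \<phi> (x, \<rho>) / w_rho (x, \<rho>)"
    using S.conjugated_laplacian[OF sl z refl, of \<gamma>]
    unfolding Sop_local[OF \<phi> x \<rho>] w_rho_local[OF x \<rho>] Q0_def[abs_def] Q1_def[abs_def] Q2_def[abs_def] v_def f_def[abs_def]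
    by simp
  finally show ?thesis .
qed

lemma smooth_fun_Sop:
  assumes \<phi>: "smooth_fun C1 \<phi>"
  shows "smooth_fun C1 (Sop \<gamma> \<phi>)"
proof (rule smooth_fun_localI[where \<Phi> = "\<lambda>i z. - 2 * z $ None * pd None (pd None (loc C1 i \<phi>)) z
     + (2 * \<gamma> + real CARD('n) - 2) * pd None (loc C1 i \<phi>) z + adiv (ml i) (Hl i) (loc C1 i \<phi>) z
     + potential (ml i) (Hl i) (wl i) z * loc C1 i \<phi> z"])
  fix i x \<rho> assume "x \<in> cdom C i" "\<rho> \<in> R"
  from Sop_local[OF \<phi> this] show "Sop \<gamma> \<phi> (x, \<rho>) = - 2 * ext (cmap C i x) \<rho> $ None * pd None (pd None (loc C1 i \<phi>)) (ext (cmap C i x) \<rho>)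
     + (2 * \<gamma> + real CARD('n) - 2) * pd None (loc C1 i \<phi>) (ext (cmap C i x) \<rho>) + adiv (ml i) (Hl i) (loc C1 i \<phi>) (ext (cmap C i x) \<rho>)
     + potential (ml i) (Hl i) (wl i) (ext (cmap C i x) \<rho>) * loc C1 i \<phi> (ext (cmap C i x) \<rho>)" .
next
  fix i
  interpret S: slab "cimg C1 i" "ml i" "wl i" "Hl i" by (rule slab_local)
  have F: "smooth_on (cimg C1 i) (loc C1 i \<phi>)" using \<phi> unfolding smooth_fun_def by blast
  have N: "smooth_on (cimg C1 i) (\<lambda>z. z $ None)" by (rule smooth_on_linear_map[OF S.open_Z bounded_linear_vec_nth])
  show "smooth_on (cimg C1 i) (\<lambda>z. - 2 * z $ None * pd None (pd None (loc C1 i \<phi>)) z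
     + (2 * \<gamma> + real CARD('n) - 2) * pd None (loc C1 i \<phi>) z + adiv (ml i) (Hl i) (loc C1 i \<phi>) z
     + potential (ml i) (Hl i) (wl i) z * loc C1 i \<phi> z)"
    by (intro smooth_on_add smooth_on_mult smooth_on_pd smooth_on_const S.open_Z S.smooth_on_adiv
        S.smooth_on_potential N F)
qed

text \<open>The change of coordinates that identifies the collar with the part \<open>\<rho> < 0\<close> of the product of
  \<open>M\<close> and the \<open>\<rho>\<close>-interval.\<close>

definition rho_coord :: "real^('n option) \<Rightarrow> real^('n option)" where
  "rho_coord y = ext (base y) (- ((y $ None)\<^sup>2 / 2))"

lemma rho_coord_ext [simp]: "rho_coord (ext y r) = ext y (- (r\<^sup>2 / 2))"
  by (simp add: rho_coord_def)

lemma smooth_rho_coord: "open S \<Longrightarrow> smooth_on S rho_coord"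
proof -
  assume S: "open S"
  have n: "smooth_on S (\<lambda>y::real^('n option). y $ a)" for a by (rule smooth_on_linear_map[OF S bounded_linear_vec_nth])
  have "smooth_on S (\<lambda>y::real^('n option). - ((1 / 2) * (y $ None)\<^sup>2))"
    by (intro smooth_on_minus smooth_on_mult smooth_on_power smooth_on_const S n)
  then show "smooth_on S rho_coord"
    unfolding rho_coord_def by (intro smooth_on_ext S) (simp_all add: n)
qed

lemma pd_rho_coord:
  assumes Q: "Q differentiable at (rho_coord y)"
  shows "pd None (\<lambda>y. Q (rho_coord y)) y = - (y $ None) * pd None Q (rho_coord y)"
    and "pd (Some j) (\<lambda>y. Q (rho_coord y)) y = pd (Some j) Q (rho_coord y)"
    and "(\<lambda>y. Q (rho_coord y)) differentiable at y"
proof -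
  have dr: "rho_coord differentiable at y"
    by (rule smooth_on_differentiable[OF smooth_rho_coord[OF open_UNIV]]) simp
  have dN: "(\<lambda>y::real^('n option). y $ None) differentiable at y"
    using bounded_linear_imp_has_derivative[OF bounded_linear_vec_nth] differentiable_def by blast
  have sq: "((\<lambda>s. - (s\<^sup>2 / 2)) has_real_derivative - (y $ None)) (at (y $ None))"
    by (auto intro!: derivative_eq_intros)
  have "pd a (\<lambda>y. rho_coord y $ None) y = - (y $ None) * pd a (\<lambda>y. y $ None) y" for a
    using pd_compose_real[OF dN sq] by (simp add: rho_coord_def)
  then have c: "pd a (\<lambda>y. rho_coord y $ None) y = (if a = None then - (y $ None) else 0)"
    "pd a (\<lambda>y. rho_coord y $ Some k) y = (if a = Some k then 1 else 0)" for a k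
    by (simp_all add: rho_coord_def)
  show "pd None (\<lambda>y. Q (rho_coord y)) y = - (y $ None) * pd None Q (rho_coord y)"
    "pd (Some j) (\<lambda>y. Q (rho_coord y)) y = pd (Some j) Q (rho_coord y)"
    unfolding pd_compose[OF dr Q] sum_option c by (simp_all add: if_distrib[of "\<lambda>x. _ * x"] cong: if_cong)
  show "(\<lambda>y. Q (rho_coord y)) differentiable at y" by (rule differentiable_compose[OF Q dr])
qed

lemma pd_powr_rho_coord:
  assumes Q: "Q differentiable at (rho_coord y)" and y: "y $ None > 0"
  shows "pd None (\<lambda>y. (y $ None) powr \<kappa> * Q (rho_coord y)) y
      = \<kappa> * (y $ None) powr (\<kappa> - 1) * Q (rho_coord y) - (y $ None) powr (\<kappa> + 1) * pd None Q (rho_coord y)"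
    and "pd (Some j) (\<lambda>y. (y $ None) powr \<kappa> * Q (rho_coord y)) y = (y $ None) powr \<kappa> * pd (Some j) Q (rho_coord y)"
proof -
  have one: "(\<lambda>y. 1::real) differentiable at (base y)" by simp
  have dp: "(\<lambda>y. (y $ None) powr \<kappa>) differentiable at y" by (rule pd_powr_base(3)[OF one y])
  have pp: "pd None (\<lambda>y. (y $ None) powr \<kappa>) y = \<kappa> * (y $ None) powr (\<kappa> - 1)"
    "pd (Some j) (\<lambda>y. (y $ None) powr \<kappa>) y = 0"
    using pd_powr_base(1)[OF one y, where \<kappa> = \<kappa>] pd_powr_base(2)[OF one y, where \<kappa> = \<kappa> and a = j] by simp_all
  show "pd None (\<lambda>y. (y $ None) powr \<kappa> * Q (rho_coord y)) y
      = \<kappa> * (y $ None) powr (\<kappa> - 1) * Q (rho_coord y) - (y $ None) powr (\<kappa> + 1) * pd None Q (rho_coord y)"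
    using y by (simp add: pd_mult[OF dp pd_rho_coord(3)[OF Q]] pp pd_rho_coord(1)[OF Q] powr_add)
  show "pd (Some j) (\<lambda>y. (y $ None) powr \<kappa> * Q (rho_coord y)) y = (y $ None) powr \<kappa> * pd (Some j) Q (rho_coord y)"
    by (simp add: pd_mult[OF dp pd_rho_coord(3)[OF Q]] pp pd_rho_coord(2)[OF Q])
qed

abbreviation "CX \<equiv> prod_atlas C {0<..<\<epsilon>}"

lemma loc_collar:
  assumes "y \<in> cimg CX i"
  shows "rho_coord y \<in> cimg C1 i" "y $ None > 0"
    "loc CX i f y = f (cinv C i (base y), y $ None)"
    "loc CX i (g_plus h i) y = pe (y $ None) (hl i (rho_coord y))"
proof -
  have y: "base y \<in> cimg C i" "y $ None > 0" "y $ None < \<epsilon>"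
    using assms cimg_prod[of y "{0<..<\<epsilon>}" i] by auto
  show yn: "y $ None > 0" by fact
  show r: "rho_coord y \<in> cimg C1 i"
    unfolding rho_coord_def using y(1) rho_of_r[OF y(2,3)] ext_in_cimg_prod by blast
  show l: "loc CX i f y = f (cinv C i (base y), y $ None)" for f by (rule loc_prod[OF assms])
  show "loc CX i (g_plus h i) y = pe (y $ None) (hl i (rho_coord y))"
    unfolding l g_plus_eq_pe hl_eq[OF r] by (simp add: rho_coord_def)
qed

lemma metric_on_g_plus: "metric_on CX (g_plus h)"
  unfolding metric_on_def
proof (intro conjI allI ballI)
  fix i
  note op = collar.open_cimg[of i]
  have hb: "smooth_on (cimg CX i) (\<lambda>y. hl i (rho_coord y) $ j $ k)" for j k
    by (rule smooth_on_compose[OF op smooth_rho_coord[OF op] smooth_hl]) (rule loc_collar(1))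
  have nN: "smooth_on (cimg CX i) (\<lambda>y. (y $ None)\<^sup>2)"
    by (intro smooth_on_power op smooth_on_linear_map bounded_linear_vec_nth)
  have nz: "(y $ None)\<^sup>2 \<noteq> 0" if "y \<in> cimg CX i" for y using loc_collar(2)[OF that] by simp
  have "smooth_on (cimg CX i) (\<lambda>y. pe (y $ None) (hl i (rho_coord y)) $ a $ b)" for a b
    by (cases a; cases b) (simp_all add: pe_nth smooth_on_divide[OF op _ nN nz] hb)
  then have "smooth_on (cimg CX i) (\<lambda>y. pe (y $ None) (hl i (rho_coord y)))"
    by (intro smooth_on_entriesI op)
  then show "smooth_on (cimg CX i) (loc CX i (g_plus h i))"
    by (rule smooth_on_congI[OF op]) (rule loc_collar(4))
next
  fix i p assume p: "p \<in> cdom CX i"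
  obtain x r where p': "p = (x, r)" by (metis surj_pair)
  have x: "x \<in> cdom C i" "0 < r" "r < \<epsilon>" using p unfolding p' cdom_prod by auto
  have "det (h i (x, - (r\<^sup>2 / 2))) \<noteq> 0" by (rule riemannian_metric_det[OF metric_rho[OF rho_of_r[OF x(2,3)]] x(1)])
  from vol_density_pos[OF this] have "vol_density (pe r (h i (x, - (r\<^sup>2 / 2)))) > 0"
    unfolding vol_density_pe[OF x(2)] using x(2) by (intro mult_pos_pos) simp_all
  then show "det (g_plus h i p) \<noteq> 0" unfolding p' g_plus_eq_pe by (auto simp: vol_density_def)
next
  fix i j p assume p: "p \<in> cdom CX i \<inter> cdom CX j"
  obtain x r where p': "p = (x, r)" by (metis surj_pair)
  have x: "x \<in> cdom C i" "x \<in> cdom C j" "r \<in> {0<..<\<epsilon>}" using p unfolding p' cdom_prod by auto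
  then have r: "- (r\<^sup>2 / 2) \<in> R" using rho_of_r by auto
  show "g_plus h i p = transpose (jac (cmap CX j \<circ> cinv CX i) (cmap CX i p)) ** g_plus h j p
      ** jac (cmap CX j \<circ> cinv CX i) (cmap CX i p)"
    unfolding p' jac_prod[OF open_greaterThanLessThan x] g_plus_eq_pe pe_congruence
    using metric_onD(3)[OF riemannian_imp_metric_on[OF metric_rho[OF r]] x(1,2)] by simp
qed

text \<open>The factor \<open>r\<^sup>-\<^sup>2\<close> of the metric on the collar contributes the power \<open>r\<^bsup>-n-1\<^esup>\<close> to the volume
  density and \<open>r\<^sup>2\<close> to the inverse, and \<open>\<partial>\<^sub>r = - r \<partial>\<^sub>\<rho>\<close>. This turns the Laplacian into \<open>r\<^sup>2\<close> times
  the expression in \<open>potential_via_log\<close>.\<close>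

lemma laplacian_log_w:
  assumes r: "0 < r" "r < \<epsilon>"
  defines "lw \<equiv> \<lambda>z. ln (w_fun C g h z)"
  shows "(lapl CX (g_plus h) lw (x, r) - form_norm2 CX (g_plus h) (dform CX lw) (x, r)) / r\<^sup>2
    = - Upot (x, - (r\<^sup>2 / 2))"
proof -
  define l where "l i z = ln (wl i z)" for i z
  have sl: "smooth_on (cimg C1 i) (l i)" for i
  proof -
    interpret S: slab "cimg C1 i" "ml i" "wl i" "Hl i" by (rule slab_local)
    show ?thesis unfolding l_def
      by (rule smooth_on_compose[OF S.open_Z S.smooth_w smooth_on_ln]) (use S.w_pos in simp)
  qed
  have loclw: "loc CX i lw y = l i (rho_coord y)" if y: "y \<in> cimg CX i" for i y
  proof -
    have "w_fun C g h (cinv C i (base y), y $ None) = loc C1 i w_rho (rho_coord y)"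
      unfolding w_fun_eq_w_rho loc_prod[OF loc_collar(1)[OF y]] by (simp add: rho_coord_def)
    then show ?thesis unfolding loc_collar(3)[OF y] lw_def l_def loc_w_rho[OF loc_collar(1)[OF y]] by simp
  qed
  have smlw: "smooth_fun CX lw"
    unfolding smooth_fun_def
  proof
    fix i
    note op = collar.open_cimg[of i]
    have "smooth_on (cimg CX i) (\<lambda>y. l i (rho_coord y))"
      by (rule smooth_on_compose[OF op smooth_rho_coord[OF op] sl]) (rule loc_collar(1))
    then show "smooth_on (cimg CX i) (loc CX i lw)"
      by (rule smooth_on_congI[OF op]) (rule loclw)
  qed
  define i where "i = chart_at CX (x, r)"
  have p: "(x, r) \<in> cdom CX i"
  proof -
    have "(x, r) \<in> cdom CX (chart_at C x)" unfolding cdom_prod using chart_at_in r by simp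
    then show ?thesis unfolding i_def chart_at_def[of CX] by (rule someI)
  qed
  then have x: "x \<in> cdom C i" unfolding cdom_prod by simp
  interpret S: slab "cimg C1 i" "ml i" "wl i" "Hl i" by (rule slab_local)
  let ?n = "real CARD('n)"
  define v where "v z = ml i z * (wl i z)\<^sup>2" for z
  have sv: "smooth_on (cimg C1 i) v" unfolding v_def
    by (intro smooth_on_mult smooth_on_power S.open_Z S.smooth_m S.smooth_w)
  define Q0 where "Q0 z = v z * pd None (l i) z" for z
  define Q2 where "Q2 j z = v z * (\<Sum>k\<in>UNIV. Hl i j k z * pd (Some k) (l i) z)" for j z
  have sQ: "smooth_on (cimg C1 i) Q0" "smooth_on (cimg C1 i) (Q2 j)" for j
    unfolding Q0_def Q2_def
    by (intro smooth_on_mult smooth_on_sum smooth_on_pd S.open_Z sv sl S.smooth_H)+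
  have dl: "dform CX lw i (cinv CX i y) $ None = - (y $ None) * pd None (l i) (rho_coord y)"
    "dform CX lw i (cinv CX i y) $ Some j = pd (Some j) (l i) (rho_coord y)"
    if y: "y \<in> cimg CX i" for y j
  proof -
    have "dform CX lw i (cinv CX i y) $ a = pd a (\<lambda>y. l i (rho_coord y)) y" for a
      using pd_cong[OF collar.open_cimg y loclw] collar.cmap_cinv[OF y] by (simp add: dform_def)
    then show "dform CX lw i (cinv CX i y) $ None = - (y $ None) * pd None (l i) (rho_coord y)"
      "dform CX lw i (cinv CX i y) $ Some j = pd (Some j) (l i) (rho_coord y)"
      using pd_rho_coord(1,2)[OF smooth_on_differentiable[OF sl loc_collar(1)[OF y]]] by simp_all
  qed
  have inv: "matrix_inv (loc CX i (g_plus h i) y) = pe_inverse (y $ None) (matrix_inv (hl i (rho_coord y)))"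
    if y: "y \<in> cimg CX i" for y
    unfolding loc_collar(4)[OF y]
    by (rule matrix_inv_pe) (use loc_collar(1,2)[OF y] hl_props(1) in auto)
  have flux: "flux CX (g_plus h) (dform CX lw) i None y = (y $ None) powr (2 - ?n) * (- Q0 (rho_coord y))"
    "flux CX (g_plus h) (dform CX lw) i (Some j) y = (y $ None) powr (1 - ?n) * Q2 j (rho_coord y)"
    and vol: "vol_density (loc CX i (g_plus h i) y) = (y $ None) powr (- ?n - 1) * v (rho_coord y)"
    if y: "y \<in> cimg CX i" for y j
  proof -
    define t z where "t = y $ None" and "z = rho_coord y"
    have t: "t > 0" unfolding t_def by (rule loc_collar(2)[OF y])
    show vol: "vol_density (loc CX i (g_plus h i) y) = (y $ None) powr (- ?n - 1) * v (rho_coord y)"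
      unfolding loc_collar(4)[OF y] vol_density_pe[OF loc_collar(2)[OF y]]
        vol_density_hl[OF loc_collar(1)[OF y]] v_def ..
    have pw: "t powr (2 - ?n) = t powr (- ?n - 1) * t\<^sup>2 * t" "t powr (1 - ?n) = t powr (- ?n - 1) * t\<^sup>2"
      using t by (simp_all add: powr_diff powr_minus power2_eq_square field_simps)
    have mv: "flux CX (g_plus h) (dform CX lw) i a y
       = t powr (- ?n - 1) * v z * (\<Sum>b\<in>UNIV. pe_inverse t (matrix_inv (hl i z)) $ a $ b * dform CX lw i (cinv CX i y) $ b)" for a
      unfolding flux_def vol inv[OF y] by (simp add: matrix_vector_mult_def t_def z_def loc_def)
    show "flux CX (g_plus h) (dform CX lw) i None y = (y $ None) powr (2 - ?n) * (- Q0 (rho_coord y))"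
      unfolding mv sum_option pe_inverse_nth dl[OF y] t_def[symmetric] z_def[symmetric] pw
      by (simp add: Q0_def)
    show "flux CX (g_plus h) (dform CX lw) i (Some j) y = (y $ None) powr (1 - ?n) * Q2 j (rho_coord y)"
      unfolding mv sum_option pe_inverse_nth dl[OF y] t_def[symmetric] z_def[symmetric] pw
      by (simp add: Q2_def Hl_def sum_distrib_left mult_ac)
  qed
  let ?y = "ext (cmap C i x) r" and ?z = "ext (cmap C i x) (- (r\<^sup>2 / 2))"
  have y: "?y \<in> cimg CX i" using x r ext_in_cimg_prod[of "cmap C i x" r "{0<..<\<epsilon>}" i] by simp
  have z: "?z \<in> cimg C1 i" using loc_collar(1)[OF y] by simp
  have cm: "cmap CX i (x, r) = ?y" by simp
  have ci: "cinv CX i ?y = (x, r)" using cinv_prod[OF y] x by simp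
  have yr: "?y $ None > 0" using r by simp
  have dQ: "Q differentiable at (rho_coord ?y)" if "smooth_on (cimg C1 i) Q" for Q :: "real^('n option) \<Rightarrow> real"
    using smooth_on_differentiable[OF that z] by simp
  have dm: "(\<lambda>z. - Q0 z) differentiable at (rho_coord ?y)" by (rule dQ[OF smooth_on_minus[OF S.open_Z sQ(1)]])
  have "pd None (flux CX (g_plus h) (dform CX lw) i None) ?y = pd None (\<lambda>y. (y $ None) powr (2 - ?n) * (- Q0 (rho_coord y))) ?y"
    by (rule pd_cong[OF collar.open_cimg y flux(1)])
  then have 1: "pd None (flux CX (g_plus h) (dform CX lw) i None) ?y
     = (2 - ?n) * r powr (1 - ?n) * - Q0 ?z + r powr (3 - ?n) * pd None Q0 ?z"
    unfolding pd_powr_rho_coord(1)[OF dm yr] pd_minus[OF dQ[OF sQ(1)]] by (simp add: algebra_simps)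
  have 2: "pd (Some j) (flux CX (g_plus h) (dform CX lw) i (Some j)) ?y = r powr (1 - ?n) * pd (Some j) (Q2 j) ?z" for j
  proof -
    have "pd (Some j) (flux CX (g_plus h) (dform CX lw) i (Some j)) ?y
      = pd (Some j) (\<lambda>y. (y $ None) powr (1 - ?n) * Q2 j (rho_coord y)) ?y"
      by (rule pd_cong[OF collar.open_cimg y flux(2)])
    then show ?thesis unfolding pd_powr_rho_coord(2)[OF dQ[OF sQ(2)] yr] by simp
  qed
  define A where "A = r powr (- ?n - 1)"
  have A: "A > 0" using r by (simp add: A_def)
  have pw: "r powr (1 - ?n) = A * r\<^sup>2" "r powr (3 - ?n) = A * r\<^sup>2 * r\<^sup>2"
    using r by (simp_all add: A_def powr_diff powr_minus power2_eq_square power3_eq_cube field_simps)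
  have vz: "v ?z > 0" unfolding v_def using S.m_pos[OF z] S.w_pos[OF z] by simp
  define X where "X = (\<Sum>j\<in>UNIV. pd (Some j) (Q2 j) ?z)"
  have "lapl CX (g_plus h) lw (x, r)
      = (\<Sum>a\<in>UNIV. pd a (flux CX (g_plus h) (dform CX lw) i a) ?y) / vol_density (loc CX i (g_plus h i) ?y)"
    unfolding lapl_def collar.codiff_eq_local(2)[OF metric_on_g_plus collar.covector_on_dform[OF smlw] p] local_codiff_def cm
    by simp
  also have "\<dots> = A * r\<^sup>2 * ((?n - 2) * Q0 ?z + r\<^sup>2 * pd None Q0 ?z + X) / (A * v ?z)"
    unfolding sum_option 1 2 vol[OF y] pw A_def[symmetric] sum_distrib_left[symmetric] X_def[symmetric] rho_coord_ext ext_nth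
    by (simp add: algebra_simps A_def[symmetric])
  also have "\<dots> = r\<^sup>2 * (((?n - 2) * Q0 ?z + r\<^sup>2 * pd None Q0 ?z + X) / v ?z)"
    using A by simp
  finally have lap: "lapl CX (g_plus h) lw (x, r) = r\<^sup>2 * (((?n - 2) * Q0 ?z + r\<^sup>2 * pd None Q0 ?z + X) / v ?z)" .
  define Y where "Y = (\<Sum>j\<in>UNIV. \<Sum>k\<in>UNIV. pd (Some j) (l i) ?z * Hl i j k ?z * pd (Some k) (l i) ?z)"
  have "form_norm2 CX (g_plus h) (dform CX lw) (x, r)
     = dform CX lw i (x, r) \<bullet> (matrix_inv (g_plus h i (x, r)) *v dform CX lw i (x, r))"
    by (simp add: form_norm2_def i_def Let_def)
  also have "g_plus h i (x, r) = loc CX i (g_plus h i) ?y" by (simp add: loc_def ci)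
  also have "dform CX lw i (x, r) \<bullet> (matrix_inv (loc CX i (g_plus h i) ?y) *v dform CX lw i (x, r))
     = r\<^sup>2 * (r\<^sup>2 * (pd None (l i) ?z)\<^sup>2 + Y)"
    unfolding inv[OF y] inner_vec_def matrix_vector_mult_def using dl[OF y]
    by (simp add: sum_option pe_inverse_nth ci Y_def Hl_def)
      (simp add: sum_distrib_left distrib_left power2_eq_square mult_ac)
  finally have nrm: "form_norm2 CX (g_plus h) (dform CX lw) (x, r) = r\<^sup>2 * (r\<^sup>2 * (pd None (l i) ?z)\<^sup>2 + Y)" .
  have "(lapl CX (g_plus h) lw (x, r) - form_norm2 CX (g_plus h) (dform CX lw) (x, r)) / r\<^sup>2
     = ((?n - 2) * Q0 ?z + r\<^sup>2 * pd None Q0 ?z + X) / v ?z - (r\<^sup>2 * (pd None (l i) ?z)\<^sup>2 + Y)"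
    unfolding lap nrm right_diff_distrib[symmetric] using r by simp
  also have "\<dots> = - potential (ml i) (Hl i) (wl i) ?z"
    using S.potential_via_log[OF z refl]
    unfolding Q0_def[abs_def] Q2_def[abs_def] v_def l_def[abs_def] X_def Y_def by simp
  also have "potential (ml i) (Hl i) (wl i) ?z = Upot (x, - (r\<^sup>2 / 2))"
    by (rule Upot_local[OF x rho_of_r[OF r], symmetric])
  finally show ?thesis .
qed

lemma generating_op_eq_Mrho:
  assumes "0 < r" "r < \<epsilon>"
  shows "generating_op C g \<epsilon> h r u x = Mrho (- (r\<^sup>2 / 2)) u x"
  using laplacian_log_w[OF assms, of x]
  by (simp add: generating_op_def Let_def Mrho_def Dop_def gr_inv_d_eq_omega)

end

section \<open>Taylor coefficients\<close>

text \<open>The Taylor coefficient of degree \<open>a\<close> in the variable \<open>s = - \<rho>/2\<close>, for which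
  \<open>\<partial>\<^sub>s = - 2 \<partial>\<^sub>\<rho>\<close>. It is a function of all the coordinates, so that it can be
  differentiated along \<open>M\<close>.\<close>

definition jet :: "nat \<Rightarrow> (real^('k::finite option) \<Rightarrow> real) \<Rightarrow> real^('k option) \<Rightarrow> real" where
  "jet a F z = ((-2) ^ a / fact a) * (pd None ^^ a) F z"

lemma jet_0 [simp]: "jet 0 F z = F z"
  by (simp add: jet_def)

lemma jet_pd_None: "- 2 * jet a (pd None F) z = real (Suc a) * jet (Suc a) F z"
proof -
  have "real (Suc a) * ((-2) ^ Suc a / fact (Suc a)) = - 2 * ((-2) ^ a / fact a)"
    by (simp add: fact_Suc del: of_nat_Suc)
  then have "real (Suc a) * ((-2) ^ Suc a / fact (Suc a)) * (pd None ^^ Suc a) F z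
     = - 2 * ((-2) ^ a / fact a) * (pd None ^^ Suc a) F z" by (simp only:)
  then show ?thesis unfolding jet_def funpow_Suc_right comp_apply by (simp only: mult.assoc)
qed

lemma iterate_pd_cong:
  assumes "open Z" "z \<in> Z" "\<And>x. x \<in> Z \<Longrightarrow> F x = G x"
  shows "(pd a ^^ k) F z = (pd a ^^ k) G z"
  using assms(2)
proof (induction k arbitrary: z)
  case (Suc k)
  from pd_cong[OF assms(1) Suc.prems Suc.IH] show ?case by simp
qed (use assms in simp)

lemma jet_cong:
  "open Z \<Longrightarrow> z \<in> Z \<Longrightarrow> (\<And>x. x \<in> Z \<Longrightarrow> F x = G x) \<Longrightarrow> jet a F z = jet a G z"
  unfolding jet_def using iterate_pd_cong[of Z z F G] by simp

lemma smooth_on_iterate_pd: "smooth_on Z F \<Longrightarrow> smooth_on Z ((pd a ^^ k) F)"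
  by (induction k) (auto intro: smooth_on_pd)

lemma smooth_on_jet: "open Z \<Longrightarrow> smooth_on Z F \<Longrightarrow> smooth_on Z (jet a F)"
  unfolding jet_def by (intro smooth_on_mult smooth_on_const smooth_on_iterate_pd)

lemma jet_add:
  assumes Z: "open Z" "z \<in> Z" and "smooth_on Z F" "smooth_on Z G"
  shows "jet a (\<lambda>z. F z + G z) z = jet a F z + jet a G z"
  using assms(3,4)
proof (induction a arbitrary: F G)
  case (Suc a)
  have "real (Suc a) * jet (Suc a) (\<lambda>z. F z + G z) z = - 2 * jet a (pd None (\<lambda>z. F z + G z)) z"
    by (rule jet_pd_None[symmetric])
  also have "jet a (pd None (\<lambda>z. F z + G z)) z = jet a (\<lambda>z. pd None F z + pd None G z) z"
    by (rule jet_cong[OF Z]) (intro pd_add smooth_on_differentiable[OF Suc.prems(1)] smooth_on_differentiable[OF Suc.prems(2)])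
  also have "\<dots> = jet a (pd None F) z + jet a (pd None G) z"
    by (rule Suc.IH) (intro smooth_on_pd Suc.prems)+
  finally have "real (Suc a) * jet (Suc a) (\<lambda>z. F z + G z) z = real (Suc a) * (jet (Suc a) F z + jet (Suc a) G z)"
    unfolding distrib_left jet_pd_None .
  then show ?case by (simp only: mult_cancel_left) simp
qed simp

lemma jet_mult:
  assumes Z: "open Z" "z \<in> Z" and "smooth_on Z F" "smooth_on Z G"
  shows "jet a (\<lambda>z. F z * G z) z = (\<Sum>b\<le>a. jet b F z * jet (a - b) G z)"
  using assms(3,4)
proof (induction a arbitrary: F G)
  case (Suc a)
  define X where "X b = jet b F z * jet (Suc a - b) G z" for b
  have "real (Suc a) * jet (Suc a) (\<lambda>z. F z * G z) z = - 2 * jet a (pd None (\<lambda>z. F z * G z)) z"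
    by (rule jet_pd_None[symmetric])
  also have "jet a (pd None (\<lambda>z. F z * G z)) z = jet a (\<lambda>z. F z * pd None G z + pd None F z * G z) z"
    by (rule jet_cong[OF Z]) (intro pd_mult smooth_on_differentiable[OF Suc.prems(1)] smooth_on_differentiable[OF Suc.prems(2)])
  also have "\<dots> = jet a (\<lambda>z. F z * pd None G z) z + jet a (\<lambda>z. pd None F z * G z) z"
    by (intro jet_add[OF Z] smooth_on_mult smooth_on_pd Z Suc.prems)
  also have "jet a (\<lambda>z. F z * pd None G z) z = (\<Sum>b\<le>a. jet b F z * jet (a - b) (pd None G) z)"
    by (rule Suc.IH[OF Suc.prems(1) smooth_on_pd[OF Suc.prems(2)]])
  also have "jet a (\<lambda>z. pd None F z * G z) z = (\<Sum>b\<le>a. jet b (pd None F) z * jet (a - b) G z)"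
    by (rule Suc.IH[OF smooth_on_pd[OF Suc.prems(1)] Suc.prems(2)])
  finally have "real (Suc a) * jet (Suc a) (\<lambda>z. F z * G z) z
     = (\<Sum>b\<le>a. jet b F z * (- 2 * jet (a - b) (pd None G) z)) + (\<Sum>b\<le>a. (- 2 * jet b (pd None F) z) * jet (a - b) G z)"
    by (simp add: distrib_left sum_distrib_left mult_ac)
  also have "(\<Sum>b\<le>a. jet b F z * (- 2 * jet (a - b) (pd None G) z)) = (\<Sum>b\<le>a. real (Suc a - b) * X b)"
    unfolding jet_pd_None X_def by (intro sum.cong refl) (simp add: Suc_diff_le)
  also have "\<dots> = (\<Sum>b\<le>Suc a. real (Suc a - b) * X b)" by simp
  also have "(\<Sum>b\<le>a. (- 2 * jet b (pd None F) z) * jet (a - b) G z) = (\<Sum>b\<le>a. real (Suc b) * X (Suc b))"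
    unfolding jet_pd_None X_def by (simp add: mult.assoc)
  also have "\<dots> = (\<Sum>b\<le>Suc a. real b * X b)" by (subst sum.atMost_Suc_shift) simp
  also have "(\<Sum>b\<le>Suc a. real (Suc a - b) * X b) + (\<Sum>b\<le>Suc a. real b * X b) = (\<Sum>b\<le>Suc a. real (Suc a) * X b)"
    unfolding sum.distrib[symmetric] by (intro sum.cong refl) (simp add: of_nat_diff algebra_simps)
  also have "\<dots> = real (Suc a) * (\<Sum>b\<le>Suc a. X b)" by (rule sum_distrib_left[symmetric])
  finally have "jet (Suc a) (\<lambda>z. F z * G z) z = (\<Sum>b\<le>Suc a. X b)" by (simp only: mult_cancel_left) simp
  then show ?case unfolding X_def .
qed simp

lemma jet_const: "jet a (\<lambda>z. c) z = (if a = 0 then c else 0)"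
proof (cases a)
  case (Suc b)
  have "(pd None ^^ b) (pd None (\<lambda>z::real^('a option). c)) z = (pd None ^^ b) (\<lambda>z. 0) z"
    by (rule iterate_pd_cong[OF open_UNIV]) simp_all
  also have "(pd None ^^ k) (\<lambda>z::real^('a option). 0) z = 0" for k z
  proof (induction k arbitrary: z)
    case (Suc k)
    have "(pd None ^^ k) (\<lambda>z::real^('a option). 0) = (\<lambda>z. 0)" by (rule ext) (rule Suc.IH)
    then show ?case by simp
  qed simp
  finally show ?thesis using Suc by (simp add: jet_def funpow_swap1)
qed simp

lemma jet_cmult:
  assumes "open Z" "z \<in> Z" "smooth_on Z F"
  shows "jet a (\<lambda>z. c * F z) z = c * jet a F z"
proof -
  have "jet a (\<lambda>z. c * F z) z = (\<Sum>b\<le>a. jet b (\<lambda>z. c) z * jet (a - b) F z)"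
    by (rule jet_mult[OF assms(1,2) smooth_on_const assms(3)])
  also have "\<dots> = (\<Sum>b\<le>a. if b = 0 then c * jet a F z else 0)"
    by (intro sum.cong refl) (auto simp: jet_const)
  finally show ?thesis by simp
qed

lemma jet_sum:
  assumes Z: "open Z" "z \<in> Z" and "finite I" "\<And>i. i \<in> I \<Longrightarrow> smooth_on Z (F i)"
  shows "jet a (\<lambda>z. \<Sum>i\<in>I. F i z) z = (\<Sum>i\<in>I. jet a (F i) z)"
  using assms(3,4)
proof (induction I)
  case (insert i I)
  have "smooth_on Z (\<lambda>z. \<Sum>i\<in>I. F i z)" by (intro smooth_on_sum Z insert.prems) simp
  with insert show ?case using jet_add[OF Z insert.prems[of i]] by simp
qed (simp add: jet_const)

lemma jet_pd_commute:
  assumes Z: "open Z" "z \<in> Z" and F: "smooth_on Z F"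
  shows "jet a (pd c F) z = pd c (jet a F) z"
proof -
  have it: "(pd None ^^ a) (pd c F) z = pd c ((pd None ^^ a) F) z" if "z \<in> Z" for z
    using that
  proof (induction a arbitrary: z)
    case (Suc a)
    have "(pd None ^^ Suc a) (pd c F) z = pd None (pd c ((pd None ^^ a) F)) z"
      using pd_cong[OF Z(1) Suc.prems Suc.IH] by simp
    also have "\<dots> = pd c (pd None ((pd None ^^ a) F)) z"
      by (rule pd_commute[OF Z(1) smooth_on_iterate_pd[OF F] Suc.prems])
    finally show ?case by simp
  qed simp
  have "pd c (jet a F) z = ((-2) ^ a / fact a) * pd c ((pd None ^^ a) F) z"
    unfolding jet_def by (rule pd_cmult[OF smooth_on_differentiable[OF smooth_on_iterate_pd[OF F] Z(2)]])
  then show ?thesis by (simp add: jet_def it[OF Z(2)])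
qed

lemma jet_coord:
  assumes "z $ None = 0"
  shows "jet b (\<lambda>z. z $ None) z = (if b = 1 then - 2 else 0)"
proof (cases b)
  case (Suc c)
  have "jet c (pd None (\<lambda>z::real^('a option). z $ None)) z = jet c (\<lambda>z. 1) z"
    by (rule jet_cong[OF open_UNIV]) simp_all
  then have "real (Suc c) * jet (Suc c) (\<lambda>z. z $ None) z = - 2 * (if c = 0 then 1 else 0)"
    unfolding jet_pd_None[symmetric] jet_const by simp
  then show ?thesis using Suc by (cases "c = 0") auto
qed (use assms in simp)

definition first_order_coef :: "(real^('k::finite option) \<Rightarrow> real) \<Rightarrow> ('k \<Rightarrow> 'k \<Rightarrow> real^('k option) \<Rightarrow> real)
    \<Rightarrow> 'k \<Rightarrow> real^('k option) \<Rightarrow> real" where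
  "first_order_coef m H k z = (\<Sum>j\<in>UNIV. pd (Some j) (\<lambda>z. m z * H j k z) z) / m z"

context slab
begin

lemma smooth_first_order_coef: "smooth_on Z (first_order_coef m H k)"
proof -
  have "m z \<noteq> 0" if "z \<in> Z" for z using m_pos[OF that] by simp
  then show ?thesis unfolding first_order_coef_def
    by (intro smooth_on_divide smooth_on_sum smooth_on_pd smooth_on_mult open_Z smooth_m smooth_H)
qed

lemma adiv_expand:
  assumes F: "smooth_on Z F" and z: "z \<in> Z"
  shows "adiv m H F z = (\<Sum>j\<in>UNIV. \<Sum>k\<in>UNIV. H j k z * pd (Some j) (pd (Some k) F) z)
     + (\<Sum>k\<in>UNIV. first_order_coef m H k z * pd (Some k) F z)"
proof -
  note d = smooth_on_differentiable[OF _ z]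
  have "pd (Some j) (aflux m H F j) z = (\<Sum>k\<in>UNIV. (m z * H j k z) * pd (Some j) (pd (Some k) F) z
      + pd (Some j) (\<lambda>z. m z * H j k z) z * pd (Some k) F z)" for j
  proof -
    have "aflux m H F j = (\<lambda>z. \<Sum>k\<in>UNIV. (m z * H j k z) * pd (Some k) F z)"
      by (rule ext) (simp add: aflux_def sum_distrib_left mult.assoc)
    then have "pd (Some j) (aflux m H F j) z = pd (Some j) (\<lambda>z. \<Sum>k\<in>UNIV. (m z * H j k z) * pd (Some k) F z) z"
      by simp
    also have "\<dots> = (\<Sum>k\<in>UNIV. pd (Some j) (\<lambda>z. (m z * H j k z) * pd (Some k) F z) z)"
      by (intro pd_sum d smooth_on_mult smooth_on_pd open_Z smooth_m smooth_H F)
    also have "\<dots> = (\<Sum>k\<in>UNIV. (m z * H j k z) * pd (Some j) (pd (Some k) F) z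
      + pd (Some j) (\<lambda>z. m z * H j k z) z * pd (Some k) F z)"
      by (rule sum.cong[OF refl], rule pd_mult)
        (intro d smooth_on_mult smooth_on_pd open_Z smooth_m smooth_H F)+
    finally show ?thesis .
  qed
  then have "adiv m H F z = (\<Sum>j\<in>UNIV. \<Sum>k\<in>UNIV. H j k z * pd (Some j) (pd (Some k) F) z)
     + (\<Sum>j\<in>UNIV. \<Sum>k\<in>UNIV. pd (Some j) (\<lambda>z. m z * H j k z) z * pd (Some k) F z) / m z"
    using m_pos[OF z] by (simp add: adiv_def sum.distrib add_divide_distrib sum_divide_distrib mult.assoc)
  also have "(\<Sum>j\<in>UNIV. \<Sum>k\<in>UNIV. pd (Some j) (\<lambda>z. m z * H j k z) z * pd (Some k) F z)
     = (\<Sum>k\<in>UNIV. \<Sum>j\<in>UNIV. pd (Some j) (\<lambda>z. m z * H j k z) z * pd (Some k) F z)"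
    by (rule sum.swap)
  finally show ?thesis
    by (simp add: first_order_coef_def sum_divide_distrib sum_distrib_right)
qed

text \<open>The coefficient of \<open>s\<^sup>b\<close> in the operator \<open>adiv + potential\<close>. It differentiates along \<open>M\<close>
  only.\<close>

definition Mjet :: "nat \<Rightarrow> (real^('k option) \<Rightarrow> real) \<Rightarrow> real^('k option) \<Rightarrow> real" where
  "Mjet b F z = (\<Sum>j\<in>UNIV. \<Sum>k\<in>UNIV. jet b (H j k) z * pd (Some j) (pd (Some k) F) z)
     + (\<Sum>k\<in>UNIV. jet b (first_order_coef m H k) z * pd (Some k) F z) + jet b (potential m H w) z * F z"

text \<open>The coefficients of the operator and the derivatives of \<open>F\<close> along \<open>M\<close> are expanded by the Leibniz
  rule; derivatives along \<open>M\<close> commute with \<open>\<partial>\<^sub>\<rho>\<close>.\<close>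

lemma jet_M:
  assumes F: "smooth_on Z F" and z: "z \<in> Z"
  shows "jet a (\<lambda>z. adiv m H F z + potential m H w z * F z) z = (\<Sum>b\<le>a. Mjet b (jet (a - b) F) z)"
proof -
  note sm = smooth_on_mult smooth_on_sum smooth_on_pd smooth_H smooth_first_order_coef smooth_on_potential F open_Z
  have J2: "jet c (pd (Some j) (pd (Some k) F)) z = pd (Some j) (pd (Some k) (jet c F)) z" for c j k
  proof -
    have "jet c (pd (Some j) (pd (Some k) F)) z = pd (Some j) (jet c (pd (Some k) F)) z"
      by (rule jet_pd_commute[OF open_Z z smooth_on_pd[OF F]])
    also have "\<dots> = pd (Some j) (pd (Some k) (jet c F)) z"
      by (rule pd_cong[OF open_Z z]) (rule jet_pd_commute[OF open_Z _ F])
    finally show ?thesis .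
  qed
  have J1: "jet c (pd (Some k) F) z = pd (Some k) (jet c F) z" for c k by (rule jet_pd_commute[OF open_Z z F])
  have "jet a (\<lambda>z. adiv m H F z + potential m H w z * F z) z
     = jet a (\<lambda>z. ((\<Sum>j\<in>UNIV. \<Sum>k\<in>UNIV. H j k z * pd (Some j) (pd (Some k) F) z)
         + (\<Sum>k\<in>UNIV. first_order_coef m H k z * pd (Some k) F z)) + potential m H w z * F z) z"
    by (rule jet_cong[OF open_Z z]) (simp add: adiv_expand[OF F])
  also have "\<dots> = jet a (\<lambda>z. (\<Sum>j\<in>UNIV. \<Sum>k\<in>UNIV. H j k z * pd (Some j) (pd (Some k) F) z)
         + (\<Sum>k\<in>UNIV. first_order_coef m H k z * pd (Some k) F z)) z + jet a (\<lambda>z. potential m H w z * F z) z"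
    by (intro jet_add[OF open_Z z] smooth_on_add sm)
  also have "jet a (\<lambda>z. (\<Sum>j\<in>UNIV. \<Sum>k\<in>UNIV. H j k z * pd (Some j) (pd (Some k) F) z)
         + (\<Sum>k\<in>UNIV. first_order_coef m H k z * pd (Some k) F z)) z
      = jet a (\<lambda>z. \<Sum>j\<in>UNIV. \<Sum>k\<in>UNIV. H j k z * pd (Some j) (pd (Some k) F) z) z
         + jet a (\<lambda>z. \<Sum>k\<in>UNIV. first_order_coef m H k z * pd (Some k) F z) z"
    by (intro jet_add[OF open_Z z] sm)
  also have "jet a (\<lambda>z. \<Sum>j\<in>UNIV. \<Sum>k\<in>UNIV. H j k z * pd (Some j) (pd (Some k) F) z) z
      = (\<Sum>j\<in>UNIV. \<Sum>k\<in>UNIV. jet a (\<lambda>z. H j k z * pd (Some j) (pd (Some k) F) z) z)"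
  proof -
    have "jet a (\<lambda>z. \<Sum>j\<in>UNIV. \<Sum>k\<in>UNIV. H j k z * pd (Some j) (pd (Some k) F) z) z
      = (\<Sum>j\<in>UNIV. jet a (\<lambda>z. \<Sum>k\<in>UNIV. H j k z * pd (Some j) (pd (Some k) F) z) z)"
      by (intro jet_sum[OF open_Z z] finite sm)
    also have "\<dots> = (\<Sum>j\<in>UNIV. \<Sum>k\<in>UNIV. jet a (\<lambda>z. H j k z * pd (Some j) (pd (Some k) F) z) z)"
      by (rule sum.cong[OF refl]) (intro jet_sum[OF open_Z z] finite sm)
    finally show ?thesis .
  qed
  also have "jet a (\<lambda>z. \<Sum>k\<in>UNIV. first_order_coef m H k z * pd (Some k) F z) z
      = (\<Sum>k\<in>UNIV. jet a (\<lambda>z. first_order_coef m H k z * pd (Some k) F z) z)"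
    by (intro jet_sum[OF open_Z z] finite sm)
  also have "(\<Sum>j\<in>UNIV. \<Sum>k\<in>UNIV. jet a (\<lambda>z. H j k z * pd (Some j) (pd (Some k) F) z) z)
     = (\<Sum>b\<le>a. \<Sum>j\<in>UNIV. \<Sum>k\<in>UNIV. jet b (H j k) z * pd (Some j) (pd (Some k) (jet (a - b) F)) z)"
  proof -
    have "jet a (\<lambda>z. H j k z * pd (Some j) (pd (Some k) F) z) z
      = (\<Sum>b\<le>a. jet b (H j k) z * pd (Some j) (pd (Some k) (jet (a - b) F)) z)" for j k
      unfolding J2[symmetric] by (intro jet_mult[OF open_Z z] sm)
    then have "(\<Sum>j\<in>UNIV. \<Sum>k\<in>UNIV. jet a (\<lambda>z. H j k z * pd (Some j) (pd (Some k) F) z) z)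
      = (\<Sum>j\<in>UNIV. \<Sum>k\<in>UNIV. \<Sum>b\<le>a. jet b (H j k) z * pd (Some j) (pd (Some k) (jet (a - b) F)) z)"
      by (simp only:)
    also have "\<dots> = (\<Sum>j\<in>UNIV. \<Sum>b\<le>a. \<Sum>k\<in>UNIV. jet b (H j k) z * pd (Some j) (pd (Some k) (jet (a - b) F)) z)"
      by (rule sum.cong[OF refl], rule sum.swap)
    also have "\<dots> = (\<Sum>b\<le>a. \<Sum>j\<in>UNIV. \<Sum>k\<in>UNIV. jet b (H j k) z * pd (Some j) (pd (Some k) (jet (a - b) F)) z)"
      by (rule sum.swap)
    finally show ?thesis .
  qed
  also have "(\<Sum>k\<in>UNIV. jet a (\<lambda>z. first_order_coef m H k z * pd (Some k) F z) z)
     = (\<Sum>b\<le>a. \<Sum>k\<in>UNIV. jet b (first_order_coef m H k) z * pd (Some k) (jet (a - b) F) z)"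
  proof -
    have "jet a (\<lambda>z. first_order_coef m H k z * pd (Some k) F z) z
      = (\<Sum>b\<le>a. jet b (first_order_coef m H k) z * pd (Some k) (jet (a - b) F) z)" for k
      unfolding J1[symmetric] by (intro jet_mult[OF open_Z z] sm)
    then show ?thesis by (simp only:) (rule sum.swap)
  qed
  also have "jet a (\<lambda>z. potential m H w z * F z) z = (\<Sum>b\<le>a. jet b (potential m H w) z * jet (a - b) F z)"
    by (intro jet_mult[OF open_Z z] sm)
  finally show ?thesis unfolding Mjet_def sum.distrib .
qed

end

section \<open>The coefficients of the generating operator\<close>

context pe_family
begin

text \<open>The Taylor coefficient in \<open>s\<close> at \<open>\<rho> = 0\<close>, as a function on \<open>M\<close>.\<close>

definition Tj :: "nat \<Rightarrow> ('m \<times> real \<Rightarrow> real) \<Rightarrow> 'm \<Rightarrow> real" where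
  "Tj a \<phi> x = ((-2) ^ a / fact a) * (deriv ^^ a) (\<lambda>\<rho>. \<phi> (x, \<rho>)) 0"

lemma Tj_local:
  assumes "smooth_fun C1 \<phi>" "x \<in> cdom C i"
  shows "Tj a \<phi> x = jet a (loc C1 i \<phi>) (ext (cmap C i x) 0)"
  unfolding Tj_def jet_def deriv_iterate_local(1)[OF assms zero_in_R] ..

lemma ext_zero_in: "y \<in> cimg C i \<Longrightarrow> ext y 0 \<in> cimg C1 i"
  using zero_in_R ext_in_cimg_prod by blast

lemma loc_Tj:
  assumes "smooth_fun C1 \<phi>" "y \<in> cimg C i"
  shows "loc C i (Tj a \<phi>) y = jet a (loc C1 i \<phi>) (ext y 0)"
  using Tj_local[OF assms(1) cinv_in[OF assms(2)], of a] cmap_cinv[OF assms(2)] by (simp add: loc_def)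

lemma smooth_on_slice_zero:
  assumes "smooth_on (cimg C1 i) F"
  shows "smooth_on (cimg C i) (\<lambda>y. F (ext y 0))"
proof (rule smooth_on_compose[where f = "\<lambda>y. ext y 0" and g = F and T = "cimg C1 i", OF open_cimg])
  show "smooth_on (cimg C i) (\<lambda>y. ext y 0)"
    by (intro smooth_on_ext open_cimg smooth_on_const smooth_on_linear_map bounded_linear_vec_nth)
qed (use assms ext_zero_in in auto)

lemma smooth_Tj:
  assumes "smooth_fun C1 \<phi>"
  shows "smooth_fun C (Tj a \<phi>)"
  unfolding smooth_fun_def
proof
  fix i
  have "smooth_on (cimg C1 i) (loc C1 i \<phi>)" using assms unfolding smooth_fun_def by blast
  from smooth_on_slice_zero[OF smooth_on_jet[OF slab1.open_cimg this]]
  show "smooth_on (cimg C i) (loc C i (Tj a \<phi>))"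
    by (rule smooth_on_congI[OF open_cimg]) (rule loc_Tj[OF assms])
qed

lemma smooth_Mrho:
  assumes \<phi>: "smooth_fun C1 \<phi>"
  shows "smooth_fun C1 (\<lambda>(x, \<rho>). Mrho \<rho> (\<lambda>x. \<phi> (x, \<rho>)) x)"
    and "z \<in> cimg C1 i \<Longrightarrow> loc C1 i (\<lambda>(x, \<rho>). Mrho \<rho> (\<lambda>x. \<phi> (x, \<rho>)) x) z
      = adiv (ml i) (Hl i) (loc C1 i \<phi>) z + potential (ml i) (Hl i) (wl i) z * loc C1 i \<phi> z"
proof -
  define M where "M = (\<lambda>i z. adiv (ml i) (Hl i) (loc C1 i \<phi>) z + potential (ml i) (Hl i) (wl i) z * loc C1 i \<phi> z)"
  have M: "(\<lambda>(x, \<rho>). Mrho \<rho> (\<lambda>x. \<phi> (x, \<rho>)) x) (x, \<rho>) = M i (ext (cmap C i x) \<rho>)"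
    if "x \<in> cdom C i" "\<rho> \<in> R" for i x \<rho>
    unfolding M_def using Mrho_local[OF \<phi> that] by simp
  have "smooth_on (cimg C1 i) (M i)" for i
  proof -
    interpret S: slab "cimg C1 i" "ml i" "wl i" "Hl i" by (rule slab_local)
    have "smooth_on (cimg C1 i) (loc C1 i \<phi>)" using \<phi> unfolding smooth_fun_def by blast
    then show ?thesis unfolding M_def
      by (intro smooth_on_add smooth_on_mult S.open_Z S.smooth_on_adiv S.smooth_on_potential)
  qed
  with M show "smooth_fun C1 (\<lambda>(x, \<rho>). Mrho \<rho> (\<lambda>x. \<phi> (x, \<rho>)) x)"
    by (rule smooth_fun_localI[where \<Phi> = M])
  show "loc C1 i (\<lambda>(x, \<rho>). Mrho \<rho> (\<lambda>x. \<phi> (x, \<rho>)) x) z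
      = adiv (ml i) (Hl i) (loc C1 i \<phi>) z + potential (ml i) (Hl i) (wl i) z * loc C1 i \<phi> z"
    if "z \<in> cimg C1 i"
    using loc_local[where \<Phi> = "M i" and i = i, OF that M] unfolding M_def .
qed

text \<open>The coefficient of \<open>s\<^bsup>j-1\<^esup>\<close> in \<open>M(\<rho>)\<close>, obtained from functions that are constant in \<open>\<rho>\<close>. The
  value at \<open>j = 0\<close> is a default.\<close>

definition mu :: "nat \<Rightarrow> ('m \<Rightarrow> real) \<Rightarrow> 'm \<Rightarrow> real" where
  "mu j u = (case j of 0 \<Rightarrow> (\<lambda>x. 0) | Suc b \<Rightarrow> Tj b (\<lambda>(x, \<rho>). Mrho \<rho> u x))"

text \<open>The coefficients of the coordinate expression of \<open>mu (Suc b)\<close>.\<close>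

definition c2 :: "'i \<Rightarrow> nat \<Rightarrow> 'n \<Rightarrow> 'n \<Rightarrow> real^'n \<Rightarrow> real" where
  "c2 i b j k y = jet b (Hl i j k) (ext y 0)"

definition c1 :: "'i \<Rightarrow> nat \<Rightarrow> 'n \<Rightarrow> real^'n \<Rightarrow> real" where
  "c1 i b k y = jet b (first_order_coef (ml i) (Hl i) k) (ext y 0)"

definition c0 :: "'i \<Rightarrow> nat \<Rightarrow> real^'n \<Rightarrow> real" where
  "c0 i b y = jet b (potential (ml i) (Hl i) (wl i)) (ext y 0)"

definition mu_loc :: "'i \<Rightarrow> nat \<Rightarrow> (real^'n \<Rightarrow> real) \<Rightarrow> real^'n \<Rightarrow> real" where
  "mu_loc i b f y = (\<Sum>j\<in>UNIV. \<Sum>k\<in>UNIV. c2 i b j k y * pd j (pd k f) y)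
     + (\<Sum>k\<in>UNIV. c1 i b k y * pd k f y) + c0 i b y * f y"

lemma smooth_coefs:
  "smooth_on (cimg C i) (c2 i b j k)" "smooth_on (cimg C i) (c1 i b k)" "smooth_on (cimg C i) (c0 i b)"
proof -
  interpret S: slab "cimg C1 i" "ml i" "wl i" "Hl i" by (rule slab_local)
  show "smooth_on (cimg C i) (c2 i b j k)" "smooth_on (cimg C i) (c1 i b k)" "smooth_on (cimg C i) (c0 i b)"
    unfolding c2_def[abs_def] c1_def[abs_def] c0_def[abs_def]
    by (intro smooth_on_slice_zero smooth_on_jet S.open_Z S.smooth_H S.smooth_first_order_coef S.smooth_on_potential)+
qed

lemma Mjet_slice:
  assumes F: "smooth_on (cimg C1 i) F" and y: "y \<in> cimg C i"
    and f: "\<And>y. y \<in> cimg C i \<Longrightarrow> F (ext y 0) = f y"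
  shows "slab.Mjet (ml i) (wl i) (Hl i) b F (ext y 0) = mu_loc i b f y"
proof -
  interpret S: slab "cimg C1 i" "ml i" "wl i" "Hl i" by (rule slab_local)
  have 1: "pd (Some k) F (ext y 0) = pd k f y" if y: "y \<in> cimg C i" for k y
  proof -
    have "pd (Some k) F (ext y 0) = pd k (\<lambda>y. F (ext y 0)) y"
      by (rule pd_slice[OF smooth_on_differentiable[OF F ext_zero_in[OF y]], symmetric])
    also have "\<dots> = pd k f y" by (rule pd_cong[OF open_cimg y f])
    finally show ?thesis .
  qed
  have "pd (Some j) (pd (Some k) F) (ext y 0) = pd j (pd k f) y" for j k
  proof -
    have "pd (Some j) (pd (Some k) F) (ext y 0) = pd j (\<lambda>y. pd (Some k) F (ext y 0)) y"
      by (rule pd_slice[OF smooth_on_differentiable[OF smooth_on_pd[OF F] ext_zero_in[OF y]], symmetric])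
    also have "\<dots> = pd j (pd k f) y" by (rule pd_cong[OF open_cimg y 1])
    finally show ?thesis .
  qed
  then show ?thesis unfolding S.Mjet_def mu_loc_def c2_def c1_def c0_def 1[OF y] f[OF y] by simp
qed

lemma mu_loc_zero: "mu_loc i b (\<lambda>y. 0) y = 0"
proof -
  have "pd k (\<lambda>y::real^'n. 0) = (\<lambda>y. 0)" for k by (rule ext) simp
  then show ?thesis by (simp add: mu_loc_def)
qed

lemma Tj_Mrho_aux:
  assumes \<phi>: "smooth_fun C1 \<phi>" and y: "y \<in> cimg C i"
  shows "loc C i (Tj a (\<lambda>(x, \<rho>). Mrho \<rho> (\<lambda>x. \<phi> (x, \<rho>)) x)) y
    = (\<Sum>b\<le>a. mu_loc i b (loc C i (Tj (a - b) \<phi>)) y)"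
proof -
  interpret S: slab "cimg C1 i" "ml i" "wl i" "Hl i" by (rule slab_local)
  have F: "smooth_on (cimg C1 i) (loc C1 i \<phi>)" using \<phi> unfolding smooth_fun_def by blast
  have "loc C i (Tj a (\<lambda>(x, \<rho>). Mrho \<rho> (\<lambda>x. \<phi> (x, \<rho>)) x)) y
    = jet a (loc C1 i (\<lambda>(x, \<rho>). Mrho \<rho> (\<lambda>x. \<phi> (x, \<rho>)) x)) (ext y 0)"
    by (rule loc_Tj[OF smooth_Mrho(1)[OF \<phi>] y])
  also have "\<dots> = jet a (\<lambda>z. adiv (ml i) (Hl i) (loc C1 i \<phi>) z + potential (ml i) (Hl i) (wl i) z * loc C1 i \<phi> z) (ext y 0)"
    by (rule jet_cong[OF S.open_Z ext_zero_in[OF y] smooth_Mrho(2)[OF \<phi>]])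
  also have "\<dots> = (\<Sum>b\<le>a. S.Mjet b (jet (a - b) (loc C1 i \<phi>)) (ext y 0))"
    by (rule S.jet_M[OF F ext_zero_in[OF y]])
  also have "\<dots> = (\<Sum>b\<le>a. mu_loc i b (loc C i (Tj (a - b) \<phi>)) y)"
    by (rule sum.cong[OF refl], rule Mjet_slice[OF smooth_on_jet[OF S.open_Z F] y]) (rule loc_Tj[OF \<phi>, symmetric])
  finally show ?thesis .
qed

lemma loc_mu:
  assumes u: "smooth_fun C u" and y: "y \<in> cimg C i"
  shows "loc C i (mu (Suc b) u) y = mu_loc i b (loc C i u) y"
proof -
  define \<phi> where "\<phi> = (\<lambda>(x::'m, \<rho>::real). u x)"
  have \<phi>: "smooth_fun C1 \<phi>" unfolding \<phi>_def by (rule smooth_fun_const_ext[OF u])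
  have T0: "Tj c \<phi> = (if c = 0 then u else (\<lambda>x. 0))" for c
  proof -
    have "(deriv ^^ Suc e) (\<lambda>\<rho>. k) \<rho> = 0" for e and k \<rho> :: real
    proof (induction e arbitrary: \<rho>)
      case (Suc e)
      have "(deriv ^^ Suc e) (\<lambda>\<rho>. k) = (\<lambda>\<rho>. 0)" by (rule ext) (rule Suc.IH)
      then show ?case by simp
    qed simp
    then show ?thesis by (cases c) (auto simp: Tj_def \<phi>_def simp del: funpow.simps(2))
  qed
  have "loc C i (mu (Suc b) u) y = loc C i (Tj b (\<lambda>(x, \<rho>). Mrho \<rho> (\<lambda>x. \<phi> (x, \<rho>)) x)) y"
    by (simp add: mu_def \<phi>_def)
  also have "\<dots> = (\<Sum>c\<le>b. mu_loc i c (loc C i (Tj (b - c) \<phi>)) y)" by (rule Tj_Mrho_aux[OF \<phi> y])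
  also have "\<dots> = (\<Sum>c\<le>b. if c = b then mu_loc i b (loc C i u) y else 0)"
  proof (rule sum.cong[OF refl])
    fix c assume "c \<in> {..b}"
    moreover have "loc C i (\<lambda>x. 0 :: real) = (\<lambda>y. 0)" by (auto simp: loc_def)
    ultimately show "mu_loc i c (loc C i (Tj (b - c) \<phi>)) y = (if c = b then mu_loc i b (loc C i u) y else 0)"
      by (simp add: T0 mu_loc_zero)
  qed
  finally show ?thesis by simp
qed

lemma loc_at: "x \<in> cdom C i \<Longrightarrow> u x = loc C i u (cmap C i x)"
  by simp

lemma smooth_mu: "smooth_fun C u \<Longrightarrow> smooth_fun C (mu j u)"
proof (cases j)
  case 0
  then show ?thesis by (simp add: mu_def smooth_fun_def loc_def comp_def)
next
  case (Suc b)
  assume "smooth_fun C u"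
  from smooth_Mrho(1)[OF smooth_fun_const_ext[OF this]] have "smooth_fun C1 (\<lambda>(x, \<rho>). Mrho \<rho> u x)" by simp
  from smooth_Tj[OF this] show ?thesis using Suc by (simp add: mu_def)
qed

lemma Tj_Mrho:
  assumes \<phi>: "smooth_fun C1 \<phi>"
  shows "Tj a (\<lambda>(x, \<rho>). Mrho \<rho> (\<lambda>x. \<phi> (x, \<rho>)) x) x = (\<Sum>b\<le>a. mu (Suc b) (Tj (a - b) \<phi>) x)"
proof -
  define i where "i = chart_at C x"
  have x: "x \<in> cdom C i" unfolding i_def by (rule chart_at_in)
  then have y: "cmap C i x \<in> cimg C i" by blast
  show ?thesis
    unfolding loc_at[OF x, of "Tj a _"] Tj_Mrho_aux[OF \<phi> y] loc_at[OF x, of "mu _ _"]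
    by (rule sum.cong[OF refl]) (rule loc_mu[OF smooth_Tj[OF \<phi>] y, symmetric])
qed

text \<open>In the variable \<open>s\<close> the operator \<open>Sop \<gamma>\<close> is \<open>s \<partial>\<^sup>2 - k \<partial> + M(s)\<close>.\<close>

lemma Tj_Sop:
  assumes \<phi>: "smooth_fun C1 \<phi>" and k: "2 * \<gamma> + real CARD('n) - 2 = 2 * k"
  shows "Tj a (Sop \<gamma> \<phi>) x = (real (Suc a) * (real a - k)) * Tj (Suc a) \<phi> x + (\<Sum>b\<le>a. mu (Suc b) (Tj (a - b) \<phi>) x)"
proof -
  define i where "i = chart_at C x"
  have x: "x \<in> cdom C i" unfolding i_def by (rule chart_at_in)
  let ?z = "ext (cmap C i x) 0" and ?\<Phi> = "loc C1 i \<phi>"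
  interpret S: slab "cimg C1 i" "ml i" "wl i" "Hl i" by (rule slab_local)
  have z: "?z \<in> cimg C1 i" using ext_zero_in x by blast
  have F: "smooth_on (cimg C1 i) ?\<Phi>" using \<phi> unfolding smooth_fun_def by blast
  have N: "smooth_on (cimg C1 i) (\<lambda>z. z $ None)" by (rule smooth_on_linear_map[OF S.open_Z bounded_linear_vec_nth])
  let ?P = "pd None (pd None ?\<Phi>)"
  let ?M = "\<lambda>z. adiv (ml i) (Hl i) ?\<Phi> z + potential (ml i) (Hl i) (wl i) z * ?\<Phi> z"
  have sM: "smooth_on (cimg C1 i) ?M"
    by (intro smooth_on_add smooth_on_mult S.open_Z S.smooth_on_adiv S.smooth_on_potential F)
  have sP: "smooth_on (cimg C1 i) (\<lambda>z. z $ None * ?P z)" by (intro smooth_on_mult smooth_on_pd S.open_Z N F)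
  have "Tj a (Sop \<gamma> \<phi>) x = jet a (loc C1 i (Sop \<gamma> \<phi>)) ?z" by (rule Tj_local[OF smooth_fun_Sop[OF \<phi>] x])
  also have "\<dots> = jet a (\<lambda>z. (- 2 * (z $ None * ?P z) + (2 * k) * pd None ?\<Phi> z) + ?M z) ?z"
  proof (rule jet_cong[OF S.open_Z z])
    fix z' assume "z' \<in> cimg C1 i"
    then show "loc C1 i (Sop \<gamma> \<phi>) z' = (- 2 * (z' $ None * ?P z') + (2 * k) * pd None ?\<Phi> z') + ?M z'"
      by (rule loc_local[where \<Phi> = "\<lambda>z. (- 2 * (z $ None * ?P z) + (2 * k) * pd None ?\<Phi> z) + ?M z"])
        (simp add: Sop_local[OF \<phi>] k)
  qed
  also have "\<dots> = jet a (\<lambda>z. - 2 * (z $ None * ?P z) + (2 * k) * pd None ?\<Phi> z) ?z + jet a ?M ?z"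
    by (intro jet_add[OF S.open_Z z] sM smooth_on_add smooth_on_mult[OF _ smooth_on_const] smooth_on_pd S.open_Z sP F)
  also have "jet a (\<lambda>z. - 2 * (z $ None * ?P z) + (2 * k) * pd None ?\<Phi> z) ?z
      = jet a (\<lambda>z. - 2 * (z $ None * ?P z)) ?z + jet a (\<lambda>z. (2 * k) * pd None ?\<Phi> z) ?z"
    by (intro jet_add[OF S.open_Z z] smooth_on_mult[OF _ smooth_on_const] smooth_on_pd S.open_Z sP F)
  also have "jet a (\<lambda>z. - 2 * (z $ None * ?P z)) ?z = - 2 * jet a (\<lambda>z. z $ None * ?P z) ?z"
    by (rule jet_cmult[OF S.open_Z z sP])
  also have "jet a (\<lambda>z. (2 * k) * pd None ?\<Phi> z) ?z = (2 * k) * jet a (pd None ?\<Phi>) ?z"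
    by (rule jet_cmult[OF S.open_Z z smooth_on_pd[OF F]])
  also have "jet a (\<lambda>z. z $ None * ?P z) ?z = (\<Sum>b\<le>a. jet b (\<lambda>z. z $ None) ?z * jet (a - b) ?P ?z)"
    by (rule jet_mult[OF S.open_Z z N smooth_on_pd[OF smooth_on_pd[OF F]]])
  also have "\<dots> = (\<Sum>b\<le>a. if b = 1 then - 2 * jet (a - 1) ?P ?z else 0)"
    by (rule sum.cong[OF refl]) (simp add: jet_coord)
  also have "\<dots> = (if a = 0 then 0 else real a * jet a (pd None ?\<Phi>) ?z)"
  proof (cases a)
    case (Suc b)
    have "(\<Sum>c\<le>Suc b. if c = 1 then - 2 * jet (Suc b - 1) ?P ?z else 0) = - 2 * jet b ?P ?z"
      unfolding sum.delta[OF finite_atMost] by (simp only: diff_Suc_1) simp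
    also have "\<dots> = real (Suc b) * jet (Suc b) (pd None ?\<Phi>) ?z" by (rule jet_pd_None)
    finally show ?thesis unfolding Suc by (simp only: nat.distinct if_False)
  qed simp
  also have "jet a (pd None ?\<Phi>) ?z = - (1 / 2) * (real (Suc a) * jet (Suc a) ?\<Phi> ?z)"
    unfolding jet_pd_None[symmetric] by simp
  also have "jet (Suc a) ?\<Phi> ?z = Tj (Suc a) \<phi> x" by (rule Tj_local[OF \<phi> x, symmetric])
  also have "jet a ?M ?z = Tj a (\<lambda>(x, \<rho>). Mrho \<rho> (\<lambda>x. \<phi> (x, \<rho>)) x) x"
    unfolding Tj_local[OF smooth_Mrho(1)[OF \<phi>] x]
    by (rule jet_cong[OF S.open_Z z smooth_Mrho(2)[OF \<phi>, symmetric]])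
  finally show ?thesis unfolding Tj_Mrho[OF \<phi>] by (cases "a = 0") (simp_all add: algebra_simps)
qed

lemma mu_loc_lin:
  assumes f: "smooth_on (cimg C i) f1" "smooth_on (cimg C i) f2" and y: "y \<in> cimg C i"
  shows "mu_loc i b (\<lambda>y. f1 y + c * f2 y) y = mu_loc i b f1 y + c * mu_loc i b f2 y"
proof -
  have p: "pd k (\<lambda>y. f1 y + c * f2 y) y = pd k f1 y + c * pd k f2 y"
    if f: "smooth_on (cimg C i) f1" "smooth_on (cimg C i) f2" and y: "y \<in> cimg C i" for k f1 f2 y
  proof -
    have d: "f1 differentiable at y" "f2 differentiable at y" using smooth_on_differentiable f y by blast+
    then have "(\<lambda>y. c * f2 y) differentiable at y" by (intro differentiable_mult differentiable_const)
    from pd_add[OF d(1) this] show ?thesis unfolding pd_cmult[OF d(2)] .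
  qed
  have "pd j (pd k (\<lambda>y. f1 y + c * f2 y)) y = pd j (\<lambda>y. pd k f1 y + c * pd k f2 y) y" for j k
    by (rule pd_cong[OF open_cimg y]) (rule p[OF f])
  also have "\<dots> j k = pd j (pd k f1) y + c * pd j (pd k f2) y" for j k
    by (rule p[OF smooth_on_pd[OF f(1)] smooth_on_pd[OF f(2)] y])
  finally have pp: "pd j (pd k (\<lambda>y. f1 y + c * f2 y)) y = pd j (pd k f1) y + c * pd j (pd k f2) y" for j k .
  show ?thesis unfolding mu_loc_def pp p[OF f y]
    by (simp add: sum.distrib distrib_left sum_distrib_left mult_ac distrib_right)
qed

lemma smooth_fun_lincomb:
  assumes "smooth_fun C u" "smooth_fun C v"
  shows "smooth_fun C (\<lambda>x. u x + c * v x)"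
  unfolding smooth_fun_def
proof
  fix i
  have "loc C i (\<lambda>x. u x + c * v x) = (\<lambda>y. loc C i u y + c * loc C i v y)" by (auto simp: loc_def)
  then show "smooth_on (cimg C i) (loc C i (\<lambda>x. u x + c * v x))"
    using assms by (auto simp: smooth_fun_def intro!: smooth_on_add smooth_on_mult open_cimg)
qed

lemma mu_lincomb:
  assumes "smooth_fun C u" "smooth_fun C v"
  shows "mu j (\<lambda>x. u x + c * v x) x = mu j u x + c * mu j v x"
proof (cases j)
  case (Suc b)
  define i where "i = chart_at C x"
  have x: "x \<in> cdom C i" unfolding i_def by (rule chart_at_in)
  then have y: "cmap C i x \<in> cimg C i" by blast
  have "loc C i (\<lambda>x. u x + c * v x) = (\<lambda>y. loc C i u y + c * loc C i v y)" by (auto simp: loc_def)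
  then show ?thesis
    unfolding Suc loc_at[OF x, of "mu _ _"] loc_mu[OF smooth_fun_lincomb[OF assms] y] loc_mu[OF assms(1) y] loc_mu[OF assms(2) y]
    using mu_loc_lin[of i "loc C i u" "loc C i v", OF _ _ y] assms by (simp add: smooth_fun_def)
qed (simp add: mu_def)

lemma smooth_fun_zero: "smooth_fun C (\<lambda>x. 0)"
  by (simp add: smooth_fun_def loc_def comp_def)

sublocale ops: operator_series "{u. smooth_fun C u}" mu
proof
  have lc: "u + v = (\<lambda>x. u x + 1 * v x)" "c *\<^sub>R u = (\<lambda>x. 0 + c * u x)" for u v :: "'m \<Rightarrow> real" and c
    by (auto simp: plus_fun_def scaleR_fun_def)
  show "subspace {u. smooth_fun C u}"
    unfolding subspace_def mem_Collect_eq
  proof (intro conjI allI ballI impI)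
    show "smooth_fun C 0" using smooth_fun_zero by (simp add: zero_fun_def)
    show "smooth_fun C (u + v)" if "u \<in> {u. smooth_fun C u}" "v \<in> {u. smooth_fun C u}" for u v
      unfolding lc(1) by (rule smooth_fun_lincomb) (use that in auto)
    show "smooth_fun C (c *\<^sub>R u)" if "u \<in> {u. smooth_fun C u}" for c u
      unfolding lc(2) by (rule smooth_fun_lincomb[OF smooth_fun_zero]) (use that in auto)
  qed
  have m0: "mu j (\<lambda>x. 0) x = 0" for j x
    using mu_lincomb[OF smooth_fun_zero smooth_fun_zero, of j 1 x] by simp
  show "lin_on {u. smooth_fun C u} (mu j)" for j
    unfolding lin_on_def
  proof (intro conjI allI ballI)
    show "mu j u \<in> {u. smooth_fun C u}" if "u \<in> {u. smooth_fun C u}" for u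
      using that smooth_mu by auto
    show "mu j (u + v) = mu j u + mu j v" if "u \<in> {u. smooth_fun C u}" "v \<in> {u. smooth_fun C u}" for u v
      unfolding lc(1) by (rule ext, rule mu_lincomb) (use that in auto)
    show "mu j (c *\<^sub>R u) = c *\<^sub>R mu j u" if "u \<in> {u. smooth_fun C u}" for c u
    proof
      fix x
      show "mu j (c *\<^sub>R u) x = (c *\<^sub>R mu j u) x"
        unfolding lc(2) using mu_lincomb[OF smooth_fun_zero, of u j c x] that by (simp add: m0)
    qed
  qed
qed

section \<open>The GJMS operators\<close>

text \<open>The degrees of homogeneity that occur in the definition of \<open>P\<^bsub>2N\<^esub>\<close>.\<close>

primrec Siter :: "nat \<Rightarrow> nat \<Rightarrow> ('m \<times> real \<Rightarrow> real) \<Rightarrow> 'm \<times> real \<Rightarrow> real" where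
  "Siter N 0 \<phi> = \<phi>"
| "Siter N (Suc k) \<phi> = Sop (real N - real CARD('n) / 2 - 2 * real k) (Siter N k \<phi>)"

lemma smooth_Siter: "smooth_fun C1 \<phi> \<Longrightarrow> smooth_fun C1 (Siter N k \<phi>)"
  by (induction k) (auto intro: smooth_fun_Sop)

lemma lapl_ambient_iterate:
  assumes \<phi>: "smooth_fun C1 \<phi>"
    and F: "\<And>x \<rho> t. \<rho> \<in> R \<Longrightarrow> t > 0 \<Longrightarrow> F ((x, \<rho>), t) = t powr (real N - real CARD('n) / 2) * (\<phi> (x, \<rho>) / w_rho (x, \<rho>))"
    and "\<rho> \<in> R" "t > 0"
  shows "(lapl C2 (g_ambient h) ^^ k) F ((x, \<rho>), t)
    = t powr (real N - real CARD('n) / 2 - 2 * real k) * (Siter N k \<phi> (x, \<rho>) / w_rho (x, \<rho>))"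
  using assms(3,4)
proof (induction k arbitrary: x \<rho> t)
  case 0
  then show ?case using F by simp
next
  case (Suc k)
  have e: "real N - real CARD('n) / 2 - 2 * real (Suc k) = real N - real CARD('n) / 2 - 2 * real k - 2" by simp
  show ?case
    unfolding e Siter.simps funpow.simps comp_apply
    by (rule lapl_ambient[OF smooth_Siter[OF \<phi>] Suc.IH Suc.prems])
qed

lemma Tj_Siter:
  assumes \<phi>: "smooth_fun C1 \<phi>"
  shows "Tj a (Siter N k \<phi>) = ops.Rit (real N - 1) k (\<lambda>a. Tj a \<phi>) a"
proof (induction k arbitrary: a)
  case (Suc k)
  have eq: "(\<lambda>a. Tj a (Siter N k \<phi>)) = ops.Rit (real N - 1) k (\<lambda>a. Tj a \<phi>)" by (rule ext) (rule Suc.IH)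
  have "Tj a (Siter N (Suc k) \<phi>) = ops.Rop (real N - 1 - 2 * real k) (\<lambda>a. Tj a (Siter N k \<phi>)) a"
  proof
    fix x
    have "2 * (real N - real CARD('n) / 2 - 2 * real k) + real CARD('n) - 2 = 2 * (real N - 1 - 2 * real k)"
      by (simp add: field_simps)
    from Tj_Sop[OF smooth_Siter[OF \<phi>] this]
    show "Tj a (Siter N (Suc k) \<phi>) x = ops.Rop (real N - 1 - 2 * real k) (\<lambda>a. Tj a (Siter N k \<phi>)) a x"
      by (simp add: ops.Rop_def plus_fun_def scaleR_fun_def sum_fun_apply)
  qed
  then show ?case unfolding eq ops.Rit.simps .
qed simp

text \<open>The extension \<open>\<phi> / w\<close> of \<open>u\<close> corresponds to a series with leading coefficient \<open>u\<close>, because \<open>w = 1\<close> at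
  \<open>\<rho> = 0\<close>. The degree \<open>\<gamma> = N - n/2 - 2 m\<close> corresponds to the parameter \<open>k = N - 1 - 2 m\<close>.\<close>

lemma gjms_eq_Pop:
  assumes u: "smooth_fun C u" and N: "N \<ge> 1"
  shows "gjms C \<epsilon> h N u = ops.Pop N u"
proof
  fix x
  define ue where "ue = (SOME ue. smooth_extension C \<epsilon> u ue)"
  have "smooth_extension C \<epsilon> u (\<lambda>(x, \<rho>). u x)"
    unfolding smooth_extension_def using smooth_fun_const_ext[OF u] by simp
  then have ue: "smooth_extension C \<epsilon> u ue" unfolding ue_def
    by (rule someI[where P = "smooth_extension C \<epsilon> u"])
  define \<phi> where "\<phi> z = w_rho z * ue z" for z
  have \<phi>: "smooth_fun C1 \<phi>"
    unfolding smooth_fun_def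
  proof
    fix i
    have "loc C1 i \<phi> = (\<lambda>z. loc C1 i w_rho z * loc C1 i ue z)" by (auto simp: loc_def \<phi>_def)
    then show "smooth_on (cimg C1 i) (loc C1 i \<phi>)"
      using ue smooth_w_rho unfolding smooth_extension_def smooth_fun_def
      by (auto intro!: smooth_on_mult slab1.open_cimg)
  qed
  have \<phi>0: "Tj 0 \<phi> = u"
    using ue by (auto simp: Tj_def \<phi>_def w_rho_zero smooth_extension_def)
  define F where "F = (\<lambda>(z, t). t powr (real N - real CARD('n) / 2) * ue z)"
  have F: "F ((x, \<rho>), t) = t powr (real N - real CARD('n) / 2) * (\<phi> (x, \<rho>) / w_rho (x, \<rho>))"
    if "\<rho> \<in> R" "t > 0" for x \<rho> t
    using w_rho_pos[OF that(1), of x] by (simp add: F_def \<phi>_def)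
  have "gjms C \<epsilon> h N u x = (lapl C2 (g_ambient h) ^^ N) F ((x, 0), 1)"
    by (simp add: gjms_def Let_def ue_def[symmetric] F_def)
  also have "\<dots> = Siter N N \<phi> (x, 0)"
    using lapl_ambient_iterate[OF \<phi> F zero_in_R, of 1 N x] by (simp add: w_rho_zero)
  also have "\<dots> = Tj 0 (Siter N N \<phi>) x" by (simp add: Tj_def)
  also have "\<dots> = ops.Rit (real N - 1) N (\<lambda>a. Tj a \<phi>) 0 x" by (simp only: Tj_Siter[OF \<phi>])
  also have "ops.Rit (real N - 1) N (\<lambda>a. Tj a \<phi>) 0 = (fact (N - 1))\<^sup>2 *\<^sub>R ops.pcoef N (Tj 0 \<phi>)"
    by (rule ops.Rit_eq_pcoef[OF N]) (use smooth_Tj[OF \<phi>] in simp)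
  finally show "gjms C \<epsilon> h N u x = ops.Pop N u x" by (simp only: ops.Pop_def \<phi>0)
qed

lemma op_comp_gjms:
  assumes "smooth_fun C u" "I \<in> compositions N"
  shows "op_comp (gjms C \<epsilon> h) I u = op_comp ops.Pop I u"
proof (rule op_comp_cong)
  show "u \<in> {u. smooth_fun C u}" using assms(1) by simp
  show "lin_on {u. smooth_fun C u} (ops.Pop k)" for k by (rule ops.Pop_lin)
  show "gjms C \<epsilon> h k v = ops.Pop k v" if "k \<in> set I" "v \<in> {u. smooth_fun C u}" for k v
    by (rule gjms_eq_Pop) (use that assms(2) in \<open>auto simp: compositions_def\<close>)
qed

lemma M_op_eq_Mop:
  assumes u: "smooth_fun C u" and N: "N \<ge> 1"
  shows "M_op C \<epsilon> h N u = ops.Mop N u"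
proof
  fix x
  have "ops.Mop N u = (\<Sum>I\<in>compositions N. m_coef I *\<^sub>R op_comp ops.Pop I u)"
    by (rule ops.Mop_eq_sum_m_coef) (use u N in auto)
  then have "ops.Mop N u x = (\<Sum>I\<in>compositions N. m_coef I * op_comp ops.Pop I u x)"
    by (simp add: sum_fun_apply scaleR_fun_def)
  then show "M_op C \<epsilon> h N u x = ops.Mop N u x"
    unfolding M_op_def by (simp add: op_comp_gjms[OF u])
qed

lemma op_comp_M_op:
  assumes "smooth_fun C u" "I \<in> compositions N"
  shows "op_comp (M_op C \<epsilon> h) I u = op_comp ops.Mop I u"
proof (rule op_comp_cong)
  show "u \<in> {u. smooth_fun C u}" using assms(1) by simp
  show "lin_on {u. smooth_fun C u} (ops.Mop k)" for k by (rule ops.Mop_lin)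
  show "M_op C \<epsilon> h k v = ops.Mop k v" if "k \<in> set I" "v \<in> {u. smooth_fun C u}" for k v
    by (rule M_op_eq_Mop) (use that assms(2) in \<open>auto simp: compositions_def\<close>)
qed

lemma gjms_eq_sum_n_coef:
  assumes u: "smooth_fun C u" and N: "N \<ge> 1"
  shows "gjms C \<epsilon> h N u x = (\<Sum>I\<in>compositions N. real (n_coef I) * op_comp (M_op C \<epsilon> h) I u x)"
proof -
  have "ops.Pop N u = (\<Sum>I\<in>compositions N. real (n_coef I) *\<^sub>R op_comp ops.Mop I u)"
    by (rule ops.Pop_eq_sum_n_coef) (use u N in auto)
  then have "ops.Pop N u x = (\<Sum>I\<in>compositions N. real (n_coef I) * op_comp ops.Mop I u x)"
    by (simp add: sum_fun_apply scaleR_fun_def)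
  then show ?thesis by (simp add: gjms_eq_Pop[OF u N] op_comp_M_op[OF u])
qed

lemma mu_eq_M_op:
  assumes "smooth_fun C u" "k \<ge> 1"
  shows "M_op C \<epsilon> h k u x * (1 / (fact (k - 1))\<^sup>2) = mu k u x"
  unfolding M_op_eq_Mop[OF assms] by (simp add: ops.Mop_def scaleR_fun_def)

text \<open>The coefficients of order two, one and zero are indexed by the lists of length two, one and
  zero.\<close>

lemma diff_op_M_op:
  assumes N: "N \<ge> 1"
  shows "diff_op C 2 (M_op C \<epsilon> h N)"
  unfolding diff_op_def
proof
  fix i
  obtain b where b: "N = Suc b" using N by (cases N) auto
  let ?f = "(fact b)\<^sup>2 :: real"
  define coef where "coef as y = (case as of [] \<Rightarrow> ?f * c0 i b y | [k] \<Rightarrow> ?f * c1 i b k y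
     | [j, k] \<Rightarrow> ?f * c2 i b j k y | _ \<Rightarrow> 0)" for as y
  have coef: "coef [] y = ?f * c0 i b y" "coef [k] y = ?f * c1 i b k y" "coef [j, k] y = ?f * c2 i b j k y" for j k y
    by (simp_all add: coef_def)
  have smooth: "smooth_on (cimg C i) (coef as)" for as
  proof -
    consider "as = []" | k where "as = [k]" | j k where "as = [j, k]" | j k l bs where "as = j # k # l # bs"
      by (metis list.exhaust)
    then show ?thesis
    proof cases
      case 4
      then have "coef as = (\<lambda>y. 0)" by (simp add: coef_def fun_eq_iff)
      then show ?thesis by simp
    qed (simp_all add: coef_def[abs_def] smooth_on_mult open_cimg smooth_coefs)
  qed
  have lists: "{as :: 'n list. length as \<le> 2} = {[]} \<union> ((\<lambda>k. [k]) ` UNIV \<union> (\<lambda>(j, k). [j, k]) ` UNIV)"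
  proof (intro equalityI subsetI)
    fix as :: "'n list" assume "as \<in> {as. length as \<le> 2}"
    then have "length as \<le> 2" by simp
    then consider "as = []" | k where "as = [k]" | j k where "as = [j, k]"
      by (cases as rule: list.exhaust; cases "tl as" rule: list.exhaust; cases "tl (tl as)" rule: list.exhaust) auto
    then show "as \<in> {[]} \<union> ((\<lambda>k. [k]) ` UNIV \<union> (\<lambda>(j, k). [j, k]) ` UNIV)" by cases auto
  qed auto
  have sum_lists: "(\<Sum>as | length as \<le> 2. G as) = G [] + ((\<Sum>k\<in>UNIV. G [k]) + (\<Sum>j\<in>UNIV. \<Sum>k\<in>UNIV. G [j, k]))"
    for G :: "'n list \<Rightarrow> real"
  proof -
    have "(\<Sum>as\<in>(\<lambda>k. [k]) ` UNIV. G as) = (\<Sum>k\<in>UNIV. G [k])"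
      by (subst sum.reindex) (auto simp: inj_on_def)
    moreover have "(\<Sum>as\<in>(\<lambda>(j, k). [j, k]) ` UNIV. G as) = (\<Sum>p\<in>UNIV. G ((\<lambda>(j, k). [j, k]) p))"
      by (subst sum.reindex) (auto simp: inj_on_def)
    moreover have "(\<Sum>p\<in>UNIV. G ((\<lambda>(j, k). [j, k]) p)) = (\<Sum>j\<in>UNIV. \<Sum>k\<in>UNIV. G [j, k])"
      unfolding UNIV_Times_UNIV[symmetric] sum.cartesian_product by (rule sum.cong) auto
    ultimately show ?thesis unfolding lists by (subst sum.union_disjoint; (subst sum.union_disjoint)?) auto
  qed
  show "\<exists>coef. (\<forall>as. smooth_on (cimg C i) (coef as)) \<and> (\<forall>u. smooth_fun C u \<longrightarrow> (\<forall>y\<in>cimg C i.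
        loc C i (M_op C \<epsilon> h N u) y = (\<Sum>as | length as \<le> 2. coef as y * pds as (loc C i u) y)))"
  proof (intro exI[of _ coef] conjI allI impI ballI)
    show "smooth_on (cimg C i) (coef as)" for as by (rule smooth)
    fix u y assume u: "smooth_fun C u" and y: "y \<in> cimg C i"
    have "loc C i (M_op C \<epsilon> h N u) y = ?f * loc C i (mu (Suc b) u) y"
      unfolding M_op_eq_Mop[OF u N] by (simp add: loc_def ops.Mop_def scaleR_fun_def b)
    also have "\<dots> = (\<Sum>as | length as \<le> 2. coef as y * pds as (loc C i u) y)"
      unfolding loc_mu[OF u y] mu_loc_def sum_lists coef
      by (simp add: pds_def distrib_left sum_distrib_left mult_ac)
    finally show "loc C i (M_op C \<epsilon> h N u) y = (\<Sum>as | length as \<le> 2. coef as y * pds as (loc C i u) y)" .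
  qed
qed

section \<open>Expansion of the generating operator\<close>

lemma deriv_iterate_DERIV:
  assumes \<phi>: "smooth_fun C1 \<phi>" and \<rho>: "\<rho> \<in> R"
  shows "((deriv ^^ k) (\<lambda>\<rho>. \<phi> (x, \<rho>)) has_real_derivative (deriv ^^ Suc k) (\<lambda>\<rho>. \<phi> (x, \<rho>)) \<rho>) (at \<rho>)"
proof -
  define i where "i = chart_at C x"
  have x: "x \<in> cdom C i" unfolding i_def by (rule chart_at_in)
  let ?G = "(pd None ^^ k) (loc C1 i \<phi>)"
  have "ext (cmap C i x) \<rho> \<in> cimg C1 i" using x \<rho> ext_in_cimg_prod by blast
  then have "((\<lambda>r. ?G (ext (cmap C i x) r)) has_real_derivative pd None ?G (ext (cmap C i x) \<rho>)) (at \<rho>)"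
    by (intro DERIV_slice smooth_on_differentiable[OF deriv_iterate_local(2)[OF \<phi> x \<rho>]])
  also have "pd None ?G (ext (cmap C i x) \<rho>) = (deriv ^^ Suc k) (\<lambda>\<rho>. \<phi> (x, \<rho>)) \<rho>"
    using deriv_iterate_local(1)[OF \<phi> x \<rho>, of "Suc k"] by simp
  finally show ?thesis
    by (rule has_field_derivative_transform_within_open[OF _ open_R \<rho>])
      (rule deriv_iterate_local(1)[OF \<phi> x, symmetric])
qed

text \<open>Taylor's formula for \<open>M(\<rho>) u\<close> at the point \<open>x\<close>, evaluated at \<open>\<rho> = - r\<^sup>2/2\<close>. The remainder of
  order \<open>N\<close> in \<open>\<rho>\<close> is \<open>O(r\<^bsup>2N\<^esup>)\<close>.\<close>

lemma generating_op_expansion: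
  assumes u: "smooth_fun C u" and N: "N \<ge> 1"
  shows "(\<lambda>r. generating_op C g \<epsilon> h r u x - (\<Sum>k=1..N. mu k u x * (r\<^sup>2 / 4) ^ (k - 1)))
     \<in> o[at_right 0](\<lambda>r. r ^ (2 * N - 2))"
proof -
  let ?\<phi> = "\<lambda>(x, \<rho>). Mrho \<rho> u x"
  have \<phi>: "smooth_fun C1 ?\<phi>" using smooth_Mrho(1)[OF smooth_fun_const_ext[OF u]] by simp
  define D where "D k = (deriv ^^ k) (\<lambda>\<rho>. Mrho \<rho> u x)" for k
  have DD: "DERIV (D k) \<rho> :> D (Suc k) \<rho>" if "\<rho> \<in> R" for k \<rho>
    using deriv_iterate_DERIV[OF \<phi> that, of k x] unfolding D_def by simp
  have "isCont (D N) 0" using DD[OF zero_in_R] DERIV_isCont by blast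
  then obtain d where d: "d > 0" "\<And>s. \<bar>s\<bar> < d \<Longrightarrow> \<bar>D N s - D N 0\<bar> < 1"
    unfolding continuous_at_eps_delta dist_real_def by (metis diff_zero zero_less_one)
  define B where "B = \<bar>D N 0\<bar> + 1"
  have B: "\<bar>D N s\<bar> \<le> B" if "\<bar>s\<bar> < d" for s using d(2)[OF that] by (simp add: B_def)
  have sums: "(\<Sum>k=1..N. mu k u x * (r\<^sup>2 / 4) ^ (k - 1)) = (\<Sum>m<N. D m 0 / fact m * (- (r\<^sup>2 / 2)) ^ m)" for r
  proof -
    have "(\<Sum>k=1..N. mu k u x * (r\<^sup>2 / 4) ^ (k - 1)) = (\<Sum>m<N. mu (Suc m) u x * (r\<^sup>2 / 4) ^ m)"
      by (rule sum.reindex_bij_witness[of _ Suc "\<lambda>k. k - 1"]) auto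
    also have "\<dots> = (\<Sum>m<N. D m 0 / fact m * (- (r\<^sup>2 / 2)) ^ m)"
    proof (rule sum.cong[OF refl])
      fix m
      have "(- 2) ^ m * (r\<^sup>2 / 4) ^ m = (- (r\<^sup>2 / 2)) ^ m"
        unfolding power_mult_distrib[symmetric] by (simp add: field_simps)
      then show "mu (Suc m) u x * (r\<^sup>2 / 4) ^ m = D m 0 / fact m * (- (r\<^sup>2 / 2)) ^ m"
        by (simp add: mu_def Tj_def D_def mult_ac)
    qed
    finally show ?thesis .
  qed
  have bound: "\<bar>generating_op C g \<epsilon> h r u x - (\<Sum>k=1..N. mu k u x * (r\<^sup>2 / 4) ^ (k - 1))\<bar> \<le> B * r ^ (2 * N)"
    if r: "0 < r" "r < \<epsilon>" "r\<^sup>2 / 2 < d" for r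
  proof -
    let ?h = "- (r\<^sup>2 / 2)"
    have h: "?h < 0" using r by simp
    have inR: "s \<in> R" if "?h \<le> s" "s \<le> 0" for s
    proof -
      have "- (\<epsilon>\<^sup>2 / 2) < ?h" using rho_of_r[OF r(1,2)] unfolding rho_range_def by auto
      moreover have "\<epsilon>\<^sup>2 / 2 > 0" using eps by simp
      ultimately show ?thesis using that unfolding rho_range_def greaterThanLessThan_iff by linarith
    qed
    obtain s where s: "?h < s" "s < 0" "Mrho ?h u x = (\<Sum>m<N. D m 0 / fact m * ?h ^ m) + D N s / fact N * ?h ^ N"
      using Maclaurin_minus[of ?h N D "\<lambda>\<rho>. Mrho \<rho> u x"] h N DD inR by (auto simp: D_def)
    have "generating_op C g \<epsilon> h r u x - (\<Sum>k=1..N. mu k u x * (r\<^sup>2 / 4) ^ (k - 1)) = D N s / fact N * ?h ^ N"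
      unfolding generating_op_eq_Mrho[OF r(1,2)] sums s(3) by simp
    also have "\<bar>\<dots>\<bar> = \<bar>D N s\<bar> * (1 / fact N) * (r\<^sup>2 / 2) ^ N"
      by (simp add: abs_mult power_abs)
    also have "\<dots> \<le> B * 1 * (r\<^sup>2) ^ N"
      using B[of s] s r by (intro mult_mono power_mono) (auto simp: fact_ge_1 B_def)
    also have "\<dots> = B * r ^ (2 * N)" by (simp add: power_mult)
    finally show ?thesis .
  qed
  have small: "\<forall>\<^sub>F r in at_right 0. 0 < r \<and> r < \<epsilon> \<and> r\<^sup>2 / 2 < d"
  proof -
    have "((\<lambda>r::real. r\<^sup>2 / 2) \<longlongrightarrow> 0\<^sup>2 / 2) (at_right 0)" by (intro tendsto_intros) auto
    then have "\<forall>\<^sub>F r in at_right 0. r\<^sup>2 / 2 < d" using d(1) by (intro order_tendstoD(2)) auto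
    moreover have "\<forall>\<^sub>F r in at_right 0. r < \<epsilon>" using eps by (simp add: eventually_at_right_field) blast
    moreover have "\<forall>\<^sub>F r::real in at_right 0. 0 < r" by (rule eventually_at_right_less)
    ultimately show ?thesis by eventually_elim auto
  qed
  have "(\<lambda>r. generating_op C g \<epsilon> h r u x - (\<Sum>k=1..N. mu k u x * (r\<^sup>2 / 4) ^ (k - 1))) \<in> O[at_right 0](\<lambda>r. r ^ (2 * N))"
    by (rule bigoI[of _ B], rule eventually_mono[OF small]) (use bound in force)
  moreover have "(\<lambda>r::real. r ^ (2 * N)) \<in> o[at_right 0](\<lambda>r. r ^ (2 * N - 2))"
  proof (rule smalloI_tendsto)
    have "2 * N = (2 * N - 2) + 2" using N by simp
    then have "r ^ (2 * N) / r ^ (2 * N - 2) = r\<^sup>2" if "r > 0" for r :: real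
      using that by (metis less_irrefl nonzero_mult_div_cancel_left power_add power_not_zero)
    then have "\<forall>\<^sub>F r::real in at_right 0. r\<^sup>2 = r ^ (2 * N) / r ^ (2 * N - 2)"
      by (intro eventually_mono[OF eventually_at_right_less]) auto
    moreover have "((\<lambda>r::real. r\<^sup>2) \<longlongrightarrow> 0) (at_right 0)" by (rule tendsto_eq_intros)+ simp_all
    ultimately show "((\<lambda>r::real. r ^ (2 * N) / r ^ (2 * N - 2)) \<longlongrightarrow> 0) (at_right 0)"
      by (rule Lim_transform_eventually[rotated])
    show "\<forall>\<^sub>F r::real in at_right 0. r ^ (2 * N - 2) \<noteq> 0"
      by (rule eventually_mono[OF eventually_at_right_less]) auto
  qed
  ultimately show ?thesis by (rule landau_o.big_small_trans)
qed

end

section \<open>Compositions with the maximal number of factors\<close>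

lemma compositions_full_length:
  assumes "I \<in> compositions N" "\<not> length I < N"
  shows "I = replicate N 1"
proof -
  have "I = replicate (length I) 1" if "\<forall>k\<in>set I. 1 \<le> k" "sum_list I \<le> length I" for I :: "nat list"
    using that
  proof (induction I)
    case (Cons k I)
    have "length I \<le> sum_list I" using Cons.prems by (intro sum_list_ge_length) auto
    with Cons show ?case by auto
  qed simp
  moreover have "length I \<le> N" using assms sum_list_ge_length[of I] by (auto simp: compositions_def)
  ultimately show ?thesis using assms by (auto simp: compositions_def)
qed

lemma replicate_in_compositions: "replicate N 1 \<in> compositions N"
  by (simp add: compositions_def sum_list_replicate)

lemma n_coef_replicate: "n_coef (replicate N 1) = 1"
  by (simp add: n_coef_def)

lemma op_comp_replicate: "op_comp P (replicate N k) = P k ^^ N"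
  by (induction N) (simp_all add: op_comp_def)

theorem theorem1p1:
  fixes C :: "('i, 'm::{t2_space, second_countable_topology}, 'n::finite) atlas"
    and g :: "'i \<Rightarrow> 'm \<Rightarrow> real^'n^'n"
    and \<epsilon> :: real
    and h :: "'i \<Rightarrow> 'm \<times> real \<Rightarrow> real^'n^'n"
  assumes "CARD('n) \<ge> 3"
    and "smooth_atlas C"
    and "riemannian_metric C g"
    and "\<epsilon> > 0"
    and "poincare_einstein C g \<epsilon> h"
  shows "\<forall>N. N \<ge> 1 \<and> (even CARD('n) \<longrightarrow> 2 * N \<le> CARD('n)) \<longrightarrow>
    (\<forall>u x. smooth_fun C u \<longrightarrow>
       gjms C \<epsilon> h N u x
         = (\<Sum>I\<in>compositions N. real (n_coef I) * op_comp (M_op C \<epsilon> h) I u x) \<and>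
       gjms C \<epsilon> h N u x
         = (M_op C \<epsilon> h 1 ^^ N) u x
           + (\<Sum>I\<in>{I \<in> compositions N. length I < N}.
                real (n_coef I) * op_comp (M_op C \<epsilon> h) I u x)) \<and>
    diff_op C 2 (M_op C \<epsilon> h N) \<and>
    (\<forall>u x. smooth_fun C u \<longrightarrow>
       (\<lambda>r. generating_op C g \<epsilon> h r u x
            - (\<Sum>k=1..N. M_op C \<epsilon> h k u x * (1 / (fact (k - 1))\<^sup>2) * (r\<^sup>2 / 4) ^ (k - 1)))
       \<in> o[at_right 0](\<lambda>r. r ^ (2 * N - 2)))"
proof (intro allI impI)
  fix N assume "N \<ge> 1 \<and> (even CARD('n) \<longrightarrow> 2 * N \<le> CARD('n))"
  then have N: "N \<ge> 1" by simp
  interpret pe_family C g \<epsilon> h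
  proof
    show "open (cdom C i)" "open (cimg C i)" "homeomorphism (cdom C i) (cimg C i) (cmap C i) (cinv C i)"
      "smooth_on (cmap C i ` (cdom C i \<inter> cdom C j)) (cmap C j \<circ> cinv C i)" for i j
      using assms(2) unfolding smooth_atlas_def by blast+
    show "(\<Union>i. cdom C i) = UNIV" using assms(2) unfolding smooth_atlas_def by blast
    show "metric_family C g \<epsilon> h" using assms(5) unfolding poincare_einstein_def by blast
  qed fact+
  have 1: "gjms C \<epsilon> h N u x = (\<Sum>I\<in>compositions N. real (n_coef I) * op_comp (M_op C \<epsilon> h) I u x)"
    if "smooth_fun C u" for u x
    by (rule gjms_eq_sum_n_coef[OF that N])
  have split: "compositions N = insert (replicate N 1) {I \<in> compositions N. length I < N}"
    using compositions_full_length replicate_in_compositions by blast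
  have 2: "gjms C \<epsilon> h N u x = (M_op C \<epsilon> h 1 ^^ N) u x
      + (\<Sum>I\<in>{I \<in> compositions N. length I < N}. real (n_coef I) * op_comp (M_op C \<epsilon> h) I u x)"
    if u: "smooth_fun C u" for u x
  proof -
    have "(\<Sum>I\<in>compositions N. real (n_coef I) * op_comp (M_op C \<epsilon> h) I u x)
      = real (n_coef (replicate N 1)) * op_comp (M_op C \<epsilon> h) (replicate N 1) u x
        + (\<Sum>I\<in>{I \<in> compositions N. length I < N}. real (n_coef I) * op_comp (M_op C \<epsilon> h) I u x)"
      by (subst split, rule sum.insert) (simp_all add: finite_compositions)
    then show ?thesis unfolding 1[OF u] n_coef_replicate op_comp_replicate by simp
  qed
  have 3: "(\<lambda>r. generating_op C g \<epsilon> h r u x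
            - (\<Sum>k=1..N. M_op C \<epsilon> h k u x * (1 / (fact (k - 1))\<^sup>2) * (r\<^sup>2 / 4) ^ (k - 1)))
       \<in> o[at_right 0](\<lambda>r. r ^ (2 * N - 2))" if u: "smooth_fun C u" for u x
  proof -
    have "(\<Sum>k=1..N. M_op C \<epsilon> h k u x * (1 / (fact (k - 1))\<^sup>2) * (r\<^sup>2 / 4) ^ (k - 1))
       = (\<Sum>k=1..N. mu k u x * (r\<^sup>2 / 4) ^ (k - 1))" for r
      by (rule sum.cong[OF refl]) (simp only: mu_eq_M_op[OF u] atLeastAtMost_iff)
    then show ?thesis using generating_op_expansion[OF u N, of x] by (simp only:)
  qed
  show "(\<forall>u x. smooth_fun C u \<longrightarrow>
       gjms C \<epsilon> h N u x
         = (\<Sum>I\<in>compositions N. real (n_coef I) * op_comp (M_op C \<epsilon> h) I u x) \<and>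
       gjms C \<epsilon> h N u x
         = (M_op C \<epsilon> h 1 ^^ N) u x
           + (\<Sum>I\<in>{I \<in> compositions N. length I < N}.
                real (n_coef I) * op_comp (M_op C \<epsilon> h) I u x)) \<and>
    diff_op C 2 (M_op C \<epsilon> h N) \<and>
    (\<forall>u x. smooth_fun C u \<longrightarrow>
       (\<lambda>r. generating_op C g \<epsilon> h r u x
            - (\<Sum>k=1..N. M_op C \<epsilon> h k u x * (1 / (fact (k - 1))\<^sup>2) * (r\<^sup>2 / 4) ^ (k - 1)))
       \<in> o[at_right 0](\<lambda>r. r ^ (2 * N - 2)))"
    using 1 2 3 diff_op_M_op[OF N] by blast
qed

end
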